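(* Let $G$ be a finite non-abelian group and let $\alpha:G\curvearrowright A$ be the inductive-limit action on the AF algebra $A=\varinjlim(A_n,\phi_n)$ described in the context (for any choice of the initial data there). Then the inclusion $A\subset A\rtimes_\alpha G$, equipped with its canonical conditional expectation $F\left(\sum_{g\in G}a_gu_g\right)=a_{1_G}$, has the weak tracial Rokhlin property and is not isomorphic to a fixed-point inclusion arising from an action of an ordinary finite group.
   Context: Construction of $(A,\alpha)$. Put $m=|G|$. Choose positive integers $k_1,r_1$ and a sequence of positive integers $\ell_n\to\infty$, and set inductively $k_{n+1}=\ell_nk_n+mr_n$, $r_{n+1}=k_n+r_n$. Let $A_n=B_n\oplus D_n$, $B_n=M_{k_n}(\mathbb C)$, $D_n=\bigoplus_{h\in G}M_{r_n}(\mathbb C)$. Choose unitary representations $U^{(1)}:G\to\mathcal U(\mathbb C^{k_1})$, $W^{(1)}:G\to\mathcal U(\mathbb C^{r_1})$, and with $\lambda$ the left regular representation of $G$ define recursively $$U^{(n+1)}_g=(U^{(n)}_g\otimes1_{\ell_n})\oplus(\lambda_g\otimes W^{(n)}_g),\qquad W^{(n+1)}_g=U^{(n)}_g\oplus W^{(n)}_g.$$ Let $G$ act on $A_n$ by $\alpha^{(n)}_g(x)=U^{(n)}_gxU^{(n)*}_g$ for $x\in B_n$ and $(\alpha^{(n)}_g(y))_k=W^{(n)}_gy_{g^{-1}k}W^{(n)*}_g$ for $y=(y_h)_{h\in G}\in D_n$, $k\in G$. Define the unital injective equivariant maps $\phi_n:A_n\to A_{n+1}$ by $$\phi_n(x,y)=\Big(\operatorname{diag}(\underbrace{x,\dots,x}_{\ell_n},(y_h)_{h\in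 G}),\ (\operatorname{diag}(x,y_h))_{h\in G}\Big)$$ (block decompositions matched with those of $U^{(n+1)}$ and $W^{(n+1)}$). Then $A=\varinjlim(A_n,\phi_n)$ and $\alpha$ is the action induced by the $\alpha^{(n)}$. Here $u_g$ are the canonical unitaries of the crossed product. "Not isomorphic to a fixed-point inclusion arising from an action of an ordinary finite group" means: there do not exist a finite group $H$, an action $\beta:H\curvearrowright D$ and a $*$-isomorphism $\Phi:A\rtimes_\alpha G\to D$ with $\Phi(A)=D^\beta$ (fixed-point algebra) and $E_\beta\circ\Phi=\Phi|_A\circ F$, where $E_\beta(d)=\frac1{|H|}\sum_{h\in H}\beta_h(d)$. Weak tracial Rokhlin property of an expectation. Fix a free ultrafilter $\omega$ on $\mathbb N$; $M_\omega=\ell^\infty(\mathbb N,M)/\{(a_n):\lim_{n\to\omega}\|a_n\|=0\}$, with $M\subset M_\omega$ as constant sequences, and a bounded linear map $F:M\to Q$ induces $F_\omega:M_\omega\to Q_\omega$. For positive $a,b$ in a $C^*$-algebra $C$, $a\lesssim b$ (in $C$) means that there is a sequence $(x_n)$ in $C$ with $x_nbx_n^*\to a$. For a unital inclusion $Q\subset M$, a conditional expectation $F:M\to Q$ is of index-finite type if there is a finite family $\{(u_j,v_j)\}_j\subset M\times M$ with $x=\sum_j u_jF(v_jx)=\sum_jF(xu_j)v_j$ for all $x\in M$; $\operatorname{Index}F:=\sum_ju_jv_j\in Z(M)$. Let $e_Q$ be the Jones projection, i.e. the adjointable operator extending $x\mapsto F(x)$ on the Hilbert $Q$-module completion of $M$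 for $\langle x,y\rangle=F(x^*y)$, on which $M$ acts by left multiplication, and $C^*\langle M,e_Q\rangle=\operatorname{span}\{xe_Qy:x,y\in M\}$. If $M$ is simple, $F$ of index-finite type has the weak tracial Rokhlin property if for every nonzero positive $a\in M_\omega$ there is a nonzero positive contraction $e\in M_\omega\cap M'$ with $(\operatorname{Index}F)e^{1/2}e_Qe^{1/2}=e$ (in the ultrapower of $C^*\langle M,e_Q\rangle$) and $1-(\operatorname{Index}F)F_\omega(e)\lesssim a$ in $M_\omega$. *)

theory Defs
  imports
    "HOL-Analysis.Analysis"
    "HOL-Algebra.Subrings"
    "Jordan_Normal_Form.Schur_Decomposition"
begin

section \<open>Unital C*-algebras with explicit carriers\<close>

text \<open>Inductive limits, crossed products, ultrapowers and basic constructions depend on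
  parameters and so cannot be types; as in \<open>HOL-Algebra\<close> they are records.  The ring and the
  scalar multiplication are the fields of the library record \<open>module\<close>.\<close>

record 'a cstar = "(complex, 'a) module" +
  star :: "'a \<Rightarrow> 'a"
  nrm :: "'a \<Rightarrow> real"

definition norm_Cauchy :: "'a cstar \<Rightarrow> (nat \<Rightarrow> 'a) \<Rightarrow> bool" where
  "norm_Cauchy C s \<longleftrightarrow> (\<forall>\<epsilon>>0. \<exists>N. \<forall>m\<ge>N. \<forall>n\<ge>N. nrm C (s m \<ominus>\<^bsub>C\<^esub> s n) < \<epsilon>)"

definition norm_lim :: "'a cstar \<Rightarrow> (nat \<Rightarrow> 'a) \<Rightarrow> 'a \<Rightarrow> bool" where
  "norm_lim C s x \<longleftrightarrow> (\<lambda>n. nrm C (s n \<ominus>\<^bsub>C\<^esub> x)) \<longlonglongrightarrow> 0"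

definition norm_closed :: "'a cstar \<Rightarrow> 'a set \<Rightarrow> bool" where
  "norm_closed C S \<longleftrightarrow>
     (\<forall>s x. range s \<subseteq> S \<longrightarrow> x \<in> carrier C \<longrightarrow> norm_lim C s x \<longrightarrow> x \<in> S)"

locale cstar_algebra = ring C for C :: "'a cstar" (structure) +
  assumes smult_closed: "x \<in> carrier C \<Longrightarrow> c \<odot> x \<in> carrier C"
    and smult_add_left: "x \<in> carrier C \<Longrightarrow> (c + d) \<odot> x = c \<odot> x \<oplus> d \<odot> x"
    and smult_add_right:
      "\<lbrakk>x \<in> carrier C; y \<in> carrier C\<rbrakk> \<Longrightarrow> c \<odot> (x \<oplus> y) = c \<odot> x \<oplus> c \<odot> y"
    and smult_smult: "x \<in> carrier C \<Longrightarrow> (c * d) \<odot> x = c \<odot> (d \<odot> x)"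
    and smult_one: "x \<in> carrier C \<Longrightarrow> 1 \<odot> x = x"
    and smult_mult_left:
      "\<lbrakk>x \<in> carrier C; y \<in> carrier C\<rbrakk> \<Longrightarrow> (c \<odot> x) \<otimes> y = c \<odot> (x \<otimes> y)"
    and smult_mult_right:
      "\<lbrakk>x \<in> carrier C; y \<in> carrier C\<rbrakk> \<Longrightarrow> x \<otimes> (c \<odot> y) = c \<odot> (x \<otimes> y)"
    and star_closed: "x \<in> carrier C \<Longrightarrow> star C x \<in> carrier C"
    and star_star: "x \<in> carrier C \<Longrightarrow> star C (star C x) = x"
    and star_add:
      "\<lbrakk>x \<in> carrier C; y \<in> carrier C\<rbrakk> \<Longrightarrow> star C (x \<oplus> y) = star C x \<oplus> star C y"
    and star_smult: "x \<in> carrier C \<Longrightarrow> star C (c \<odot> x) = cnj c \<odot> star C x"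
    and star_mult:
      "\<lbrakk>x \<in> carrier C; y \<in> carrier C\<rbrakk> \<Longrightarrow> star C (x \<otimes> y) = star C y \<otimes> star C x"
    and nrm_eq_0: "x \<in> carrier C \<Longrightarrow> nrm C x = 0 \<longleftrightarrow> x = \<zero>"
    and nrm_smult: "x \<in> carrier C \<Longrightarrow> nrm C (c \<odot> x) = cmod c * nrm C x"
    and nrm_triangle:
      "\<lbrakk>x \<in> carrier C; y \<in> carrier C\<rbrakk> \<Longrightarrow> nrm C (x \<oplus> y) \<le> nrm C x + nrm C y"
    and nrm_mult:
      "\<lbrakk>x \<in> carrier C; y \<in> carrier C\<rbrakk> \<Longrightarrow> nrm C (x \<otimes> y) \<le> nrm C x * nrm C y"
    and cstar_identity: "x \<in> carrier C \<Longrightarrow> nrm C (star C x \<otimes> x) = (nrm C x)\<^sup>2"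
    and complete:
      "\<lbrakk>range s \<subseteq> carrier C; norm_Cauchy C s\<rbrakk> \<Longrightarrow> \<exists>x\<in>carrier C. norm_lim C s x"

definition positive :: "'a cstar \<Rightarrow> 'a \<Rightarrow> bool" where
  "positive C a \<longleftrightarrow> (\<exists>x\<in>carrier C. a = star C x \<otimes>\<^bsub>C\<^esub> x)"

definition cuntz_below :: "'a cstar \<Rightarrow> 'a \<Rightarrow> 'a \<Rightarrow> bool" where
  "cuntz_below C a b \<longleftrightarrow> (\<exists>x. range x \<subseteq> carrier C \<and>
     norm_lim C (\<lambda>n. x n \<otimes>\<^bsub>C\<^esub> b \<otimes>\<^bsub>C\<^esub> star C (x n)) a)"

definition simple_cstar :: "'a cstar \<Rightarrow> bool" where
  "simple_cstar C \<longleftrightarrow> carrier C \<noteq> {\<zero>\<^bsub>C\<^esub>} \<and>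
     (\<forall>I. ideal I C \<and> norm_closed C I \<longrightarrow> I = {\<zero>\<^bsub>C\<^esub>} \<or> I = carrier C)"

definition cstar_subalgebra :: "'a set \<Rightarrow> 'a cstar \<Rightarrow> bool" where
  "cstar_subalgebra Q C \<longleftrightarrow> subring Q C \<and> (\<forall>c. \<forall>x\<in>Q. c \<odot>\<^bsub>C\<^esub> x \<in> Q) \<and>
     (\<forall>x\<in>Q. star C x \<in> Q) \<and> norm_closed C Q"

definition star_iso :: "'a cstar \<Rightarrow> 'b cstar \<Rightarrow> ('a \<Rightarrow> 'b) set" where
  "star_iso C D = {f \<in> Ring.ring_hom C D.
     (\<forall>c. \<forall>x\<in>carrier C. f (c \<odot>\<^bsub>C\<^esub> x) = c \<odot>\<^bsub>D\<^esub> f x) \<and>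
     (\<forall>x\<in>carrier C. f (star C x) = star D (f x)) \<and>
     bij_betw f (carrier C) (carrier D)}"

definition cstar_action ::
  "('g, 'm) monoid_scheme \<Rightarrow> 'a cstar \<Rightarrow> ('g \<Rightarrow> 'a \<Rightarrow> 'a) \<Rightarrow> bool" where
  "cstar_action G C \<alpha> \<longleftrightarrow> (\<forall>g\<in>carrier G. \<alpha> g \<in> star_iso C C) \<and>
     (\<forall>g\<in>carrier G. \<forall>h\<in>carrier G. \<forall>x\<in>carrier C. \<alpha> (g \<otimes>\<^bsub>G\<^esub> h) x = \<alpha> g (\<alpha> h x))"

section \<open>Sequence algebras modulo null sequences\<close>

text \<open>\<open>seq_quot C S \<FF>\<close> consists of the sequences in \<open>S\<close> (with \<open>n\<close>-th term in \<open>C n\<close>) modulo those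
  whose norms tend to zero along the filter \<open>\<FF>\<close>.  Ultrapowers, inductive limits and
  completions are all of this form.\<close>

definition null_rel ::
  "(nat \<Rightarrow> 'a cstar) \<Rightarrow> (nat \<Rightarrow> 'a) set \<Rightarrow> nat filter \<Rightarrow> (nat \<Rightarrow> 'a) rel" where
  "null_rel C S \<FF> = {(a, b). a \<in> S \<and> b \<in> S \<and>
     ((\<lambda>n. nrm (C n) (a n \<ominus>\<^bsub>C n\<^esub> b n)) \<longlongrightarrow> 0) \<FF>}"

definition seq_quot ::
  "(nat \<Rightarrow> 'a cstar) \<Rightarrow> (nat \<Rightarrow> 'a) set \<Rightarrow> nat filter \<Rightarrow> (nat \<Rightarrow> 'a) set cstar" where
  "seq_quot C S \<FF> = (let R = null_rel C S \<FF> in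
     \<lparr>carrier = S // R,
      mult = (\<lambda>X Y. \<Union>a\<in>X. \<Union>b\<in>Y. R `` {\<lambda>n. a n \<otimes>\<^bsub>C n\<^esub> b n}),
      one = R `` {\<lambda>n. \<one>\<^bsub>C n\<^esub>},
      zero = R `` {\<lambda>n. \<zero>\<^bsub>C n\<^esub>},
      add = (\<lambda>X Y. \<Union>a\<in>X. \<Union>b\<in>Y. R `` {\<lambda>n. a n \<oplus>\<^bsub>C n\<^esub> b n}),
      smult = (\<lambda>c X. \<Union>a\<in>X. R `` {\<lambda>n. c \<odot>\<^bsub>C n\<^esub> a n}),
      star = (\<lambda>X. \<Union>a\<in>X. R `` {\<lambda>n. star (C n) (a n)}),
      nrm = (\<lambda>X. the_elem ((\<lambda>a. Lim \<FF> (\<lambda>n. nrm (C n) (a n))) ` X))\<rparr>)"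

text \<open>The map \<open>[a n] \<mapsto> [f n (a n)]\<close> into the quotient by \<open>R\<close>.\<close>

definition seq_map ::
  "(nat \<Rightarrow> 'b) rel \<Rightarrow> (nat \<Rightarrow> 'a \<Rightarrow> 'b) \<Rightarrow> (nat \<Rightarrow> 'a) set \<Rightarrow> (nat \<Rightarrow> 'b) set" where
  "seq_map R f X = (\<Union>a\<in>X. R `` {\<lambda>n. f n (a n)})"

definition free_ultrafilter :: "nat filter \<Rightarrow> bool" where
  "free_ultrafilter \<omega> \<longleftrightarrow> \<omega> \<noteq> bot \<and>
     (\<forall>P. eventually P \<omega> \<or> eventually (\<lambda>n. \<not> P n) \<omega>) \<and>
     (\<forall>n. eventually (\<lambda>k. k \<noteq> n) \<omega>)"

definition bounded_seqs :: "'a cstar \<Rightarrow> (nat \<Rightarrow> 'a) set" where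
  "bounded_seqs M = {a. range a \<subseteq> carrier M \<and> (\<exists>B. \<forall>n. nrm M (a n) \<le> B)}"

definition ultra_rel :: "nat filter \<Rightarrow> 'a cstar \<Rightarrow> (nat \<Rightarrow> 'a) rel" where
  "ultra_rel \<omega> M = null_rel (\<lambda>_. M) (bounded_seqs M) \<omega>"

definition ultrapower :: "nat filter \<Rightarrow> 'a cstar \<Rightarrow> (nat \<Rightarrow> 'a) set cstar" where
  "ultrapower \<omega> M = seq_quot (\<lambda>_. M) (bounded_seqs M) \<omega>"

definition ultra_const :: "nat filter \<Rightarrow> 'a cstar \<Rightarrow> 'a \<Rightarrow> (nat \<Rightarrow> 'a) set" where
  "ultra_const \<omega> M x = ultra_rel \<omega> M `` {\<lambda>_. x}"

primrec connecting :: "(nat \<Rightarrow> 'a \<Rightarrow> 'a) \<Rightarrow> nat \<Rightarrow> nat \<Rightarrow> 'a \<Rightarrow> 'a" where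
  "connecting \<phi> N 0 = id"
| "connecting \<phi> N (Suc d) = \<phi> (N + d) \<circ> connecting \<phi> N d"

text \<open>The inductive limit is the closure, in the product of the \<open>C n\<close> modulo null sequences, of
  the set of classes of sequences that are eventually coherent for the connecting maps.\<close>

definition limit_seqs :: "(nat \<Rightarrow> 'a cstar) \<Rightarrow> (nat \<Rightarrow> 'a \<Rightarrow> 'a) \<Rightarrow> (nat \<Rightarrow> 'a) set" where
  "limit_seqs C \<phi> = {a. (\<forall>n. a n \<in> carrier (C n)) \<and>
     (\<forall>\<epsilon>>0. \<exists>N. \<exists>b\<in>carrier (C N). \<forall>d.
        nrm (C (N + d)) (a (N + d) \<ominus>\<^bsub>C (N + d)\<^esub> connecting \<phi> N d b) < \<epsilon>)}"

definition inductive_limit ::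
  "(nat \<Rightarrow> 'a cstar) \<Rightarrow> (nat \<Rightarrow> 'a \<Rightarrow> 'a) \<Rightarrow> (nat \<Rightarrow> 'a) set cstar" where
  "inductive_limit C \<phi> = seq_quot C (limit_seqs C \<phi>) sequentially"

definition limit_action ::
  "(nat \<Rightarrow> 'a cstar) \<Rightarrow> (nat \<Rightarrow> 'a \<Rightarrow> 'a) \<Rightarrow> (nat \<Rightarrow> 'g \<Rightarrow> 'a \<Rightarrow> 'a) \<Rightarrow>
   'g \<Rightarrow> (nat \<Rightarrow> 'a) set \<Rightarrow> (nat \<Rightarrow> 'a) set" where
  "limit_action C \<phi> \<alpha> g =
     seq_map (null_rel C (limit_seqs C \<phi>) sequentially) (\<lambda>n. \<alpha> n g)"

section \<open>Crossed products by finite groups\<close>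

text \<open>A function \<open>f\<close> on \<open>G\<close> stands for the sum of the \<open>f g u\<^sub>g\<close>.  The norm is that of the regular
  representation on the Hilbert \<open>A\<close>-module of functions \<open>\<xi>\<close> on \<open>G\<close>, in which \<open>a \<in> A\<close> acts by
  \<open>(a \<xi>) h = \<alpha> (inv h) a \<cdot> \<xi> h\<close> and \<open>u\<^sub>g\<close> by left translation.\<close>

definition l2_norm :: "('g, 'm) monoid_scheme \<Rightarrow> 'a cstar \<Rightarrow> ('g \<Rightarrow> 'a) \<Rightarrow> real" where
  "l2_norm G A \<xi> = sqrt (nrm A (\<Oplus>\<^bsub>A\<^esub>h\<in>carrier G. star A (\<xi> h) \<otimes>\<^bsub>A\<^esub> \<xi> h))"

definition regular_rep ::
  "('g, 'm) monoid_scheme \<Rightarrow> 'a cstar \<Rightarrow> ('g \<Rightarrow> 'a \<Rightarrow> 'a) \<Rightarrow> ('g \<Rightarrow> 'a) \<Rightarrow> ('g \<Rightarrow> 'a) \<Rightarrow> 'g \<Rightarrow> 'a"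
  where
  "regular_rep G A \<alpha> f \<xi> = (\<lambda>h\<in>carrier G.
     \<Oplus>\<^bsub>A\<^esub>g\<in>carrier G. \<alpha> (inv\<^bsub>G\<^esub> h) (f g) \<otimes>\<^bsub>A\<^esub> \<xi> (inv\<^bsub>G\<^esub> g \<otimes>\<^bsub>G\<^esub> h))"

definition crossed_embed ::
  "('g, 'm) monoid_scheme \<Rightarrow> 'a cstar \<Rightarrow> 'a \<Rightarrow> 'g \<Rightarrow> 'a" where
  "crossed_embed G A a = (\<lambda>k\<in>carrier G. if k = \<one>\<^bsub>G\<^esub> then a else \<zero>\<^bsub>A\<^esub>)"

definition crossed_product ::
  "('g, 'm) monoid_scheme \<Rightarrow> 'a cstar \<Rightarrow> ('g \<Rightarrow> 'a \<Rightarrow> 'a) \<Rightarrow> ('g \<Rightarrow> 'a) cstar" where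
  "crossed_product G A \<alpha> =
     \<lparr>carrier = carrier G \<rightarrow>\<^sub>E carrier A,
      mult = (\<lambda>f f'. \<lambda>k\<in>carrier G.
        \<Oplus>\<^bsub>A\<^esub>h\<in>carrier G. f h \<otimes>\<^bsub>A\<^esub> \<alpha> h (f' (inv\<^bsub>G\<^esub> h \<otimes>\<^bsub>G\<^esub> k))),
      one = crossed_embed G A \<one>\<^bsub>A\<^esub>,
      zero = (\<lambda>k\<in>carrier G. \<zero>\<^bsub>A\<^esub>),
      add = (\<lambda>f f'. \<lambda>k\<in>carrier G. f k \<oplus>\<^bsub>A\<^esub> f' k),
      smult = (\<lambda>c f. \<lambda>k\<in>carrier G. c \<odot>\<^bsub>A\<^esub> f k),
      star = (\<lambda>f. \<lambda>k\<in>carrier G. \<alpha> k (star A (f (inv\<^bsub>G\<^esub> k)))),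
      nrm = (\<lambda>f. Sup {l2_norm G A (regular_rep G A \<alpha> f \<xi>) | \<xi>.
        \<xi> \<in> carrier G \<rightarrow>\<^sub>E carrier A \<and> l2_norm G A \<xi> \<le> 1})\<rparr>"

definition crossed_expectation ::
  "('g, 'm) monoid_scheme \<Rightarrow> 'a cstar \<Rightarrow> ('g \<Rightarrow> 'a) \<Rightarrow> 'g \<Rightarrow> 'a" where
  "crossed_expectation G A f = crossed_embed G A (f \<one>\<^bsub>G\<^esub>)"

section \<open>Conditional expectations, index and basic construction\<close>

definition conditional_expectation :: "'a cstar \<Rightarrow> 'a set \<Rightarrow> ('a \<Rightarrow> 'a) \<Rightarrow> bool" where
  "conditional_expectation M Q F \<longleftrightarrow> F \<in> carrier M \<rightarrow> Q \<and> (\<forall>q\<in>Q. F q = q) \<and>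
     (\<forall>x\<in>carrier M. \<forall>y\<in>carrier M. F (x \<oplus>\<^bsub>M\<^esub> y) = F x \<oplus>\<^bsub>M\<^esub> F y) \<and>
     (\<forall>c. \<forall>x\<in>carrier M. F (c \<odot>\<^bsub>M\<^esub> x) = c \<odot>\<^bsub>M\<^esub> F x) \<and>
     (\<forall>p\<in>Q. \<forall>q\<in>Q. \<forall>x\<in>carrier M. F (p \<otimes>\<^bsub>M\<^esub> x \<otimes>\<^bsub>M\<^esub> q) = p \<otimes>\<^bsub>M\<^esub> F x \<otimes>\<^bsub>M\<^esub> q) \<and>
     (\<forall>x\<in>carrier M. positive M x \<longrightarrow> positive M (F x))"

definition quasi_basis :: "'a cstar \<Rightarrow> ('a \<Rightarrow> 'a) \<Rightarrow> ('a \<times> 'a) list \<Rightarrow> bool" where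
  "quasi_basis M F us \<longleftrightarrow> set us \<subseteq> carrier M \<times> carrier M \<and>
     (\<forall>x\<in>carrier M.
        x = (\<Oplus>\<^bsub>M\<^esub>j\<in>{..<length us}. fst (us ! j) \<otimes>\<^bsub>M\<^esub> F (snd (us ! j) \<otimes>\<^bsub>M\<^esub> x)) \<and>
        x = (\<Oplus>\<^bsub>M\<^esub>j\<in>{..<length us}. F (x \<otimes>\<^bsub>M\<^esub> fst (us ! j)) \<otimes>\<^bsub>M\<^esub> snd (us ! j)))"

definition index_finite :: "'a cstar \<Rightarrow> ('a \<Rightarrow> 'a) \<Rightarrow> bool" where
  "index_finite M F \<longleftrightarrow> (\<exists>us. quasi_basis M F us)"

text \<open>The sum below does not depend on the quasi-basis.\<close>

definition index_of :: "'a cstar \<Rightarrow> ('a \<Rightarrow> 'a) \<Rightarrow> 'a" where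
  "index_of M F = (THE c. \<exists>us. quasi_basis M F us \<and>
     c = (\<Oplus>\<^bsub>M\<^esub>j\<in>{..<length us}. fst (us ! j) \<otimes>\<^bsub>M\<^esub> snd (us ! j)))"

text \<open>\<open>M\<close> with the seminorm of the inner product \<open>F (x* y)\<close>, and its Hilbert module completion as
  Cauchy sequences modulo null sequences (which also divides out vectors of length zero).  Only
  the linear structure and the norm of these two records are meaningful.\<close>

definition pre_hilbert_module :: "'a cstar \<Rightarrow> ('a \<Rightarrow> 'a) \<Rightarrow> 'a cstar" where
  "pre_hilbert_module M F = M\<lparr>nrm := \<lambda>x. sqrt (nrm M (F (star M x \<otimes>\<^bsub>M\<^esub> x)))\<rparr>"

definition hilbert_seqs :: "'a cstar \<Rightarrow> ('a \<Rightarrow> 'a) \<Rightarrow> (nat \<Rightarrow> 'a) set" where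
  "hilbert_seqs M F = {a. range a \<subseteq> carrier M \<and> norm_Cauchy (pre_hilbert_module M F) a}"

definition hilbert_rel :: "'a cstar \<Rightarrow> ('a \<Rightarrow> 'a) \<Rightarrow> (nat \<Rightarrow> 'a) rel" where
  "hilbert_rel M F = null_rel (\<lambda>_. pre_hilbert_module M F) (hilbert_seqs M F) sequentially"

definition hilbert_module :: "'a cstar \<Rightarrow> ('a \<Rightarrow> 'a) \<Rightarrow> (nat \<Rightarrow> 'a) set cstar" where
  "hilbert_module M F = seq_quot (\<lambda>_. pre_hilbert_module M F) (hilbert_seqs M F) sequentially"

definition hilbert_extend ::
  "'a cstar \<Rightarrow> ('a \<Rightarrow> 'a) \<Rightarrow> ('a \<Rightarrow> 'a) \<Rightarrow> (nat \<Rightarrow> 'a) set \<Rightarrow> (nat \<Rightarrow> 'a) set" where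
  "hilbert_extend M F T =
     (\<lambda>X\<in>carrier (hilbert_module M F). seq_map (hilbert_rel M F) (\<lambda>_. T) X)"

definition left_mult ::
  "'a cstar \<Rightarrow> ('a \<Rightarrow> 'a) \<Rightarrow> 'a \<Rightarrow> (nat \<Rightarrow> 'a) set \<Rightarrow> (nat \<Rightarrow> 'a) set" where
  "left_mult M F x = hilbert_extend M F (\<lambda>z. x \<otimes>\<^bsub>M\<^esub> z)"

definition jones_projection ::
  "'a cstar \<Rightarrow> ('a \<Rightarrow> 'a) \<Rightarrow> (nat \<Rightarrow> 'a) set \<Rightarrow> (nat \<Rightarrow> 'a) set" where
  "jones_projection M F = hilbert_extend M F F"

text \<open>\<open>S\<close> is the adjoint of \<open>T\<close>; the inner product of two classes is the limit of \<open>F (x\<^sub>n* y\<^sub>n)\<close>.\<close>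

definition is_adjoint ::
  "'a cstar \<Rightarrow> ('a \<Rightarrow> 'a) \<Rightarrow> ((nat \<Rightarrow> 'a) set \<Rightarrow> (nat \<Rightarrow> 'a) set) \<Rightarrow>
   ((nat \<Rightarrow> 'a) set \<Rightarrow> (nat \<Rightarrow> 'a) set) \<Rightarrow> bool" where
  "is_adjoint M F T S \<longleftrightarrow>
     (\<forall>X\<in>carrier (hilbert_module M F). \<forall>Y\<in>carrier (hilbert_module M F).
        \<forall>x\<in>X. \<forall>y\<in>Y. \<forall>x'\<in>T X. \<forall>y'\<in>S Y.
        (\<lambda>n. nrm M (F (star M (x' n) \<otimes>\<^bsub>M\<^esub> y n) \<ominus>\<^bsub>M\<^esub> F (star M (x n) \<otimes>\<^bsub>M\<^esub> y' n)))
          \<longlonglongrightarrow> 0)"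

definition basic_construction ::
  "'a cstar \<Rightarrow> ('a \<Rightarrow> 'a) \<Rightarrow> ((nat \<Rightarrow> 'a) set \<Rightarrow> (nat \<Rightarrow> 'a) set) cstar" where
  "basic_construction M F = (let H = hilbert_module M F;
       B = {\<lambda>X\<in>carrier H. \<Oplus>\<^bsub>H\<^esub>j\<in>{..<length ps}.
              left_mult M F (fst (ps ! j)) (jones_projection M F
                (left_mult M F (snd (ps ! j)) X)) | ps. set ps \<subseteq> carrier M \<times> carrier M} in
     \<lparr>carrier = B,
      mult = (\<lambda>S T. compose (carrier H) S T),
      one = (\<lambda>X\<in>carrier H. X),
      zero = (\<lambda>X\<in>carrier H. \<zero>\<^bsub>H\<^esub>),
      add = (\<lambda>S T. \<lambda>X\<in>carrier H. S X \<oplus>\<^bsub>H\<^esub> T X),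
      smult = (\<lambda>c T. \<lambda>X\<in>carrier H. c \<odot>\<^bsub>H\<^esub> T X),
      star = (\<lambda>T. THE S. S \<in> B \<and> is_adjoint M F T S),
      nrm = (\<lambda>T. Sup {nrm H (T X) | X. X \<in> carrier H \<and> nrm H X \<le> 1})\<rparr>)"

section \<open>The weak tracial Rokhlin property\<close>

text \<open>For \<open>F\<close> of index-finite type, left multiplications lie in the basic construction;
  \<open>\<iota>\<close> is the resulting map from the ultrapower of \<open>M\<close> to that of the basic construction.
  The element \<open>s\<close> is the positive square root of \<open>e\<close>.\<close>

definition weak_tracial_rokhlin ::
  "nat filter \<Rightarrow> 'a cstar \<Rightarrow> 'a set \<Rightarrow> ('a \<Rightarrow> 'a) \<Rightarrow> bool" where
  "weak_tracial_rokhlin \<omega> M Q F \<longleftrightarrow>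
     cstar_algebra M \<and> cstar_subalgebra Q M \<and> conditional_expectation M Q F \<and>
     simple_cstar M \<and> index_finite M F \<and>
     (let M\<omega> = ultrapower \<omega> M;
          K = basic_construction M F;
          K\<omega> = ultrapower \<omega> K;
          \<iota> = seq_map (ultra_rel \<omega> K) (\<lambda>_. left_mult M F);
          F\<omega> = seq_map (ultra_rel \<omega> M) (\<lambda>_. F);
          Ind = ultra_const \<omega> M (index_of M F);
          eQ = ultra_const \<omega> K (jones_projection M F)
      in \<forall>a\<in>carrier M\<omega>. positive M\<omega> a \<and> a \<noteq> \<zero>\<^bsub>M\<omega>\<^esub> \<longrightarrow>
        (\<exists>e\<in>carrier M\<omega>. e \<noteq> \<zero>\<^bsub>M\<omega>\<^esub> \<and> positive M\<omega> e \<and> nrm M\<omega> e \<le> 1 \<and>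
           (\<forall>x\<in>carrier M. e \<otimes>\<^bsub>M\<omega>\<^esub> ultra_const \<omega> M x = ultra_const \<omega> M x \<otimes>\<^bsub>M\<omega>\<^esub> e) \<and>
           (\<exists>s\<in>carrier M\<omega>. positive M\<omega> s \<and> s \<otimes>\<^bsub>M\<omega>\<^esub> s = e \<and>
              \<iota> Ind \<otimes>\<^bsub>K\<omega>\<^esub> (\<iota> s \<otimes>\<^bsub>K\<omega>\<^esub> eQ \<otimes>\<^bsub>K\<omega>\<^esub> \<iota> s) = \<iota> e) \<and>
           cuntz_below M\<omega> (\<one>\<^bsub>M\<omega>\<^esub> \<ominus>\<^bsub>M\<omega>\<^esub> Ind \<otimes>\<^bsub>M\<omega>\<^esub> F\<omega> e) a))"

section \<open>Fixed-point inclusions\<close>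

definition fixed_points ::
  "('h, 'm) monoid_scheme \<Rightarrow> 'd cstar \<Rightarrow> ('h \<Rightarrow> 'd \<Rightarrow> 'd) \<Rightarrow> 'd set" where
  "fixed_points H D \<beta> = {d \<in> carrier D. \<forall>h\<in>carrier H. \<beta> h d = d}"

definition average ::
  "('h, 'm) monoid_scheme \<Rightarrow> 'd cstar \<Rightarrow> ('h \<Rightarrow> 'd \<Rightarrow> 'd) \<Rightarrow> 'd \<Rightarrow> 'd" where
  "average H D \<beta> d = (1 / of_nat (card (carrier H))) \<odot>\<^bsub>D\<^esub> (\<Oplus>\<^bsub>D\<^esub>h\<in>carrier H. \<beta> h d)"

definition iso_to_fixed_point_inclusion ::
  "'a cstar \<Rightarrow> 'a set \<Rightarrow> ('a \<Rightarrow> 'a) \<Rightarrow> ('h, 'm) monoid_scheme \<Rightarrow> 'd cstar \<Rightarrow>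
   ('h \<Rightarrow> 'd \<Rightarrow> 'd) \<Rightarrow> ('a \<Rightarrow> 'd) \<Rightarrow> bool" where
  "iso_to_fixed_point_inclusion M Q F H D \<beta> \<Phi> \<longleftrightarrow>
     group H \<and> finite (carrier H) \<and> cstar_algebra D \<and> cstar_action H D \<beta> \<and>
     \<Phi> \<in> star_iso M D \<and> \<Phi> ` Q = fixed_points H D \<beta> \<and>
     (\<forall>x\<in>carrier M. average H D \<beta> (\<Phi> x) = \<Phi> (F x))"

section \<open>Finite-dimensional building blocks\<close>

definition euclid_norm :: "complex vec \<Rightarrow> real" where
  "euclid_norm v = sqrt (Re (v \<bullet>c v))"

definition mat_cstar :: "nat \<Rightarrow> complex mat cstar" where
  "mat_cstar n =
     \<lparr>carrier = carrier_mat n n,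
      mult = (*),
      one = 1\<^sub>m n,
      zero = 0\<^sub>m n n,
      add = (+),
      smult = (\<cdot>\<^sub>m),
      star = mat_adjoint,
      nrm = (\<lambda>x. Sup {euclid_norm (x *\<^sub>v v) | v. v \<in> carrier_vec n \<and> euclid_norm v \<le> 1})\<rparr>"

definition sum_cstar :: "'a cstar \<Rightarrow> 'b cstar \<Rightarrow> ('a \<times> 'b) cstar" where
  "sum_cstar C D =
     \<lparr>carrier = carrier C \<times> carrier D,
      mult = (\<lambda>(x, y) (x', y'). (x \<otimes>\<^bsub>C\<^esub> x', y \<otimes>\<^bsub>D\<^esub> y')),
      one = (\<one>\<^bsub>C\<^esub>, \<one>\<^bsub>D\<^esub>),
      zero = (\<zero>\<^bsub>C\<^esub>, \<zero>\<^bsub>D\<^esub>),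
      add = (\<lambda>(x, y) (x', y'). (x \<oplus>\<^bsub>C\<^esub> x', y \<oplus>\<^bsub>D\<^esub> y')),
      smult = (\<lambda>c (x, y). (c \<odot>\<^bsub>C\<^esub> x, c \<odot>\<^bsub>D\<^esub> y)),
      star = (\<lambda>(x, y). (star C x, star D y)),
      nrm = (\<lambda>(x, y). max (nrm C x) (nrm D y))\<rparr>"

definition power_cstar :: "'i set \<Rightarrow> 'a cstar \<Rightarrow> ('i \<Rightarrow> 'a) cstar" where
  "power_cstar I C =
     \<lparr>carrier = I \<rightarrow>\<^sub>E carrier C,
      mult = (\<lambda>x y. \<lambda>i\<in>I. x i \<otimes>\<^bsub>C\<^esub> y i),
      one = (\<lambda>i\<in>I. \<one>\<^bsub>C\<^esub>),
      zero = (\<lambda>i\<in>I. \<zero>\<^bsub>C\<^esub>),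
      add = (\<lambda>x y. \<lambda>i\<in>I. x i \<oplus>\<^bsub>C\<^esub> y i),
      smult = (\<lambda>c x. \<lambda>i\<in>I. c \<odot>\<^bsub>C\<^esub> x i),
      star = (\<lambda>x. \<lambda>i\<in>I. star C (x i)),
      nrm = (\<lambda>x. Max ((\<lambda>i. nrm C (x i)) ` I))\<rparr>"

definition kronecker :: "complex mat \<Rightarrow> complex mat \<Rightarrow> complex mat" where
  "kronecker A B = mat (dim_row A * dim_row B) (dim_col A * dim_col B)
     (\<lambda>(i, j). A $$ (i div dim_row B, j div dim_col B) * B $$ (i mod dim_row B, j mod dim_col B))"

definition unitary_rep :: "('g, 'm) monoid_scheme \<Rightarrow> nat \<Rightarrow> ('g \<Rightarrow> complex mat) \<Rightarrow> bool" where
  "unitary_rep G n U \<longleftrightarrow>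
     (\<forall>g\<in>carrier G. U g \<in> carrier_mat n n \<and>
        U g * mat_adjoint (U g) = 1\<^sub>m n \<and> mat_adjoint (U g) * U g = 1\<^sub>m n) \<and>
     (\<forall>g\<in>carrier G. \<forall>h\<in>carrier G. U (g \<otimes>\<^bsub>G\<^esub> h) = U g * U h)"

section \<open>The inductive system\<close>

text \<open>Stages are numbered from 0, so \<open>k\<close>, \<open>r\<close>, \<open>U\<close>, \<open>W\<close> below are the data of the first stage.
  The list \<open>gs\<close> enumerates \<open>G\<close> and fixes the order of the blocks indexed by \<open>G\<close>.\<close>

fun k_dim r_dim :: "nat \<Rightarrow> (nat \<Rightarrow> nat) \<Rightarrow> nat \<Rightarrow> nat \<Rightarrow> nat \<Rightarrow> nat" where
  "k_dim m l k r 0 = k"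
| "r_dim m l k r 0 = r"
| "k_dim m l k r (Suc n) = l n * k_dim m l k r n + m * r_dim m l k r n"
| "r_dim m l k r (Suc n) = k_dim m l k r n + r_dim m l k r n"

definition left_regular ::
  "('g, 'm) monoid_scheme \<Rightarrow> 'g list \<Rightarrow> 'g \<Rightarrow> complex mat" where
  "left_regular G gs g = mat (length gs) (length gs)
     (\<lambda>(i, j). if gs ! i = g \<otimes>\<^bsub>G\<^esub> gs ! j then 1 else 0)"

text \<open>The summand \<open>U\<^sub>g \<otimes> 1\<close> is written as the block diagonal matrix with equal blocks, to match
  the block decomposition of the connecting maps.\<close>

fun U_rep W_rep ::
  "('g, 'm) monoid_scheme \<Rightarrow> 'g list \<Rightarrow> (nat \<Rightarrow> nat) \<Rightarrow>
   ('g \<Rightarrow> complex mat) \<Rightarrow> ('g \<Rightarrow> complex mat) \<Rightarrow> nat \<Rightarrow> 'g \<Rightarrow> complex mat" where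
  "U_rep G gs l U W 0 g = U g"
| "W_rep G gs l U W 0 g = W g"
| "U_rep G gs l U W (Suc n) g = diag_block_mat
     (replicate (l n) (U_rep G gs l U W n g) @
      [kronecker (left_regular G gs g) (W_rep G gs l U W n g)])"
| "W_rep G gs l U W (Suc n) g = diag_block_mat [U_rep G gs l U W n g, W_rep G gs l U W n g]"

type_synonym 'g stage = "complex mat \<times> ('g \<Rightarrow> complex mat)"

definition stage_algebra ::
  "('g, 'm) monoid_scheme \<Rightarrow> (nat \<Rightarrow> nat) \<Rightarrow> nat \<Rightarrow> nat \<Rightarrow> nat \<Rightarrow> 'g stage cstar" where
  "stage_algebra G l k r n =
     sum_cstar (mat_cstar (k_dim (card (carrier G)) l k r n))
       (power_cstar (carrier G) (mat_cstar (r_dim (card (carrier G)) l k r n)))"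

definition stage_map ::
  "('g, 'm) monoid_scheme \<Rightarrow> 'g list \<Rightarrow> (nat \<Rightarrow> nat) \<Rightarrow> nat \<Rightarrow> 'g stage \<Rightarrow> 'g stage" where
  "stage_map G gs l n = (\<lambda>(x, y).
     (diag_block_mat (replicate (l n) x @ map y gs),
      \<lambda>h\<in>carrier G. diag_block_mat [x, y h]))"

definition stage_action ::
  "('g, 'm) monoid_scheme \<Rightarrow> 'g list \<Rightarrow> (nat \<Rightarrow> nat) \<Rightarrow>
   ('g \<Rightarrow> complex mat) \<Rightarrow> ('g \<Rightarrow> complex mat) \<Rightarrow> nat \<Rightarrow> 'g \<Rightarrow> 'g stage \<Rightarrow> 'g stage" where
  "stage_action G gs l U W n g = (\<lambda>(x, y).
     (U_rep G gs l U W n g * x * mat_adjoint (U_rep G gs l U W n g),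
      \<lambda>h\<in>carrier G. W_rep G gs l U W n g * y (inv\<^bsub>G\<^esub> g \<otimes>\<^bsub>G\<^esub> h) *
        mat_adjoint (W_rep G gs l U W n g)))"

definition AF_algebra ::
  "('g, 'm) monoid_scheme \<Rightarrow> 'g list \<Rightarrow> (nat \<Rightarrow> nat) \<Rightarrow> nat \<Rightarrow> nat \<Rightarrow>
   (nat \<Rightarrow> 'g stage) set cstar" where
  "AF_algebra G gs l k r = inductive_limit (stage_algebra G l k r) (stage_map G gs l)"

definition AF_action ::
  "('g, 'm) monoid_scheme \<Rightarrow> 'g list \<Rightarrow> (nat \<Rightarrow> nat) \<Rightarrow> nat \<Rightarrow> nat \<Rightarrow>
   ('g \<Rightarrow> complex mat) \<Rightarrow> ('g \<Rightarrow> complex mat) \<Rightarrow>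
   'g \<Rightarrow> (nat \<Rightarrow> 'g stage) set \<Rightarrow> (nat \<Rightarrow> 'g stage) set" where
  "AF_action G gs l k r U W = limit_action (stage_algebra G l k r) (stage_map G gs l)
     (stage_action G gs l U W)"

end

(* The unitaries v_g = (U_g, 0) implement the action on the first summand of A_n, so the average
 e_n of the v_g^* u_g is a projection of the crossed product that commutes with A_n and satisfies
 |G| e_n F(e_n x) = e_n x exactly; the defect 1 - |G| F(e_n) = (0, 1) is small because k_n / r_n
 tends to infinity.  On the second summand the translation action is free, so the minimal
 projections of D_n compress the crossed product of A_n by G to scalars.  This gives the comparison
 needed for the Rokhlin property, simplicity, and the triviality of the relative commutant of A.
 If A were the fixed-point algebra of a finite group, each of its elements would therefore multiply
 every u_g by a character of G, so that u_g for a commutator g would lie in A, which is impossible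
 for a non-abelian G. *)
theory Submission imports Defs begin

\<comment> \<open>Spectra and functional calculus are avoided; every use of positivity is a norm
  estimate. Order enters only through two inequalities for finite sums of squares,
  \<open>cauchy_schwarz_on\<close> and \<open>squares_positive_on\<close>. They are proved with
  vectors in a single matrix algebra and inherited along isometric embeddings and by quotients of
  sequence algebras, which carries them to the limit. In place of the spectral radius stands
  |x^(2^k)| = |x|^(2^k) for self-adjoint x: an estimate with a constant factor, applied to powers of
  x, loses the factor (\<open>power_dominated_le\<close>). So crude bounds on matrix entries already
  give isometries, and arguments that look at one minimal projection become uniform, although the
  number of its translates that add up to 1 depends on the stage. The comparison y b* b y* = q_j is
  an exact equation at finite stages, and |y| |b| is bounded by 2 |G|^4 at every stage. For the
  Rokhlin property it remains to choose one index j n for each n. Read in the crossed product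
  itself, the same comparison gives simplicity.\<close>
syntax "_index" :: "logic \<Rightarrow> index" (\<open>(00\<^sub>_)\<close> [1000] 1000)

section \<open>Scalar estimates, suprema over unit balls, finite sums in groups\<close>

text \<open>If s < t, then C (s/t)^(2^k) tends to 0 although it is at least 1 for every k. Combined
  with \<open>nrm_pow_selfadjoint\<close> it turns a norm bound up to a constant into the bound with
  constant 1.\<close>

lemma power_dominated_le:
 fixes s t C :: real
 assumes "s >= 0" "!!k. t ^ (2 ^ k) <= C * s ^ (2 ^ k)"
 shows "t <= s"
proof (rule ccontr)
 assume "\<not> t <= s"
 then have ts: "s < t" "t > 0" using assms(1) by auto
 define q where "q = s / t"
 have q: "0 <= q" "q < 1" using ts assms(1) by (auto simp: q_def)
 have "(%k. C * q ^ k) \<longlonglongrightarrow> C * 0"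
  by (intro tendsto_mult tendsto_const LIMSEQ_realpow_zero q)
 moreover have "filterlim (%k. 2 ^ k :: nat) sequentially sequentially"
  by (intro filterlim_subseq) (auto simp: strict_mono_def)
 ultimately have "(%k. C * q ^ (2 ^ k)) \<longlonglongrightarrow> C * 0"
  by (rule filterlim_compose)
 moreover have "1 <= C * q ^ (2 ^ k)" for k :: nat
  using assms(2)[of k] ts by (simp add: q_def power_divide field_simps)
 ultimately have "1 <= C * 0" by (intro LIMSEQ_le_const) auto
 then show False by simp
qed

text \<open>Shared by the operator norms of matrices, of the crossed product and of the basic
  construction. The crude bound \<open>bd\<close> makes the set bounded, so that its real
  \<open>Sup\<close> is a genuine supremum; vectors of length zero are treated apart, as they cannot
  be rescaled.\<close>

lemma sup_norm_bound:
 fixes t N :: "'v => real" and sc :: "real => 'v => 'v"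
 assumes sc: "!!c x. x : V ==> sc c x : V" "!!c x. x : V ==> N (sc c x) = \<bar>c\<bar> * N x"
   "!!c x. x : V ==> t (sc c x) = \<bar>c\<bar> * t x"
  and bd: "!!x. x : V ==> t x <= C * N x" and pos: "!!x. x : V ==> N x >= 0"
  and x: "x : V"
 shows "t x <= Sup {t x |x. x : V & N x <= 1} * N x"
proof (cases "N x = 0")
 case True then show ?thesis using bd[OF x] by simp
next
 case False
 then have n: "N x > 0" using pos[OF x] by simp
 have "t (sc (inverse (N x)) x) <= Sup {t x |x. x : V & N x <= 1}"
 proof (rule cSup_upper)
  show "t (sc (inverse (N x)) x) : {t x |x. x : V & N x <= 1}"
   using sc x n by (intro CollectI exI[of _ "sc (inverse (N x)) x"]) auto
  show "bdd_above {t x |x. x : V & N x <= 1}"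
  proof (rule bdd_aboveI, safe)
   fix y assume "y : V" "N y <= 1"
   then have "t y <= \<bar>C\<bar> * N y" using bd[of y] pos[of y]
    by (smt (verit) mult_right_mono)
   also have "... <= \<bar>C\<bar> * 1" using \<open>N y <= 1\<close> by (intro mult_left_mono) auto
   finally show "t y <= \<bar>C\<bar>" by simp
  qed
 qed
 then show ?thesis using n sc(3)[OF x] by (simp add: field_simps)
qed

lemma sup_norm_least:
 fixes t N :: "'v => real"
 assumes "!!x. x : V ==> t x <= C * N x" "C >= 0" "v : V" "N v <= 1"
 shows "Sup {t x |x. x : V & N x <= 1} <= C"
proof (rule cSup_least)
 show "{t x |x. x : V & N x <= 1} ~= {}" using assms by blast
 fix y assume "y : {t x |x. x : V & N x <= 1}"
 then obtain x where "y = t x" "x : V" "N x <= 1" by blast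
 with assms(1)[of x] assms(2) mult_left_mono[of "N x" 1 C] show "y <= C" by simp
qed

text \<open>A vector killed by the map puts 0 into the set whose supremum is taken.\<close>

lemma sup_norm_nonneg:
 fixes t N :: "'v => real"
 assumes "!!x. x : V ==> t x <= C * N x" "C >= 0" "v : V" "N v <= 1" "t v = 0"
 shows "0 <= Sup {t x |x. x : V & N x <= 1}"
proof -
 have "t v <= Sup {t x |x. x : V & N x <= 1}"
 proof (rule cSup_upper)
  show "bdd_above {t x |x. x : V & N x <= 1}"
  proof (rule bdd_aboveI[of _ C], safe)
   fix y assume "y : V" "N y <= 1"
   with assms(1)[of y] assms(2) mult_left_mono[of "N y" 1 C] show "t y <= C" by simp
  qed
 qed (use assms in blast)
 then show ?thesis using assms by simp
qed

lemma (in abelian_group) a_minus_closed [simp]: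
 "[|x : carrier G; y : carrier G|] ==> x \<ominus> y : carrier G"
 by (simp add: minus_eq)

lemma (in abelian_monoid) finsum_Sigma_swap:
 assumes "finite I" "finite J" "!!i j. [|i : I; j : J|] ==> f i j : carrier G"
 shows "(\<Oplus>i\<in>I. \<Oplus>j\<in>J. f i j) = (\<Oplus>j\<in>J. \<Oplus>i\<in>I. f i j)"
 using assms(1,3)
proof (induction I)
 case empty then show ?case by (simp add: finsum_zero)
next
 case (insert i I)
 have "(\<Oplus>j\<in>J. \<Oplus>i\<in>insert i I. f i j) = (\<Oplus>j\<in>J. f i j \<oplus> (\<Oplus>i\<in>I. f i j))"
  using insert by (intro finsum_cong') (auto intro!: finsum_insert finsum_closed)
 also have "... = (\<Oplus>j\<in>J. f i j) \<oplus> (\<Oplus>j\<in>J. \<Oplus>i\<in>I. f i j)"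
  using insert by (intro finsum_addf) (auto intro!: finsum_closed)
 finally show ?case using insert by (subst finsum_insert) (auto intro!: finsum_closed)
qed

lemma (in abelian_monoid) finsum_eq_single:
 assumes "finite I" "i : I" "f i : carrier G" "!!j. [|j : I; j ~= i|] ==> f j = \<zero>"
 shows "(\<Oplus>j\<in>I. f j) = f i"
proof -
 have I: "I = insert i (I - {i})" using assms by auto
 have "(\<Oplus>j\<in>insert i (I - {i}). f j) = f i \<oplus> (\<Oplus>j\<in>I - {i}. f j)"
  using assms by (intro finsum_insert) auto
 also have "(\<Oplus>j\<in>I - {i}. f j) = \<zero>" using assms by (intro add.finprod_one_eqI) auto
 finally show ?thesis using I assms by simp
qed

lemma (in group) mult_left_image:
 assumes "g : carrier G" shows "(%h. g \<otimes> h) ` carrier G = carrier G"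
proof -
 have "x : (%h. g \<otimes> h) ` carrier G" if "x : carrier G" for x
  using that assms by (intro image_eqI[of _ _ "inv g \<otimes> x"]) (simp_all add: m_assoc[symmetric])
 then show ?thesis using assms by auto
qed

lemma (in group) inv_image_carrier: "(%h. inv h) ` carrier G = carrier G"
proof -
 have "x : (%h. inv h) ` carrier G" if "x : carrier G" for x
  using that by (intro image_eqI[of _ _ "inv x"]) simp_all
 then show ?thesis by auto
qed

section \<open>Seminormed modules and pre-C*-algebras\<close>

text \<open>The structure common to the algebras and to the Hilbert module of the expectation, for
  which only the linear operations and the norm have a meaning.\<close>

locale seminormed_module = abelian_group C for C :: "'a cstar" (structure) +
 assumes smult_closed [simp, intro]: "x : carrier C ==> c \<odot> x : carrier C"
  and smult_add_left: "x : carrier C ==> (c + d) \<odot> x = c \<odot> x \<oplus> d \<odot> x"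
  and smult_add_right:
   "[|x : carrier C; y : carrier C|] ==> c \<odot> (x \<oplus> y) = c \<odot> x \<oplus> c \<odot> y"
  and smult_smult: "x : carrier C ==> (c * d) \<odot> x = c \<odot> (d \<odot> x)"
  and smult_one [simp]: "x : carrier C ==> 1 \<odot> x = x"
  and nrm_smult: "x : carrier C ==> nrm C (c \<odot> x) = cmod c * nrm C x"
  and nrm_triangle:
   "[|x : carrier C; y : carrier C|] ==> nrm C (x \<oplus> y) <= nrm C x + nrm C y"
begin

lemma smult_zero_left [simp]: assumes "x : carrier C" shows "0 \<odot> x = \<zero>"
proof -
 have "0 \<odot> x \<oplus> 0 \<odot> x = 0 \<odot> x" using smult_add_left[of x 0 0] assms by simp
 then show ?thesis using assms by (simp add: add.l_cancel_one)
qed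

lemma smult_zero_right [simp]: "c \<odot> \<zero> = \<zero>"
 using smult_smult[of \<zero> c 0] by simp

lemma smult_minus_one: assumes "x : carrier C" shows "(-1) \<odot> x = \<ominus> x"
proof -
 have "(-1) \<odot> x \<oplus> x = \<zero>" using smult_add_left[of x "-1" 1] assms by simp
 then show ?thesis using assms by (simp add: minus_equality)
qed

lemma nrm_zero [simp]: "nrm C \<zero> = 0"
 using nrm_smult[of \<zero> 0] by simp

lemma nrm_minus [simp]: "x : carrier C ==> nrm C (\<ominus> x) = nrm C x"
 using nrm_smult[of x "-1"] by (simp add: smult_minus_one)

lemma nrm_nonneg [simp]: assumes "x : carrier C" shows "0 <= nrm C x"
 using nrm_triangle[of x "\<ominus> x"] assms by (simp add: r_neg)

lemma nrm_le_zeroD: "[|x : carrier C; nrm C x <= 0|] ==> nrm C x = 0"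
 using nrm_nonneg[of x] by linarith

lemma nrm_diff: "[|x : carrier C; y : carrier C|] ==> nrm C (x \<ominus> y) <= nrm C x + nrm C y"
 using nrm_triangle[of x "\<ominus> y"] by (simp add: minus_eq)

lemma minus_swap: "[|x : carrier C; y : carrier C|] ==> \<ominus> (x \<ominus> y) = y \<ominus> x"
 by (simp add: minus_eq minus_add a_comm)

lemma nrm_swap: "[|x : carrier C; y : carrier C|] ==> nrm C (x \<ominus> y) = nrm C (y \<ominus> x)"
 using nrm_minus[of "x \<ominus> y"] by (simp add: minus_swap)

lemma minus_add_cancel: "[|x : carrier C; y : carrier C|] ==> (x \<ominus> y) \<oplus> y = x"
 by (simp add: minus_eq a_assoc l_neg)

lemma minus_telescope:
 "[|x : carrier C; y : carrier C; z : carrier C|] ==> (x \<ominus> y) \<oplus> (y \<ominus> z) = x \<ominus> z"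
 by (metis a_assoc a_inv_closed a_minus_closed minus_add_cancel minus_eq)

lemma minus_add_distrib:
 assumes "x : carrier C" "y : carrier C" "z : carrier C" "w : carrier C"
 shows "(x \<oplus> y) \<ominus> (z \<oplus> w) = (x \<ominus> z) \<oplus> (y \<ominus> w)"
 using assms by (simp add: minus_eq minus_add a_ac)

lemma nrm_dist_triangle:
 "[|x : carrier C; y : carrier C; z : carrier C|]
  ==> nrm C (x \<ominus> z) <= nrm C (x \<ominus> y) + nrm C (y \<ominus> z)"
 using nrm_triangle[of "x \<ominus> y" "y \<ominus> z"] by (simp add: minus_telescope)

lemma nrm_le_dist: "[|x : carrier C; y : carrier C|] ==> nrm C x <= nrm C (x \<ominus> y) + nrm C y"
 using nrm_triangle[of "x \<ominus> y" y] by (simp add: minus_add_cancel)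

lemma nrm_diff_abs:
 "[|x : carrier C; y : carrier C|] ==> \<bar>nrm C x - nrm C y\<bar> <= nrm C (x \<ominus> y)"
 using nrm_le_dist[of x y] nrm_le_dist[of y x] nrm_swap[of x y] by simp

lemma smult_minus_right:
 "[|x : carrier C; y : carrier C|] ==> c \<odot> (x \<ominus> y) = c \<odot> x \<ominus> c \<odot> y"
 using smult_add_right[of x "\<ominus> y" c] smult_smult[of y c "-1"] smult_smult[of y "-1" c]
 by (simp add: minus_eq smult_minus_one)

lemma smult_diff_left:
 "x : carrier C ==> (c - d) \<odot> x = c \<odot> x \<ominus> d \<odot> x"
 using smult_add_left[of x c "-d"] smult_smult[of x "-1" d]
 by (simp add: minus_eq smult_minus_one)

lemma sub_zero [simp]: "x : carrier C ==> x \<ominus> \<zero> = x"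
 by (simp add: minus_eq)

lemma sub_self [simp]: "x : carrier C ==> x \<ominus> x = \<zero>"
 by (simp add: minus_eq r_neg)

lemma nrm_finsum:
 "[|finite I; f : I \<rightarrow> carrier C|] ==> nrm C (\<Oplus>i\<in>I. f i) <= (\<Sum>i\<in>I. nrm C (f i))"
proof (induction I rule: finite_induct)
 case (insert i I)
 then have "nrm C (\<Oplus>i\<in>insert i I. f i) <= nrm C (f i) + nrm C (\<Oplus>i\<in>I. f i)"
  by (subst finsum_insert) (auto intro!: nrm_triangle finsum_closed)
 then show ?case using insert by auto
qed simp

lemma smult_finsum:
 "[|finite I; f : I \<rightarrow> carrier C|] ==> c \<odot> (\<Oplus>i\<in>I. f i) = (\<Oplus>i\<in>I. c \<odot> f i)"
proof (induction I rule: finite_induct)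
 case (insert i I)
 have "c \<odot> (\<Oplus>i\<in>insert i I. f i) = c \<odot> (f i \<oplus> (\<Oplus>i\<in>I. f i))"
  using insert by (subst finsum_insert) auto
 also have "... = c \<odot> f i \<oplus> (\<Oplus>i\<in>I. c \<odot> f i)" using insert
  by (subst smult_add_right) (auto intro!: finsum_closed)
 finally show ?case using insert by (subst (2) finsum_insert) auto
qed simp

end

locale seminormed_algebra = ring C + seminormed_module C for C :: "'a cstar" (structure) +
 assumes smult_mult_left:
   "[|x : carrier C; y : carrier C|] ==> (c \<odot> x) \<otimes> y = c \<odot> (x \<otimes> y)"
  and smult_mult_right:
   "[|x : carrier C; y : carrier C|] ==> x \<otimes> (c \<odot> y) = c \<odot> (x \<otimes> y)"
  and nrm_mult:
   "[|x : carrier C; y : carrier C|] ==> nrm C (x \<otimes> y) <= nrm C x * nrm C y"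
begin

lemma minus_mult_left:
 "[|x : carrier C; y : carrier C; z : carrier C|] ==> (x \<ominus> y) \<otimes> z = x \<otimes> z \<ominus> y \<otimes> z"
 by (simp add: minus_eq l_distr l_minus)

lemma minus_mult_right:
 "[|x : carrier C; y : carrier C; z : carrier C|] ==> z \<otimes> (x \<ominus> y) = z \<otimes> x \<ominus> z \<otimes> y"
 by (simp add: minus_eq r_distr r_minus)

lemma nrm_mult_diff:
 assumes "a : carrier C" "b : carrier C" "a' : carrier C" "b' : carrier C"
 shows "nrm C (a \<otimes> b \<ominus> a' \<otimes> b') <= nrm C (a \<ominus> a') * nrm C b + nrm C a' * nrm C (b \<ominus> b')"
proof -
 have "a \<otimes> b \<ominus> a' \<otimes> b' = (a \<ominus> a') \<otimes> b \<oplus> a' \<otimes> (b \<ominus> b')"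
  using assms by (simp add: minus_mult_left minus_mult_right minus_telescope)
 then show ?thesis using assms nrm_triangle[of "(a \<ominus> a') \<otimes> b" "a' \<otimes> (b \<ominus> b')"]
   nrm_mult[of "a \<ominus> a'" b] nrm_mult[of a' "b \<ominus> b'"] by simp
qed

lemma nrm_pow: "x : carrier C ==> nrm C (x [^] Suc n) <= nrm C x ^ Suc n"
proof (induction n)
 case (Suc n)
 have "nrm C (x [^] Suc (Suc n)) <= nrm C (x [^] Suc n) * nrm C x"
  using nrm_mult[of "x [^] Suc n" x] Suc by simp
 also have "... <= nrm C x ^ Suc n * nrm C x" using Suc by (intro mult_right_mono) auto
 finally show ?case by (simp add: mult.commute)
qed simp

end

text \<open>A C*-algebra up to completeness. Stages, quotients of sequence algebras and sums are
  treated at this level; completeness is established for the inductive limit and for the crossed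
  product.\<close>

locale pre_cstar = seminormed_algebra C for C :: "'a cstar" (structure) +
 assumes star_closed [simp, intro]: "x : carrier C ==> star C x : carrier C"
  and star_star [simp]: "x : carrier C ==> star C (star C x) = x"
  and star_add:
   "[|x : carrier C; y : carrier C|] ==> star C (x \<oplus> y) = star C x \<oplus> star C y"
  and star_smult: "x : carrier C ==> star C (c \<odot> x) = cnj c \<odot> star C x"
  and star_mult:
   "[|x : carrier C; y : carrier C|] ==> star C (x \<otimes> y) = star C y \<otimes> star C x"
  and nrm_eq_0: "x : carrier C ==> nrm C x = 0 \<longleftrightarrow> x = \<zero>"
  and cstar_identity: "x : carrier C ==> nrm C (star C x \<otimes> x) = (nrm C x)\<^sup>2"
begin

lemma cstar_algebraI:
 assumes "!!s. [|range s <= carrier C; norm_Cauchy C s|] ==> \<exists>x\<in>carrier C. norm_lim C s x"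
 shows "cstar_algebra C"
 by unfold_locales
  (auto simp: smult_add_left smult_add_right smult_smult smult_mult_left smult_mult_right star_add
   star_smult star_mult nrm_eq_0 nrm_smult cstar_identity intro: nrm_triangle nrm_mult assms)

lemma star_zero [simp]: "star C \<zero> = \<zero>"
 using star_smult[of \<zero> 0] by simp

lemma star_one [simp]: "star C \<one> = \<one>"
 by (metis one_closed r_one star_closed star_mult star_star l_one)

lemma star_minus: "x : carrier C ==> star C (\<ominus> x) = \<ominus> star C x"
 using star_smult[of x "-1"] by (simp add: smult_minus_one)

lemma star_diff:
 "[|x : carrier C; y : carrier C|] ==> star C (x \<ominus> y) = star C x \<ominus> star C y"
 by (simp add: minus_eq star_add star_minus)

lemma star_finsum:
 "[|finite I; f : I \<rightarrow> carrier C|] ==> star C (\<Oplus>i\<in>I. f i) = (\<Oplus>i\<in>I. star C (f i))"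
proof (induction I rule: finite_induct)
 case (insert i I)
 have "star C (\<Oplus>i\<in>insert i I. f i) = star C (f i \<oplus> (\<Oplus>i\<in>I. f i))"
  using insert by (subst finsum_insert) auto
 also have "... = star C (f i) \<oplus> (\<Oplus>i\<in>I. star C (f i))" using insert
  by (subst star_add) (auto intro!: finsum_closed)
 finally show ?case using insert by (subst (2) finsum_insert) auto
qed simp

lemma nrm_star [simp]: assumes x: "x : carrier C" shows "nrm C (star C x) = nrm C x"
proof -
 have le: "nrm C y <= nrm C (star C y)" if "y : carrier C" for y
 proof (cases "nrm C y = 0")
  case False
  then have "nrm C y > 0" using that nrm_nonneg[of y] by linarith
  moreover have "(nrm C y)\<^sup>2 <= nrm C (star C y) * nrm C y"
   using cstar_identity[of y] nrm_mult[of "star C y" y] that by simp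
  ultimately show ?thesis by (simp add: power2_eq_square)
 qed (use that in auto)
 from le[OF x] le[of "star C x"] x show ?thesis by simp
qed

lemma nrm_one_le: "nrm C \<one> <= 1"
proof -
 have "nrm C \<one> = (nrm C \<one>)\<^sup>2" using cstar_identity[of \<one>] by simp
 then have "nrm C \<one> = 0 \<or> nrm C \<one> = 1" by (auto simp: power2_eq_square)
 then show ?thesis by auto
qed

lemma nrm_projection:
 assumes "p : carrier C" "star C p = p" "p \<otimes> p = p" shows "nrm C p = 0 \<or> nrm C p = 1"
proof -
 have "nrm C p = (nrm C p)\<^sup>2" using cstar_identity[of p] assms by simp
 then show ?thesis by (auto simp: power2_eq_square)
qed

lemma nrm_le_zero_imp: "[|x : carrier C; nrm C x <= 0|] ==> x = \<zero>"
 using nrm_le_zeroD[of x] nrm_eq_0[of x] by simp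

lemma nrm_eq_zeroD: "[|x : carrier C; y : carrier C; nrm C (x \<ominus> y) = 0|] ==> x = y"
 using nrm_eq_0[of "x \<ominus> y"] minus_add_cancel[of x y] by simp

lemma star_pow: "x : carrier C ==> star C (x [^] (n::nat)) = star C x [^] n"
proof (induction n)
 case (Suc n)
 then have "star C (x [^] Suc n) = star C x \<otimes> star C x [^] n" by (simp add: star_mult)
 then show ?case using Suc nat_pow_Suc2[of "star C x" n] by simp
qed simp

text \<open>The C*-identity applied to x^(2^k) doubles the exponent. Along powers of two the norm of
  a self-adjoint element is multiplicative, which serves in place of the spectral radius
  formula.\<close>

lemma nrm_pow_selfadjoint:
 assumes "x : carrier C" "star C x = x" shows "nrm C (x [^] ((2::nat) ^ k)) = nrm C x ^ (2 ^ k)"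
proof (induction k)
 case (Suc k)
 have "nrm C (x [^] ((2::nat) ^ Suc k)) = nrm C (star C (x [^] ((2::nat) ^ k)) \<otimes> x [^] ((2::nat) ^ k))"
  using assms by (simp add: star_pow nat_pow_mult mult_2)
 also have "... = nrm C x ^ (2 ^ Suc k)" using assms Suc
  by (subst cstar_identity) (auto simp: power_mult[symmetric] mult.commute)
 finally show ?case .
qed (use assms in simp)

end

lemma cstar_algebra_pre_cstar: "cstar_algebra C ==> pre_cstar C"
proof -
 assume "cstar_algebra C"
 then interpret cstar_algebra C .
 show ?thesis by unfold_locales
  (auto simp: smult_add_left smult_add_right smult_smult smult_mult_left smult_mult_right star_add
   star_smult star_mult nrm_eq_0 nrm_smult cstar_identity smult_one smult_closed star_closed star_star
   intro: nrm_triangle nrm_mult)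
qed

definition star_hom :: "'a cstar => 'b cstar => ('a => 'b) => bool" where
 "star_hom C D f \<longleftrightarrow> f : Ring.ring_hom C D \<and>
   (\<forall>c. \<forall>x\<in>carrier C. f (c \<odot>\<^sub>C x) = c \<odot>\<^sub>D f x) \<and>
   (\<forall>x\<in>carrier C. f (star C x) = star D (f x))"

lemma star_homI:
 assumes "!!x. x : carrier C ==> f x : carrier D" "f \<one>\<^sub>C = \<one>\<^sub>D"
  "!!x y. [|x : carrier C; y : carrier C|] ==> f (x \<oplus>\<^sub>C y) = f x \<oplus>\<^sub>D f y"
  "!!x y. [|x : carrier C; y : carrier C|] ==> f (x \<otimes>\<^sub>C y) = f x \<otimes>\<^sub>D f y"
  "!!c x. x : carrier C ==> f (c \<odot>\<^sub>C x) = c \<odot>\<^sub>D f x"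
  "!!x. x : carrier C ==> f (star C x) = star D (f x)"
 shows "star_hom C D f"
 using assms by (auto simp: star_hom_def Ring.ring_hom_def)

context
 fixes C :: "'a cstar" and D :: "'b cstar" and f
 assumes hom: "star_hom C D f"
begin

lemma
 assumes "x : carrier C"
 shows star_hom_closed: "f x : carrier D"
  and star_hom_smult: "f (c \<odot>\<^sub>C x) = c \<odot>\<^sub>D f x"
  and star_hom_star: "f (star C x) = star D (f x)"
 using assms hom by (auto simp: star_hom_def Ring.ring_hom_def)

lemma star_hom_one: "f \<one>\<^sub>C = \<one>\<^sub>D"
 using hom by (auto simp: star_hom_def Ring.ring_hom_def)

lemma
 assumes "x : carrier C" "y : carrier C"
 shows star_hom_add: "f (x \<oplus>\<^sub>C y) = f x \<oplus>\<^sub>D f y"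
  and star_hom_mult: "f (x \<otimes>\<^sub>C y) = f x \<otimes>\<^sub>D f y"
 using assms hom by (auto simp: star_hom_def Ring.ring_hom_def)

context
 assumes pre: "pre_cstar C" "pre_cstar D"
begin

interpretation C: pre_cstar C by (rule pre)
interpretation D: pre_cstar D by (rule pre)

lemma star_hom_zero: "f \<zero>\<^sub>C = \<zero>\<^sub>D"
 using star_hom_smult[of "\<zero>\<^sub>C" 0] star_hom_closed[of "\<zero>\<^sub>C"] by simp

lemma star_hom_minus:
 assumes "x : carrier C" "y : carrier C"
 shows "f (x \<ominus>\<^sub>C y) = f x \<ominus>\<^sub>D f y"
 using assms star_hom_add[of x "(-1) \<odot>\<^sub>C y"] star_hom_smult[of y "-1"] star_hom_closed[of y]
 by (simp add: C.smult_minus_one D.smult_minus_one C.minus_eq D.minus_eq)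

lemma star_hom_finsum:
 "[|finite I; x : I \<rightarrow> carrier C|] ==> f (\<Oplus>\<^sub>C i\<in>I. x i) = (\<Oplus>\<^sub>D i\<in>I. f (x i))"
proof (induction I rule: finite_induct)
 case (insert i I)
 then show ?case
  by (subst C.finsum_insert D.finsum_insert; auto simp: star_hom_add intro: star_hom_closed)+
qed (simp add: star_hom_zero)

lemma star_hom_pow: "x : carrier C ==> f (x [^]\<^sub>C (n::nat)) = f x [^]\<^sub>D n"
 by (induction n) (simp_all add: star_hom_one star_hom_mult)

text \<open>For self-adjoint y the bound with K, applied to y^(2^k), reads |f y|^(2^k) <= K
  |y|^(2^k), so K may be replaced by 1. The general case follows by passing to x* x.\<close>

lemma star_hom_contractive:
 assumes bd: "!!x. x : carrier C ==> nrm D (f x) <= K * nrm C x" and x: "x : carrier C"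
 shows "nrm D (f x) <= nrm C x"
proof -
 have sa: "nrm D (f y) <= nrm C y" if "y : carrier C" "star C y = y" for y
 proof (rule power_dominated_le[where C = K])
  fix k
  have "star D (f y) = f y" using that star_hom_star[of y] by simp
  then show "nrm D (f y) ^ 2 ^ k <= K * nrm C y ^ 2 ^ k"
   using bd[of "y [^]\<^sub>C ((2::nat) ^ k)"] that star_hom_closed[of y]
   by (simp add: star_hom_pow C.nrm_pow_selfadjoint D.nrm_pow_selfadjoint)
 qed (use that in simp)
 have "(nrm D (f x))\<^sup>2 = nrm D (f (star C x \<otimes>\<^sub>C x))"
  using x star_hom_closed[of x] by (simp add: D.cstar_identity star_hom_mult star_hom_star)
 also have "... <= (nrm C x)\<^sup>2"
  using sa[of "star C x \<otimes>\<^sub>C x"] x by (simp add: C.cstar_identity C.star_mult)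
 finally show ?thesis using x by (simp add: power2_le_iff_abs_le)
qed

text \<open>Mirror image of the contractive case. Together they show that a homomorphism bounded
  above and below by any constants is isometric.\<close>

lemma star_hom_expansive:
 assumes bd: "!!x. x : carrier C ==> nrm C x <= K * nrm D (f x)" and x: "x : carrier C"
 shows "nrm C x <= nrm D (f x)"
proof -
 have sa: "nrm C y <= nrm D (f y)" if "y : carrier C" "star C y = y" for y
 proof (rule power_dominated_le[where C = K])
  fix k
  have "star D (f y) = f y" using that star_hom_star[of y] by simp
  then show "nrm C y ^ 2 ^ k <= K * nrm D (f y) ^ 2 ^ k"
   using bd[of "y [^]\<^sub>C ((2::nat) ^ k)"] that star_hom_closed[of y]
   by (simp add: star_hom_pow C.nrm_pow_selfadjoint D.nrm_pow_selfadjoint)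
 qed (use that star_hom_closed in simp)
 have "(nrm C x)\<^sup>2 = nrm C (star C x \<otimes>\<^sub>C x)" using x by (simp add: C.cstar_identity)
 also have "... <= nrm D (f (star C x \<otimes>\<^sub>C x))"
  using sa[of "star C x \<otimes>\<^sub>C x"] x by (simp add: C.star_mult)
 also have "... = (nrm D (f x))\<^sup>2"
  using x star_hom_closed[of x] by (simp add: D.cstar_identity star_hom_mult star_hom_star)
 finally show ?thesis using x star_hom_closed[of x] by (simp add: power2_le_iff_abs_le)
qed

end
end

section \<open>Sequences modulo null sequences\<close>

text \<open>Cauchy-Schwarz for the C-valued inner product on the column module C^I. As an inequality
  between norms it passes to limits of sequences and is inherited along isometric
  homomorphisms.\<close>

definition cauchy_schwarz_on :: "'i set => 'a cstar => bool" where
 "cauchy_schwarz_on I C \<longleftrightarrow> (\<forall>x\<in>I \<rightarrow> carrier C. \<forall>y\<in>I \<rightarrow> carrier C.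
   (nrm C (\<Oplus>\<^sub>C i\<in>I. star C (x i) \<otimes>\<^sub>C y i))\<^sup>2 \<le>
   nrm C (\<Oplus>\<^sub>C i\<in>I. star C (x i) \<otimes>\<^sub>C x i) * nrm C (\<Oplus>\<^sub>C i\<in>I. star C (y i) \<otimes>\<^sub>C y i))"

text \<open>The bound below says that a sum of squares \<open>s\<close> satisfies \<open>0 <= s <= t\<close>, without reference to an
 order relation.\<close>

definition squares_positive_on :: "'i set => 'a cstar => bool" where
 "squares_positive_on I C \<longleftrightarrow> (\<forall>x\<in>I \<rightarrow> carrier C. \<forall>t.
   nrm C (\<Oplus>\<^sub>C i\<in>I. star C (x i) \<otimes>\<^sub>C x i) <= t \<longrightarrow>
   nrm C (of_real t \<odot>\<^sub>C \<one>\<^sub>C \<ominus>\<^sub>C (\<Oplus>\<^sub>C i\<in>I. star C (x i) \<otimes>\<^sub>C x i)) <= t)"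

text \<open>One frame for ultrapowers, inductive limits and Hilbert module completions. The quotient
  norm is a \<open>Lim\<close>, which is meaningful because of \<open>S_conv\<close>: an ultrafilter
  provides the limit by compactness, and in the other two cases the norms form a Cauchy
  sequence.\<close>

locale seq_module =
 fixes C :: "nat => 'a cstar" and S :: "(nat => 'a) set" and \<FF> :: "nat filter"
 assumes modules: "seminormed_module (C n)"
  and nontrivial: "\<FF> ~= bot"
  and S_carrier: "a : S ==> a n : carrier (C n)"
  and S_zero: "(%n. \<zero>\<^sub>(C n)) : S"
  and S_add: "[|a : S; b : S|] ==> (%n. a n \<oplus>\<^sub>(C n) b n) : S"
  and S_smult: "a : S ==> (%n. c \<odot>\<^sub>(C n) a n) : S"
  and S_conv: "a : S ==> \<exists>L. ((%n. nrm (C n) (a n)) \<longlongrightarrow> L) \<FF>"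
begin

sublocale C: seminormed_module "C n" for n by (rule modules)

abbreviation cls :: "(nat => 'a) => (nat => 'a) set" where
 "cls a \<equiv> null_rel C S \<FF> `` {a}"

abbreviation quot :: "(nat => 'a) set cstar" where
 "quot \<equiv> seq_quot C S \<FF>"

lemma S_minus: assumes "a : S" "b : S" shows "(%n. a n \<ominus>\<^sub>(C n) b n) : S"
 using S_add[OF assms(1) S_smult[OF assms(2), of "-1"]] assms
 by (simp add: C.smult_minus_one S_carrier C.minus_eq)

lemma null_relI:
 assumes "a : S" "b : S" "!!n. nrm (C n) (a n \<ominus>\<^sub>(C n) b n) <= g n" "(g \<longlongrightarrow> 0) \<FF>"
 shows "(a, b) : null_rel C S \<FF>"
proof -
 have "((%n. nrm (C n) (a n \<ominus>\<^sub>(C n) b n)) \<longlongrightarrow> 0) \<FF>"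
  by (rule tendsto_sandwich[OF _ _ tendsto_const assms(4)])
   (use assms(1-3) in "simp_all add: S_carrier")
 then show ?thesis using assms(1,2) by (simp add: null_rel_def)
qed

lemma null_relD:
 "(a, b) : null_rel C S \<FF> ==> ((%n. nrm (C n) (a n \<ominus>\<^sub>(C n) b n)) \<longlongrightarrow> 0) \<FF>"
 by (auto simp: null_rel_def)

lemma equiv_null_rel: "equiv S (null_rel C S \<FF>)"
proof (rule equivI)
 show "null_rel C S \<FF> <= S \<times> S" by (auto simp: null_rel_def)
 show "refl_on S (null_rel C S \<FF>)"
  by (rule refl_onI) (auto intro!: null_relI[where g = "%_. 0"] simp: S_carrier)
 show "sym (null_rel C S \<FF>)"
 proof (rule symI)
  fix a b assume ab: "(a, b) : null_rel C S \<FF>"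
  then have "a : S" "b : S" by (auto simp: null_rel_def)
  then show "(b, a) : null_rel C S \<FF>"
   by (intro null_relI[OF _ _ _ null_relD[OF ab]]) (simp_all add: S_carrier C.nrm_swap[of "b _" _ "a _"])
 qed
 show "trans (null_rel C S \<FF>)"
 proof (rule transI)
  fix a b c assume ab: "(a, b) : null_rel C S \<FF>" and bc: "(b, c) : null_rel C S \<FF>"
  then have "a : S" "b : S" "c : S" by (auto simp: null_rel_def)
  then show "(a, c) : null_rel C S \<FF>"
   using tendsto_add[OF null_relD[OF ab] null_relD[OF bc]]
   by (intro null_relI[where g = "%n. nrm (C n) (a n \<ominus>\<^sub>(C n) b n) + nrm (C n) (b n \<ominus>\<^sub>(C n) c n)"])
    (simp_all add: S_carrier C.nrm_dist_triangle)
 qed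
qed

lemma cls_eqI:
 assumes "a : S" "b : S" "!!n. nrm (C n) (a n \<ominus>\<^sub>(C n) b n) <= g n" "(g \<longlongrightarrow> 0) \<FF>"
 shows "cls a = cls b"
 using equiv_class_eq[OF equiv_null_rel null_relI[OF assms]] .

lemma cls_eqI_eventually:
 assumes "a : S" "b : S" "eventually (%n. a n = b n) \<FF>" shows "cls a = cls b"
proof (rule cls_eqI[OF assms(1,2) order_refl])
 have "eventually (%n. nrm (C n) (a n \<ominus>\<^sub>(C n) b n) = 0) \<FF>"
  using assms(3) by eventually_elim (use assms(2) in "simp add: S_carrier")
 then show "((%n. nrm (C n) (a n \<ominus>\<^sub>(C n) b n)) \<longlongrightarrow> 0) \<FF>" by (rule tendsto_eventually)
qed

lemma cls_eq_iff:
 assumes "a : S" "b : S"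
 shows "cls a = cls b \<longleftrightarrow> ((%n. nrm (C n) (a n \<ominus>\<^sub>(C n) b n)) \<longlongrightarrow> 0) \<FF>"
 using eq_equiv_class_iff[OF equiv_null_rel assms] assms by (auto simp: null_rel_def)

lemma quot_carrier: "carrier quot = cls ` S"
 by (auto simp: seq_quot_def Let_def quotient_def)

lemma cls_closed [intro]: "a : S ==> cls a : carrier quot"
 by (simp add: quot_carrier)

lemma quotE: assumes "X : carrier quot" obtains a where "a : S" "X = cls a"
 using assms by (auto simp: quot_carrier)

lemma cls_binop:
 assumes "a : S" "b : S"
  and "!!a a' b b'. [|(a, a') : null_rel C S \<FF>; (b, b') : null_rel C S \<FF>|]
   ==> (F a b, F a' b') : null_rel C S \<FF>"
 shows "(\<Union>a\<in>cls a. \<Union>b\<in>cls b. cls (F a b)) = cls (F a b)"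
proof (rule UN_equiv_class2[OF equiv_null_rel equiv_null_rel _ assms(1,2)])
 show "congruent2 (null_rel C S \<FF>) (null_rel C S \<FF>) (%a b. cls (F a b))"
  using assms(3) equiv_class_eq[OF equiv_null_rel] unfolding congruent2_def by fast
qed

lemma cls_unop:
 assumes "a : S" and "!!a a'. (a, a') : null_rel C S \<FF> ==> R `` {F a} = R `` {F a'}"
 shows "(\<Union>a\<in>cls a. R `` {F a}) = R `` {F a}"
 by (rule UN_equiv_class[OF equiv_null_rel _ assms(1)])
  (use assms(2) in "auto simp: congruent_def")

lemma add_cls: assumes "a : S" "b : S"
 shows "cls a \<oplus>\<^sub>quot cls b = cls (%n. a n \<oplus>\<^sub>(C n) b n)"
proof -
 have "(\<Union>a\<in>cls a. \<Union>b\<in>cls b. cls (%n. a n \<oplus>\<^sub>(C n) b n)) = cls (%n. a n \<oplus>\<^sub>(C n) b n)"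
 proof (rule cls_binop[OF assms])
  fix a a' b b' assume ab: "(a, a') : null_rel C S \<FF>" "(b, b') : null_rel C S \<FF>"
  then have "a : S" "b : S" "a' : S" "b' : S" by (auto simp: null_rel_def)
  then show "(%n. a n \<oplus>\<^sub>(C n) b n, %n. a' n \<oplus>\<^sub>(C n) b' n) : null_rel C S \<FF>"
   using tendsto_add[OF null_relD[OF ab(1)] null_relD[OF ab(2)]]
   by (intro null_relI[where g = "%n. nrm (C n) (a n \<ominus>\<^sub>(C n) a' n) + nrm (C n) (b n \<ominus>\<^sub>(C n) b' n)"])
    (auto intro!: S_add C.nrm_triangle simp: C.minus_add_distrib S_carrier)
 qed
 then show ?thesis by (simp add: seq_quot_def Let_def)
qed

lemma smult_cls: assumes "a : S"
 shows "c \<odot>\<^sub>quot cls a = cls (%n. c \<odot>\<^sub>(C n) a n)"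
proof -
 have "(\<Union>a\<in>cls a. cls (%n. c \<odot>\<^sub>(C n) a n)) = cls (%n. c \<odot>\<^sub>(C n) a n)"
 proof (rule cls_unop[OF assms])
  fix a a' assume ab: "(a, a') : null_rel C S \<FF>"
  then have "a : S" "a' : S" by (auto simp: null_rel_def)
  then show "cls (%n. c \<odot>\<^sub>(C n) a n) = cls (%n. c \<odot>\<^sub>(C n) a' n)"
   using tendsto_mult[OF tendsto_const[of "cmod c"] null_relD[OF ab]]
   by (intro cls_eqI[where g = "%n. cmod c * nrm (C n) (a n \<ominus>\<^sub>(C n) a' n)"])
    (auto intro!: S_smult simp: C.smult_minus_right[symmetric] C.nrm_smult S_carrier)
 qed
 then show ?thesis by (simp add: seq_quot_def Let_def)
qed

lemma zero_cls: "\<zero>\<^sub>quot = cls (%n. \<zero>\<^sub>(C n))"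
 by (simp add: seq_quot_def Let_def)

text \<open>Equivalent representatives have norms with the same limit, so the image set in the
  definition of the norm is a singleton and \<open>the_elem\<close> returns that limit.\<close>

lemma nrm_cls_tendsto: assumes "a : S"
 shows "((%n. nrm (C n) (a n)) \<longlongrightarrow> nrm quot (cls a)) \<FF>"
proof -
 obtain L where L: "((%n. nrm (C n) (a n)) \<longlongrightarrow> L) \<FF>" using S_conv[OF assms] by blast
 have "Lim \<FF> (%n. nrm (C n) (b n)) = L" if "b : cls a" for b
 proof (rule tendsto_Lim[OF nontrivial])
  have b: "(a, b) : null_rel C S \<FF>" using that by simp
  then have S: "b : S" by (auto simp: null_rel_def)
  have "((%n. nrm (C n) (a n) - nrm (C n) (b n)) \<longlongrightarrow> 0) \<FF>"
   by (rule tendsto_rabs_zero_cancel, rule tendsto_sandwich[OF _ _ tendsto_const null_relD[OF b]])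
    (use assms S in "auto intro!: always_eventually C.nrm_diff_abs simp: S_carrier")
  from tendsto_diff[OF L this] show "((%n. nrm (C n) (b n)) \<longlongrightarrow> L) \<FF>" by simp
 qed
 moreover have "a : cls a" using assms equiv_class_self[OF equiv_null_rel] by blast
 ultimately have "(%a. Lim \<FF> (%n. nrm (C n) (a n))) ` cls a = {L}" by auto
 then have "nrm quot (cls a) = L" by (simp add: seq_quot_def Let_def)
 with L show ?thesis by simp
qed

lemma nrm_cls_le:
 assumes "a : S" "eventually (%n. nrm (C n) (a n) <= K) \<FF>" shows "nrm quot (cls a) <= K"
 using tendsto_upperbound[OF nrm_cls_tendsto[OF assms(1)] assms(2) nontrivial] .

lemma nrm_cls_const:
 assumes "a : S" "eventually (%n. nrm (C n) (a n) = K) \<FF>" shows "nrm quot (cls a) = K"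
 using tendsto_unique[OF nontrivial nrm_cls_tendsto[OF assms(1)] tendsto_eventually[OF assms(2)]] .

lemma quot_module: "seminormed_module quot"
proof -
 have ab: "abelian_group quot"
 proof (rule abelian_groupI)
  fix X assume "X : carrier quot"
  then obtain a where a: "a : S" "X = cls a" by (rule quotE)
  then have "cls (%n. (-1) \<odot>\<^sub>(C n) a n) \<oplus>\<^sub>quot X = \<zero>\<^sub>quot"
   by (simp add: add_cls S_smult zero_cls) (simp add: C.smult_minus_one S_carrier C.l_neg)
  then show "\<exists>Y\<in>carrier quot. Y \<oplus>\<^sub>quot X = \<zero>\<^sub>quot" using a S_smult by blast
 next
  fix X Y assume "X : carrier quot" "Y : carrier quot"
  then obtain a b where a: "a : S" "X = cls a" and b: "b : S" "Y = cls b" by (metis quotE)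
  then show "X \<oplus>\<^sub>quot Y : carrier quot" "X \<oplus>\<^sub>quot Y = Y \<oplus>\<^sub>quot X"
   by (simp_all add: add_cls S_add cls_closed C.a_comm S_carrier)
  fix Z assume "Z : carrier quot"
  then obtain c where "c : S" "Z = cls c" by (metis quotE)
  with a b show "X \<oplus>\<^sub>quot Y \<oplus>\<^sub>quot Z = X \<oplus>\<^sub>quot (Y \<oplus>\<^sub>quot Z)"
   by (simp add: add_cls S_add C.a_assoc S_carrier)
 qed (auto elim!: quotE simp: add_cls zero_cls S_zero S_carrier intro!: cls_closed)
 show ?thesis
 proof (intro seminormed_module.intro ab seminormed_module_axioms.intro)
  fix X Y c assume "X : carrier quot" "Y : carrier quot"
  then obtain a b where a: "a : S" "X = cls a" and b: "b : S" "Y = cls b" by (metis quotE)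
  show "nrm quot (X \<oplus>\<^sub>quot Y) <= nrm quot X + nrm quot Y"
   using a b unfolding a(2) b(2)
   by (simp add: add_cls)
    (rule tendsto_le[OF nontrivial tendsto_add[OF nrm_cls_tendsto nrm_cls_tendsto] nrm_cls_tendsto],
     auto intro!: always_eventually C.nrm_triangle S_add simp: S_carrier)
 next
  fix X c assume "X : carrier quot"
  then obtain a where a: "a : S" "X = cls a" by (metis quotE)
  have "((%n. nrm (C n) (c \<odot>\<^sub>(C n) a n)) \<longlongrightarrow> cmod c * nrm quot X) \<FF>"
   unfolding a(2) using a(1)
   by (simp add: C.nrm_smult S_carrier tendsto_mult[OF tendsto_const nrm_cls_tendsto])
  moreover have "((%n. nrm (C n) (c \<odot>\<^sub>(C n) a n)) \<longlongrightarrow> nrm quot (c \<odot>\<^sub>quot X)) \<FF>"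
   unfolding a(2) smult_cls[OF a(1)] by (rule nrm_cls_tendsto[OF S_smult[OF a(1)]])
  ultimately show "nrm quot (c \<odot>\<^sub>quot X) = cmod c * nrm quot X"
   using tendsto_unique[OF nontrivial] by blast
 qed (auto elim!: quotE simp: add_cls smult_cls S_smult S_add S_carrier C.smult_add_left
   C.smult_add_right C.smult_smult intro!: cls_closed)
qed

sublocale Q: seminormed_module quot by (rule quot_module)

lemma minus_cls: assumes "a : S" "b : S"
 shows "cls a \<ominus>\<^sub>quot cls b = cls (%n. a n \<ominus>\<^sub>(C n) b n)"
proof -
 have "cls a \<ominus>\<^sub>quot cls b = cls a \<oplus>\<^sub>quot (-1) \<odot>\<^sub>quot cls b"
  using assms by (simp add: Q.minus_eq Q.smult_minus_one cls_closed)
 also have "... = cls (%n. a n \<ominus>\<^sub>(C n) b n)"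
  using assms by (simp add: smult_cls add_cls S_smult) (simp add: C.smult_minus_one S_carrier C.minus_eq)
 finally show ?thesis .
qed

lemma finsum_cls:
 assumes "finite I" "!!i. i : I ==> x i : S"
 shows "(%n. \<Oplus>\<^sub>(C n) i\<in>I. x i n) : S \<and>
  (\<Oplus>\<^sub>quot i\<in>I. cls (x i)) = cls (%n. \<Oplus>\<^sub>(C n) i\<in>I. x i n)"
 using assms
proof (induction I rule: finite_induct)
 case empty
 show ?case using S_zero by (simp add: zero_cls)
next
 case (insert i I)
 then have "(%n. \<Oplus>\<^sub>(C n) i\<in>insert i I. x i n) = (%n. x i n \<oplus>\<^sub>(C n) (\<Oplus>\<^sub>(C n) i\<in>I. x i n))"
  by (intro ext C.finsum_insert) (auto simp: S_carrier)
 moreover have "(\<Oplus>\<^sub>quot i\<in>insert i I. cls (x i)) = cls (x i) \<oplus>\<^sub>quot (\<Oplus>\<^sub>quot i\<in>I. cls (x i))"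
  using insert by (intro Q.finsum_insert) (auto intro!: cls_closed)
 ultimately show ?case using insert by (auto simp: add_cls intro!: S_add)
qed

end

locale seq_algebra = seq_module +
 assumes algebras: "seminormed_algebra (C n)"
  and S_one: "(%n. \<one>\<^sub>(C n)) : S"
  and S_mult: "[|a : S; b : S|] ==> (%n. a n \<otimes>\<^sub>(C n) b n) : S"
begin

sublocale C: seminormed_algebra "C n" for n by (rule algebras)

lemma one_cls: "\<one>\<^sub>quot = cls (%n. \<one>\<^sub>(C n))"
 by (simp add: seq_quot_def Let_def)

lemma mult_cls: assumes "a : S" "b : S"
 shows "cls a \<otimes>\<^sub>quot cls b = cls (%n. a n \<otimes>\<^sub>(C n) b n)"
proof -
 have "(\<Union>a\<in>cls a. \<Union>b\<in>cls b. cls (%n. a n \<otimes>\<^sub>(C n) b n)) = cls (%n. a n \<otimes>\<^sub>(C n) b n)"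
 proof (rule cls_binop[OF assms])
  fix a a' b b' assume ab: "(a, a') : null_rel C S \<FF>" "(b, b') : null_rel C S \<FF>"
  then have S: "a : S" "b : S" "a' : S" "b' : S" by (auto simp: null_rel_def)
  have "((%n. nrm (C n) (a n \<ominus>\<^sub>(C n) a' n) * nrm (C n) (b n) +
    nrm (C n) (a' n) * nrm (C n) (b n \<ominus>\<^sub>(C n) b' n)) \<longlongrightarrow> 0 * nrm quot (cls b) + nrm quot (cls a') * 0) \<FF>"
   by (intro tendsto_intros nrm_cls_tendsto S null_relD ab)
  then show "(%n. a n \<otimes>\<^sub>(C n) b n, %n. a' n \<otimes>\<^sub>(C n) b' n) : null_rel C S \<FF>"
   using S by (intro null_relI[OF _ _ C.nrm_mult_diff]) (auto intro!: S_mult simp: S_carrier)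
 qed
 then show ?thesis by (simp add: seq_quot_def Let_def)
qed

lemma quot_algebra: "seminormed_algebra quot"
proof -
 have ring: "ring quot"
 proof (rule ringI[OF Q.abelian_group_axioms])
  show "Group.monoid quot"
   by (rule monoidI) (auto elim!: quotE simp: mult_cls one_cls S_one S_mult C.m_assoc S_carrier
     intro!: cls_closed)
 qed (auto elim!: quotE simp: mult_cls S_mult add_cls S_add C.l_distr C.r_distr S_carrier)
 show ?thesis
 proof (intro seminormed_algebra.intro ring quot_module seminormed_algebra_axioms.intro)
  fix X Y assume "X : carrier quot" "Y : carrier quot"
  then obtain a b where a: "a : S" "X = cls a" and b: "b : S" "Y = cls b" by (metis quotE)
  show "nrm quot (X \<otimes>\<^sub>quot Y) <= nrm quot X * nrm quot Y"
   using a b unfolding a(2) b(2)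
   by (simp add: mult_cls)
    (rule tendsto_le[OF nontrivial tendsto_mult[OF nrm_cls_tendsto nrm_cls_tendsto] nrm_cls_tendsto],
     auto intro!: always_eventually C.nrm_mult S_mult simp: S_carrier)
 qed (auto elim!: quotE simp: mult_cls S_mult smult_cls S_smult C.smult_mult_left
   C.smult_mult_right S_carrier)
qed

sublocale Q: seminormed_algebra quot by (rule quot_algebra)

end

locale seq_cstar = seq_algebra +
 assumes cstars: "pre_cstar (C n)"
  and S_star: "a : S ==> (%n. star (C n) (a n)) : S"
begin

sublocale C: pre_cstar "C n" for n by (rule cstars)

lemma star_cls: assumes "a : S"
 shows "star quot (cls a) = cls (%n. star (C n) (a n))"
proof -
 have "(\<Union>a\<in>cls a. cls (%n. star (C n) (a n))) = cls (%n. star (C n) (a n))"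
 proof (rule cls_unop[OF assms])
  fix a a' assume ab: "(a, a') : null_rel C S \<FF>"
  then have "a : S" "a' : S" by (auto simp: null_rel_def)
  then show "cls (%n. star (C n) (a n)) = cls (%n. star (C n) (a' n))"
   using null_relD[OF ab]
   by (intro cls_eqI[where g = "%n. nrm (C n) (a n \<ominus>\<^sub>(C n) a' n)"])
    (auto intro!: S_star simp: C.star_diff[symmetric] S_carrier)
 qed
 then show ?thesis by (simp add: seq_quot_def Let_def)
qed

lemma quot_cstar: "pre_cstar quot"
proof (intro pre_cstar.intro quot_algebra pre_cstar_axioms.intro)
 fix X assume "X : carrier quot"
 then obtain a where a: "a : S" "X = cls a" by (metis quotE)
 show "nrm quot X = 0 \<longleftrightarrow> X = \<zero>\<^sub>quot"
 proof
  assume "nrm quot X = 0"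
  with nrm_cls_tendsto[OF a(1)] a show "X = \<zero>\<^sub>quot"
   unfolding zero_cls a(2)
   by (intro cls_eqI[where g = "%n. nrm (C n) (a n)"] S_zero) (auto simp: S_carrier)
 qed simp
 have "((%n. (nrm (C n) (a n))\<^sup>2) \<longlongrightarrow> (nrm quot X)\<^sup>2) \<FF>"
  unfolding a(2) using a(1) by (intro tendsto_intros nrm_cls_tendsto)
 moreover have "((%n. (nrm (C n) (a n))\<^sup>2) \<longlongrightarrow> nrm quot (star quot X \<otimes>\<^sub>quot X)) \<FF>"
  using nrm_cls_tendsto[OF S_mult[OF S_star[OF a(1)] a(1)]] a
  by (simp add: star_cls mult_cls S_star C.cstar_identity S_carrier)
 ultimately show "nrm quot (star quot X \<otimes>\<^sub>quot X) = (nrm quot X)\<^sup>2"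
  using tendsto_unique[OF nontrivial] by blast
qed (auto elim!: quotE simp: star_cls S_star add_cls S_add mult_cls S_mult smult_cls S_smult
  C.star_add C.star_mult C.star_smult S_carrier intro!: cls_closed)

sublocale Q: pre_cstar quot by (rule quot_cstar)

lemma finsum_star_mult_cls:
 assumes "finite I" "!!i. i : I ==> a i : S" "!!i. i : I ==> b i : S"
  "!!i. i : I ==> x i = cls (a i)" "!!i. i : I ==> y i = cls (b i)"
 shows "(%n. \<Oplus>\<^sub>(C n) i\<in>I. star (C n) (a i n) \<otimes>\<^sub>(C n) b i n) : S \<and>
  (\<Oplus>\<^sub>quot i\<in>I. star quot (x i) \<otimes>\<^sub>quot y i) =
   cls (%n. \<Oplus>\<^sub>(C n) i\<in>I. star (C n) (a i n) \<otimes>\<^sub>(C n) b i n)"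
proof -
 have "(\<Oplus>\<^sub>quot i\<in>I. star quot (x i) \<otimes>\<^sub>quot y i) =
   (\<Oplus>\<^sub>quot i\<in>I. cls (%n. star (C n) (a i n) \<otimes>\<^sub>(C n) b i n))"
  using assms by (intro Q.finsum_cong') (auto simp: star_cls mult_cls S_star S_mult intro!: cls_closed)
 then show ?thesis
  using finsum_cls[of I "%i n. star (C n) (a i n) \<otimes>\<^sub>(C n) b i n"] assms
  by (simp add: S_mult S_star)
qed

lemma quot_cauchy_schwarz:
 assumes I: "finite I" and cs: "!!n. cauchy_schwarz_on I (C n)"
 shows "cauchy_schwarz_on I quot"
 unfolding cauchy_schwarz_on_def
proof (intro ballI)
 fix x y assume "x : I \<rightarrow> carrier quot" "y : I \<rightarrow> carrier quot"
 then have "\<forall>i\<in>I. \<exists>a. a : S & x i = cls a" "\<forall>i\<in>I. \<exists>a. a : S & y i = cls a"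
  by (auto simp: quot_carrier Pi_iff image_iff)
 then obtain a b where a: "!!i. i : I ==> a i : S" "!!i. i : I ==> x i = cls (a i)"
  and b: "!!i. i : I ==> b i : S" "!!i. i : I ==> y i = cls (b i)" by metis
 define s where "s u v n = (\<Oplus>\<^sub>(C n) i\<in>I. star (C n) (u i n) \<otimes>\<^sub>(C n) v i n)" for u v n
 have s: "s a b : S" "s a a : S" "s b b : S"
  and eqs: "(\<Oplus>\<^sub>quot i\<in>I. star quot (x i) \<otimes>\<^sub>quot y i) = cls (s a b)"
   "(\<Oplus>\<^sub>quot i\<in>I. star quot (x i) \<otimes>\<^sub>quot x i) = cls (s a a)"
   "(\<Oplus>\<^sub>quot i\<in>I. star quot (y i) \<otimes>\<^sub>quot y i) = cls (s b b)"
  using finsum_star_mult_cls[OF I a(1) b(1) a(2) b(2)] finsum_star_mult_cls[OF I a(1) a(1) a(2) a(2)]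
   finsum_star_mult_cls[OF I b(1) b(1) b(2) b(2)] by (simp_all add: s_def[abs_def])
 have "(nrm (C n) (s a b n))\<^sup>2 <= nrm (C n) (s a a n) * nrm (C n) (s b b n)" for n
 proof -
  have "(%i. a i n) : I \<rightarrow> carrier (C n)" "(%i. b i n) : I \<rightarrow> carrier (C n)"
   using a(1) b(1) by (auto simp: S_carrier)
  with cs[of n] show ?thesis unfolding cauchy_schwarz_on_def s_def by fast
 qed
 then have "(nrm quot (cls (s a b)))\<^sup>2 <= nrm quot (cls (s a a)) * nrm quot (cls (s b b))"
  by (intro tendsto_le[OF nontrivial tendsto_mult[OF nrm_cls_tendsto[OF s(2)] nrm_cls_tendsto[OF s(3)]]
     tendsto_power[OF nrm_cls_tendsto[OF s(1)]]] always_eventually allI)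
 then show "(nrm quot (\<Oplus>\<^sub>quot i\<in>I. star quot (x i) \<otimes>\<^sub>quot y i))\<^sup>2 \<le>
   nrm quot (\<Oplus>\<^sub>quot i\<in>I. star quot (x i) \<otimes>\<^sub>quot x i) *
   nrm quot (\<Oplus>\<^sub>quot i\<in>I. star quot (y i) \<otimes>\<^sub>quot y i)"
  by (simp add: eqs)
qed

text \<open>Representatives satisfy the bound t only in the limit. At index n it is therefore
  replaced by the maximum of t and |s n|; this changes the element by a multiple of 1 of norm at
  most the excess over t, and the excess tends to 0.\<close>

lemma quot_squares_positive:
 assumes I: "finite I" and pos: "!!n. squares_positive_on I (C n)"
 shows "squares_positive_on I quot"
 unfolding squares_positive_on_def
proof (intro ballI allI impI)
 fix x t assume "x : I \<rightarrow> carrier quot"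
  and le: "nrm quot (\<Oplus>\<^sub>quot i\<in>I. star quot (x i) \<otimes>\<^sub>quot x i) <= t"
 then have "\<forall>i\<in>I. \<exists>a. a : S & x i = cls a" by (auto simp: quot_carrier Pi_iff image_iff)
 then obtain a where a: "!!i. i : I ==> a i : S" "!!i. i : I ==> x i = cls (a i)" by metis
 define s where "s n = (\<Oplus>\<^sub>(C n) i\<in>I. star (C n) (a i n) \<otimes>\<^sub>(C n) a i n)" for n
 have s: "s : S" and xs: "(\<Oplus>\<^sub>quot i\<in>I. star quot (x i) \<otimes>\<^sub>quot x i) = cls s"
  using finsum_star_mult_cls[OF I a(1) a(1) a(2) a(2)] by (simp_all add: s_def[abs_def])
 define T where "T n = of_real t \<odot>\<^sub>(C n) \<one>\<^sub>(C n) \<ominus>\<^sub>(C n) s n" for n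
 have T: "T : S" unfolding T_def[abs_def] by (intro S_minus S_smult S_one s)
 have lim: "((%n. (max t (nrm (C n) (s n)) - t) + max t (nrm (C n) (s n))) \<longlongrightarrow> (max t (nrm quot (cls s)) - t) +
   max t (nrm quot (cls s))) \<FF>"
  by (rule tendsto_add[OF tendsto_diff[OF tendsto_max[OF tendsto_const] tendsto_const]
     tendsto_max[OF tendsto_const]]; rule nrm_cls_tendsto[OF s])
 have "nrm (C n) (T n) <= (max t (nrm (C n) (s n)) - t) + max t (nrm (C n) (s n))" for n
 proof -
  let ?t = "max t (nrm (C n) (s n))"
  have sn: "s n : carrier (C n)" using s by (simp add: S_carrier)
  have "(%i. a i n) : I \<rightarrow> carrier (C n)" using a(1) by (auto simp: S_carrier)
  from pos[of n, unfolded squares_positive_on_def, rule_format, OF this, of ?t]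
  have 1: "nrm (C n) (of_real ?t \<odot>\<^sub>(C n) \<one>\<^sub>(C n) \<ominus>\<^sub>(C n) s n) <= ?t"
   unfolding s_def by linarith
  let ?A = "of_real t \<odot>\<^sub>(C n) \<one>\<^sub>(C n)" and ?B = "of_real ?t \<odot>\<^sub>(C n) \<one>\<^sub>(C n)"
  have AB: "?A : carrier (C n)" "?B : carrier (C n)" by simp_all
  have "T n \<ominus>\<^sub>(C n) (?B \<ominus>\<^sub>(C n) s n) = (?A \<ominus>\<^sub>(C n) s n) \<oplus>\<^sub>(C n) \<ominus>\<^sub>(C n) (?B \<ominus>\<^sub>(C n) s n)"
   unfolding T_def by (rule C.minus_eq)
  also have "... = ?A \<ominus>\<^sub>(C n) ?B"
   unfolding C.minus_swap[OF AB(2) sn] by (rule C.minus_telescope[OF AB(1) sn AB(2)])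
  also have "... = of_real (t - ?t) \<odot>\<^sub>(C n) \<one>\<^sub>(C n)"
   by (simp add: C.smult_diff_left)
  also have "nrm (C n) ... <= \<bar>t - ?t\<bar> * 1"
   unfolding C.nrm_smult[OF C.one_closed] norm_of_real using C.nrm_one_le by (rule mult_left_mono) simp
  finally have "nrm (C n) (T n \<ominus>\<^sub>(C n) (of_real ?t \<odot>\<^sub>(C n) \<one>\<^sub>(C n) \<ominus>\<^sub>(C n) s n)) <= ?t - t"
   by simp
  with 1 C.nrm_le_dist[OF S_carrier[OF T, of n] C.a_minus_closed[OF AB(2) sn]] show ?thesis by linarith
 qed
 then have "nrm quot (cls T) <= (max t (nrm quot (cls s)) - t) + max t (nrm quot (cls s))"
  by (intro tendsto_le[OF nontrivial lim nrm_cls_tendsto[OF T]] always_eventually allI)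
 also have "... = t" using le xs by simp
 finally show "nrm quot (of_real t \<odot>\<^sub>quot \<one>\<^sub>quot \<ominus>\<^sub>quot
   (\<Oplus>\<^sub>quot i\<in>I. star quot (x i) \<otimes>\<^sub>quot x i)) <= t"
  unfolding xs one_cls smult_cls[OF S_one] minus_cls[OF S_smult[OF S_one] s] T_def[abs_def] .
qed

end

text \<open>A Lipschitz constant common to all indices sends null differences to null differences,
  so the union over all representatives is the class of any one image sequence.\<close>

lemma seq_map_class:
 assumes "seq_module C S \<FF>" "seq_module D T \<FF>"
  and f: "!!a. a : S ==> (%n. f n (a n)) : T"
  and lip: "!!n x y. [|x : carrier (C n); y : carrier (C n)|]
   ==> nrm (D n) (f n x \<ominus>\<^sub>(D n) f n y) <= K * nrm (C n) (x \<ominus>\<^sub>(C n) y)"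
  and a: "a : S"
 shows "seq_map (null_rel D T \<FF>) f (null_rel C S \<FF> `` {a}) = null_rel D T \<FF> `` {%n. f n (a n)}"
proof -
 interpret C: seq_module C S \<FF> by fact
 interpret D: seq_module D T \<FF> by fact
 show ?thesis unfolding seq_map_def
 proof (rule C.cls_unop[OF a])
  fix a a' assume ab: "(a, a') : null_rel C S \<FF>"
  then have "a : S" "a' : S" by (auto simp: null_rel_def)
  then show "D.cls (%n. f n (a n)) = D.cls (%n. f n (a' n))"
   using tendsto_mult[OF tendsto_const[of K] C.null_relD[OF ab]]
   by (intro D.cls_eqI[OF _ _ lip]) (auto intro!: f simp: C.S_carrier)
 qed
qed

no_notation Finite_Cartesian_Product.vec.vec_nth (infixl \<open>$\<close> 90)

section \<open>Matrix algebras and their finite direct sums\<close>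

abbreviation sq :: "nat => complex mat set" where "sq n \<equiv> carrier_mat n n"
abbreviation adj :: "complex mat => complex mat" where "adj \<equiv> mat_adjoint"
abbreviation "vnorm \<equiv> euclid_norm"
abbreviation "Mat \<equiv> mat_cstar"

lemma cscalar_prod_sum:
 assumes "v : carrier_vec n" "w : carrier_vec n"
 shows "v \<bullet>c w = (\<Sum>i<n. v $ i * cnj (w $ i))"
 using assms by (auto simp: scalar_prod_def atLeast0LessThan intro!: sum.cong)

lemma cscalar_prod_self:
 assumes "v : carrier_vec n" shows "v \<bullet>c v = complex_of_real ((vnorm v)\<^sup>2)"
  and euclid_norm_L2: "vnorm v = L2_set (%i. cmod (v $ i)) {..<n}"
proof -
 have "z * cnj z = complex_of_real ((cmod z)\<^sup>2)" for z
  using complex_norm_square[of z] by simp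
 then have *: "v \<bullet>c v = complex_of_real (\<Sum>i<n. (cmod (v $ i))\<^sup>2)"
  using assms by (auto simp: cscalar_prod_sum simp del: of_real_power intro!: sum.cong)
 then show "vnorm v = L2_set (%i. cmod (v $ i)) {..<n}"
  by (simp add: euclid_norm_def L2_set_def)
 moreover have "(L2_set (%i. cmod (v $ i)) {..<n})\<^sup>2 = (\<Sum>i<n. (cmod (v $ i))\<^sup>2)"
  by (simp add: L2_set_def sum_nonneg)
 ultimately show "v \<bullet>c v = complex_of_real ((vnorm v)\<^sup>2)" using * by simp
qed

lemma euclid_norm_nonneg [simp]: "v : carrier_vec n ==> 0 <= vnorm v"
 by (simp add: euclid_norm_L2)

lemma cscalar_prod_le:
 assumes "v : carrier_vec n" "w : carrier_vec n"
 shows "cmod (v \<bullet>c w) <= vnorm v * vnorm w"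
proof -
 have "cmod (v \<bullet>c w) <= (\<Sum>i<n. \<bar>cmod (v $ i)\<bar> * \<bar>cmod (w $ i)\<bar>)"
  using assms by (auto simp: cscalar_prod_sum norm_mult intro: sum_norm_le)
 also have "... <= L2_set (%i. cmod (v $ i)) {..<n} * L2_set (%i. cmod (w $ i)) {..<n}"
  by (rule L2_set_mult_ineq)
 finally show ?thesis using assms by (simp add: euclid_norm_L2)
qed

lemma euclid_norm_add:
 assumes "v : carrier_vec n" "w : carrier_vec n"
 shows "vnorm (v + w) <= vnorm v + vnorm w"
proof -
 have "vnorm (v + w) = L2_set (%i. cmod (v $ i + w $ i)) {..<n}"
  using assms by (subst euclid_norm_L2[of _ n]) (auto intro!: L2_set_cong)
 also have "... <= L2_set (%i. cmod (v $ i) + cmod (w $ i)) {..<n}"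
  by (intro L2_set_mono norm_triangle_ineq) auto
 also have "... <= vnorm v + vnorm w"
  using assms by (simp add: euclid_norm_L2 L2_set_triangle_ineq)
 finally show ?thesis .
qed

lemma euclid_norm_smult:
 assumes "v : carrier_vec n" shows "vnorm (c \<cdot>\<^sub>v v) = cmod c * vnorm v"
proof -
 have "vnorm (c \<cdot>\<^sub>v v) = L2_set (%i. cmod c * cmod (v $ i)) {..<n}"
  using assms by (subst euclid_norm_L2[of _ n]) (auto intro!: L2_set_cong simp: norm_mult)
 also have "... = cmod c * vnorm v"
  using assms by (simp add: euclid_norm_L2 L2_set_right_distrib)
 finally show ?thesis .
qed

lemma mat_adjoint_carrier [intro]:
 "A : carrier_mat n m ==> adj A : carrier_mat m n"
 by (rule carrier_matI) (auto simp: mat_adjoint_def)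

lemma mat_adjoint_index [simp]:
 fixes A :: "complex mat"
 assumes "i < dim_col A" "j < dim_row A" shows "adj A $$ (i, j) = cnj (A $$ (j, i))"
 using assms unfolding mat_adjoint_def by (simp add: mat_of_rows_index)

lemma mat_adjoint_dim [simp]:
 "dim_row (adj A) = dim_col A" "dim_col (adj A) = dim_row A"
 by (auto simp: mat_adjoint_def)

lemma mat_vec_index_sum:
 fixes A :: "complex mat"
 assumes "A : carrier_mat n m" "v : carrier_vec m" "i < n"
 shows "(A *\<^sub>v v) $ i = (\<Sum>j<m. A $$ (i, j) * v $ j)"
 using assms by (auto simp: scalar_prod_def atLeast0LessThan intro!: sum.cong)

lemma mat_mult_index_sum:
 fixes A :: "complex mat"
 assumes "A : carrier_mat n m" "B : carrier_mat m k" "i < n" "j < k"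
 shows "(A * B) $$ (i, j) = (\<Sum>l<m. A $$ (i, l) * B $$ (l, j))"
 using assms by (auto simp: scalar_prod_def atLeast0LessThan intro!: sum.cong)

lemma mat_adjoint_inner:
 fixes A :: "complex mat"
 assumes "A : carrier_mat n m" "v : carrier_vec m" "w : carrier_vec n"
 shows "(A *\<^sub>v v) \<bullet>c w = v \<bullet>c (adj A *\<^sub>v w)"
proof -
 have "(A *\<^sub>v v) \<bullet>c w = (\<Sum>i<n. \<Sum>j<m. A $$ (i, j) * v $ j * cnj (w $ i))"
  using assms by (subst cscalar_prod_sum[of _ n])
   (auto simp: mat_vec_index_sum sum_distrib_right simp del: index_mult_mat_vec)
 also have "... = (\<Sum>j<m. \<Sum>i<n. A $$ (i, j) * v $ j * cnj (w $ i))" by (rule sum.swap)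
 also have "... = v \<bullet>c (adj A *\<^sub>v w)"
  using assms mat_adjoint_carrier[OF assms(1)] by (subst cscalar_prod_sum[of _ m])
   (auto simp: mat_vec_index_sum[OF mat_adjoint_carrier[OF assms(1)]] sum_distrib_left ac_simps
    simp del: index_mult_mat_vec intro!: sum.cong)
 finally show ?thesis .
qed

lemma mat_adjoint_adjoint [simp]:
 fixes A :: "complex mat" shows "adj (adj A) = A"
 by (rule eq_matI) auto

lemma mat_adjoint_mult:
 fixes A :: "complex mat"
 assumes "A : carrier_mat n m" "B : carrier_mat m k"
 shows "adj (A * B) = adj B * adj A"
 using assms by (intro eq_matI) (auto simp: scalar_prod_def ac_simps intro!: sum.cong)

lemma mat_adjoint_one [simp]: "adj (1\<^sub>m n) = (1\<^sub>m n :: complex mat)"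
 by (rule eq_matI) auto

lemma mat_adjoint_zero [simp]: "adj (0\<^sub>m n m) = (0\<^sub>m m n :: complex mat)"
 by (rule eq_matI) auto

lemma mat_cstar_simps [simp]:
 "carrier (Mat n) = sq n" "mult (Mat n) = (*)" "one (Mat n) = 1\<^sub>m n"
 "zero (Mat n) = 0\<^sub>m n n" "add (Mat n) = (+)" "smult (Mat n) = (\<cdot>\<^sub>m)"
 "star (Mat n) = adj"
 by (simp_all add: mat_cstar_def)

text \<open>Far from sharp; it shows that the supremum defining the operator norm is taken over a
  bounded set.\<close>

lemma mat_vec_norm_crude:
 fixes A :: "complex mat"
 assumes A: "A : sq n" and v: "v : carrier_vec n"
 shows "vnorm (A *\<^sub>v v) <= (\<Sum>i<n. \<Sum>j<n. cmod (A $$ (i, j))) * vnorm v"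
proof -
 have "cmod ((A *\<^sub>v v) $ i) <= (\<Sum>j<n. cmod (A $$ (i, j))) * vnorm v" if i: "i < n" for i
 proof -
  have "cmod ((A *\<^sub>v v) $ i) <= (\<Sum>j<n. cmod (A $$ (i, j)) * cmod (v $ j))"
   using mat_vec_index_sum[OF A v i] by (auto simp: norm_mult intro: sum_norm_le)
  also have "... <= (\<Sum>j<n. cmod (A $$ (i, j)) * vnorm v)"
   using v by (intro sum_mono mult_left_mono) (auto simp: euclid_norm_L2 intro: member_le_L2_set)
  finally show ?thesis by (simp add: sum_distrib_right)
 qed
 then have "(\<Sum>i<n. cmod ((A *\<^sub>v v) $ i)) <= (\<Sum>i<n. (\<Sum>j<n. cmod (A $$ (i, j))) * vnorm v)"
  by (intro sum_mono) auto
 moreover have "vnorm (A *\<^sub>v v) <= (\<Sum>i<n. cmod ((A *\<^sub>v v) $ i))"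
  unfolding euclid_norm_L2[OF mult_mat_vec_carrier[OF A v]] by (rule L2_set_le_sum) simp
 ultimately show ?thesis by (simp add: sum_distrib_right)
qed

lemma mat_norm_eq:
 "nrm (Mat n) A = Sup {vnorm (A *\<^sub>v v) | v. v : carrier_vec n & vnorm v <= 1}"
 by (simp add: mat_cstar_def)

lemma mat_norm_bound:
 assumes A: "A : sq n" and v: "v : carrier_vec n"
 shows "vnorm (A *\<^sub>v v) <= nrm (Mat n) A * vnorm v"
 unfolding mat_norm_eq
proof (rule sup_norm_bound[where sc = "%c v. complex_of_real c \<cdot>\<^sub>v v"])
 show "vnorm (A *\<^sub>v (complex_of_real c \<cdot>\<^sub>v x)) = \<bar>c\<bar> * vnorm (A *\<^sub>v x)"
  if "x : carrier_vec n" for c x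
  using that A by (simp add: mult_mat_vec euclid_norm_smult[of _ n])
qed (use assms mat_vec_norm_crude euclid_norm_smult in \<open>auto\<close>)

lemma euclid_norm_zero [simp]: "vnorm (0\<^sub>v n) = 0"
 by (subst euclid_norm_L2[of _ n]) (auto simp: L2_set_def)

lemma mat_norm_least:
 assumes "!!v. v : carrier_vec n ==> vnorm (A *\<^sub>v v) <= K * vnorm v" "K >= 0"
 shows "nrm (Mat n) A <= K"
 unfolding mat_norm_eq by (rule sup_norm_least[OF assms, where v = "0\<^sub>v n"]) auto

lemma mat_norm_nonneg:
 assumes A: "A : sq n" shows "0 <= nrm (Mat n) A"
 unfolding mat_norm_eq
proof (rule sup_norm_nonneg[where v = "0\<^sub>v n" and C = "\<Sum>i<n. \<Sum>j<n. cmod (A $$ (i, j))"])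
 have "A *\<^sub>v 0\<^sub>v n = 0\<^sub>v n" using A by (intro eq_vecI) auto
 then show "vnorm (A *\<^sub>v 0\<^sub>v n) = 0" by simp
 show "0 <= (\<Sum>i<n. \<Sum>j<n. cmod (A $$ (i, j)))" by (intro sum_nonneg) simp
qed (auto intro: mat_vec_norm_crude[OF A])

lemma mat_norm_entry_sum:
 assumes "A : sq n"
 shows "nrm (Mat n) A <= (\<Sum>i<n. \<Sum>j<n. cmod (A $$ (i, j)))"
 using mat_vec_norm_crude[OF assms] by (rule mat_norm_least) (assumption, intro sum_nonneg norm_ge_zero)

lemma mat_norm_entry:
 assumes A: "A : sq n" and "i < n" "j < n"
 shows "cmod (A $$ (i, j)) <= nrm (Mat n) A"
proof -
 have u: "vnorm (unit_vec n j :: complex vec) = 1"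
  using assms by (subst euclid_norm_L2[of _ n])
   (auto simp: L2_set_def unit_vec_def if_distrib[where f = "%x. (cmod x)\<^sup>2"] cong: if_cong)
 have "A $$ (i, j) = (A *\<^sub>v unit_vec n j) $ i"
  using assms by (simp add: mat_vec_index_sum[of _ n n] unit_vec_def if_distrib del: index_mult_mat_vec cong: if_cong)
 also have "cmod ... <= vnorm (A *\<^sub>v unit_vec n j)"
  unfolding euclid_norm_L2[OF mult_mat_vec_carrier[OF A unit_vec_carrier]]
  by (rule member_le_L2_set) (use assms in auto)
 also have "... <= nrm (Mat n) A" using mat_norm_bound[OF A, of "unit_vec n j"] u by simp
 finally show ?thesis .
qed

lemma mat_norm_adjoint_le:
 assumes A: "A : sq n"
 shows "nrm (Mat n) (adj A) <= nrm (Mat n) A"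
proof (rule mat_norm_least)
 fix v :: "complex vec" assume v: "v : carrier_vec n"
 let ?w = "adj A *\<^sub>v v"
 have w: "?w : carrier_vec n" using A v mat_adjoint_carrier[OF A] by auto
 have "complex_of_real ((vnorm ?w)\<^sup>2) = (A *\<^sub>v ?w) \<bullet>c v"
  using cscalar_prod_self(1)[OF w] mat_adjoint_inner[OF A w v] by simp
 then have "(vnorm ?w)\<^sup>2 = cmod ((A *\<^sub>v ?w) \<bullet>c v)"
  by (metis abs_of_nonneg norm_of_real zero_le_power2)
 also have "... <= vnorm (A *\<^sub>v ?w) * vnorm v"
  using A w v by (intro cscalar_prod_le[of _ n]) auto
 also have "... <= (nrm (Mat n) A * vnorm ?w) * vnorm v"
  using A w v by (intro mult_right_mono mat_norm_bound) auto
 finally have "vnorm ?w * vnorm ?w <= vnorm ?w * (nrm (Mat n) A * vnorm v)"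
  by (simp add: power2_eq_square ac_simps)
 then show "vnorm ?w <= nrm (Mat n) A * vnorm v"
  using mat_norm_nonneg[OF A] v euclid_norm_nonneg[OF w] by (cases "vnorm ?w = 0")
   (auto simp: mult_le_cancel_left)
qed (rule mat_norm_nonneg[OF A])

lemma mat_norm_mult:
 assumes "A : sq n" "B : sq n"
 shows "nrm (Mat n) (A * B) <= nrm (Mat n) A * nrm (Mat n) B"
proof (rule mat_norm_least)
 fix v :: "complex vec" assume v: "v : carrier_vec n"
 have "vnorm (A * B *\<^sub>v v) <= nrm (Mat n) A * vnorm (B *\<^sub>v v)"
  using assms v mat_norm_bound[of A n "B *\<^sub>v v"] by (simp add: assoc_mult_mat_vec[of _ n n _ n])
 also have "... <= nrm (Mat n) A * (nrm (Mat n) B * vnorm v)"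
  using assms v by (intro mult_left_mono mat_norm_bound mat_norm_nonneg)
 finally show "vnorm (A * B *\<^sub>v v) <= nrm (Mat n) A * nrm (Mat n) B * vnorm v"
  by (simp add: ac_simps)
qed (use assms mat_norm_nonneg in auto)

lemma pre_cstar_mat: "pre_cstar (Mat n)"
proof -
 have ab: "abelian_group (Mat n)"
 proof (rule abelian_groupI)
  fix x assume "x : carrier (Mat n)"
  then show "\<exists>y\<in>carrier (Mat n). y \<oplus>\<^sub>(Mat n) x = \<zero>\<^sub>(Mat n)"
   by (intro bexI[of _ "- x"]) (auto intro: uminus_l_inv_mat)
 qed (auto intro: comm_add_mat)
 have ring: "ring (Mat n)"
  by (rule ringI[OF ab monoidI])
   (auto simp: add_mult_distrib_mat[of _ n n] mult_add_distrib_mat[of _ n n])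
 have smod: "seminormed_module (Mat n)"
 proof (intro seminormed_module.intro ab seminormed_module_axioms.intro)
  fix x y assume x: "x : carrier (Mat n)" and y: "y : carrier (Mat n)"
  show "nrm (Mat n) (x \<oplus>\<^sub>(Mat n) y) <= nrm (Mat n) x + nrm (Mat n) y"
  proof (simp, rule mat_norm_least)
   fix v :: "complex vec" assume v: "v : carrier_vec n"
   have "vnorm ((x + y) *\<^sub>v v) <= vnorm (x *\<^sub>v v) + vnorm (y *\<^sub>v v)"
    using x y v by (simp add: add_mult_distrib_mat_vec[of _ n n] euclid_norm_add[of _ n])
   also have "... <= (nrm (Mat n) x + nrm (Mat n) y) * vnorm v"
    using x y v mat_norm_bound[of x n v] mat_norm_bound[of y n v] by (simp add: algebra_simps)
   finally show "vnorm ((x + y) *\<^sub>v v)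
    <= (nrm (Mat n) x + nrm (Mat n) y) * vnorm v" .
  qed (use x y mat_norm_nonneg in auto)
 next
  fix x c assume x: "x : carrier (Mat n)"
  have le: "nrm (Mat n) (c \<cdot>\<^sub>m x) <= cmod c * nrm (Mat n) x"
   if "x : sq n" for c x
  proof (rule mat_norm_least)
   fix v :: "complex vec" assume v: "v : carrier_vec n"
   have "c \<cdot>\<^sub>m x *\<^sub>v v = c \<cdot>\<^sub>v (x *\<^sub>v v)"
    using that v by (intro eq_vecI) auto
   then show "vnorm (c \<cdot>\<^sub>m x *\<^sub>v v) <= cmod c * nrm (Mat n) x * vnorm v"
    using mat_norm_bound[OF that v] that v
    by (auto simp: euclid_norm_smult[of _ n] mult.assoc intro: mult_left_mono)
  qed (use that mat_norm_nonneg in auto)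
  show "nrm (Mat n) (c \<odot>\<^sub>(Mat n) x) = cmod c * nrm (Mat n) x"
  proof (cases "c = 0")
   case True
   have "nrm (Mat n) (0\<^sub>m n n) <= 0"
   proof (rule mat_norm_least)
    fix v :: "complex vec" assume v: "v : carrier_vec n"
    have "0\<^sub>m n n *\<^sub>v v = 0\<^sub>v n" using v by (intro eq_vecI) auto
    then show "vnorm (0\<^sub>m n n *\<^sub>v v) <= 0 * vnorm v" by simp
   qed simp
   moreover have "0 \<cdot>\<^sub>m x = 0\<^sub>m n n" using x by (intro eq_matI) auto
   ultimately show ?thesis using True mat_norm_nonneg[of "0\<^sub>m n n" n] by simp
  next
   case False
   have "x = inverse c \<cdot>\<^sub>m (c \<cdot>\<^sub>m x)" using False x by (intro eq_matI) auto
   then have "nrm (Mat n) x <= inverse (cmod c) * nrm (Mat n) (c \<cdot>\<^sub>m x)"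
    using le[of "c \<cdot>\<^sub>m x" "inverse c"] x by (simp add: norm_inverse)
   then show ?thesis using le[of x c] x False by (simp add: field_simps)
  qed
 qed (auto simp: add_smult_distrib_left_mat add_smult_distrib_right_mat intro!: eq_matI simp: algebra_simps)
 show ?thesis
 proof (intro pre_cstar.intro seminormed_algebra.intro ring smod seminormed_algebra_axioms.intro
   pre_cstar_axioms.intro)
  fix x assume x: "x : carrier (Mat n)"
  let ?N = "nrm (Mat n)"
  show "?N x = 0 \<longleftrightarrow> x = \<zero>\<^sub>(Mat n)"
  proof
   assume "?N x = 0"
   then show "x = \<zero>\<^sub>(Mat n)"
    using x mat_norm_entry[of x n] by (intro eq_matI) auto
  next
   assume "x = \<zero>\<^sub>(Mat n)"
   then show "?N x = 0"
    using mat_norm_entry_sum[of x n] mat_norm_nonneg[of x n] by simp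
  qed
  have ax: "adj x : sq n" "adj x * x : sq n" using x by auto
  have "?N x <= sqrt (?N (adj x * x))"
  proof (rule mat_norm_least)
   fix v :: "complex vec" assume v: "v : carrier_vec n"
   have xv: "x *\<^sub>v v : carrier_vec n" using x v by auto
   have "complex_of_real ((vnorm (x *\<^sub>v v))\<^sup>2) = v \<bullet>c (adj x * x *\<^sub>v v)"
    using cscalar_prod_self(1)[OF xv] mat_adjoint_inner[of x n n v "x *\<^sub>v v"] x v ax xv
    by (simp add: assoc_mult_mat_vec[of _ n n _ n])
   then have "(vnorm (x *\<^sub>v v))\<^sup>2 = cmod (v \<bullet>c (adj x * x *\<^sub>v v))"
    by (metis abs_of_nonneg norm_of_real zero_le_power2)
   also have "... <= vnorm v * vnorm (adj x * x *\<^sub>v v)"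
    using x v ax by (intro cscalar_prod_le[of _ n]) auto
   also have "... <= vnorm v * (?N (adj x * x) * vnorm v)"
    using x v ax by (intro mult_left_mono mat_norm_bound) auto
   finally have "(vnorm (x *\<^sub>v v))\<^sup>2 <= ?N (adj x * x) * (vnorm v)\<^sup>2"
    by (simp add: power2_eq_square ac_simps)
   then have "sqrt ((vnorm (x *\<^sub>v v))\<^sup>2) <= sqrt (?N (adj x * x) * (vnorm v)\<^sup>2)"
    by (rule real_sqrt_le_mono)
   then show "vnorm (x *\<^sub>v v) <= sqrt (?N (adj x * x)) * vnorm v"
    using v xv by (simp add: real_sqrt_mult)
  qed (use x ax mat_norm_nonneg[of "adj x * x" n] in auto)
  then have 1: "(?N x)\<^sup>2 <= ?N (adj x * x)"
   using mat_norm_nonneg[of x n] mat_norm_nonneg[OF ax(2)] x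
    power_mono[of "?N x" "sqrt (?N (adj x * x))" 2] by simp
  have "?N (adj x * x) <= ?N (adj x) * ?N x"
   using x ax by (intro mat_norm_mult) auto
  also have "... <= ?N x * ?N x"
   using x mat_norm_adjoint_le[of x n] by (intro mult_right_mono mat_norm_nonneg) auto
  finally show "?N (star (Mat n) x \<otimes>\<^sub>(Mat n) x) = (?N x)\<^sup>2"
   using 1 by (simp add: power2_eq_square)
 qed (auto simp: mat_norm_mult mat_adjoint_mult[of _ n n] mult_smult_assoc_mat[of _ n n _ n]
   mult_smult_distrib[of _ n n _ n] intro!: eq_matI)
qed

interpretation mat: pre_cstar "Mat n" for n by (rule pre_cstar_mat)

text \<open>With X and Y the block columns of the \<open>x i\<close> and \<open>y i\<close>, the sum
  is X* Y, and its pairing is moved to the column space.\<close>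

lemma mat_sum_inner:
 assumes "finite I" "x : I \<rightarrow> sq n" "y : I \<rightarrow> sq n"
  and v: "v : carrier_vec n" and w: "w : carrier_vec n"
 shows "((\<Oplus>\<^sub>(Mat n) i\<in>I. adj (x i) * y i) *\<^sub>v v) \<bullet>c w = (\<Sum>i\<in>I. (y i *\<^sub>v v) \<bullet>c (x i *\<^sub>v w))"
 using assms(1-3)
proof (induction I rule: finite_induct)
 case empty
 have "0\<^sub>m n n *\<^sub>v v = 0\<^sub>v n" using v by (intro eq_vecI) auto
 then show ?case using w by simp
next
 case (insert i I)
 let ?s = "\<Oplus>\<^sub>(Mat n) i\<in>I. adj (x i) * y i"
 have car: "x i : sq n" "y i : sq n" "adj (x i) : sq n"
  using insert by auto
 have in_I: "!!j. j : I ==> adj (x j) : sq n & y j : sq n"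
  using insert by auto
 have s: "?s : sq n"
  using mat.finsum_closed[of "%i. adj (x i) * y i" I n] in_I by (auto intro!: mult_carrier_mat)
 have "(\<Oplus>\<^sub>(Mat n) i\<in>insert i I. adj (x i) * y i) = adj (x i) * y i + ?s"
  using insert(1,2) car in_I
  by (subst mat.finsum_insert) (auto intro!: mult_carrier_mat)
 also have "(... *\<^sub>v v) \<bullet>c w = (adj (x i) *\<^sub>v (y i *\<^sub>v v)) \<bullet>c w + (?s *\<^sub>v v) \<bullet>c w"
  using s car v w
  by (subst add_mult_distrib_mat_vec[of _ n n])
   (auto intro!: mult_carrier_mat add_scalar_prod_distrib[of _ n] simp: assoc_mult_mat_vec[of _ n n _ n])
 also have "(adj (x i) *\<^sub>v (y i *\<^sub>v v)) \<bullet>c w = (y i *\<^sub>v v) \<bullet>c (x i *\<^sub>v w)"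
  using mat_adjoint_inner[OF car(3), of "y i *\<^sub>v v" w] car v w by simp
 finally show ?case using insert by auto
qed

lemma mat_gram_bound:
 assumes I: "finite I" and x: "x : I \<rightarrow> sq n" and v: "v : carrier_vec n"
 shows "(L2_set (%i. vnorm (x i *\<^sub>v v)) I)\<^sup>2 \<le>
  nrm (Mat n) (\<Oplus>\<^sub>(Mat n) i\<in>I. adj (x i) * x i) * (vnorm v)\<^sup>2"
proof -
 let ?s = "\<Oplus>\<^sub>(Mat n) i\<in>I. adj (x i) * x i"
 have in_I: "!!j. j : I ==> adj (x j) : sq n & x j : sq n"
  using x by auto
 have s: "?s : sq n"
  using mat.finsum_closed[of "%i. adj (x i) * x i" I n] in_I by (auto intro!: mult_carrier_mat)
 have "(?s *\<^sub>v v) \<bullet>c v = complex_of_real (\<Sum>i\<in>I. (vnorm (x i *\<^sub>v v))\<^sup>2)"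
  unfolding mat_sum_inner[OF I x x v v] using mult_mat_vec_carrier[OF funcset_mem[OF x] v]
  by (auto intro!: sum.cong cscalar_prod_self(1)[of _ n, simplified])
 moreover have "0 <= (\<Sum>i\<in>I. (vnorm (x i *\<^sub>v v))\<^sup>2)" by (simp add: sum_nonneg)
 ultimately have "(L2_set (%i. vnorm (x i *\<^sub>v v)) I)\<^sup>2 = cmod ((?s *\<^sub>v v) \<bullet>c v)"
  by (simp add: L2_set_def del: of_real_sum)
 also have "... <= vnorm (?s *\<^sub>v v) * vnorm v"
  using s v by (intro cscalar_prod_le[of _ n]) auto
 also have "... <= nrm (Mat n) ?s * vnorm v * vnorm v"
  using s v by (intro mult_right_mono mat_norm_bound) auto
 finally show ?thesis by (simp add: power2_eq_square ac_simps)
qed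

text \<open>For the block columns X, Y and w = X* Y v one has |w|^2 = <Y v, X w> <= |Y v| |X w|,
  while |X w|^2 <= |X* X| |w|^2 by \<open>mat_gram_bound\<close>. Squaring and cancelling |w|^2
  leaves the claim.\<close>

lemma mat_mixed_bound:
 assumes I: "finite I" and x: "x : I \<rightarrow> sq n" and y: "y : I \<rightarrow> sq n"
  and v: "v : carrier_vec n"
 shows "(vnorm ((\<Oplus>\<^sub>(Mat n) i\<in>I. adj (x i) * y i) *\<^sub>v v))\<^sup>2 \<le>
  nrm (Mat n) (\<Oplus>\<^sub>(Mat n) i\<in>I. adj (x i) * x i) *
  (L2_set (%i. vnorm (y i *\<^sub>v v)) I)\<^sup>2"
proof -
 let ?s = "\<Oplus>\<^sub>(Mat n) i\<in>I. adj (x i) * y i"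
 let ?X = "nrm (Mat n) (\<Oplus>\<^sub>(Mat n) i\<in>I. adj (x i) * x i)"
 let ?w = "?s *\<^sub>v v" and ?L = "L2_set (%i. vnorm (y i *\<^sub>v v)) I"
 have in_I: "!!j. j : I ==> adj (x j) : sq n & y j : sq n"
  using x y by auto
 have s: "?s : sq n"
  using mat.finsum_closed[of "%i. adj (x i) * y i" I n] in_I by (auto intro!: mult_carrier_mat)
 have w: "?w : carrier_vec n" using s v by auto
 have "(vnorm ?w)\<^sup>2 = cmod (?w \<bullet>c ?w)" using cscalar_prod_self(1)[OF w] by (simp add: norm_power)
 also have "... = cmod (\<Sum>i\<in>I. (y i *\<^sub>v v) \<bullet>c (x i *\<^sub>v ?w))"
  unfolding mat_sum_inner[OF I x y v w] ..
 also have "... <= (\<Sum>i\<in>I. \<bar>vnorm (y i *\<^sub>v v)\<bar> * \<bar>vnorm (x i *\<^sub>v ?w)\<bar>)"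
 proof (rule sum_norm_le)
  fix i assume "i : I"
  then have "y i *\<^sub>v v : carrier_vec n" "x i *\<^sub>v ?w : carrier_vec n"
   using mult_mat_vec_carrier[OF funcset_mem[OF y] v] mult_mat_vec_carrier[OF funcset_mem[OF x] w]
   by blast+
  then show "cmod ((y i *\<^sub>v v) \<bullet>c (x i *\<^sub>v ?w)) <= \<bar>vnorm (y i *\<^sub>v v)\<bar> * \<bar>vnorm (x i *\<^sub>v ?w)\<bar>"
   using cscalar_prod_le[of "y i *\<^sub>v v" n "x i *\<^sub>v ?w"] by (simp add: abs_of_nonneg)
 qed
 also have "... <= ?L * L2_set (%i. vnorm (x i *\<^sub>v ?w)) I" by (rule L2_set_mult_ineq)
 finally have "(vnorm ?w)\<^sup>2 <= ?L * L2_set (%i. vnorm (x i *\<^sub>v ?w)) I" .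
 then have "((vnorm ?w)\<^sup>2)\<^sup>2 <= (?L * L2_set (%i. vnorm (x i *\<^sub>v ?w)) I)\<^sup>2"
  by (intro power_mono) auto
 also have "... <= ?L\<^sup>2 * (?X * (vnorm ?w)\<^sup>2)"
  unfolding power_mult_distrib by (intro mult_left_mono mat_gram_bound[OF I x w]) auto
 finally have le: "(vnorm ?w)\<^sup>2 * (vnorm ?w)\<^sup>2 <= (vnorm ?w)\<^sup>2 * (?X * ?L\<^sup>2)"
  by (simp only: power2_eq_square ac_simps)
 have "0 <= ?X"
  using x by (intro mat.nrm_nonneg mat.finsum_closed) (auto intro!: mult_carrier_mat)
 then show ?thesis
  by (cases "vnorm ?w = 0") (simp_all add: mult_left_le_imp_le[OF le])
qed

lemma mat_cauchy_schwarz: assumes I: "finite I" shows "cauchy_schwarz_on I (Mat n)"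
 unfolding cauchy_schwarz_on_def
proof (intro ballI)
 fix x y assume "x : I \<rightarrow> carrier (Mat n)" "y : I \<rightarrow> carrier (Mat n)"
 then have x: "x : I \<rightarrow> sq n" and y: "y : I \<rightarrow> sq n" by auto
 let ?X = "nrm (Mat n) (\<Oplus>\<^sub>(Mat n) i\<in>I. adj (x i) * x i)"
 let ?Y = "nrm (Mat n) (\<Oplus>\<^sub>(Mat n) i\<in>I. adj (y i) * y i)"
 let ?s = "\<Oplus>\<^sub>(Mat n) i\<in>I. adj (x i) * y i"
 have X: "0 <= ?X" and Y: "0 <= ?Y"
  using x y by (intro mat.nrm_nonneg mat.finsum_closed; auto intro!: mult_carrier_mat)+
 have s: "?s : sq n"
  using x y mat.finsum_closed[of "%i. adj (x i) * y i" I n] by (auto intro!: mult_carrier_mat simp: Pi_iff)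
 have "nrm (Mat n) ?s <= sqrt (?X * ?Y)"
 proof (rule mat_norm_least)
  fix v :: "complex vec" assume v: "v : carrier_vec n"
  have "(vnorm (?s *\<^sub>v v))\<^sup>2 <= ?X * (?Y * (vnorm v)\<^sup>2)"
   by (rule order_trans[OF mat_mixed_bound[OF I x y v] mult_left_mono[OF mat_gram_bound[OF I y v] X]])
  then have "sqrt ((vnorm (?s *\<^sub>v v))\<^sup>2) <= sqrt (?X * (?Y * (vnorm v)\<^sup>2))"
   by (rule real_sqrt_le_mono)
  then show "vnorm (?s *\<^sub>v v) <= sqrt (?X * ?Y) * vnorm v"
   using v s by (simp add: real_sqrt_mult abs_of_nonneg mult.assoc)
 qed (use X Y in auto)
 then have "(nrm (Mat n) ?s)\<^sup>2 <= (sqrt (?X * ?Y))\<^sup>2"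
  using mat_norm_nonneg[OF s] by (intro power_mono) auto
 then show "(nrm (Mat n) (\<Oplus>\<^sub>(Mat n) i\<in>I. star (Mat n) (x i) \<otimes>\<^sub>(Mat n) y i))\<^sup>2
    <= nrm (Mat n) (\<Oplus>\<^sub>(Mat n) i\<in>I. star (Mat n) (x i) \<otimes>\<^sub>(Mat n) x i) *
     nrm (Mat n) (\<Oplus>\<^sub>(Mat n) i\<in>I. star (Mat n) (y i) \<otimes>\<^sub>(Mat n) y i)"
  using X Y by simp
qed

lemma euclid_norm_diff_sq:
 assumes "v : carrier_vec n" "w : carrier_vec n"
 shows "(vnorm (complex_of_real t \<cdot>\<^sub>v v - w))\<^sup>2 =
  t\<^sup>2 * (vnorm v)\<^sup>2 - 2 * t * Re (w \<bullet>c v) + (vnorm w)\<^sup>2"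
proof -
 have "complex_of_real t \<cdot>\<^sub>v v - w : carrier_vec n" using assms by auto
 note d = cscalar_prod_self(1)[OF this]
 have sq: "(vnorm u)\<^sup>2 = Re (u \<bullet>c u)" if "u : carrier_vec n" for u
  using cscalar_prod_self(1)[OF that] by simp
 have "(\<Sum>i<n. (complex_of_real t * v $ i - w $ i) * cnj (complex_of_real t * v $ i - w $ i)) =
   (of_real t)\<^sup>2 * (\<Sum>i<n. v $ i * cnj (v $ i)) - of_real t * (\<Sum>i<n. w $ i * cnj (v $ i))
   - of_real t * cnj (\<Sum>i<n. w $ i * cnj (v $ i)) + (\<Sum>i<n. w $ i * cnj (w $ i))"
  by (simp add: sum_distrib_left sum.distrib[symmetric] sum_subtractf[symmetric] algebra_simps power2_eq_square)
 then have "(complex_of_real t \<cdot>\<^sub>v v - w) \<bullet>c (complex_of_real t \<cdot>\<^sub>v v - w) =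
   (of_real t)\<^sup>2 * (v \<bullet>c v) - of_real t * (w \<bullet>c v) - of_real t * cnj (w \<bullet>c v) + w \<bullet>c w"
  using assms by (subst (1 2 3 4 5) cscalar_prod_sum[of _ n]) auto
 then have "Re ((complex_of_real t \<cdot>\<^sub>v v - w) \<bullet>c (complex_of_real t \<cdot>\<^sub>v v - w)) =
   t\<^sup>2 * Re (v \<bullet>c v) - 2 * t * Re (w \<bullet>c v) + Re (w \<bullet>c w)"
  by (simp add: power2_eq_square)
 then show ?thesis using assms by (simp add: sq)
qed

text \<open>For s = X* X the cross term is <s v, v> = |X v|^2, and |s v|^2 <= |s| |X v|^2 <= t |X
  v|^2. Hence |t v - s v|^2 <= t^2 |v|^2 - t |X v|^2, which is at most (t |v|)^2.\<close>

lemma mat_squares_positive: assumes I: "finite I" shows "squares_positive_on I (Mat n)"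
 unfolding squares_positive_on_def
proof (intro ballI allI impI)
 fix x t assume "x : I \<rightarrow> carrier (Mat n)"
  and le: "nrm (Mat n) (\<Oplus>\<^sub>(Mat n) i\<in>I. star (Mat n) (x i) \<otimes>\<^sub>(Mat n) x i) <= t"
 then have x: "x : I \<rightarrow> sq n" by auto
 let ?s = "\<Oplus>\<^sub>(Mat n) i\<in>I. adj (x i) * x i"
 have s: "?s : sq n"
  using x mat.finsum_closed[of "%i. adj (x i) * x i" I n] by (auto intro!: mult_carrier_mat simp: Pi_iff)
 have t: "nrm (Mat n) ?s <= t" "0 <= t" using le mat_norm_nonneg[OF s] by auto
 have "nrm (Mat n) (complex_of_real t \<cdot>\<^sub>m 1\<^sub>m n \<ominus>\<^sub>(Mat n) ?s) <= t"
 proof (rule mat_norm_least)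
  fix v :: "complex vec" assume v: "v : carrier_vec n"
  let ?L = "L2_set (%i. vnorm (x i *\<^sub>v v)) I"
  have "complex_of_real t \<cdot>\<^sub>m 1\<^sub>m n \<ominus>\<^sub>(Mat n) ?s = complex_of_real t \<cdot>\<^sub>m 1\<^sub>m n + (-1) \<cdot>\<^sub>m ?s"
   using s mat.smult_minus_one[of ?s n] by (simp add: mat.minus_eq)
  also have "... *\<^sub>v v = complex_of_real t \<cdot>\<^sub>v v - ?s *\<^sub>v v"
   using s v by (intro eq_vecI) (auto simp: add_scalar_prod_distrib[of _ n])
  finally have 1: "(vnorm ((complex_of_real t \<cdot>\<^sub>m 1\<^sub>m n \<ominus>\<^sub>(Mat n) ?s) *\<^sub>v v))\<^sup>2 =
    t\<^sup>2 * (vnorm v)\<^sup>2 - 2 * t * Re ((?s *\<^sub>v v) \<bullet>c v) + (vnorm (?s *\<^sub>v v))\<^sup>2"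
   using euclid_norm_diff_sq[OF v, of "?s *\<^sub>v v" t] s v by simp
  have "(?s *\<^sub>v v) \<bullet>c v = complex_of_real (\<Sum>i\<in>I. (vnorm (x i *\<^sub>v v))\<^sup>2)"
   unfolding mat_sum_inner[OF I x x v v] using mult_mat_vec_carrier[OF funcset_mem[OF x] v]
   by (auto intro!: sum.cong cscalar_prod_self(1)[of _ n, simplified])
  then have 2: "Re ((?s *\<^sub>v v) \<bullet>c v) = ?L\<^sup>2"
   by (simp add: L2_set_def sum_nonneg del: of_real_sum)
  have "(vnorm (?s *\<^sub>v v))\<^sup>2 <= nrm (Mat n) ?s * ?L\<^sup>2" by (rule mat_mixed_bound[OF I x x v])
  also have "... <= t * ?L\<^sup>2" using t by (intro mult_right_mono) auto
  finally have "(vnorm ((complex_of_real t \<cdot>\<^sub>m 1\<^sub>m n \<ominus>\<^sub>(Mat n) ?s) *\<^sub>v v))\<^sup>2 \<le>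
    t\<^sup>2 * (vnorm v)\<^sup>2 - t * ?L\<^sup>2" using 1 2 by simp
  also have "... <= (t * vnorm v)\<^sup>2" using t by (simp add: power_mult_distrib)
  finally show "vnorm ((complex_of_real t \<cdot>\<^sub>m 1\<^sub>m n \<ominus>\<^sub>(Mat n) ?s) *\<^sub>v v) <= t * vnorm v"
   using t v by (auto intro: power2_le_imp_le)
 qed (use t in auto)
 then show "nrm (Mat n) (complex_of_real t \<odot>\<^sub>(Mat n) \<one>\<^sub>(Mat n) \<ominus>\<^sub>(Mat n)
   (\<Oplus>\<^sub>(Mat n) i\<in>I. star (Mat n) (x i) \<otimes>\<^sub>(Mat n) x i)) <= t" by simp
qed

section \<open>Finite direct sums\<close>

lemma sum_cstar_simps [simp]:
 "carrier (sum_cstar C D) = carrier C \<times> carrier D"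
 "mult (sum_cstar C D) (x, y) (x', y') = (x \<otimes>\<^sub>C x', y \<otimes>\<^sub>D y')"
 "one (sum_cstar C D) = (\<one>\<^sub>C, \<one>\<^sub>D)" "zero (sum_cstar C D) = (\<zero>\<^sub>C, \<zero>\<^sub>D)"
 "add (sum_cstar C D) (x, y) (x', y') = (x \<oplus>\<^sub>C x', y \<oplus>\<^sub>D y')"
 "smult (sum_cstar C D) c (x, y) = (c \<odot>\<^sub>C x, c \<odot>\<^sub>D y)"
 "star (sum_cstar C D) (x, y) = (star C x, star D y)"
 "nrm (sum_cstar C D) (x, y) = max (nrm C x) (nrm D y)"
 by (simp_all add: sum_cstar_def)

lemma max_square: fixes a b :: real assumes "0 <= a" "0 <= b" shows "(max a b)\<^sup>2 = max (a\<^sup>2) (b\<^sup>2)"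
proof (cases "a <= b")
 case True then show ?thesis using assms by (simp add: max_absorb2 power_mono)
next
 case False then show ?thesis using assms by (simp add: max_absorb1 power_mono)
qed

lemma pre_cstar_sum: assumes "pre_cstar C" "pre_cstar D" shows "pre_cstar (sum_cstar C D)"
proof -
 interpret C: pre_cstar C by fact
 interpret D: pre_cstar D by fact
 let ?S = "sum_cstar C D"
 have ab: "abelian_group ?S"
 proof (rule abelian_groupI)
  fix x assume "x : carrier ?S"
  then show "\<exists>y\<in>carrier ?S. y \<oplus>\<^sub>?S x = \<zero>\<^sub>?S"
   by (intro bexI[of _ "(\<ominus>\<^sub>C fst x, \<ominus>\<^sub>D snd x)"]) (auto simp: C.l_neg D.l_neg)
 qed (auto simp: C.a_ac D.a_ac)
 have ring: "ring ?S"
  by (rule ringI[OF ab monoidI])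
   (auto simp: C.m_assoc D.m_assoc C.l_distr D.l_distr C.r_distr D.r_distr)
 have smod: "seminormed_module ?S"
 proof (intro seminormed_module.intro ab seminormed_module_axioms.intro)
  fix x y assume "x : carrier ?S" "y : carrier ?S"
  then obtain a b c d where "x = (a, b)" "y = (c, d)" "a : carrier C" "b : carrier D" "c : carrier C" "d : carrier D"
   by auto
  then show "nrm ?S (x \<oplus>\<^sub>?S y) <= nrm ?S x + nrm ?S y"
   by (auto intro!: order_trans[OF C.nrm_triangle add_mono] order_trans[OF D.nrm_triangle add_mono]
     simp: le_max_iff_disj)
 qed (auto simp: C.smult_add_left D.smult_add_left C.smult_add_right D.smult_add_right
   C.smult_smult D.smult_smult C.nrm_smult D.nrm_smult max_mult_distrib_left)
 show ?thesis
 proof (intro pre_cstar.intro seminormed_algebra.intro ring smod seminormed_algebra_axioms.intro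
   pre_cstar_axioms.intro)
  fix x y assume "x : carrier ?S" "y : carrier ?S"
  then obtain a b c d where *: "x = (a, b)" "y = (c, d)" "a : carrier C" "b : carrier D" "c : carrier C" "d : carrier D"
   by auto
  have "nrm C (a \<otimes>\<^sub>C c) <= max (nrm C a) (nrm D b) * max (nrm C c) (nrm D d)"
   by (rule order_trans[OF C.nrm_mult[OF *(3,5)] mult_mono]) (use * in "auto simp: le_max_iff_disj")
  moreover have "nrm D (b \<otimes>\<^sub>D d) <= max (nrm C a) (nrm D b) * max (nrm C c) (nrm D d)"
   by (rule order_trans[OF D.nrm_mult[OF *(4,6)] mult_mono]) (use * in "auto simp: le_max_iff_disj")
  ultimately show "nrm ?S (x \<otimes>\<^sub>?S y) <= nrm ?S x * nrm ?S y" using * by simp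
 next
  fix x assume "x : carrier ?S"
  then obtain a b where *: "x = (a, b)" "a : carrier C" "b : carrier D" by auto
  have "max (nrm C a) (nrm D b) = 0 \<longleftrightarrow> nrm C a = 0 & nrm D b = 0"
   using C.nrm_nonneg[OF *(2)] D.nrm_nonneg[OF *(3)] by (smt (verit))
  then show "nrm ?S x = 0 \<longleftrightarrow> x = \<zero>\<^sub>?S"
   using * C.nrm_eq_0[of a] D.nrm_eq_0[of b] by simp
  show "nrm ?S (star ?S x \<otimes>\<^sub>?S x) = (nrm ?S x)\<^sup>2"
   using * by (simp add: C.cstar_identity D.cstar_identity max_square)
 qed (auto simp: C.smult_mult_left D.smult_mult_left C.smult_mult_right D.smult_mult_right
   C.star_add D.star_add C.star_mult D.star_mult C.star_smult D.star_smult)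
qed

lemma power_cstar_simps [simp]:
 "carrier (power_cstar J C) = J \<rightarrow>\<^sub>E carrier C"
 "mult (power_cstar J C) x y = (\<lambda>j\<in>J. x j \<otimes>\<^sub>C y j)"
 "one (power_cstar J C) = (\<lambda>j\<in>J. \<one>\<^sub>C)" "zero (power_cstar J C) = (\<lambda>j\<in>J. \<zero>\<^sub>C)"
 "add (power_cstar J C) x y = (\<lambda>j\<in>J. x j \<oplus>\<^sub>C y j)"
 "smult (power_cstar J C) c x = (\<lambda>j\<in>J. c \<odot>\<^sub>C x j)"
 "star (power_cstar J C) x = (\<lambda>j\<in>J. star C (x j))"
 by (simp_all add: power_cstar_def)

text \<open>A nonempty index set guarantees that the maximum defining the norm is attained.\<close>

lemma power_norm_le_iff:
 assumes "finite J" "J ~= {}"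
 shows "nrm (power_cstar J C) x <= K \<longleftrightarrow> (\<forall>j\<in>J. nrm C (x j) <= K)"
 using assms by (simp add: power_cstar_def)

lemma power_norm_component:
 assumes "finite J" "j : J" shows "nrm C (x j) <= nrm (power_cstar J C) x"
 using power_norm_le_iff[of J C x "nrm (power_cstar J C) x"] assms by auto

lemma power_norm_attained:
 assumes "finite J" "J ~= {}" obtains j where "j : J" "nrm (power_cstar J C) x = nrm C (x j)"
proof -
 have "Max ((%i. nrm C (x i)) ` J) : (%i. nrm C (x i)) ` J" using assms by (intro Max_in) auto
 then show ?thesis using that by (auto simp: power_cstar_def)
qed

lemma pre_cstar_power:
 assumes "pre_cstar C" and J: "finite J" "J ~= {}" shows "pre_cstar (power_cstar J C)"
proof -
 interpret C: pre_cstar C by fact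
 let ?S = "power_cstar J C"
 have car: "x j : carrier C" if "x : J \<rightarrow>\<^sub>E carrier C" "j : J" for x j
  using that by auto
 have ab: "abelian_group ?S"
 proof (rule abelian_groupI)
  fix x assume "x : carrier ?S"
  then show "\<exists>y\<in>carrier ?S. y \<oplus>\<^sub>?S x = \<zero>\<^sub>?S"
   by (intro bexI[of _ "\<lambda>j\<in>J. \<ominus>\<^sub>C x j"]) (auto simp: C.l_neg PiE_iff)
 qed (auto simp: C.a_ac PiE_iff fun_eq_iff extensional_def)
 have ring: "ring ?S"
  by (rule ringI[OF ab monoidI])
   (auto simp: C.m_assoc C.l_distr C.r_distr PiE_iff fun_eq_iff extensional_def)
 have smod: "seminormed_module ?S"
 proof (intro seminormed_module.intro ab seminormed_module_axioms.intro)
  fix x y assume xy: "x : carrier ?S" "y : carrier ?S"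
  show "nrm ?S (x \<oplus>\<^sub>?S y) <= nrm ?S x + nrm ?S y"
   unfolding power_norm_le_iff[OF J]
  proof
   fix j assume j: "j : J"
   have "nrm C (x j \<oplus>\<^sub>C y j) <= nrm C (x j) + nrm C (y j)"
    using xy j by (intro C.nrm_triangle) auto
   then show "nrm C ((x \<oplus>\<^sub>?S y) j) <= nrm ?S x + nrm ?S y"
    using j power_norm_component[OF J(1) j, of C x] power_norm_component[OF J(1) j, of C y] by simp
  qed
 next
  fix c x assume x: "x : carrier ?S"
  obtain j where j: "j : J" "nrm ?S x = nrm C (x j)" by (rule power_norm_attained[OF J])
  show "nrm ?S (c \<odot>\<^sub>?S x) = cmod c * nrm ?S x"
  proof (rule antisym)
   show "nrm ?S (c \<odot>\<^sub>?S x) <= cmod c * nrm ?S x"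
    unfolding power_norm_le_iff[OF J] using x
    by (auto simp: C.nrm_smult PiE_iff intro!: mult_left_mono power_norm_component[OF J(1)])
   show "cmod c * nrm ?S x <= nrm ?S (c \<odot>\<^sub>?S x)"
    using power_norm_component[OF J(1) j(1), of C "c \<odot>\<^sub>?S x"] x j by (simp add: C.nrm_smult PiE_iff)
  qed
 qed (auto simp: C.smult_add_left C.smult_add_right C.smult_smult PiE_iff fun_eq_iff extensional_def)
 show ?thesis
 proof (intro pre_cstar.intro seminormed_algebra.intro ring smod seminormed_algebra_axioms.intro
   pre_cstar_axioms.intro)
  interpret S: seminormed_module ?S by (rule smod)
  fix x y assume xy: "x : carrier ?S" "y : carrier ?S"
  show "nrm ?S (x \<otimes>\<^sub>?S y) <= nrm ?S x * nrm ?S y"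
   unfolding power_norm_le_iff[OF J]
  proof
   fix j assume j: "j : J"
   have "nrm C (x j \<otimes>\<^sub>C y j) <= nrm C (x j) * nrm C (y j)"
    using xy j by (intro C.nrm_mult) auto
   also have "... <= nrm ?S x * nrm ?S y"
    using j xy by (intro mult_mono power_norm_component[OF J(1)] S.nrm_nonneg) (auto simp: PiE_iff)
   finally show "nrm C ((x \<otimes>\<^sub>?S y) j) <= nrm ?S x * nrm ?S y" using j by simp
  qed
 next
  interpret S: seminormed_module ?S by (rule smod)
  fix x assume x: "x : carrier ?S"
  show "nrm ?S x = 0 \<longleftrightarrow> x = \<zero>\<^sub>?S"
  proof
   assume 0: "nrm ?S x = 0"
   have "x j = \<zero>\<^sub>C" if j: "j : J" for j
   proof -
    have xj: "x j : carrier C" using x j by (simp add: PiE_iff)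
    have "nrm C (x j) <= 0" using power_norm_component[OF J(1) j, of C x] 0 by simp
    then have "nrm C (x j) = 0" using C.nrm_nonneg[OF xj] by linarith
    then show ?thesis using C.nrm_eq_0[OF xj] by simp
   qed
   then show "x = \<zero>\<^sub>?S" using x by (auto intro!: PiE_ext)
  next
   assume "x = \<zero>\<^sub>?S"
   then show "nrm ?S x = 0" by (simp only: S.nrm_zero)
  qed
  obtain j where j: "j : J" "nrm ?S x = nrm C (x j)" by (rule power_norm_attained[OF J])
  show "nrm ?S (star ?S x \<otimes>\<^sub>?S x) = (nrm ?S x)\<^sup>2"
  proof (rule antisym)
   show "nrm ?S (star ?S x \<otimes>\<^sub>?S x) <= (nrm ?S x)\<^sup>2"
    unfolding power_norm_le_iff[OF J] using x
    by (auto simp: C.cstar_identity PiE_iff intro!: power_mono power_norm_component[OF J(1)])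
   show "(nrm ?S x)\<^sup>2 <= nrm ?S (star ?S x \<otimes>\<^sub>?S x)"
    using power_norm_component[OF J(1) j(1), of C "star ?S x \<otimes>\<^sub>?S x"] x j
    by (simp add: C.cstar_identity PiE_iff)
  qed
 qed (auto simp: C.smult_mult_left C.smult_mult_right C.star_add C.star_mult C.star_smult
   PiE_iff fun_eq_iff extensional_def)
qed

section \<open>Inductive limits\<close>

locale inductive_system =
 fixes C :: "nat => 'a cstar" and \<phi> :: "nat => 'a => 'a"
 assumes stages: "pre_cstar (C n)"
  and stage_hom: "star_hom (C n) (C (Suc n)) (\<phi> n)"
  and stage_isometric: "x : carrier (C n) ==> nrm (C (Suc n)) (\<phi> n x) = nrm (C n) x"
begin

abbreviation "LS \<equiv> limit_seqs C \<phi>"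

sublocale C: pre_cstar "C n" for n by (rule stages)

lemma connecting_hom: "star_hom (C N) (C (N + d)) (connecting \<phi> N d)"
proof (induction d)
 case 0 show ?case by (auto intro!: star_homI)
next
 case (Suc d)
 show ?case
  using star_hom_closed[OF Suc] star_hom_one[OF Suc] star_hom_add[OF Suc] star_hom_mult[OF Suc]
   star_hom_smult[OF Suc] star_hom_star[OF Suc]
   star_hom_closed[OF stage_hom] star_hom_one[OF stage_hom] star_hom_add[OF stage_hom]
   star_hom_mult[OF stage_hom] star_hom_smult[OF stage_hom] star_hom_star[OF stage_hom]
  by (intro star_homI) simp_all
qed

lemmas connecting_closed = star_hom_closed[OF connecting_hom]
lemmas connecting_minus = star_hom_minus[OF connecting_hom stages stages]

lemma connecting_isometric:
 "x : carrier (C N) ==> nrm (C (N + d)) (connecting \<phi> N d x) = nrm (C N) x"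
 by (induction d) (simp_all add: stage_isometric connecting_closed)

lemma connecting_add: "connecting \<phi> N (d + e) b = connecting \<phi> (N + d) e (connecting \<phi> N d b)"
 by (induction e) (simp_all add: add.assoc)

text \<open>The thread through b. Its values below stage N are set to 0, a choice that is invisible
  in the limit, where sequences count modulo null sequences.\<close>

definition lift :: "nat => 'a => nat => 'a" where
 "lift N b n = (if n < N then \<zero>\<^sub>(C n) else connecting \<phi> N (n - N) b)"

lemma lift_closed: "b : carrier (C N) ==> lift N b n : carrier (C n)"
 using connecting_closed[of b N "n - N"] by (cases "n < N") (simp_all add: lift_def)

lemma lift_shift:
 assumes "N <= N'" "N' <= n" shows "lift N' (connecting \<phi> N (N' - N) b) n = lift N b n"
 using connecting_add[of N "N' - N" "n - N'" b] assms by (simp add: lift_def)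

context
 fixes N :: nat and x y :: 'a
 assumes xy: "x : carrier (C N)" "y : carrier (C N)"
begin

lemma lift_add: "lift N (x \<oplus>\<^sub>(C N) y) n = lift N x n \<oplus>\<^sub>(C n) lift N y n"
 using star_hom_add[OF connecting_hom[of N "n - N"] xy] by (simp add: lift_def)

lemma lift_mult: "lift N (x \<otimes>\<^sub>(C N) y) n = lift N x n \<otimes>\<^sub>(C n) lift N y n"
 using star_hom_mult[OF connecting_hom[of N "n - N"] xy] by (simp add: lift_def)

lemma lift_smult: "lift N (c \<odot>\<^sub>(C N) x) n = c \<odot>\<^sub>(C n) lift N x n"
 using star_hom_smult[OF connecting_hom[of N "n - N"] xy(1)] by (simp add: lift_def)

lemma lift_star: "lift N (star (C N) x) n = star (C n) (lift N x n)"
 using star_hom_star[OF connecting_hom[of N "n - N"] xy(1)] by (simp add: lift_def)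

lemma nrm_lift: "N <= n ==> nrm (C n) (lift N x n) = nrm (C N) x"
 using connecting_isometric[of x N "n - N"] xy by (simp add: lift_def)

end

definition near :: "real => nat => 'a => (nat => 'a) => bool" where
 "near \<eta> N b a \<longleftrightarrow> b : carrier (C N) & (\<forall>n\<ge>N. nrm (C n) (a n \<ominus>\<^sub>(C n) lift N b n) < \<eta>)"

lemma near_shift:
 assumes "near \<eta> N b a" "N <= N'" shows "near \<eta> N' (connecting \<phi> N (N' - N) b) a"
 using assms lift_shift[of N N' _ b] connecting_closed[of b N "N' - N"] by (auto simp: near_def)

lemma limit_seqs_iff:
 "a : LS \<longleftrightarrow> (\<forall>n. a n : carrier (C n)) & (\<forall>\<eta>>0. \<exists>N b. near \<eta> N b a)"
proof -
 have "(\<forall>d. nrm (C (N + d)) (a (N + d) \<ominus>\<^sub>(C (N + d)) connecting \<phi> N d b) < \<eta>) \<longleftrightarrow>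
   (\<forall>n\<ge>N. nrm (C n) (a n \<ominus>\<^sub>(C n) lift N b n) < \<eta>)" for N b \<eta>
 proof
  assume *: "\<forall>d. nrm (C (N + d)) (a (N + d) \<ominus>\<^sub>(C (N + d)) connecting \<phi> N d b) < \<eta>"
  show "\<forall>n\<ge>N. nrm (C n) (a n \<ominus>\<^sub>(C n) lift N b n) < \<eta>"
  proof (intro allI impI)
   fix n assume "N <= n"
   then show "nrm (C n) (a n \<ominus>\<^sub>(C n) lift N b n) < \<eta>"
    using *[rule_format, of "n - N"] by (simp add: lift_def)
  qed
 next
  assume *: "\<forall>n\<ge>N. nrm (C n) (a n \<ominus>\<^sub>(C n) lift N b n) < \<eta>"
  show "\<forall>d. nrm (C (N + d)) (a (N + d) \<ominus>\<^sub>(C (N + d)) connecting \<phi> N d b) < \<eta>"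
  proof
   fix d show "nrm (C (N + d)) (a (N + d) \<ominus>\<^sub>(C (N + d)) connecting \<phi> N d b) < \<eta>"
    using *[rule_format, of "N + d"] by (simp add: lift_def)
  qed
 qed
 then show ?thesis unfolding limit_seqs_def near_def by (simp add: Bex_def)
qed

lemma limit_seqs_closed: "a : LS ==> a n : carrier (C n)"
 by (simp add: limit_seqs_iff)

lemma limit_seqs_nearE:
 assumes "a : LS" "\<eta> > 0" obtains N b where "near \<eta> N b a"
 using assms unfolding limit_seqs_iff by blast

lemma limit_seqs_near:
 assumes "a : LS" "\<eta> > 0" obtains N where "!!N'. N <= N' ==> \<exists>b. near \<eta> N' b a"
 using assms near_shift unfolding limit_seqs_iff by metis

lemma lift_in_limit: assumes "b : carrier (C N)" shows "lift N b : LS"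
 unfolding limit_seqs_iff near_def using assms lift_closed[of b N] by (auto intro!: exI[of _ N] exI[of _ b])

text \<open>Both arguments have to be approximated at one and the same stage.
  \<open>near_shift\<close> allows any late stage, so the maximum of the three thresholds serves.
  Unary operations are handled by taking b = a.\<close>

lemma limit_seqs_binop:
 assumes a: "a : LS" and b: "b : LS"
  and F: "!!n x y. [|x : carrier (C n); y : carrier (C n)|] ==> F n x y : carrier (C n)"
  and near: "!!\<eta>. \<eta> > 0 ==> \<exists>\<delta>>0. \<exists>N0. \<forall>N\<ge>N0. \<forall>x y. near \<delta> N x a --> near \<delta> N y b \<longrightarrow>
   near \<eta> N (F N x y) (%n. F n (a n) (b n))"
 shows "(%n. F n (a n) (b n)) : LS"
 unfolding limit_seqs_iff
proof (intro conjI allI impI)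
 fix \<eta> :: real assume "\<eta> > 0"
 then obtain \<delta> N0 where d: "\<delta> > 0" "!!N x y. [|N >= N0; near \<delta> N x a; near \<delta> N y b|] ==>
   near \<eta> N (F N x y) (%n. F n (a n) (b n))" using near by meson
 obtain N1 where N1: "!!N'. N1 <= N' ==> \<exists>x. near \<delta> N' x a" using limit_seqs_near[OF a d(1)] by blast
 obtain N2 where N2: "!!N'. N2 <= N' ==> \<exists>x. near \<delta> N' x b" using limit_seqs_near[OF b d(1)] by blast
 define M where "M = max N0 (max N1 N2)"
 have M: "N0 <= M" "N1 <= M" "N2 <= M" by (auto simp: M_def)
 obtain x where x: "near \<delta> M x a" using N1[OF M(2)] by blast
 obtain y where y: "near \<delta> M y b" using N2[OF M(3)] by blast
 show "\<exists>N c. near \<eta> N c (%n. F n (a n) (b n))" using d(2)[OF M(1) x y] by blast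
qed (use F a b in "auto simp: limit_seqs_closed")

lemma near_add:
 assumes "near \<delta> N x a" "near \<delta> N y b" "a : LS" "b : LS"
 shows "near (2 * \<delta>) N (x \<oplus>\<^sub>(C N) y) (%n. a n \<oplus>\<^sub>(C n) b n)"
proof -
 have xy: "x : carrier (C N)" "y : carrier (C N)" using assms by (auto simp: near_def)
 have "nrm (C n) (a n \<oplus>\<^sub>(C n) b n \<ominus>\<^sub>(C n) lift N (x \<oplus>\<^sub>(C N) y) n) < 2 * \<delta>" if n: "N <= n" for n
 proof -
  note c = limit_seqs_closed[OF assms(3), of n] limit_seqs_closed[OF assms(4), of n]
   lift_closed[OF xy(1), of n] lift_closed[OF xy(2), of n]
  have "nrm (C n) (a n \<oplus>\<^sub>(C n) b n \<ominus>\<^sub>(C n) lift N (x \<oplus>\<^sub>(C N) y) n) \<le>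
    nrm (C n) (a n \<ominus>\<^sub>(C n) lift N x n) + nrm (C n) (b n \<ominus>\<^sub>(C n) lift N y n)"
   using C.nrm_triangle[OF C.a_minus_closed[OF c(1,3)] C.a_minus_closed[OF c(2,4)]]
   unfolding lift_add[OF xy] C.minus_add_distrib[OF c] .
  moreover have "nrm (C n) (a n \<ominus>\<^sub>(C n) lift N x n) < \<delta>" "nrm (C n) (b n \<ominus>\<^sub>(C n) lift N y n) < \<delta>"
   using assms(1,2) n by (auto simp: near_def)
  ultimately show ?thesis by linarith
 qed
 then show ?thesis using xy by (auto simp: near_def)
qed

text \<open>Origin of 2 K + 1: in |a b - x y| <= |a - x| |b| + |x| |b - y|, where x and y stand for
  their lifts, the first term is at most \<delta> K, and |x| <= K + 1 because \<delta> <= 1.\<close>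

lemma near_mult:
 assumes "near \<delta> N x a" "near \<delta> N y b" "a : LS" "b : LS"
  and K: "!!n. n >= N ==> nrm (C n) (a n) <= K" "!!n. n >= N ==> nrm (C n) (b n) <= K"
  and \<delta>: "0 < \<delta>" "\<delta> <= 1" "\<delta> * (2 * K + 1) <= \<eta>"
 shows "near \<eta> N (x \<otimes>\<^sub>(C N) y) (%n. a n \<otimes>\<^sub>(C n) b n)"
proof -
 have xy: "x : carrier (C N)" "y : carrier (C N)" using assms by (auto simp: near_def)
 have K0: "0 <= K" using K(1)[of N] C.nrm_nonneg[OF limit_seqs_closed[OF assms(3)], of N] by simp
 have "nrm (C n) (a n \<otimes>\<^sub>(C n) b n \<ominus>\<^sub>(C n) lift N (x \<otimes>\<^sub>(C N) y) n) < \<eta>" if n: "N <= n" for n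
 proof -
  note c = limit_seqs_closed[OF assms(3), of n] limit_seqs_closed[OF assms(4), of n]
   lift_closed[OF xy(1), of n] lift_closed[OF xy(2), of n]
  have a: "nrm (C n) (a n \<ominus>\<^sub>(C n) lift N x n) < \<delta>" and b: "nrm (C n) (b n \<ominus>\<^sub>(C n) lift N y n) < \<delta>"
   using assms(1,2) n by (auto simp: near_def)
  have "nrm (C n) (lift N x n) <= nrm (C n) (lift N x n \<ominus>\<^sub>(C n) a n) + nrm (C n) (a n)"
   by (rule C.nrm_le_dist[OF c(3,1)])
  then have lx: "nrm (C n) (lift N x n) <= K + 1"
   using a K(1)[OF n] \<delta> by (simp add: C.nrm_swap[OF c(3,1)])
  have "nrm (C n) (a n \<otimes>\<^sub>(C n) b n \<ominus>\<^sub>(C n) lift N (x \<otimes>\<^sub>(C N) y) n) \<le>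
    nrm (C n) (a n \<ominus>\<^sub>(C n) lift N x n) * nrm (C n) (b n) +
    nrm (C n) (lift N x n) * nrm (C n) (b n \<ominus>\<^sub>(C n) lift N y n)"
   unfolding lift_mult[OF xy] by (rule C.nrm_mult_diff[OF c])
  also have "nrm (C n) (a n \<ominus>\<^sub>(C n) lift N x n) * nrm (C n) (b n) <= \<delta> * K"
   using a K(2)[OF n] c \<delta> by (intro mult_mono) auto
  also have "nrm (C n) (lift N x n) * nrm (C n) (b n \<ominus>\<^sub>(C n) lift N y n) <= (K + 1) * nrm (C n) (b n \<ominus>\<^sub>(C n) lift N y n)"
   using lx c by (intro mult_right_mono) auto
  also have "(K + 1) * nrm (C n) (b n \<ominus>\<^sub>(C n) lift N y n) < (K + 1) * \<delta>"
   using b K0 by (intro mult_strict_left_mono) auto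
  finally show ?thesis using \<delta>(3) by (simp add: algebra_simps)
 qed
 then show ?thesis using xy by (auto simp: near_def)
qed

lemma limit_seqs_bounded:
 assumes "a : LS" obtains N K where "!!n. N <= n ==> nrm (C n) (a n) <= K"
proof -
 obtain N b where nb: "near 1 N b a" by (rule limit_seqs_nearE[OF assms, of 1]) simp
 then have b: "b : carrier (C N)" by (simp add: near_def)
 have "nrm (C n) (a n) <= 1 + nrm (C N) b" if "N <= n" for n
 proof -
  have "nrm (C n) (a n \<ominus>\<^sub>(C n) lift N b n) < 1" using nb that by (simp add: near_def)
  moreover have "nrm (C n) (lift N b n) = nrm (C N) b" by (rule nrm_lift[OF b b that])
  ultimately show ?thesis
   using C.nrm_le_dist[OF limit_seqs_closed[OF assms, of n] lift_closed[OF b, of n]] by linarith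
 qed
 then show ?thesis by (rule that)
qed

sublocale limit: seq_cstar C "LS" sequentially
proof unfold_locales
 show "sequentially ~= bot" by simp
 show "a n : carrier (C n)" if "a : LS" for a n by (rule limit_seqs_closed[OF that])
 have "lift 0 \<zero>\<^sub>(C 0) = (%n. \<zero>\<^sub>(C n))"
 proof
  fix n show "lift 0 \<zero>\<^sub>(C 0) n = \<zero>\<^sub>(C n)"
   using star_hom_zero[OF connecting_hom[of 0 n] stages stages] by (simp add: lift_def)
 qed
 then show "(%n. \<zero>\<^sub>(C n)) : LS" using lift_in_limit[of "\<zero>\<^sub>(C 0)" 0] by simp
 have "lift 0 \<one>\<^sub>(C 0) = (%n. \<one>\<^sub>(C n))"
 proof
  fix n show "lift 0 \<one>\<^sub>(C 0) n = \<one>\<^sub>(C n)"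
   using star_hom_one[OF connecting_hom[of 0 n]] by (simp add: lift_def)
 qed
 then show "(%n. \<one>\<^sub>(C n)) : LS" using lift_in_limit[of "\<one>\<^sub>(C 0)" 0] by simp
next
 fix a b assume a: "a : LS" and b: "b : LS"
 show "(%n. a n \<oplus>\<^sub>(C n) b n) : LS"
 proof (rule limit_seqs_binop[OF a b])
  show "\<exists>\<delta>>0. \<exists>N0. \<forall>N\<ge>N0. \<forall>x y. near \<delta> N x a --> near \<delta> N y b \<longrightarrow>
   near \<eta> N (x \<oplus>\<^sub>(C N) y) (%n. a n \<oplus>\<^sub>(C n) b n)" if "\<eta> > 0" for \<eta>
   using that near_add[OF _ _ a b, of "\<eta> / 2"] by (intro exI[of _ "\<eta> / 2"]) auto
 qed simp
 show "(%n. a n \<otimes>\<^sub>(C n) b n) : LS"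
 proof (rule limit_seqs_binop[OF a b])
  fix \<eta> :: real assume e: "\<eta> > 0"
  obtain N1 K1 where 1: "!!n. N1 <= n ==> nrm (C n) (a n) <= K1" using limit_seqs_bounded[OF a] by blast
  obtain N2 K2 where 2: "!!n. N2 <= n ==> nrm (C n) (b n) <= K2" using limit_seqs_bounded[OF b] by blast
  define K where "K = max 0 (max K1 K2)"
  define \<delta> where "\<delta> = min 1 (\<eta> / (2 * K + 1))"
  have K: "0 <= K" by (simp add: K_def)
  then have d: "0 < \<delta>" "\<delta> <= 1" using e by (auto simp: \<delta>_def)
  have "\<delta> * (2 * K + 1) <= \<eta> / (2 * K + 1) * (2 * K + 1)"
   using K by (intro mult_right_mono) (auto simp: \<delta>_def)
  then have d3: "\<delta> * (2 * K + 1) <= \<eta>" using K by simp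
  show "\<exists>\<delta>>0. \<exists>N0. \<forall>N\<ge>N0. \<forall>x y. near \<delta> N x a --> near \<delta> N y b \<longrightarrow>
   near \<eta> N (x \<otimes>\<^sub>(C N) y) (%n. a n \<otimes>\<^sub>(C n) b n)"
  proof (intro exI[of _ \<delta>] exI[of _ "max N1 N2"] conjI allI impI d)
   fix N x y assume N: "max N1 N2 <= N" and xy: "near \<delta> N x a" "near \<delta> N y b"
   have "nrm (C n) (a n) <= K" "nrm (C n) (b n) <= K" if "N <= n" for n
    using 1[of n] 2[of n] that N by (auto simp: K_def)
   then show "near \<eta> N (x \<otimes>\<^sub>(C N) y) (%n. a n \<otimes>\<^sub>(C n) b n)"
    by (intro near_mult[OF xy a b _ _ d d3]) auto
  qed
 qed simp
next
 fix a c assume a: "a : LS"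
 show "(%n. c \<odot>\<^sub>(C n) a n) : LS"
 proof (rule limit_seqs_binop[OF a a, where F = "%n x y. c \<odot>\<^sub>(C n) x"])
  fix \<eta> :: real assume e: "\<eta> > 0"
  have "near \<eta> N (c \<odot>\<^sub>(C N) x) (%n. c \<odot>\<^sub>(C n) a n)" if x: "near (\<eta> / (cmod c + 1)) N x a" for N x
  proof -
   have xc: "x : carrier (C N)" using x by (simp add: near_def)
   have "nrm (C n) (c \<odot>\<^sub>(C n) a n \<ominus>\<^sub>(C n) lift N (c \<odot>\<^sub>(C N) x) n) < \<eta>" if n: "N <= n" for n
   proof -
    note cc = limit_seqs_closed[OF a, of n] lift_closed[OF xc, of n]
    have "nrm (C n) (c \<odot>\<^sub>(C n) a n \<ominus>\<^sub>(C n) lift N (c \<odot>\<^sub>(C N) x) n) = cmod c * nrm (C n) (a n \<ominus>\<^sub>(C n) lift N x n)"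
     using cc by (simp add: lift_smult[OF xc xc] C.smult_minus_right[symmetric] C.nrm_smult)
    also have "... <= (cmod c) * (\<eta> / (cmod c + 1))"
     using x n by (intro mult_left_mono) (auto simp: near_def less_imp_le)
    also have "... < \<eta>" using e by (simp add: field_simps add_pos_nonneg)
    finally show ?thesis .
   qed
   then show ?thesis using xc by (auto simp: near_def)
  qed
  moreover have "\<eta> / (cmod c + 1) > 0" using e by (simp add: add_nonneg_pos)
  ultimately show "\<exists>\<delta>>0. \<exists>N0. \<forall>N\<ge>N0. \<forall>x y. near \<delta> N x a --> near \<delta> N y a \<longrightarrow>
   near \<eta> N (c \<odot>\<^sub>(C N) x) (%n. c \<odot>\<^sub>(C n) a n)" by blast
 qed simp
 show "(%n. star (C n) (a n)) : LS"
 proof (rule limit_seqs_binop[OF a a, where F = "%n x y. star (C n) x"])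
  fix \<eta> :: real assume e: "\<eta> > 0"
  have "near \<eta> N (star (C N) x) (%n. star (C n) (a n))" if x: "near \<eta> N x a" for N x
  proof -
   have xc: "x : carrier (C N)" using x by (simp add: near_def)
   have "nrm (C n) (star (C n) (a n) \<ominus>\<^sub>(C n) lift N (star (C N) x) n) < \<eta>" if n: "N <= n" for n
    using x n limit_seqs_closed[OF a, of n] lift_closed[OF xc, of n]
    by (simp add: lift_star[OF xc xc] C.star_diff[symmetric] near_def)
   then show ?thesis using xc by (auto simp: near_def)
  qed
  then show "\<exists>\<delta>>0. \<exists>N0. \<forall>N\<ge>N0. \<forall>x y. near \<delta> N x a --> near \<delta> N y a \<longrightarrow>
   near \<eta> N (star (C N) x) (%n. star (C n) (a n))" using e by blast
 qed simp
 have "Cauchy (%n. nrm (C n) (a n))"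
 proof (rule metric_CauchyI)
  fix \<eta> :: real assume "\<eta> > 0"
  then obtain N b where nb: "near (\<eta> / 2) N b a" by (auto intro: limit_seqs_nearE[OF a, of "\<eta> / 2"])
  then have b: "b : carrier (C N)" by (simp add: near_def)
  have "\<bar>nrm (C n) (a n) - nrm (C N) b\<bar> < \<eta> / 2" if n: "N <= n" for n
  proof -
   have "\<bar>nrm (C n) (a n) - nrm (C n) (lift N b n)\<bar> <= nrm (C n) (a n \<ominus>\<^sub>(C n) lift N b n)"
    by (rule C.nrm_diff_abs[OF limit_seqs_closed[OF a] lift_closed[OF b]])
   then show ?thesis using nb n by (auto simp: near_def nrm_lift[OF b b n])
  qed
  then show "\<exists>M. \<forall>m\<ge>M. \<forall>n\<ge>M. dist (nrm (C m) (a m)) (nrm (C n) (a n)) < \<eta>"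
   by (intro exI[of _ N]) (smt (verit) dist_real_def field_sum_of_halves)
 qed
 then show "\<exists>L. (%n. nrm (C n) (a n)) \<longlonglongrightarrow> L"
  using Cauchy_convergent_iff convergent_def by blast
qed

abbreviation "lim_algebra \<equiv> inductive_limit C \<phi>"

definition stage_incl :: "nat => 'a => (nat => 'a) set" where
 "stage_incl N b = limit.cls (lift N b)"

lemma stage_incl_hom: "star_hom (C N) lim_algebra (stage_incl N)"
proof (rule star_homI)
 have "limit.cls (lift N \<one>\<^sub>(C N)) = limit.cls (%n. \<one>\<^sub>(C n))"
 proof (rule limit.cls_eqI_eventually)
  show "\<forall>\<^sub>F n in sequentially. lift N \<one>\<^sub>(C N) n = \<one>\<^sub>(C n)"
   using eventually_ge_at_top[of N]
  proof eventually_elim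
   fix n assume "N <= n" then show "lift N \<one>\<^sub>(C N) n = \<one>\<^sub>(C n)"
    using star_hom_one[OF connecting_hom[of N "n - N"]] by (simp add: lift_def)
  qed
 qed (auto intro!: lift_in_limit limit.S_one)
 then show "stage_incl N \<one>\<^sub>(C N) = \<one>\<^sub>lim_algebra"
  by (simp add: stage_incl_def inductive_limit_def limit.one_cls)
next
 fix x y c assume x: "x : carrier (C N)"
 show "stage_incl N x : carrier lim_algebra"
  using x by (simp add: stage_incl_def inductive_limit_def lift_in_limit limit.cls_closed)
 have "lift N (c \<odot>\<^sub>(C N) x) = (%n. c \<odot>\<^sub>(C n) lift N x n)" "lift N (star (C N) x) = (%n. star (C n) (lift N x n))"
  using x by (auto simp: lift_smult lift_star)
 then show "stage_incl N (c \<odot>\<^sub>(C N) x) = c \<odot>\<^sub>lim_algebra stage_incl N x"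
  "stage_incl N (star (C N) x) = star lim_algebra (stage_incl N x)"
  using x by (simp_all add: stage_incl_def inductive_limit_def lift_in_limit limit.smult_cls limit.star_cls)
 assume y: "y : carrier (C N)"
 have "lift N (x \<oplus>\<^sub>(C N) y) = (%n. lift N x n \<oplus>\<^sub>(C n) lift N y n)"
  "lift N (x \<otimes>\<^sub>(C N) y) = (%n. lift N x n \<otimes>\<^sub>(C n) lift N y n)"
  using x y by (auto simp: lift_add lift_mult)
 then show "stage_incl N (x \<oplus>\<^sub>(C N) y) = stage_incl N x \<oplus>\<^sub>lim_algebra stage_incl N y"
  "stage_incl N (x \<otimes>\<^sub>(C N) y) = stage_incl N x \<otimes>\<^sub>lim_algebra stage_incl N y"
  using x y by (simp_all add: stage_incl_def inductive_limit_def lift_in_limit limit.add_cls limit.mult_cls)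
qed

lemma stage_incl_isometric: "b : carrier (C N) ==> nrm lim_algebra (stage_incl N b) = nrm (C N) b"
 unfolding stage_incl_def inductive_limit_def
 by (intro limit.nrm_cls_const lift_in_limit eventually_sequentiallyI[of N] nrm_lift)

lemma stage_incl_connecting:
 assumes "b : carrier (C N)" "N <= N'" shows "stage_incl N' (connecting \<phi> N (N' - N) b) = stage_incl N b"
 unfolding stage_incl_def
 by (rule limit.cls_eqI_eventually)
  (use assms connecting_closed[of b N "N' - N"] in
   "auto intro!: lift_in_limit eventually_sequentiallyI[of N'] lift_shift")

lemma stage_incl_Suc: "b : carrier (C N) ==> stage_incl (Suc N) (\<phi> N b) = stage_incl N b"
 using stage_incl_connecting[of b N "Suc N"] by simp

text \<open>Approximation is asserted at all late stages, so that finitely many elements can later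
  be approximated at a common one.\<close>

lemma stage_incl_dense:
 assumes "X : carrier lim_algebra" "\<eta> > 0"
 obtains N where "!!N'. N <= N' ==> \<exists>b\<in>carrier (C N'). nrm lim_algebra (X \<ominus>\<^sub>lim_algebra stage_incl N' b) < \<eta>"
proof -
 obtain a where a: "a : LS" "X = limit.cls a"
  using assms(1) unfolding inductive_limit_def by (rule limit.quotE)
 obtain N where N: "!!N'. N <= N' ==> \<exists>b. near (\<eta> / 2) N' b a"
  using limit_seqs_near[OF a(1), of "\<eta> / 2"] assms(2) by auto
 show ?thesis
 proof (rule that[of N])
  fix N' assume "N <= N'"
  then obtain b where b: "near (\<eta> / 2) N' b a" using N by blast
  then have bc: "b : carrier (C N')" by (simp add: near_def)
  have "nrm limit.quot (limit.cls (%n. a n \<ominus>\<^sub>(C n) lift N' b n)) <= \<eta> / 2"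
  proof (rule limit.nrm_cls_le[OF limit.S_minus[OF a(1) lift_in_limit[OF bc]]])
   show "\<forall>\<^sub>F n in sequentially. nrm (C n) (a n \<ominus>\<^sub>(C n) lift N' b n) <= \<eta> / 2"
    using b by (intro eventually_sequentiallyI[of N']) (auto simp: near_def less_imp_le)
  qed
  then have "nrm lim_algebra (X \<ominus>\<^sub>lim_algebra stage_incl N' b) < \<eta>"
   using assms(2) a bc by (simp add: stage_incl_def inductive_limit_def limit.minus_cls lift_in_limit)
  then show "\<exists>b\<in>carrier (C N'). nrm lim_algebra (X \<ominus>\<^sub>lim_algebra stage_incl N' b) < \<eta>" using bc by blast
 qed
qed

sublocale L: pre_cstar lim_algebra
 using limit.quot_cstar by (simp add: inductive_limit_def)

lemmas stage_incl_closed = star_hom_closed[OF stage_incl_hom]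

lemma stage_incl_minus:
 "[|x : carrier (C N); y : carrier (C N)|] ==> stage_incl N (x \<ominus>\<^sub>(C N) y) = stage_incl N x \<ominus>\<^sub>lim_algebra stage_incl N y"
 using star_hom_minus[OF stage_incl_hom stages L.pre_cstar_axioms] .

text \<open>The limit of a Cauchy sequence of elements \<open>stage_incl (N i) (b i)\<close> is the class of the sequence
 which at stage \<open>n\<close> uses the largest \<open>i <= n\<close> such that \<open>b 0, ..., b i\<close> have appeared by stage \<open>n\<close>.
 Completeness of the stages is not needed.\<close>

lemma lim_complete:
 assumes X: "range X <= carrier lim_algebra" and cauchy: "norm_Cauchy lim_algebra X"
 shows "\<exists>x\<in>carrier lim_algebra. norm_lim lim_algebra X x"
proof -
 let ?L = lim_algebra
 have Xc: "X i : carrier ?L" for i using X by auto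
 have "\<exists>p. snd p : carrier (C (fst p)) & nrm ?L (X i \<ominus>\<^sub>?L stage_incl (fst p) (snd p)) < 1 / real (Suc i)" for i
 proof -
  have e: "0 < 1 / real (Suc i)" by simp
  show ?thesis
  proof (rule stage_incl_dense[OF Xc[of i] e])
   fix N assume "!!N'. N <= N' ==> \<exists>b\<in>carrier (C N'). nrm ?L (X i \<ominus>\<^sub>?L stage_incl N' b) < 1 / real (Suc i)"
   then obtain b where "b : carrier (C N)" "nrm ?L (X i \<ominus>\<^sub>?L stage_incl N b) < 1 / real (Suc i)" by blast
   then show ?thesis by (intro exI[of _ "(N, b)"]) simp
  qed
 qed
 then obtain p where p: "!!i. snd (p i) : carrier (C (fst (p i))) \<and>
   nrm ?L (X i \<ominus>\<^sub>?L stage_incl (fst (p i)) (snd (p i))) < 1 / real (Suc i)"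
  using choice[of "%i p. snd p : carrier (C (fst p)) \<and>
   nrm ?L (X i \<ominus>\<^sub>?L stage_incl (fst p) (snd p)) < 1 / real (Suc i)"] by blast
 define N where "N i = fst (p i)" for i
 define b where "b i = snd (p i)" for i
 have b: "b i : carrier (C (N i))" for i using p by (simp add: N_def b_def)
 define Y where "Y i = stage_incl (N i) (b i)" for i
 have bX: "nrm ?L (X i \<ominus>\<^sub>?L Y i) < 1 / real (Suc i)" for i
  using p unfolding Y_def N_def b_def by blast
 have Y: "Y i : carrier ?L" for i unfolding Y_def by (rule stage_incl_closed[OF b])
 have XY: "(%i. nrm ?L (X i \<ominus>\<^sub>?L Y i)) \<longlonglongrightarrow> 0"
 proof (rule tendsto_sandwich[OF _ _ tendsto_const LIMSEQ_Suc[OF lim_1_over_n]])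
  show "\<forall>\<^sub>F i in sequentially. 0 <= nrm ?L (X i \<ominus>\<^sub>?L Y i)"
   using Xc Y by (simp add: always_eventually)
  show "\<forall>\<^sub>F i in sequentially. nrm ?L (X i \<ominus>\<^sub>?L Y i) <= 1 / real (Suc i)"
   by (rule always_eventually) (use bX less_imp_le in blast)
 qed
 have Ycauchy: "\<exists>I. \<forall>i\<ge>I. \<forall>j\<ge>I. nrm ?L (Y i \<ominus>\<^sub>?L Y j) < \<eta>" if e: "\<eta> > 0" for \<eta>
 proof -
  obtain I1 where 1: "!!i. i >= I1 ==> nrm ?L (X i \<ominus>\<^sub>?L Y i) < \<eta> / 3"
  proof -
   have "eventually (%i. nrm ?L (X i \<ominus>\<^sub>?L Y i) < \<eta> / 3) sequentially"
    by (rule order_tendstoD(2)[OF XY]) (use e in simp)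
   then show ?thesis using that unfolding eventually_sequentially by blast
  qed
  obtain I2 where 2: "!!i j. [|i >= I2; j >= I2|] ==> nrm ?L (X i \<ominus>\<^sub>?L X j) < \<eta> / 3"
  proof -
   have "\<eta> / 3 > 0" using e by simp
   then show ?thesis using that cauchy unfolding norm_Cauchy_def by blast
  qed
  have "nrm ?L (Y i \<ominus>\<^sub>?L Y j) < \<eta>" if "i >= max I1 I2" "j >= max I1 I2" for i j
  proof -
   have "nrm ?L (Y i \<ominus>\<^sub>?L Y j) <= nrm ?L (Y i \<ominus>\<^sub>?L X i) + nrm ?L (X i \<ominus>\<^sub>?L Y j)"
    by (rule L.nrm_dist_triangle[OF Y Xc Y])
   moreover have "nrm ?L (X i \<ominus>\<^sub>?L Y j) <= nrm ?L (X i \<ominus>\<^sub>?L X j) + nrm ?L (X j \<ominus>\<^sub>?L Y j)"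
    by (rule L.nrm_dist_triangle[OF Xc Xc Y])
   ultimately show ?thesis
    using 1[of i] 1[of j] 2[of i j] that L.nrm_swap[OF Y[of i] Xc[of i]] by simp
  qed
  then show ?thesis by blast
 qed
 define ok where "ok n i \<longleftrightarrow> i <= n & (\<forall>j\<le>i. N j <= n)" for n i
 define ix where "ix n = Max {i. ok n i}" for n
 define a where "a n = (if ok n 0 then lift (N (ix n)) (b (ix n)) n else \<zero>\<^sub>(C n))" for n
 have fin: "finite {i. ok n i}" for n by (rule finite_subset[of _ "{..n}"]) (auto simp: ok_def)
 have ix: "ok n (ix n)" "i <= ix n" if "ok n i" for n i
  using Max_in[OF fin, of n] Max_ge[OF fin, of i n] that by (auto simp: ix_def)
 have a_closed: "a n : carrier (C n)" for n by (simp add: a_def lift_closed[OF b])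
 have diff: "nrm (C n) (lift (N i) (b i) n \<ominus>\<^sub>(C n) lift (N j) (b j) n) = nrm ?L (Y i \<ominus>\<^sub>?L Y j)"
  if n: "N i <= n" "N j <= n" for n i j
 proof -
  let ?c = "%i. connecting \<phi> (N i) (n - N i) (b i)"
  have c: "?c i : carrier (C n)" "?c j : carrier (C n)"
   using connecting_closed[OF b[of i], of "n - N i"] connecting_closed[OF b[of j], of "n - N j"] n by simp_all
  have "nrm ?L (Y i \<ominus>\<^sub>?L Y j) = nrm ?L (stage_incl n (?c i \<ominus>\<^sub>(C n) ?c j))"
   using stage_incl_minus[OF c] stage_incl_connecting[OF b n(1)] stage_incl_connecting[OF b n(2)] by (simp add: Y_def)
  also have "... = nrm (C n) (?c i \<ominus>\<^sub>(C n) ?c j)" using c by (simp add: stage_incl_isometric)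
  finally show ?thesis using n by (simp add: lift_def)
 qed
 \<comment> \<open>The stage used here is the largest of i and N 0, ..., N i. From it on
   \<open>ok n i\<close> holds, so \<open>ix n >= i\<close> and the Cauchy estimate applies.\<close>
 have conv: "\<exists>I. \<forall>i\<ge>I. near \<eta> (Max (insert i (N ` {..i}))) (connecting \<phi> (N i) (Max (insert i (N ` {..i})) - N i) (b i)) a"
  if e: "\<eta> > 0" for \<eta>
 proof -
  obtain I where I: "!!i j. [|i >= I; j >= I|] ==> nrm ?L (Y i \<ominus>\<^sub>?L Y j) < \<eta>" using Ycauchy[OF e] by blast
  show ?thesis
  proof (intro exI[of _ I] allI impI)
   fix i assume i: "I <= i"
   let ?M = "Max (insert i (N ` {..i}))"
   have M: "i <= ?M" "!!j. j <= i ==> N j <= ?M" by (rule Max_ge; simp)+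
   show "near \<eta> ?M (connecting \<phi> (N i) (?M - N i) (b i)) a"
    unfolding near_def
   proof (intro conjI allI impI)
    show "connecting \<phi> (N i) (?M - N i) (b i) : carrier (C ?M)"
     using connecting_closed[OF b[of i], of "?M - N i"] M(2)[of i] by simp
    fix n assume n: "?M <= n"
    have ok: "ok n i"
     unfolding ok_def using order_trans[OF M(1) n] order_trans[OF M(2) n] by blast
    then have ok0: "ok n 0" by (auto simp: ok_def)
    have "nrm (C n) (a n \<ominus>\<^sub>(C n) lift (N i) (b i) n) = nrm ?L (Y (ix n) \<ominus>\<^sub>?L Y i)"
     using diff[of "ix n" n i] ix(1)[OF ok] ok ok0 by (simp add: a_def) (simp add: ok_def)
    also have "... < \<eta>" using I[of "ix n" i] ix(2)[OF ok] i by simp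
    finally show "nrm (C n) (a n \<ominus>\<^sub>(C n) lift ?M (connecting \<phi> (N i) (?M - N i) (b i)) n) < \<eta>"
     using lift_shift[OF M(2)[of i] n] by simp
   qed
  qed
 qed
 have a: "a : LS"
  unfolding limit_seqs_iff using conv a_closed by blast
 have "norm_lim ?L X (limit.cls a)"
  unfolding norm_lim_def
 proof (rule tendsto_sandwich[OF _ _ tendsto_const])
  have ac: "limit.cls a : carrier ?L" using a by (simp add: inductive_limit_def limit.cls_closed)
  show "\<forall>\<^sub>F i in sequentially. nrm ?L (X i \<ominus>\<^sub>?L limit.cls a) \<le>
    nrm ?L (X i \<ominus>\<^sub>?L Y i) + nrm ?L (Y i \<ominus>\<^sub>?L limit.cls a)"
   using L.nrm_dist_triangle[OF Xc Y ac] by (simp add: always_eventually)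
  show "\<forall>\<^sub>F i in sequentially. 0 <= nrm ?L (X i \<ominus>\<^sub>?L limit.cls a)"
   using Xc ac by (simp add: always_eventually)
  have "(%i. nrm ?L (Y i \<ominus>\<^sub>?L limit.cls a)) \<longlonglongrightarrow> 0"
  proof (rule LIMSEQ_I)
   fix \<eta> :: real assume "\<eta> > 0"
   then obtain I where I: "!!i. i >= I ==> near (\<eta> / 2) (Max (insert i (N ` {..i}))) (connecting \<phi> (N i) (Max (insert i (N ` {..i})) - N i) (b i)) a"
    using conv[of "\<eta> / 2"] by auto
   have "nrm ?L (Y i \<ominus>\<^sub>?L limit.cls a) < \<eta>" if i: "i >= I" for i
   proof -
    let ?M = "Max (insert i (N ` {..i}))"
    have M: "N i <= ?M" by (rule Max_ge) simp_all
    have "nrm limit.quot (limit.cls (%n. lift (N i) (b i) n \<ominus>\<^sub>(C n) a n)) <= \<eta> / 2"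
    proof (rule limit.nrm_cls_le[OF limit.S_minus[OF lift_in_limit[OF b] a]], rule eventually_sequentiallyI[of ?M])
     fix n assume n: "?M <= n"
     have "nrm (C n) (a n \<ominus>\<^sub>(C n) lift ?M (connecting \<phi> (N i) (?M - N i) (b i)) n) < \<eta> / 2"
      using I[OF i] n unfolding near_def by blast
     then have "nrm (C n) (a n \<ominus>\<^sub>(C n) lift (N i) (b i) n) < \<eta> / 2"
      unfolding lift_shift[OF M n] .
     then show "nrm (C n) (lift (N i) (b i) n \<ominus>\<^sub>(C n) a n) <= \<eta> / 2"
      using C.nrm_swap[OF a_closed[of n] lift_closed[OF b[of i], of n]] by simp
    qed
    then show ?thesis using \<open>\<eta> > 0\<close> a
     by (simp add: Y_def stage_incl_def inductive_limit_def limit.minus_cls lift_in_limit[OF b])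
   qed
   then show "\<exists>no. \<forall>n\<ge>no. norm (nrm ?L (Y n \<ominus>\<^sub>?L limit.cls a) - 0) < \<eta>"
    using Y ac by (intro exI[of _ I]) auto
  qed
  from tendsto_add[OF XY this]
  show "(%i. nrm ?L (X i \<ominus>\<^sub>?L Y i) + nrm ?L (Y i \<ominus>\<^sub>?L limit.cls a)) \<longlonglongrightarrow> 0" by simp
 qed
 moreover have "limit.cls a : carrier ?L" using a by (simp add: inductive_limit_def limit.cls_closed)
 ultimately show ?thesis by blast
qed

lemma cstar_algebra_limit: "cstar_algebra lim_algebra"
 by (rule L.cstar_algebraI[OF lim_complete])

lemma limit_cauchy_schwarz:
 "[|finite I; !!n. cauchy_schwarz_on I (C n)|] ==> cauchy_schwarz_on I lim_algebra"
 unfolding inductive_limit_def by (rule limit.quot_cauchy_schwarz)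

lemma limit_squares_positive:
 "[|finite I; !!n. squares_positive_on I (C n)|] ==> squares_positive_on I lim_algebra"
 unfolding inductive_limit_def by (rule limit.quot_squares_positive)

section \<open>Maps of the limit induced by equivariant maps of the stages\<close>

context
 fixes f :: "nat => 'a => 'a"
 assumes f_hom: "!!n. star_hom (C n) (C n) (f n)"
  and f_isometric: "!!n x. x : carrier (C n) ==> nrm (C n) (f n x) = nrm (C n) x"
  and f_equiv: "!!n x. x : carrier (C n) ==> f (Suc n) (\<phi> n x) = \<phi> n (f n x)"
begin

lemma connecting_equivariant:
 "x : carrier (C N) ==> f (N + d) (connecting \<phi> N d x) = connecting \<phi> N d (f N x)"
 by (induction d) (simp_all add: f_equiv connecting_closed)

lemma lift_equivariant:
 assumes "x : carrier (C N)" shows "f n (lift N x n) = lift N (f N x) n"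
 using connecting_equivariant[OF assms, of "n - N"] star_hom_zero[OF f_hom stages stages]
 by (cases "n < N") (simp_all add: lift_def)

lemma limit_seqs_map: assumes a: "a : LS" shows "(%n. f n (a n)) : LS"
 unfolding limit_seqs_iff
proof (intro conjI allI impI)
 fix \<eta> :: real assume "\<eta> > 0"
 then obtain N b where nb: "near \<eta> N b a" by (rule limit_seqs_nearE[OF a])
 then have b: "b : carrier (C N)" by (simp add: near_def)
 have "near \<eta> N (f N b) (%n. f n (a n))"
  unfolding near_def
 proof (intro conjI allI impI)
  fix n assume n: "N <= n"
  have "nrm (C n) (f n (a n) \<ominus>\<^sub>(C n) lift N (f N b) n) = nrm (C n) (f n (a n \<ominus>\<^sub>(C n) lift N b n))"
   by (simp add: lift_equivariant[OF b, symmetric]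
     star_hom_minus[OF f_hom stages stages limit_seqs_closed[OF a] lift_closed[OF b]])
  also have "... = nrm (C n) (a n \<ominus>\<^sub>(C n) lift N b n)"
   using limit_seqs_closed[OF a] lift_closed[OF b] by (simp add: f_isometric)
  finally show "nrm (C n) (f n (a n) \<ominus>\<^sub>(C n) lift N (f N b) n) < \<eta>" using nb n by (simp add: near_def)
 qed (rule star_hom_closed[OF f_hom b])
 then show "\<exists>N b. near \<eta> N b (%n. f n (a n))" by blast
qed (rule star_hom_closed[OF f_hom limit_seqs_closed[OF a]])

abbreviation "limit_map \<equiv> seq_map (null_rel C (LS) sequentially) f"

lemma limit_map_cls: "a : LS ==> limit_map (limit.cls a) = limit.cls (%n. f n (a n))"
 by (rule seq_map_class[OF limit.seq_module_axioms limit.seq_module_axioms limit_seqs_map, where K = 1])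
  (simp_all add: star_hom_minus[OF f_hom stages stages, symmetric] f_isometric)

lemma limit_map_stage_incl: "b : carrier (C N) ==> limit_map (stage_incl N b) = stage_incl N (f N b)"
 by (simp add: stage_incl_def limit_map_cls lift_in_limit lift_equivariant)

lemma limit_map_hom: "star_hom lim_algebra lim_algebra limit_map"
proof (rule star_homI)
 show "limit_map \<one>\<^sub>lim_algebra = \<one>\<^sub>lim_algebra"
  by (simp add: inductive_limit_def limit.one_cls limit_map_cls limit.S_one star_hom_one[OF f_hom])
 fix X Y c assume "X : carrier lim_algebra"
 then obtain a where a: "a : LS" "X = limit.cls a"
  unfolding inductive_limit_def by (rule limit.quotE)
 note ac = limit_seqs_closed[OF a(1)]
 show "limit_map X : carrier lim_algebra"
  using a by (simp add: inductive_limit_def limit_map_cls limit_seqs_map limit.cls_closed)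
 show "limit_map (c \<odot>\<^sub>lim_algebra X) = c \<odot>\<^sub>lim_algebra limit_map X"
  using a ac by (simp add: inductive_limit_def limit_map_cls limit_seqs_map limit.smult_cls
    limit.S_smult star_hom_smult[OF f_hom])
 show "limit_map (star lim_algebra X) = star lim_algebra (limit_map X)"
  using a ac by (simp add: inductive_limit_def limit_map_cls limit_seqs_map limit.star_cls
    limit.S_star star_hom_star[OF f_hom])
 assume "Y : carrier lim_algebra"
 then obtain b where b: "b : LS" "Y = limit.cls b"
  unfolding inductive_limit_def by (rule limit.quotE)
 note bc = limit_seqs_closed[OF b(1)]
 show "limit_map (X \<oplus>\<^sub>lim_algebra Y) = limit_map X \<oplus>\<^sub>lim_algebra limit_map Y"
  using a b ac bc by (simp add: inductive_limit_def limit_map_cls limit_seqs_map limit.add_cls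
    limit.S_add star_hom_add[OF f_hom])
 show "limit_map (X \<otimes>\<^sub>lim_algebra Y) = limit_map X \<otimes>\<^sub>lim_algebra limit_map Y"
  using a b ac bc by (simp add: inductive_limit_def limit_map_cls limit_seqs_map limit.mult_cls
    limit.S_mult star_hom_mult[OF f_hom])
qed

lemma limit_map_isometric:
 assumes "X : carrier lim_algebra" shows "nrm lim_algebra (limit_map X) = nrm lim_algebra X"
proof -
 obtain a where a: "a : LS" "X = limit.cls a"
  using assms unfolding inductive_limit_def by (rule limit.quotE)
 have "(%n. nrm (C n) (f n (a n))) \<longlonglongrightarrow> nrm lim_algebra (limit_map X)"
  using limit.nrm_cls_tendsto[OF limit_seqs_map[OF a(1)]] a by (simp add: inductive_limit_def limit_map_cls)
 moreover have "(%n. nrm (C n) (f n (a n))) \<longlonglongrightarrow> nrm lim_algebra X"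
  using limit.nrm_cls_tendsto[OF a(1)] a limit_seqs_closed[OF a(1)] by (simp add: inductive_limit_def f_isometric)
 ultimately show ?thesis by (rule LIMSEQ_unique)
qed

end

end

section \<open>Crossed products by finite groups\<close>

text \<open>The last two assumptions carry the positivity of the A-valued inner product on columns
  indexed by G. From the first come the triangle inequality and the norm of the crossed product,
  from the second the positivity of the conditional expectation. The limit algebra inherits both
  from its matrix stages.\<close>

locale finite_action =
 fixes G :: "('g, 'm) monoid_scheme" (structure) and A :: "'a cstar" and \<alpha> :: "'g => 'a => 'a"
 assumes group_G: "group G" and finite_G: "finite (carrier G)" and cstar_A: "cstar_algebra A"
  and act_hom: "g : carrier G ==> star_hom A A (\<alpha> g)"
  and act_isometric: "[|g : carrier G; x : carrier A|] ==> nrm A (\<alpha> g x) = nrm A x"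
  and act_mult: "[|g : carrier G; h : carrier G; x : carrier A|] ==> \<alpha> (g \<otimes> h) x = \<alpha> g (\<alpha> h x)"
  and act_one: "x : carrier A ==> \<alpha> \<one> x = x"
  and cauchy_schwarz: "cauchy_schwarz_on (carrier G) A"
  and squares_positive: "squares_positive_on (carrier G) A"
begin

abbreviation "GG \<equiv> carrier G"
abbreviation "AC \<equiv> carrier A"

abbreviation times_A (infixl \<open>\<star>\<close> 70) where "x \<star> y \<equiv> x \<otimes>\<^sub>A y"

sublocale group G by (rule group_G)
sublocale A: pre_cstar A by (rule cstar_algebra_pre_cstar[OF cstar_A])

lemma act_closed [simp, intro]: "[|g : GG; x : AC|] ==> \<alpha> g x : AC"
 by (rule star_hom_closed[OF act_hom])

lemmas act_A_add = star_hom_add[OF act_hom]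
 and act_A_mult = star_hom_mult[OF act_hom]
 and act_A_smult = star_hom_smult[OF act_hom]
 and act_A_star = star_hom_star[OF act_hom]
 and act_A_one [simp] = star_hom_one[OF act_hom]
 and act_A_zero [simp] = star_hom_zero[OF act_hom A.pre_cstar_axioms A.pre_cstar_axioms]
 and act_A_finsum = star_hom_finsum[OF act_hom A.pre_cstar_axioms A.pre_cstar_axioms]

lemma act_inv_left [simp]: "[|g : GG; x : AC|] ==> \<alpha> (inv g) (\<alpha> g x) = x"
 using act_mult[of "inv g" g x] by (simp add: act_one)

lemma act_inv_right [simp]: "[|g : GG; x : AC|] ==> \<alpha> g (\<alpha> (inv g) x) = x"
 using act_mult[of g "inv g" x] by (simp add: act_one)

lemma inv_mult_cancel_left [simp]:
 "[|g : GG; h : GG|] ==> inv g \<otimes> (g \<otimes> h) = h"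
 "[|g : GG; h : GG|] ==> g \<otimes> (inv g \<otimes> h) = h"
 by (simp_all add: m_assoc[symmetric])

lemma sum_translate:
 assumes "g : GG" "f : GG \<rightarrow> AC"
 shows "(\<Oplus>\<^sub>A h\<in>GG. f (g \<otimes> h)) = (\<Oplus>\<^sub>A h\<in>GG. f h)"
proof -
 have "inj_on (%h. g \<otimes> h) (GG)" using assms(1) by (auto intro!: inj_onI)
 from A.finsum_reindex[OF _ this, of f] show ?thesis
  using assms by (simp add: mult_left_image)
qed

lemma sum_inverse:
 assumes "f : GG \<rightarrow> AC"
 shows "(\<Oplus>\<^sub>A h\<in>GG. f (inv h)) = (\<Oplus>\<^sub>A h\<in>GG. f h)"
proof -
 have "inj_on (%h. inv h) (GG)" by (auto intro!: inj_onI)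
 from A.finsum_reindex[OF _ this, of f] show ?thesis
  using assms by (simp add: inv_image_carrier)
qed

abbreviation "M \<equiv> crossed_product G A \<alpha>"
abbreviation times_M (infixl \<open>\<cdot>\<close> 70) where "x \<cdot> y \<equiv> x \<otimes>\<^sub>M y"
abbreviation "MM \<equiv> carrier M"

lemma crossed_simps:
 "MM = GG \<rightarrow>\<^sub>E AC"
 "one M = crossed_embed G A \<one>\<^sub>A" "zero M = (\<lambda>k\<in>GG. \<zero>\<^sub>A)"
 "mult M x y = (\<lambda>k\<in>GG. \<Oplus>\<^sub>A h\<in>GG. x h \<star> \<alpha> h (y (inv h \<otimes> k)))"
 "add M x y = (\<lambda>k\<in>GG. x k \<oplus>\<^sub>A y k)"
 "smult M c x = (\<lambda>k\<in>GG. c \<odot>\<^sub>A x k)"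
 "star M x = (\<lambda>k\<in>GG. \<alpha> k (star A (x (inv k))))"
 by (simp_all add: crossed_product_def)

lemma crossed_coeff [simp, intro]: "[|x : MM; g : GG|] ==> x g : AC"
 by (auto simp: crossed_simps)

lemma crossed_eqI:
 "[|x : MM; y : MM; !!g. g : GG ==> x g = y g|] ==> x = y"
 by (auto simp: crossed_simps intro: PiE_ext)

lemma crossed_mult_coeff:
 "k : GG ==> (x \<cdot> y) k = (\<Oplus>\<^sub>A h\<in>GG. x h \<star> \<alpha> h (y (inv h \<otimes> k)))"
 by (simp add: crossed_simps)

lemma crossed_coeff_simps [simp]:
 assumes "k : GG"
 shows "(x \<oplus>\<^sub>M y) k = x k \<oplus>\<^sub>A y k" "(c \<odot>\<^sub>M x) k = c \<odot>\<^sub>A x k"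
  "\<zero>\<^sub>M k = \<zero>\<^sub>A" "star M x k = \<alpha> k (star A (x (inv k)))"
  "\<one>\<^sub>M k = (if k = \<one> then \<one>\<^sub>A else \<zero>\<^sub>A)"
 using assms by (simp_all add: crossed_simps crossed_embed_def)

lemma crossed_closed:
 "[|x : MM; y : MM|] ==> x \<oplus>\<^sub>M y : MM" "\<one>\<^sub>M : MM" "\<zero>\<^sub>M : MM"
 "[|x : MM; y : MM|] ==> x \<cdot> y : MM"
 "x : MM ==> c \<odot>\<^sub>M x : MM" "x : MM ==> star M x : MM"
 by (auto simp: crossed_simps crossed_embed_def PiE_iff intro!: A.finsum_closed)

lemma crossed_mult_assoc:
 assumes x: "x : MM" and y: "y : MM" and z: "z : MM"
 shows "x \<cdot> y \<cdot> z = x \<cdot> (y \<cdot> z)"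
proof (rule crossed_eqI)
 fix k assume k: "k : GG"
 let ?t = "%h j. x j \<star> \<alpha> j (y (inv j \<otimes> h)) \<star> \<alpha> h (z (inv h \<otimes> k))"
 have t: "?t h j : AC" if "h : GG" "j : GG" for h j
  using x y z k that by simp
 have "(x \<cdot> y \<cdot> z) k = (\<Oplus>\<^sub>A h\<in>GG. \<Oplus>\<^sub>A j\<in>GG. ?t h j)"
  unfolding crossed_mult_coeff[OF k]
 proof (intro A.finsum_cong' refl)
  fix h assume h: "h : GG"
  show "(x \<cdot> y) h \<star> \<alpha> h (z (inv h \<otimes> k)) = (\<Oplus>\<^sub>A j\<in>GG. ?t h j)"
   unfolding crossed_mult_coeff[OF h] using x y z k h finite_G
   by (intro A.finsum_ldistr) auto
 qed (use t finite_G in "auto intro!: A.finsum_closed")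
 also have "... = (\<Oplus>\<^sub>A j\<in>GG. \<Oplus>\<^sub>A h\<in>GG. ?t h j)"
  using t by (intro A.finsum_Sigma_swap finite_G)
 also have "... = (\<Oplus>\<^sub>A j\<in>GG. x j \<star> \<alpha> j ((y \<cdot> z) (inv j \<otimes> k)))"
 proof (intro A.finsum_cong' refl)
  fix j assume j: "j : GG"
  have "(\<Oplus>\<^sub>A h\<in>GG. ?t h j) = (\<Oplus>\<^sub>A i\<in>GG. ?t (j \<otimes> i) j)"
   using t j by (intro sum_translate[symmetric]) auto
  also have "... = (\<Oplus>\<^sub>A i\<in>GG. x j \<star> \<alpha> j (y i \<star> \<alpha> i (z (inv i \<otimes> (inv j \<otimes> k)))))"
   using x y z j k by (intro A.finsum_cong') (auto simp: A.m_assoc act_A_mult act_mult inv_mult_group m_assoc)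
  also have "... = x j \<star> (\<Oplus>\<^sub>A i\<in>GG. \<alpha> j (y i \<star> \<alpha> i (z (inv i \<otimes> (inv j \<otimes> k)))))"
   using x y z j k finite_G by (intro A.finsum_rdistr[symmetric]) auto
  also have "(\<Oplus>\<^sub>A i\<in>GG. \<alpha> j (y i \<star> \<alpha> i (z (inv i \<otimes> (inv j \<otimes> k))))) =
    \<alpha> j (\<Oplus>\<^sub>A i\<in>GG. y i \<star> \<alpha> i (z (inv i \<otimes> (inv j \<otimes> k))))"
   using x y z j k finite_G by (intro act_A_finsum[symmetric]) auto
  also have "(\<Oplus>\<^sub>A i\<in>GG. y i \<star> \<alpha> i (z (inv i \<otimes> (inv j \<otimes> k)))) = (y \<cdot> z) (inv j \<otimes> k)"
   using j k by (simp add: crossed_mult_coeff)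
  finally show "(\<Oplus>\<^sub>A h\<in>GG. ?t h j) = x j \<star> \<alpha> j ((y \<cdot> z) (inv j \<otimes> k))" .
 qed (use x y z k crossed_closed(4)[OF y z] in auto)
 also have "... = (x \<cdot> (y \<cdot> z)) k" by (simp add: crossed_mult_coeff[OF k])
 finally show "(x \<cdot> y \<cdot> z) k = (x \<cdot> (y \<cdot> z)) k" .
qed (use assms crossed_closed in auto)

text \<open>\<open>monomial g a\<close> is the element \<open>a u\<^sub>g\<close>.\<close>

definition monomial :: "'g => 'a => 'g => 'a" where
 "monomial g a = (\<lambda>k\<in>GG. if k = g then a else \<zero>\<^sub>A)"

lemma monomial_coeff [simp]: "k : GG ==> monomial g a k = (if k = g then a else \<zero>\<^sub>A)"
 by (simp add: monomial_def)

lemma monomial_closed [simp, intro]: "a : AC ==> monomial g a : MM"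
 by (auto simp: monomial_def crossed_simps)

lemma crossed_embed_monomial: "crossed_embed G A a = monomial \<one> a"
 by (simp add: crossed_embed_def monomial_def)

lemma monomial_mult_coeff:
 assumes "g : GG" "a : AC" "x : MM" "k : GG"
 shows "(monomial g a \<cdot> x) k = a \<star> \<alpha> g (x (inv g \<otimes> k))"
 unfolding crossed_mult_coeff[OF assms(4)] using assms finite_G
 by (subst A.finsum_eq_single[of _ g]) auto

lemma mult_monomial_coeff:
 assumes "g : GG" "a : AC" "x : MM" "k : GG"
 shows "(x \<cdot> monomial g a) k = x (k \<otimes> inv g) \<star> \<alpha> (k \<otimes> inv g) a"
proof -
 have *: "inv h \<otimes> k = g \<longleftrightarrow> h = k \<otimes> inv g" if "h : GG" for h
  using assms that by (metis inv_closed inv_solve_left inv_solve_right)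
 have "inv (k \<otimes> inv g) \<otimes> k = g" using *[of "k \<otimes> inv g"] assms by simp
 then show ?thesis
  unfolding crossed_mult_coeff[OF assms(4)] using assms finite_G *
  by (subst A.finsum_eq_single[of _ "k \<otimes> inv g"]) auto
qed

lemma crossed_star_mult:
 assumes x: "x : MM" and y: "y : MM"
 shows "star M (x \<cdot> y) = star M y \<cdot> star M x"
proof (rule crossed_eqI)
 fix k assume k: "k : GG"
 let ?f = "%j. \<alpha> j (star A (y (inv j))) \<star> \<alpha> k (star A (x (inv k \<otimes> j)))"
 have f: "?f : GG \<rightarrow> AC" using x y k by auto
 have "star M (x \<cdot> y) k = \<alpha> k (star A (\<Oplus>\<^sub>A h\<in>GG. x h \<star> \<alpha> h (y (inv h \<otimes> inv k))))"
  using k by (simp add: crossed_mult_coeff)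
 also have "... = \<alpha> k (\<Oplus>\<^sub>A h\<in>GG. star A (x h \<star> \<alpha> h (y (inv h \<otimes> inv k))))"
  using x y k finite_G by (subst A.star_finsum) auto
 also have "... = (\<Oplus>\<^sub>A h\<in>GG. \<alpha> k (star A (x h \<star> \<alpha> h (y (inv h \<otimes> inv k)))))"
  using x y k finite_G by (subst act_A_finsum) auto
 also have "... = (\<Oplus>\<^sub>A h\<in>GG. ?f (k \<otimes> h))"
  using x y k by (intro A.finsum_cong')
   (auto simp: A.star_mult act_A_star[symmetric] act_A_mult act_mult inv_mult_group)
 also have "... = (\<Oplus>\<^sub>A j\<in>GG. ?f j)" by (rule sum_translate[OF k f])
 also have "... = (star M y \<cdot> star M x) k"
  unfolding crossed_mult_coeff[OF k] using x y k
  by (intro A.finsum_cong') (auto simp: act_mult[symmetric] inv_mult_group)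
 finally show "star M (x \<cdot> y) k = (star M y \<cdot> star M x) k" .
qed (use assms crossed_closed in auto)

lemma crossed_abelian_group: "abelian_group M"
proof (rule abelian_groupI)
 fix x assume x: "x : MM"
 have "(-1) \<odot>\<^sub>M x \<oplus>\<^sub>M x = \<zero>\<^sub>M"
  using x by (intro crossed_eqI) (simp_all add: crossed_closed A.smult_minus_one A.l_neg)
 then show "\<exists>y\<in>MM. y \<oplus>\<^sub>M x = \<zero>\<^sub>M" using crossed_closed(5)[OF x] by blast
 show "\<zero>\<^sub>M \<oplus>\<^sub>M x = x" using x by (intro crossed_eqI) (simp_all add: crossed_closed)
next
 fix x y z assume "x : MM" "y : MM" "z : MM"
 then show "x \<oplus>\<^sub>M y \<oplus>\<^sub>M z = x \<oplus>\<^sub>M (y \<oplus>\<^sub>M z)"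
  by (intro crossed_eqI) (simp_all add: crossed_closed A.a_assoc)
next
 fix x y assume "x : MM" "y : MM"
 then show "x \<oplus>\<^sub>M y = y \<oplus>\<^sub>M x"
  by (intro crossed_eqI) (simp_all add: crossed_closed A.a_comm)
qed (auto intro: crossed_closed)

lemma crossed_ring: "ring M"
proof (rule ringI[OF crossed_abelian_group])
 have "\<one>\<^sub>M \<cdot> x = x" if x: "x : MM" for x
  using x unfolding crossed_simps(2) crossed_embed_monomial
  by (intro crossed_eqI crossed_closed) (auto simp: monomial_mult_coeff act_one)
 moreover have "x \<cdot> \<one>\<^sub>M = x" if x: "x : MM" for x
  using x unfolding crossed_simps(2) crossed_embed_monomial
  by (intro crossed_eqI crossed_closed) (auto simp: mult_monomial_coeff)
 ultimately show "Group.monoid M" by (intro monoidI crossed_closed crossed_mult_assoc) auto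
next
 fix x y z assume x: "x : MM" and y: "y : MM" and z: "z : MM"
 show "(x \<oplus>\<^sub>M y) \<cdot> z = x \<cdot> z \<oplus>\<^sub>M y \<cdot> z"
 proof (rule crossed_eqI)
  fix k assume k: "k : GG"
  show "((x \<oplus>\<^sub>M y) \<cdot> z) k = (x \<cdot> z \<oplus>\<^sub>M y \<cdot> z) k"
  proof -
   have "(\<Oplus>\<^sub>A h\<in>GG. (x \<oplus>\<^sub>M y) h \<star> \<alpha> h (z (inv h \<otimes> k))) =
     (\<Oplus>\<^sub>A h\<in>GG. x h \<star> \<alpha> h (z (inv h \<otimes> k)) \<oplus>\<^sub>A y h \<star> \<alpha> h (z (inv h \<otimes> k)))"
    using x y z k by (intro A.finsum_cong') (auto simp: A.l_distr)
   also have "... = (x \<cdot> z) k \<oplus>\<^sub>A (y \<cdot> z) k"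
    unfolding crossed_mult_coeff[OF k] using x y z k by (intro A.finsum_addf) auto
   finally show ?thesis unfolding crossed_mult_coeff[OF k, of "x \<oplus>\<^sub>M y"] crossed_coeff_simps(1)[OF k] .
  qed
 qed (use x y z crossed_closed in auto)
 show "z \<cdot> (x \<oplus>\<^sub>M y) = z \<cdot> x \<oplus>\<^sub>M z \<cdot> y"
 proof (rule crossed_eqI)
  fix k assume k: "k : GG"
  show "(z \<cdot> (x \<oplus>\<^sub>M y)) k = (z \<cdot> x \<oplus>\<^sub>M z \<cdot> y) k"
  proof -
   have "(\<Oplus>\<^sub>A h\<in>GG. z h \<star> \<alpha> h ((x \<oplus>\<^sub>M y) (inv h \<otimes> k))) =
     (\<Oplus>\<^sub>A h\<in>GG. z h \<star> \<alpha> h (x (inv h \<otimes> k)) \<oplus>\<^sub>A z h \<star> \<alpha> h (y (inv h \<otimes> k)))"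
    using x y z k by (intro A.finsum_cong') (auto simp: A.r_distr act_A_add)
   also have "... = (z \<cdot> x) k \<oplus>\<^sub>A (z \<cdot> y) k"
    unfolding crossed_mult_coeff[OF k] using x y z k by (intro A.finsum_addf) auto
   finally show ?thesis unfolding crossed_mult_coeff[OF k, of _ "x \<oplus>\<^sub>M y"] crossed_coeff_simps(1)[OF k] .
  qed
 qed (use x y z crossed_closed in auto)
qed

interpretation M: ring M by (rule crossed_ring)

subsection \<open>The norm of the crossed product\<close>

text \<open>\<open>\<parallel>x\<parallel>\<^sub>2\<close> is the norm of \<open>x\<close> in the Hilbert \<open>A\<close>-module \<open>\<ell>\<^sup>2 G A\<close>, identified with the
 crossed product by \<open>\<xi> h = \<alpha> (inv h) (x h)\<close>; it makes the regular representation left multiplication.\<close>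

definition hnorm :: "('g => 'a) => real" where
 "hnorm x = sqrt (nrm A ((star M x \<cdot> x) \<one>))"

definition untwist :: "('g => 'a) => 'g => 'a" where
 "untwist x = (\<lambda>h\<in>GG. \<alpha> (inv h) (x h))"

lemma untwist_closed: "x : MM ==> untwist x : GG \<rightarrow>\<^sub>E AC"
 by (auto simp: untwist_def)

lemma untwist_surj:
 assumes "\<xi> : GG \<rightarrow>\<^sub>E AC" obtains x where "x : MM" "\<xi> = untwist x"
proof
 show "(\<lambda>h\<in>GG. \<alpha> h (\<xi> h)) : MM" using assms by (auto simp: crossed_simps)
 show "\<xi> = untwist (\<lambda>h\<in>GG. \<alpha> h (\<xi> h))"
  using assms by (intro PiE_ext[OF assms]) (auto simp: untwist_def PiE_iff)
qed

text \<open>Untwisting by \<alpha> (inv h) removes the automorphisms from the coefficients. The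
  value of x* y at the identity becomes the standard inner product of columns indexed by G, to which
  \<open>cauchy_schwarz_on\<close> applies.\<close>

lemma inner_coeff:
 assumes "x : MM" "y : MM"
 shows "(star M x \<cdot> y) \<one> = (\<Oplus>\<^sub>A h\<in>GG. star A (untwist x h) \<star> untwist y h)"
proof -
 let ?f = "%h. star A (untwist x h) \<star> untwist y h"
 have f: "?f : GG \<rightarrow> AC" using assms by (auto simp: untwist_def)
 have "(star M x \<cdot> y) \<one> = (\<Oplus>\<^sub>A h\<in>GG. ?f (inv h))"
  unfolding crossed_mult_coeff[OF one_closed] using assms
  by (intro A.finsum_cong') (auto simp: untwist_def act_A_star)
 then show ?thesis using sum_inverse[OF f] by simp
qed

lemma l2_norm_untwist: "x : MM ==> l2_norm G A (untwist x) = hnorm x"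
 by (simp add: l2_norm_def hnorm_def inner_coeff)

lemma regular_rep_untwist:
 assumes "f : MM" "x : MM"
 shows "regular_rep G A \<alpha> f (untwist x) = untwist (f \<cdot> x)"
proof
 fix h
 show "regular_rep G A \<alpha> f (untwist x) h = untwist (f \<cdot> x) h"
 proof (cases "h : GG")
  case h: True
  have "untwist (f \<cdot> x) h = \<alpha> (inv h) (\<Oplus>\<^sub>A g\<in>GG. f g \<star> \<alpha> g (x (inv g \<otimes> h)))"
   using h by (simp add: untwist_def crossed_mult_coeff)
  also have "... = (\<Oplus>\<^sub>A g\<in>GG. \<alpha> (inv h) (f g \<star> \<alpha> g (x (inv g \<otimes> h))))"
   using assms h finite_G by (intro act_A_finsum) auto
  also have "... = regular_rep G A \<alpha> f (untwist x) h"
   using assms h unfolding regular_rep_def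
   by (auto intro!: A.finsum_cong' simp: untwist_def act_A_mult act_mult inv_mult_group)
  finally show ?thesis by simp
 qed (simp add: regular_rep_def untwist_def)
qed

lemma crossed_norm:
 assumes "f : MM"
 shows "nrm M f = Sup {hnorm (f \<cdot> x) |x. x : MM & hnorm x <= 1}"
proof -
 have "{l2_norm G A (regular_rep G A \<alpha> f \<xi>) |\<xi>. \<xi> : GG \<rightarrow>\<^sub>E AC & l2_norm G A \<xi> <= 1} =
  {hnorm (f \<cdot> x) |x. x : MM & hnorm x <= 1}" (is "?L = ?R")
 proof
  show "?L <= ?R"
  proof
   fix t assume "t : ?L"
   then obtain \<xi> where \<xi>: "\<xi> : GG \<rightarrow>\<^sub>E AC" "l2_norm G A \<xi> <= 1"
    "t = l2_norm G A (regular_rep G A \<alpha> f \<xi>)" by blast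
   obtain x where "x : MM" "\<xi> = untwist x" using untwist_surj[OF \<xi>(1)] .
   then show "t : ?R" using \<xi> assms
    by (auto simp: l2_norm_untwist regular_rep_untwist crossed_closed intro!: exI[of _ x])
  qed
  show "?R <= ?L"
  proof
   fix t assume "t : ?R"
   then obtain x where "x : MM" "hnorm x <= 1" "t = hnorm (f \<cdot> x)" by blast
   then show "t : ?L" using assms untwist_closed[of x]
    by (intro CollectI exI[of _ "untwist x"]) (auto simp: l2_norm_untwist regular_rep_untwist crossed_closed)
  qed
 qed
 then show ?thesis by (simp add: crossed_product_def)
qed

lemma inner_closed [simp, intro]:
 "[|x : MM; y : MM|] ==> (star M x \<cdot> y) \<one> : AC"
 by (auto intro!: crossed_coeff crossed_closed)

lemma hnorm_nonneg [simp]: "x : MM ==> 0 <= hnorm x"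
 by (simp add: hnorm_def)

lemma hnorm_square: "x : MM ==> (hnorm x)\<^sup>2 = nrm A ((star M x \<cdot> x) \<one>)"
 by (simp add: hnorm_def)

lemma inner_le:
 assumes "x : MM" "y : MM"
 shows "nrm A ((star M x \<cdot> y) \<one>) <= hnorm x * hnorm y"
proof -
 have "untwist x : GG \<rightarrow> AC" "untwist y : GG \<rightarrow> AC"
  using assms by (auto simp: untwist_def)
 then have "(nrm A ((star M x \<cdot> y) \<one>))\<^sup>2 <= (hnorm x)\<^sup>2 * (hnorm y)\<^sup>2"
  using cauchy_schwarz assms by (simp add: cauchy_schwarz_on_def inner_coeff hnorm_square)
 then have "(nrm A ((star M x \<cdot> y) \<one>))\<^sup>2 <= (hnorm x * hnorm y)\<^sup>2" by (simp add: power_mult_distrib)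
 then show ?thesis using assms by (auto intro: power2_le_imp_le)
qed

lemma crossed_star_star [simp]: "x : MM ==> star M (star M x) = x"
 by (intro crossed_eqI crossed_closed) (auto simp: act_A_star[symmetric])

lemma crossed_star_add:
 "[|x : MM; y : MM|] ==> star M (x \<oplus>\<^sub>M y) = star M x \<oplus>\<^sub>M star M y"
 by (intro crossed_eqI crossed_closed) (auto simp: A.star_add act_A_add)

lemma crossed_star_smult: "x : MM ==> star M (c \<odot>\<^sub>M x) = cnj c \<odot>\<^sub>M star M x"
 by (intro crossed_eqI crossed_closed) (auto simp: A.star_smult act_A_smult)

lemma crossed_smult_mult:
 assumes "x : MM" "y : MM"
 shows "(c \<odot>\<^sub>M x) \<cdot> y = c \<odot>\<^sub>M (x \<cdot> y)" "x \<cdot> (c \<odot>\<^sub>M y) = c \<odot>\<^sub>M (x \<cdot> y)"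
proof -
 have s: "c \<odot>\<^sub>A (\<Oplus>\<^sub>A h\<in>GG. x h \<star> \<alpha> h (y (inv h \<otimes> k))) =
   (\<Oplus>\<^sub>A h\<in>GG. c \<odot>\<^sub>A (x h \<star> \<alpha> h (y (inv h \<otimes> k))))" if "k : GG" for k
  using assms that finite_G by (intro A.smult_finsum) auto
 show "(c \<odot>\<^sub>M x) \<cdot> y = c \<odot>\<^sub>M (x \<cdot> y)"
  using assms by (intro crossed_eqI crossed_closed)
   (auto simp: crossed_mult_coeff s A.smult_mult_left intro!: A.finsum_cong')
 show "x \<cdot> (c \<odot>\<^sub>M y) = c \<odot>\<^sub>M (x \<cdot> y)"
  using assms by (intro crossed_eqI crossed_closed)
   (auto simp: crossed_mult_coeff s A.smult_mult_right act_A_smult intro!: A.finsum_cong')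
qed

lemma hnorm_add:
 assumes x: "x : MM" and y: "y : MM"
 shows "hnorm (x \<oplus>\<^sub>M y) <= hnorm x + hnorm y"
proof -
 note sx = crossed_closed(6)[OF x] and sy = crossed_closed(6)[OF y] and xy = crossed_closed(1)[OF x y]
 have "star M (x \<oplus>\<^sub>M y) \<cdot> (x \<oplus>\<^sub>M y) =
   (star M x \<cdot> x \<oplus>\<^sub>M star M x \<cdot> y) \<oplus>\<^sub>M (star M y \<cdot> x \<oplus>\<^sub>M star M y \<cdot> y)"
  using x y sx sy by (simp add: crossed_star_add M.l_distr M.r_distr M.a_ac)
 then have "(hnorm (x \<oplus>\<^sub>M y))\<^sup>2 = nrm A (((star M x \<cdot> x) \<one> \<oplus>\<^sub>A (star M x \<cdot> y) \<one>) \<oplus>\<^sub>A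
   ((star M y \<cdot> x) \<one> \<oplus>\<^sub>A (star M y \<cdot> y) \<one>))"
  by (simp add: hnorm_square[OF xy])
 also have "... <= (nrm A ((star M x \<cdot> x) \<one>) + nrm A ((star M x \<cdot> y) \<one>)) +
   (nrm A ((star M y \<cdot> x) \<one>) + nrm A ((star M y \<cdot> y) \<one>))"
  by (rule order_trans[OF A.nrm_triangle add_mono[OF A.nrm_triangle A.nrm_triangle]]) (use x y in auto)
 also have "... <= ((hnorm x)\<^sup>2 + hnorm x * hnorm y) + (hnorm y * hnorm x + (hnorm y)\<^sup>2)"
  using inner_le[OF x y] inner_le[OF y x] unfolding hnorm_square[OF x] hnorm_square[OF y] by linarith
 also have "... = (hnorm x + hnorm y)\<^sup>2" by (simp add: power2_eq_square algebra_simps)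
 finally show ?thesis using x y by (auto intro: power2_le_imp_le)
qed

lemma hnorm_smult: assumes x: "x : MM" shows "hnorm (c \<odot>\<^sub>M x) = cmod c * hnorm x"
proof -
 note sx = crossed_closed(6)[OF x] and cx = crossed_closed(5)[OF x, of c]
 have "star M (c \<odot>\<^sub>M x) \<cdot> (c \<odot>\<^sub>M x) = cnj c \<odot>\<^sub>M (c \<odot>\<^sub>M (star M x \<cdot> x))"
  using x sx cx by (simp add: crossed_star_smult crossed_smult_mult)
 then have "(hnorm (c \<odot>\<^sub>M x))\<^sup>2 = (cmod c * hnorm x)\<^sup>2"
  using x by (simp add: hnorm_square[OF cx] A.nrm_smult hnorm_square power_mult_distrib)
   (simp add: power2_eq_square)
 then show ?thesis using x cx by (auto intro: power2_eq_imp_eq)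
qed

text \<open>Cauchy-Schwarz against the unitary u_g: the coefficient of u_g* x at the identity is
  \<open>x g\<close> up to the isometric automorphism \<alpha> (inv g), and u_g has length at most
  1.\<close>

lemma coeff_le_hnorm: assumes x: "x : MM" and g: "g : GG" shows "nrm A (x g) <= hnorm x"
proof -
 let ?u = "monomial g \<one>\<^sub>A"
 have u: "?u : MM" by auto
 have 1: "(star M ?u \<cdot> y) \<one> = \<alpha> (inv g) (y g)" if y: "y : MM" for y
 proof -
  have "star M ?u = monomial (inv g) \<one>\<^sub>A"
   using g by (intro crossed_eqI crossed_closed) (auto dest: inv_inv)
  then show ?thesis using y g by (simp add: monomial_mult_coeff)
 qed
 have "hnorm ?u = sqrt (nrm A \<one>\<^sub>A)" unfolding hnorm_def 1[OF u] using g by simp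
 then have "hnorm ?u <= 1" using A.nrm_one_le by simp
 have "nrm A (x g) <= hnorm ?u * hnorm x"
  using inner_le[OF u x] unfolding 1[OF x] using x g by (simp add: act_isometric)
 also have "... <= 1 * hnorm x" using \<open>hnorm ?u <= 1\<close> x by (intro mult_right_mono) auto
 finally show ?thesis by simp
qed

text \<open>The squared length is at most the sum of the squared coefficient norms, hence at most
  the square of their sum.\<close>

lemma hnorm_le_sum: assumes x: "x : MM" shows "hnorm x <= (\<Sum>g\<in>GG. nrm A (x g))"
proof -
 have "(hnorm x)\<^sup>2 <= (\<Sum>h\<in>GG. nrm A (star A (untwist x h) \<star> untwist x h))"
  unfolding hnorm_square[OF x] inner_coeff[OF x x] using x finite_G
  by (intro A.nrm_finsum) (auto simp: untwist_def)
 also have "... = (\<Sum>h\<in>GG. (nrm A (x h))\<^sup>2)"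
  using x by (intro sum.cong) (auto simp: untwist_def A.cstar_identity act_isometric)
 also have "... <= (\<Sum>h\<in>GG. nrm A (x h) * (\<Sum>g\<in>GG. nrm A (x g)))"
  unfolding power2_eq_square using x finite_G
  by (intro sum_mono mult_left_mono member_le_sum) auto
 also have "... = (\<Sum>g\<in>GG. nrm A (x g))\<^sup>2" by (simp add: sum_distrib_right power2_eq_square)
 finally show ?thesis by (rule power2_le_imp_le) (use x in "auto intro!: sum_nonneg")
qed

definition oG :: real where "oG = real (card (GG))"

lemma order_real_ge: "1 <= oG"
 unfolding oG_def using finite_G card_gt_0_iff[of "GG"] by (auto simp: Suc_le_eq)

text \<open>Bounds the set over which the norm of the crossed product is a supremum. The factor |G|
  comes from adding up the coefficients of the product.\<close>

lemma hnorm_mult_crude: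
 assumes f: "f : MM" and x: "x : MM"
 shows "hnorm (f \<cdot> x) <= oG * (\<Sum>g\<in>GG. nrm A (f g)) * hnorm x"
proof -
 have "nrm A ((f \<cdot> x) k) <= (\<Sum>g\<in>GG. nrm A (f g)) * hnorm x" if k: "k : GG" for k
 proof -
  have "nrm A ((f \<cdot> x) k) <= (\<Sum>h\<in>GG. nrm A (f h \<star> \<alpha> h (x (inv h \<otimes> k))))"
   unfolding crossed_mult_coeff[OF k] using f x k finite_G by (intro A.nrm_finsum) auto
  also have "... <= (\<Sum>h\<in>GG. nrm A (f h) * hnorm x)"
  proof (rule sum_mono)
   fix h assume h: "h : GG"
   have "nrm A (f h \<star> \<alpha> h (x (inv h \<otimes> k))) <= nrm A (f h) * nrm A (\<alpha> h (x (inv h \<otimes> k)))"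
    using f x h k by (intro A.nrm_mult) auto
   also have "... <= nrm A (f h) * hnorm x"
    using f x h k coeff_le_hnorm[OF x, of "inv h \<otimes> k"] by (intro mult_left_mono) (auto simp: act_isometric)
   finally show "nrm A (f h \<star> \<alpha> h (x (inv h \<otimes> k))) <= nrm A (f h) * hnorm x" .
  qed
  finally show ?thesis by (simp add: sum_distrib_right)
 qed
 then have "(\<Sum>k\<in>GG. nrm A ((f \<cdot> x) k)) <= (\<Sum>k\<in>GG. (\<Sum>g\<in>GG. nrm A (f g)) * hnorm x)"
  by (rule sum_mono)
 then show ?thesis using hnorm_le_sum[OF crossed_closed(4)[OF f x]] by (simp add: oG_def)
qed

lemma hnorm_mult_le:
 assumes f: "f : MM" and x: "x : MM" shows "hnorm (f \<cdot> x) <= nrm M f * hnorm x"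
 unfolding crossed_norm[OF f]
proof (rule sup_norm_bound[where sc = "%c x. of_real c \<odot>\<^sub>M x"])
 show "hnorm (f \<cdot> (of_real c \<odot>\<^sub>M y)) = \<bar>c\<bar> * hnorm (f \<cdot> y)" if "y : MM" for c y
  using that f by (simp add: crossed_smult_mult hnorm_smult crossed_closed)
qed (use assms hnorm_mult_crude[OF f] in "auto simp: hnorm_smult crossed_closed")

lemma hnorm_zero [simp]: "hnorm \<zero>\<^sub>M = 0"
 using hnorm_le_sum[of "\<zero>\<^sub>M"] by (intro antisym) (simp_all add: crossed_closed)

lemma crossed_norm_least:
 assumes "f : MM" "!!x. x : MM ==> hnorm (f \<cdot> x) <= K * hnorm x" "0 <= K"
 shows "nrm M f <= K"
 unfolding crossed_norm[OF assms(1)] by (rule sup_norm_least[OF assms(2,3), where v = "\<zero>\<^sub>M"]) (auto simp: crossed_closed)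

text \<open>Apply f to the unit, a vector of length at most 1. That the supremum
  \<open>nrm M f\<close> is nonnegative has not been established at this point, hence the case
  distinction.\<close>

lemma hnorm_le_nrm: assumes f: "f : MM" shows "hnorm f <= nrm M f"
proof -
 have "(star M \<one>\<^sub>M \<cdot> \<one>\<^sub>M) \<one> = \<one>\<^sub>A"
  using crossed_closed(2) by (simp add: inner_coeff) (subst A.finsum_eq_single[of _ \<one>];
   auto simp: untwist_def act_one finite_G)
 then have 1: "hnorm \<one>\<^sub>M <= 1" using A.nrm_one_le by (simp add: hnorm_def)
 have f1: "hnorm f <= nrm M f * hnorm \<one>\<^sub>M"
  using hnorm_mult_le[OF f, of "\<one>\<^sub>M"] f by (simp add: crossed_closed)
 show ?thesis
 proof (cases "0 <= nrm M f")
  case True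
  then show ?thesis using f1 mult_left_mono[OF 1 True] by simp
 next
  case False
  then have "nrm M f * hnorm \<one>\<^sub>M <= 0"
   using hnorm_nonneg[OF crossed_closed(2)] by (simp add: mult_nonpos_nonneg)
  then have f0: "hnorm f = 0" "nrm M f * hnorm \<one>\<^sub>M = 0" using f1 hnorm_nonneg[OF f] by linarith+
  have "0 <= nrm M f"
   unfolding crossed_norm[OF f]
  proof (rule sup_norm_nonneg[OF hnorm_mult_crude[OF f], where v = "\<zero>\<^sub>M"])
   show "0 <= oG * (\<Sum>g\<in>GG. nrm A (f g))"
    using f order_real_ge by (auto intro!: mult_nonneg_nonneg sum_nonneg)
   show "hnorm (f \<cdot> \<zero>\<^sub>M) = 0" using f by simp
  qed (auto simp: crossed_closed)
  then show ?thesis using f0 by simp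
 qed
qed

lemma crossed_norm_nonneg: "f : MM ==> 0 <= nrm M f"
 using hnorm_le_nrm[of f] hnorm_nonneg[of f] by linarith

lemma coeff_le_nrm: "[|x : MM; g : GG|] ==> nrm A (x g) <= nrm M x"
 using coeff_le_hnorm[of x g] hnorm_le_nrm[of x] by linarith

lemma nrm_le_sum: "x : MM ==> nrm M x <= oG * (\<Sum>g\<in>GG. nrm A (x g))"
 by (rule crossed_norm_least[OF _ hnorm_mult_crude])
  (use order_real_ge in "auto intro!: mult_nonneg_nonneg sum_nonneg")

lemma inner_star_swap:
 assumes "x : MM" "y : MM" "f : MM"
 shows "star M (f \<cdot> x) \<cdot> y = star M x \<cdot> (star M f \<cdot> y)"
 using assms by (simp add: crossed_star_mult crossed_closed M.m_assoc)

text \<open>Moving f across the inner product gives <f x, f x> = <x, f* f x>. This is the source of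
  the C*-identity in the crossed product.\<close>

lemma hnorm_mult_square:
 assumes f: "f : MM" and x: "x : MM"
 shows "(hnorm (f \<cdot> x))\<^sup>2 <= hnorm x * hnorm ((star M f \<cdot> f) \<cdot> x)"
proof -
 note c = crossed_closed(4)[OF f x] crossed_closed(6)[OF f]
 have "(hnorm (f \<cdot> x))\<^sup>2 = nrm A ((star M x \<cdot> (star M f \<cdot> f \<cdot> x)) \<one>)"
  unfolding hnorm_square[OF c(1)] inner_star_swap[OF x c(1) f] using f x c by (simp add: M.m_assoc)
 also have "... <= hnorm x * hnorm ((star M f \<cdot> f) \<cdot> x)"
  using f x c by (intro inner_le) (auto intro!: crossed_closed)
 finally show ?thesis .
qed

lemma crossed_nrm_mult:
 assumes f: "f : MM" and f': "f' : MM" shows "nrm M (f \<cdot> f') <= nrm M f * nrm M f'"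
proof (rule crossed_norm_least[OF crossed_closed(4)[OF f f']])
 fix x assume x: "x : MM"
 have "hnorm (f \<cdot> f' \<cdot> x) <= nrm M f * hnorm (f' \<cdot> x)"
  using f f' x by (simp add: M.m_assoc hnorm_mult_le crossed_closed)
 also have "... <= nrm M f * (nrm M f' * hnorm x)"
  by (intro mult_left_mono hnorm_mult_le f' x crossed_norm_nonneg f)
 finally show "hnorm (f \<cdot> f' \<cdot> x) <= nrm M f * nrm M f' * hnorm x" by (simp add: mult.assoc)
qed (use f f' crossed_norm_nonneg in auto)

lemma crossed_module: "seminormed_module M"
proof (intro seminormed_module.intro crossed_abelian_group seminormed_module_axioms.intro)
 fix x y assume x: "x : MM" and y: "y : MM"
 show "nrm M (x \<oplus>\<^sub>M y) <= nrm M x + nrm M y"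
 proof (rule crossed_norm_least[OF crossed_closed(1)[OF x y]])
  fix z assume z: "z : MM"
  have "hnorm ((x \<oplus>\<^sub>M y) \<cdot> z) <= hnorm (x \<cdot> z) + hnorm (y \<cdot> z)"
   using x y z by (simp add: M.l_distr hnorm_add crossed_closed)
  then show "hnorm ((x \<oplus>\<^sub>M y) \<cdot> z) <= (nrm M x + nrm M y) * hnorm z"
   using hnorm_mult_le[OF x z] hnorm_mult_le[OF y z] by (simp add: algebra_simps)
 qed (use x y crossed_norm_nonneg in auto)
next
 have le: "nrm M (c \<odot>\<^sub>M x) <= cmod c * nrm M x" if x: "x : MM" for c x
 proof (rule crossed_norm_least[OF crossed_closed(5)[OF x]])
  fix z assume z: "z : MM"
  show "hnorm ((c \<odot>\<^sub>M x) \<cdot> z) <= cmod c * nrm M x * hnorm z"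
   using x z mult_left_mono[OF hnorm_mult_le[OF x z], of "cmod c"]
   by (simp add: crossed_smult_mult hnorm_smult crossed_closed mult.assoc)
 qed (use x crossed_norm_nonneg in auto)
 fix c x assume x: "x : MM"
 show "nrm M (c \<odot>\<^sub>M x) = cmod c * nrm M x"
 proof (cases "c = 0")
  case True
  then show ?thesis using le[OF x, of 0] crossed_norm_nonneg[OF crossed_closed(5)[OF x, of 0]] by simp
 next
  case False
  have "x = inverse c \<odot>\<^sub>M (c \<odot>\<^sub>M x)"
   using x False by (intro crossed_eqI crossed_closed) (auto simp: A.smult_smult[symmetric])
  then have "nrm M x <= inverse (cmod c) * nrm M (c \<odot>\<^sub>M x)"
   using le[OF crossed_closed(5)[OF x, of c], of "inverse c"] by (simp add: norm_inverse)
  then show ?thesis using le[OF x, of c] False by (simp add: field_simps)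
 qed
qed (auto intro!: crossed_eqI crossed_closed simp: A.smult_add_left A.smult_add_right A.smult_smult)

lemma crossed_nrm_square_le:
 assumes f: "f : MM" shows "(nrm M f)\<^sup>2 <= nrm M (star M f \<cdot> f)"
proof -
 have ff: "star M f \<cdot> f : MM" using f by (intro crossed_closed)
 have "nrm M f <= sqrt (nrm M (star M f \<cdot> f))"
 proof (rule crossed_norm_least[OF f])
  fix x assume x: "x : MM"
  have "(hnorm (f \<cdot> x))\<^sup>2 <= hnorm x * (nrm M (star M f \<cdot> f) * hnorm x)"
   using hnorm_mult_square[OF f x] mult_left_mono[OF hnorm_mult_le[OF ff x] hnorm_nonneg[OF x]] by linarith
  also have "... = (sqrt (nrm M (star M f \<cdot> f)) * hnorm x)\<^sup>2"
   using crossed_norm_nonneg[OF ff] by (simp add: power_mult_distrib) (simp add: power2_eq_square)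
  finally show "hnorm (f \<cdot> x) <= sqrt (nrm M (star M f \<cdot> f)) * hnorm x"
   using crossed_norm_nonneg[OF ff] x by (auto intro: power2_le_imp_le)
 qed (use crossed_norm_nonneg[OF ff] in auto)
 then have "(nrm M f)\<^sup>2 <= (sqrt (nrm M (star M f \<cdot> f)))\<^sup>2"
  using crossed_norm_nonneg[OF f] by (intro power_mono)
 then show ?thesis using crossed_norm_nonneg[OF ff] by simp
qed

lemma pre_cstar_crossed: "pre_cstar M"
proof (intro pre_cstar.intro seminormed_algebra.intro crossed_ring crossed_module
  seminormed_algebra_axioms.intro pre_cstar_axioms.intro)
 fix x assume x: "x : MM"
 show "nrm M x = 0 \<longleftrightarrow> x = \<zero>\<^sub>M"
 proof
  assume 0: "nrm M x = 0"
  have "x g = \<zero>\<^sub>A" if g: "g : GG" for g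
   using coeff_le_nrm[OF x g] 0 A.nrm_nonneg[OF crossed_coeff[OF x g]] A.nrm_eq_0[OF crossed_coeff[OF x g]]
   by simp
  then show "x = \<zero>\<^sub>M" using x by (intro crossed_eqI crossed_closed) auto
 next
  interpret seminormed_module M by (rule crossed_module)
  assume "x = \<zero>\<^sub>M" then show "nrm M x = 0" by simp
 qed
 have le: "nrm M y <= nrm M (star M y)" if y: "y : MM" for y
 proof (cases "nrm M y = 0")
  case False
  then have "nrm M y > 0" using crossed_norm_nonneg[OF y] by linarith
  moreover have "(nrm M y)\<^sup>2 <= nrm M (star M y) * nrm M y"
   using crossed_nrm_square_le[OF y] crossed_nrm_mult[OF crossed_closed(6)[OF y] y] by linarith
  ultimately show ?thesis by (simp add: power2_eq_square)
 qed (use crossed_norm_nonneg[OF crossed_closed(6)[OF y]] in simp)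
 have "nrm M (star M x \<cdot> x) <= nrm M (star M x) * nrm M x"
  by (rule crossed_nrm_mult[OF crossed_closed(6)[OF x] x])
 also have "... <= nrm M x * nrm M x"
  using le[OF crossed_closed(6)[OF x]] x crossed_norm_nonneg[OF x] by (intro mult_right_mono) auto
 finally show "nrm M (star M x \<cdot> x) = (nrm M x)\<^sup>2"
  using crossed_nrm_square_le[OF x] by (simp add: power2_eq_square)
qed (auto intro: crossed_closed crossed_nrm_mult crossed_star_add crossed_star_smult crossed_star_mult
  simp: crossed_smult_mult)

end

text \<open>The square root of \<open>1 - c\<close> is \<open>1 - b\<close>, where \<open>b = (c + b\<^sup>2) / 2\<close> is the limit of the obvious
 iteration; the scalar iteration for \<open>c = 1\<close> dominates it and converges, so no power series is needed.\<close>

lemma (in cstar_algebra) square_root_exists: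
 assumes c: "c : carrier C" "star C c = c" "nrm C c <= 1"
 shows "\<exists>t\<in>carrier C. star C t = t & t \<otimes> t = \<one> \<ominus> c"
proof -
 interpret P: pre_cstar C by (rule cstar_algebra_pre_cstar[OF cstar_algebra_axioms])
 define b where "b = rec_nat \<zero> (%_ b. of_real (1/2) \<odot> (c \<oplus> b \<otimes> b))"
 define \<beta> where "\<beta> = rec_nat 0 (%_ t. (1/2) * (1 + t * t :: real))"
 have b0: "b 0 = \<zero>" and bS: "b (Suc n) = of_real (1/2) \<odot> (c \<oplus> b n \<otimes> b n)" for n
  by (simp_all add: b_def)
 have \<beta>0: "\<beta> 0 = 0" and \<beta>S: "\<beta> (Suc n) = (1/2) * (1 + \<beta> n * \<beta> n)" for n
  by (simp_all add: \<beta>_def)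
 have bc: "b n : carrier C" for n by (induction n) (simp_all add: b0 bS c)
 have bstar: "star C (b n) = b n" for n
 proof (induction n)
  case (Suc n)
  then show ?case unfolding bS using bc[of n] c(1,2)
   by (simp add: P.star_smult P.star_add P.star_mult)
 qed (simp add: b0)
 have \<beta>01: "0 <= \<beta> n & \<beta> n <= 1" for n
 proof (induction n)
  case (Suc n)
  then have "\<beta> n * \<beta> n <= 1 * 1" by (intro mult_mono) auto
  then show ?case by (simp add: \<beta>S)
 qed (simp add: \<beta>0)
 have bn: "nrm C (b n) <= \<beta> n" for n
 proof (induction n)
  case (Suc n)
  have "nrm C (b n \<otimes> b n) <= nrm C (b n) * nrm C (b n)" by (rule P.nrm_mult[OF bc bc])
  also have "... <= \<beta> n * \<beta> n" using Suc bc \<beta>01[of n] by (intro mult_mono) auto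
  finally have "nrm C (c \<oplus> b n \<otimes> b n) <= 1 + \<beta> n * \<beta> n"
   using P.nrm_triangle[of c "b n \<otimes> b n"] c bc by simp
  moreover have "nrm C (b (Suc n)) = (1/2) * nrm C (c \<oplus> b n \<otimes> b n)"
   unfolding bS using c bc by (subst P.nrm_smult) auto
  ultimately show ?case by (simp add: \<beta>S)
 qed (simp add: b0 \<beta>0)
 have diff: "b (Suc (Suc n)) \<ominus> b (Suc n) = of_real (1/2) \<odot> (b (Suc n) \<otimes> b (Suc n) \<ominus> b n \<otimes> b n)" for n
 proof -
  have "(c \<oplus> b (Suc n) \<otimes> b (Suc n)) \<ominus> (c \<oplus> b n \<otimes> b n) = b (Suc n) \<otimes> b (Suc n) \<ominus> b n \<otimes> b n"
   using c bc by (simp add: P.minus_add_distrib)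
  then show ?thesis unfolding bS[of "Suc n"] using c bc
   by (subst (3) bS) (simp add: P.smult_minus_right[symmetric])
 qed
 have step: "nrm C (b (Suc n) \<ominus> b n) <= \<beta> (Suc n) - \<beta> n" for n
 proof (induction n)
  case 0
  have "nrm C (b (Suc 0)) = (1/2) * nrm C c"
   unfolding bS b0 using c by (subst P.nrm_smult) auto
  then show ?case using c bc[of 1] by (simp add: b0 \<beta>0 \<beta>S)
 next
  case (Suc n)
  have inc: "\<beta> n <= \<beta> (Suc n)" using order_trans[OF P.nrm_nonneg Suc] bc by simp
  have "nrm C (b (Suc n) \<otimes> b (Suc n) \<ominus> b n \<otimes> b n) \<le>
    nrm C (b (Suc n) \<ominus> b n) * nrm C (b (Suc n)) + nrm C (b n) * nrm C (b (Suc n) \<ominus> b n)"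
   by (rule P.nrm_mult_diff[OF bc bc bc bc])
  also have "... <= (\<beta> (Suc n) - \<beta> n) * \<beta> (Suc n) + \<beta> n * (\<beta> (Suc n) - \<beta> n)"
   using Suc bn bc \<beta>01 inc by (intro add_mono mult_mono) auto
  finally have "nrm C (b (Suc n) \<otimes> b (Suc n) \<ominus> b n \<otimes> b n) <= \<beta> (Suc n) * \<beta> (Suc n) - \<beta> n * \<beta> n"
   by (simp add: algebra_simps)
  moreover have "nrm C (b (Suc (Suc n)) \<ominus> b (Suc n)) = (1/2) * nrm C (b (Suc n) \<otimes> b (Suc n) \<ominus> b n \<otimes> b n)"
   unfolding diff using bc by (subst P.nrm_smult) auto
  ultimately show ?case using \<beta>S[of "Suc n"] \<beta>S[of n] by argo
 qed
 have mono: "\<beta> n <= \<beta> (n + k)" for n k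
 proof (induction k)
  case (Suc k)
  have "0 <= nrm C (b (Suc (n + k)) \<ominus> b (n + k))" using bc by simp
  with step[of "n + k"] Suc show ?case by simp
 qed simp
 have far: "nrm C (b (n + k) \<ominus> b n) <= \<beta> (n + k) - \<beta> n" for n k
 proof (induction k)
  case (Suc k)
  have "nrm C (b (Suc (n + k)) \<ominus> b n) <= nrm C (b (Suc (n + k)) \<ominus> b (n + k)) + nrm C (b (n + k) \<ominus> b n)"
   by (rule P.nrm_dist_triangle[OF bc bc bc])
  with step[of "n + k"] Suc show ?case by simp
 qed (use bc in simp)
 have "incseq \<beta>" by (rule incseq_SucI) (use mono[of _ 1] in simp)
 moreover have "\<beta> n <= 1" for n using \<beta>01 by blast
 ultimately have "Cauchy \<beta>" using incseq_convergent[of \<beta> 1] by (meson LIMSEQ_imp_Cauchy)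
 have "norm_Cauchy C b"
  unfolding norm_Cauchy_def
 proof (intro allI impI)
  fix \<eta> :: real assume "\<eta> > 0"
  then obtain N where N: "!!m n. [|m >= N; n >= N|] ==> dist (\<beta> m) (\<beta> n) < \<eta>"
   using \<open>Cauchy \<beta>\<close> unfolding Cauchy_def by blast
  have one: "nrm C (b m \<ominus> b n) < \<eta>" if "n >= N" "m >= n" for m n
   using far[of n "m - n"] N[of m n] that by (auto simp: dist_real_def)
  have "nrm C (b m \<ominus> b n) < \<eta>" if "m >= N" "n >= N" for m n
   using one[of n m] one[of m n] that P.nrm_swap[OF bc bc, of m n] by (cases "m >= n") auto
  then show "\<exists>N. \<forall>m\<ge>N. \<forall>n\<ge>N. nrm C (b m \<ominus> b n) < \<eta>" by blast
 qed
 then obtain z where z: "z : carrier C" "norm_lim C b z" using complete[of b] bc by blast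
 have lim: "(%n. nrm C (b n \<ominus> z)) \<longlonglongrightarrow> 0" using z(2) by (simp add: norm_lim_def)
 have zstar: "star C z = z"
 proof (rule P.nrm_eq_zeroD)
  have "nrm C (star C z \<ominus> z) <= nrm C (b n \<ominus> z) + nrm C (b n \<ominus> z)" for n
   using P.nrm_dist_triangle[of "star C z" "b n" z] z bc[of n] P.nrm_star[of "b n \<ominus> z"]
    P.nrm_swap[of "star C z" "b n"] bstar[of n] by (simp add: P.star_diff)
  then have "nrm C (star C z \<ominus> z) <= 0 + 0" using LIMSEQ_le_const[OF tendsto_add[OF lim lim]] by blast
  then show "nrm C (star C z \<ominus> z) = 0" using P.nrm_le_zeroD[of "star C z \<ominus> z"] z by simp
 qed (use z in auto)
 have zeq: "z = of_real (1/2) \<odot> (c \<oplus> z \<otimes> z)"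
 proof (rule P.nrm_eq_zeroD)
  let ?w = "of_real (1/2) \<odot> (c \<oplus> z \<otimes> z)"
  have w: "?w : carrier C" using z c by auto
  have bw: "nrm C (b (Suc n) \<ominus> ?w) <= nrm C (b n \<ominus> z) * (1 + nrm C z)" for n
  proof -
   have "(c \<oplus> b n \<otimes> b n) \<ominus> (c \<oplus> z \<otimes> z) = b n \<otimes> b n \<ominus> z \<otimes> z"
    using c bc z by (simp add: P.minus_add_distrib)
   then have "b (Suc n) \<ominus> ?w = of_real (1/2) \<odot> (b n \<otimes> b n \<ominus> z \<otimes> z)"
    unfolding bS using c bc z by (simp add: P.smult_minus_right[symmetric])
   then have "nrm C (b (Suc n) \<ominus> ?w) = (1/2) * nrm C (b n \<otimes> b n \<ominus> z \<otimes> z)"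
    using bc z by (simp only: P.nrm_smult a_minus_closed m_closed) simp
   also have "nrm C (b n \<otimes> b n \<ominus> z \<otimes> z) <= nrm C (b n \<ominus> z) * nrm C (b n) + nrm C z * nrm C (b n \<ominus> z)"
    by (rule P.nrm_mult_diff[OF bc bc z(1) z(1)])
   also have "nrm C (b n \<ominus> z) * nrm C (b n) <= nrm C (b n \<ominus> z) * 1"
    using bn[of n] \<beta>01[of n] bc z by (intro mult_left_mono) auto
   finally have "nrm C (b (Suc n) \<ominus> ?w) <= (1/2) * (nrm C (b n \<ominus> z) * (1 + nrm C z))"
    by (simp add: algebra_simps)
   also have "... <= nrm C (b n \<ominus> z) * (1 + nrm C z)" using bc z by simp
   finally show ?thesis .
  qed
  have "nrm C (z \<ominus> ?w) <= nrm C (b (Suc n) \<ominus> z) + nrm C (b n \<ominus> z) * (1 + nrm C z)" for n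
   using P.nrm_dist_triangle[OF z(1) bc[of "Suc n"] w] bw[of n] P.nrm_swap[OF z(1) bc[of "Suc n"]] by linarith
  then have "nrm C (z \<ominus> ?w) <= 0 + 0 * (1 + nrm C z)"
   using LIMSEQ_le_const[OF tendsto_add[OF LIMSEQ_Suc[OF lim] tendsto_mult[OF lim tendsto_const]]] by blast
  then show "nrm C (z \<ominus> ?w) = 0" using P.nrm_le_zeroD[of "z \<ominus> ?w"] z w by simp
 qed (use z c in auto)
 have "z \<oplus> z = c \<oplus> z \<otimes> z"
 proof -
  have "z \<oplus> z = of_real 2 \<odot> z" using P.smult_add_left[OF z(1), of 1 1] z by simp
  also have "... = c \<oplus> z \<otimes> z"
   using arg_cong[OF zeq, of "%t. of_real 2 \<odot> t"] z c
   by (simp add: P.smult_smult[symmetric])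
  finally show ?thesis .
 qed
 then have "(\<one> \<ominus> z) \<otimes> (\<one> \<ominus> z) = \<one> \<ominus> c"
 proof -
  assume e: "z \<oplus> z = c \<oplus> z \<otimes> z"
  have "(\<one> \<ominus> z) \<otimes> (\<one> \<ominus> z) = (\<one> \<ominus> z) \<ominus> (z \<ominus> z \<otimes> z)"
   using z by (simp add: P.minus_mult_left P.minus_mult_right)
  also have "... = (\<one> \<ominus> z) \<oplus> \<ominus> (z \<ominus> z \<otimes> z)" by (rule minus_eq)
  also have "... = (\<one> \<oplus> z \<otimes> z) \<ominus> (z \<oplus> z)"
   using z by (simp add: P.minus_swap P.minus_add_distrib)
  also have "... = (\<one> \<oplus> z \<otimes> z) \<ominus> (c \<oplus> z \<otimes> z)" by (simp only: e)
  also have "... = \<one> \<ominus> c" using z c by (simp add: P.minus_add_distrib)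
  finally show ?thesis .
 qed
 then show ?thesis using z zstar by (intro bexI[of _ "\<one> \<ominus> z"]) (simp_all add: P.star_diff)
qed

section \<open>Completeness of the crossed product; its conditional expectation\<close>

context finite_action
begin

sublocale M: pre_cstar M by (rule pre_cstar_crossed)

lemma crossed_minus_coeff [simp]:
 assumes "x : MM" "y : MM" "g : GG"
 shows "(x \<ominus>\<^sub>M y) g = x g \<ominus>\<^sub>A y g"
proof -
 have "x \<ominus>\<^sub>M y = x \<oplus>\<^sub>M (-1) \<odot>\<^sub>M y" using assms by (simp add: M.minus_eq M.smult_minus_one)
 then show ?thesis using assms by (simp add: A.smult_minus_one A.minus_eq)
qed

text \<open>Norm convergence is coefficientwise convergence: every coefficient is dominated by the
  norm, and the norm by |G| times the sum of the coefficient norms. So completeness passes from A to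
  the crossed product.\<close>

lemma crossed_complete:
 assumes s: "range s <= MM" and cauchy: "norm_Cauchy M s"
 shows "\<exists>x\<in>MM. norm_lim M s x"
proof -
 interpret AC: cstar_algebra A by (rule cstar_A)
 have sc: "s n : MM" for n using s by auto
 have "\<exists>y\<in>AC. norm_lim A (%n. s n g) y" if g: "g : GG" for g
 proof (rule AC.complete)
  show "range (%n. s n g) <= AC" using sc g by auto
  show "norm_Cauchy A (%n. s n g)"
   unfolding norm_Cauchy_def
  proof (intro allI impI)
   fix \<eta> :: real assume "\<eta> > 0"
   then obtain N where N: "!!m n. [|m >= N; n >= N|] ==> nrm M (s m \<ominus>\<^sub>M s n) < \<eta>"
    using cauchy unfolding norm_Cauchy_def by blast
   have "nrm A (s m g \<ominus>\<^sub>A s n g) < \<eta>" if "m >= N" "n >= N" for m n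
    using coeff_le_nrm[OF M.a_minus_closed[OF sc sc] g, of m n] N[OF that] sc g by simp
   then show "\<exists>N. \<forall>m\<ge>N. \<forall>n\<ge>N. nrm A (s m g \<ominus>\<^sub>A s n g) < \<eta>" by blast
  qed
 qed
 then obtain y where y: "!!g. g : GG ==> y g : AC"
  "!!g. g : GG ==> norm_lim A (%n. s n g) (y g)" by metis
 define x where "x = (\<lambda>g\<in>GG. y g)"
 have x: "x : MM" using y by (auto simp: x_def crossed_simps)
 have "(%n. nrm M (s n \<ominus>\<^sub>M x)) \<longlonglongrightarrow> 0"
 proof (rule tendsto_sandwich[OF _ _ tendsto_const])
  show "\<forall>\<^sub>F n in sequentially. 0 <= nrm M (s n \<ominus>\<^sub>M x)" using sc x by (simp add: always_eventually)
  show "\<forall>\<^sub>F n in sequentially. nrm M (s n \<ominus>\<^sub>M x) <= oG * (\<Sum>g\<in>GG. nrm A (s n g \<ominus>\<^sub>A x g))"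
   using nrm_le_sum[OF M.a_minus_closed[OF sc x]] sc x by (simp add: always_eventually)
  have "(%n. oG * (\<Sum>g\<in>GG. nrm A (s n g \<ominus>\<^sub>A x g))) \<longlonglongrightarrow> oG * (\<Sum>g\<in>GG. 0)"
   using y(2) by (intro tendsto_mult tendsto_const tendsto_sum) (auto simp: norm_lim_def x_def)
  then show "(%n. oG * (\<Sum>g\<in>GG. nrm A (s n g \<ominus>\<^sub>A x g))) \<longlonglongrightarrow> 0" by simp
 qed
 then show ?thesis using x by (auto simp: norm_lim_def)
qed

lemma cstar_algebra_crossed: "cstar_algebra M"
 by (rule M.cstar_algebraI[OF crossed_complete])

abbreviation emb :: "'a => 'g => 'a" where "emb a \<equiv> crossed_embed G A a"
abbreviation Q :: "('g => 'a) set" where "Q \<equiv> crossed_embed G A ` AC"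
abbreviation F :: "('g => 'a) => 'g => 'a" where "F \<equiv> crossed_expectation G A"

lemma emb_coeff [simp]: "k : GG ==> emb a k = (if k = \<one> then a else \<zero>\<^sub>A)"
 by (simp add: crossed_embed_def)

lemma emb_closed [simp, intro]: "a : AC ==> emb a : MM"
 by (simp add: crossed_embed_monomial)

lemma emb_mult_coeff:
 "[|a : AC; x : MM; k : GG|] ==> (emb a \<cdot> x) k = a \<star> x k"
 unfolding crossed_embed_monomial by (simp add: monomial_mult_coeff act_one)

lemma mult_emb_coeff:
 "[|a : AC; x : MM; k : GG|] ==> (x \<cdot> emb a) k = x k \<star> \<alpha> k a"
 unfolding crossed_embed_monomial by (simp add: mult_monomial_coeff)

lemma emb_hom: "star_hom A M emb"
proof (rule star_homI)
 show "emb \<one>\<^sub>A = \<one>\<^sub>M" by (simp add: crossed_simps)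
qed (auto intro!: crossed_eqI simp: emb_mult_coeff act_one)

lemmas emb_add = star_hom_add[OF emb_hom]
 and emb_mult = star_hom_mult[OF emb_hom]
 and emb_smult = star_hom_smult[OF emb_hom]
 and emb_star = star_hom_star[OF emb_hom]
 and emb_one = star_hom_one[OF emb_hom]
 and emb_minus = star_hom_minus[OF emb_hom A.pre_cstar_axioms M.pre_cstar_axioms]

text \<open>The bound by the coefficient sum carries the constant |G|, which
  \<open>star_hom_contractive\<close> removes. The converse estimate reads off the coefficient at
  the identity.\<close>

lemma emb_isometric: assumes a: "a : AC" shows "nrm M (emb a) = nrm A a"
proof (rule antisym)
 have "nrm M (emb x) <= oG * nrm A x" if "x : AC" for x
 proof -
  have "(\<Sum>g\<in>GG. nrm A (emb x g)) = (\<Sum>g\<in>GG. if g = \<one> then nrm A x else 0)"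
   by (intro sum.cong) auto
  also have "... = nrm A x" using finite_G by simp
  finally show ?thesis using nrm_le_sum[OF emb_closed[OF that]] by simp
 qed
 from star_hom_contractive[OF emb_hom A.pre_cstar_axioms M.pre_cstar_axioms this a]
 show "nrm M (emb a) <= nrm A a" .
 show "nrm A a <= nrm M (emb a)" using coeff_le_nrm[OF emb_closed[OF a], of \<one>] by simp
qed

lemma F_eq: "F x = emb (x \<one>)" by (simp add: crossed_expectation_def)

lemma F_closed [simp, intro]: "x : MM ==> F x : MM" by (simp add: F_eq)

text \<open>Scale the sum s by its norm \<nu>. Then c = 1 - s/\<nu> has norm at most 1 by
  \<open>squares_positive\<close>, so s/\<nu> = 1 - c has a square root by
  \<open>square_root_exists\<close>. Applied to the inner product of y with itself, this gives
  positivity of F.\<close>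

lemma sum_squares_root:
 assumes x: "x : GG \<rightarrow> AC"
 shows "\<exists>t\<in>AC. star A t \<star> t = (\<Oplus>\<^sub>A i\<in>GG. star A (x i) \<star> x i)"
proof -
 interpret AC: cstar_algebra A by (rule cstar_A)
 let ?s = "\<Oplus>\<^sub>A i\<in>GG. star A (x i) \<star> x i"
 have s: "?s : AC" using x by (intro A.finsum_closed) auto
 have sstar: "star A ?s = ?s"
  using x finite_G by (subst A.star_finsum) (auto intro!: A.finsum_cong' simp: A.star_mult Pi_iff)
 show ?thesis
 proof (cases "nrm A ?s = 0")
  case True
  then have "?s = \<zero>\<^sub>A" using A.nrm_eq_0[OF s] by simp
  then show ?thesis by (intro bexI[of _ "\<zero>\<^sub>A"]) auto
 next
  case False
  define \<nu> where "\<nu> = nrm A ?s"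
  have \<nu>: "\<nu> > 0" using False A.nrm_nonneg[OF s] by (simp add: \<nu>_def)
  define c where "c = \<one>\<^sub>A \<ominus>\<^sub>A of_real (1 / \<nu>) \<odot>\<^sub>A ?s"
  have c: "c : AC" using s by (simp add: c_def)
  have cstar: "star A c = c" using s sstar by (simp add: c_def A.star_diff A.star_smult)
  have "nrm A (of_real \<nu> \<odot>\<^sub>A \<one>\<^sub>A \<ominus>\<^sub>A ?s) <= \<nu>"
   using squares_positive x unfolding squares_positive_on_def \<nu>_def by blast
  moreover have "of_real \<nu> \<odot>\<^sub>A \<one>\<^sub>A \<ominus>\<^sub>A ?s = of_real \<nu> \<odot>\<^sub>A c"
   using s \<nu> by (simp add: c_def A.smult_minus_right A.smult_smult[symmetric])
  ultimately have cn: "nrm A c <= 1" using c \<nu> by (simp add: A.nrm_smult)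
  obtain t where t: "t : AC" "star A t = t" "t \<star> t = \<one>\<^sub>A \<ominus>\<^sub>A c"
   using AC.square_root_exists[OF c cstar cn] by blast
  have "\<one>\<^sub>A \<ominus>\<^sub>A c = of_real (1 / \<nu>) \<odot>\<^sub>A ?s"
  proof -
   let ?r = "of_real (1 / \<nu>) \<odot>\<^sub>A ?s"
   have r: "?r : AC" using s by simp
   have "\<one>\<^sub>A \<ominus>\<^sub>A (\<one>\<^sub>A \<ominus>\<^sub>A ?r) = \<one>\<^sub>A \<oplus>\<^sub>A (?r \<ominus>\<^sub>A \<one>\<^sub>A)"
    using A.minus_swap[OF A.one_closed r] by (simp only: A.minus_eq[of _ "\<one>\<^sub>A \<ominus>\<^sub>A ?r"])
   then show ?thesis unfolding c_def using A.minus_add_cancel[OF r A.one_closed] r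
    by (simp add: A.a_comm)
  qed
  then have tt: "t \<star> t = of_real (1 / \<nu>) \<odot>\<^sub>A ?s" using t(3) by simp
  let ?t = "of_real (sqrt \<nu>) \<odot>\<^sub>A t"
  have "star A ?t \<star> ?t = of_real (sqrt \<nu> * sqrt \<nu>) \<odot>\<^sub>A (t \<star> t)"
   using t(1,2) by (simp add: A.star_smult A.smult_mult_left A.smult_mult_right A.smult_smult del: real_sqrt_mult_self)
  also have "... = ?s" unfolding tt using s \<nu> by (simp add: A.smult_smult[symmetric] flip: of_real_mult)
  finally show ?thesis using t by (intro bexI[of _ ?t]) auto
 qed
qed

lemma conditional_expectation_F: "conditional_expectation M Q F"
 unfolding conditional_expectation_def
proof (intro conjI ballI allI impI)
 show "F : MM \<rightarrow> Q" by (auto simp: F_eq)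
next
 fix q assume "q : Q" then show "F q = q" by (auto simp: F_eq)
next
 fix x y assume "x : MM" "y : MM"
 then show "F (x \<oplus>\<^sub>M y) = F x \<oplus>\<^sub>M F y" by (simp add: F_eq emb_add)
next
 fix c x assume "x : MM"
 then show "F (c \<odot>\<^sub>M x) = c \<odot>\<^sub>M F x" by (simp add: F_eq emb_smult)
next
 fix p q x assume "p : Q" "q : Q" and x: "x : MM"
 then obtain a b where "p = emb a" "q = emb b" "a : AC" "b : AC" by blast
 then show "F (p \<cdot> x \<cdot> q) = p \<cdot> F x \<cdot> q"
  using x by (simp add: F_eq mult_emb_coeff emb_mult_coeff act_one emb_mult)
next
 fix x assume "x : MM" "positive M x"
 then obtain y where y: "y : MM" "x = star M y \<cdot> y" by (auto simp: positive_def)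
 have "untwist y : GG \<rightarrow> AC" using y by (auto simp: untwist_def)
 from sum_squares_root[OF this] obtain t where t: "t : AC"
  "star A t \<star> t = (\<Oplus>\<^sub>A i\<in>GG. star A (untwist y i) \<star> untwist y i)" by blast
 have "F x = star M (emb t) \<cdot> emb t"
  unfolding F_eq y(2) inner_coeff[OF y(1) y(1)] t(2)[symmetric] using t(1) by (simp add: emb_mult emb_star)
 then show "positive M (F x)" using t(1) unfolding positive_def by (intro bexI[of _ "emb t"]) auto
qed

lemma cstar_subalgebra_Q: "cstar_subalgebra Q M"
 unfolding cstar_subalgebra_def
proof (intro conjI ballI allI)
 show "subring Q M"
 proof (rule M.subringI)
  show "Q <= MM" by auto
  show "\<one>\<^sub>M : Q" using emb_one by (metis A.one_closed image_eqI)
  fix p q assume "p : Q" "q : Q"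
  then obtain a b where ab: "p = emb a" "q = emb b" "a : AC" "b : AC" by blast
  have "\<ominus>\<^sub>M p = emb ((-1) \<odot>\<^sub>A a)" using ab by (simp only: emb_smult M.smult_minus_one emb_closed)
  then show "\<ominus>\<^sub>M p : Q" using ab by blast
  show "p \<cdot> q : Q" using ab by (auto simp: emb_mult[symmetric])
  show "p \<oplus>\<^sub>M q : Q" using ab by (auto simp: emb_add[symmetric])
 qed
next
 fix c x assume "x : Q" then show "c \<odot>\<^sub>M x : Q" by (auto simp: emb_smult[symmetric])
next
 fix x assume "x : Q" then show "star M x : Q" by (auto simp: emb_star[symmetric])
next
 show "norm_closed M Q"
  unfolding norm_closed_def
 proof (intro allI impI)
  fix s x assume s: "range s <= Q" and x: "x : MM" and lim: "norm_lim M s x"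
  have "x = emb (x \<one>)"
  proof (rule crossed_eqI)
   fix g assume g: "g : GG"
   show "x g = emb (x \<one>) g"
   proof (cases "g = \<one>")
    case False
    have "nrm A (x g) <= nrm M (s n \<ominus>\<^sub>M x)" for n
    proof -
     obtain a where a: "s n = emb a" "a : AC" using s by blast
     have "nrm A ((x \<ominus>\<^sub>M s n) g) <= nrm M (x \<ominus>\<^sub>M s n)"
      using a x g by (intro coeff_le_nrm) auto
     moreover have "(x \<ominus>\<^sub>M s n) g = x g" using a x g False by simp
     ultimately show ?thesis using M.nrm_swap[of x "s n"] a x by simp
    qed
    then have "nrm A (x g) <= 0" using lim unfolding norm_lim_def by (intro LIMSEQ_le_const) auto
    then show ?thesis using A.nrm_le_zero_imp[of "x g"] x g False by simp
   qed simp
  qed (use x in auto)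
  then show "x : Q" using x by (intro image_eqI[of _ _ "x \<one>"]) auto
 qed
qed

end

section \<open>Index and basic construction of a crossed product\<close>

lemma (in seminormed_module) finsum_const_smult:
 "[|finite I; x : carrier C|] ==> (\<Oplus>i\<in>I. x) = of_nat (card I) \<odot> x"
proof (induction I rule: finite_induct)
 case (insert i I)
 then show ?case by (subst finsum_insert) (auto simp: smult_add_left)
qed simp

lemma nth_pairs_closed:
 assumes "set ps <= A \<times> B" "j < length ps" shows "fst (ps ! j) : A" "snd (ps ! j) : B"
proof -
 have "ps ! j : A \<times> B" using assms nth_mem[OF assms(2)] by blast
 then show "fst (ps ! j) : A" "snd (ps ! j) : B" by (auto simp: mem_Times_iff)
qed

context finite_action
begin

lemma finsum_coeff:
 assumes "finite I" "!!i. i : I ==> y i : MM" "k : GG"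
 shows "(\<Oplus>\<^sub>M i\<in>I. y i) k = (\<Oplus>\<^sub>A i\<in>I. y i k)"
 using assms(1,2)
proof (induction I rule: finite_induct)
 case (insert i I)
 have "(\<Oplus>\<^sub>M i\<in>insert i I. y i) = y i \<oplus>\<^sub>M (\<Oplus>\<^sub>M i\<in>I. y i)"
  using insert by (intro M.finsum_insert) auto
 moreover have "(\<Oplus>\<^sub>A i\<in>insert i I. y i k) = y i k \<oplus>\<^sub>A (\<Oplus>\<^sub>A i\<in>I. y i k)"
  using insert assms(3) by (intro A.finsum_insert) auto
 ultimately show ?case using insert assms(3) by simp
qed (use assms(3) in simp)

definition unit_of :: "'g => 'g => 'a" where "unit_of g = monomial g \<one>\<^sub>A"

lemma unit_of_closed [simp, intro]: "unit_of g : MM"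
 by (auto simp: unit_of_def)

lemma unit_of_coeff: "k : GG ==> unit_of g k = (if k = g then \<one>\<^sub>A else \<zero>\<^sub>A)"
 by (simp add: unit_of_def)

lemma unit_mult_coeff:
 "[|g : GG; x : MM; k : GG|] ==> (unit_of g \<cdot> x) k = \<alpha> g (x (inv g \<otimes> k))"
 by (simp add: unit_of_def monomial_mult_coeff)

lemma mult_unit_coeff:
 "[|g : GG; x : MM; k : GG|] ==> (x \<cdot> unit_of g) k = x (k \<otimes> inv g)"
 by (simp add: unit_of_def mult_monomial_coeff)

lemma unit_of_mult:
 assumes "g : GG" "h : GG" shows "unit_of g \<cdot> unit_of h = unit_of (g \<otimes> h)"
proof (rule crossed_eqI)
 fix k assume k: "k : GG"
 have "inv g \<otimes> k = h \<longleftrightarrow> k = g \<otimes> h" using assms k by (metis inv_solve_left)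
 then show "(unit_of g \<cdot> unit_of h) k = unit_of (g \<otimes> h) k"
  using assms k by (simp add: unit_mult_coeff unit_of_coeff)
qed (use assms in auto)

lemma unit_of_one: "unit_of \<one> = \<one>\<^sub>M"
 by (rule crossed_eqI) (auto simp: unit_of_coeff)

lemma star_unit_of: assumes "g : GG" shows "star M (unit_of g) = unit_of (inv g)"
proof (rule crossed_eqI)
 fix k assume k: "k : GG"
 have "inv k = g \<longleftrightarrow> k = inv g" using assms k by auto
 then show "star M (unit_of g) k = unit_of (inv g) k" using assms k by (simp add: unit_of_coeff)
qed (use assms in auto)

text \<open>The second and third expansions say that the u_g with their inverses form a quasi-basis;
  the first one later bounds Q-linear maps by their values on the u_g.\<close>

lemma expand_units:
 assumes x: "x : MM"
 shows "x = (\<Oplus>\<^sub>M g\<in>GG. unit_of g \<cdot> emb (\<alpha> (inv g) (x g)))"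
  and "x = (\<Oplus>\<^sub>M g\<in>GG. unit_of g \<cdot> F (unit_of (inv g) \<cdot> x))"
  and "x = (\<Oplus>\<^sub>M g\<in>GG. F (x \<cdot> unit_of g) \<cdot> unit_of (inv g))"
proof -
 show 1: "x = (\<Oplus>\<^sub>M g\<in>GG. unit_of g \<cdot> emb (\<alpha> (inv g) (x g)))"
 proof (rule crossed_eqI)
  fix k assume k: "k : GG"
  have "(\<Oplus>\<^sub>M g\<in>GG. unit_of g \<cdot> emb (\<alpha> (inv g) (x g))) k =
    (\<Oplus>\<^sub>A g\<in>GG. (unit_of g \<cdot> emb (\<alpha> (inv g) (x g))) k)"
   using x k finite_G by (intro finsum_coeff) auto
  also have "... = (unit_of k \<cdot> emb (\<alpha> (inv k) (x k))) k"
   using x k finite_G by (intro A.finsum_eq_single) (auto simp: mult_emb_coeff unit_of_coeff)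
  also have "... = x k" using x k by (simp add: mult_emb_coeff unit_of_coeff)
  finally show "x k = (\<Oplus>\<^sub>M g\<in>GG. unit_of g \<cdot> emb (\<alpha> (inv g) (x g))) k" by simp
 qed (use x in "auto intro!: M.finsum_closed")
 have "(\<Oplus>\<^sub>M g\<in>GG. unit_of g \<cdot> F (unit_of (inv g) \<cdot> x)) =
   (\<Oplus>\<^sub>M g\<in>GG. unit_of g \<cdot> emb (\<alpha> (inv g) (x g)))"
  using x by (intro M.finsum_cong') (auto simp: F_eq unit_mult_coeff)
 then show "x = (\<Oplus>\<^sub>M g\<in>GG. unit_of g \<cdot> F (unit_of (inv g) \<cdot> x))" using 1 by simp
 show "x = (\<Oplus>\<^sub>M g\<in>GG. F (x \<cdot> unit_of g) \<cdot> unit_of (inv g))"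
 proof (rule crossed_eqI)
  fix k assume k: "k : GG"
  have "(\<Oplus>\<^sub>M g\<in>GG. F (x \<cdot> unit_of g) \<cdot> unit_of (inv g)) k =
    (\<Oplus>\<^sub>A g\<in>GG. (F (x \<cdot> unit_of g) \<cdot> unit_of (inv g)) k)"
   using x k finite_G by (intro finsum_coeff) auto
  also have "... = (F (x \<cdot> unit_of (inv k)) \<cdot> unit_of (inv (inv k))) k"
  proof (intro A.finsum_eq_single)
   fix j assume j: "j : GG" "j ~= inv k"
   then have "k ~= inv j" by auto
   then show "(F (x \<cdot> unit_of j) \<cdot> unit_of (inv j)) k = \<zero>\<^sub>A"
    using x j k by (simp add: F_eq emb_mult_coeff unit_of_coeff)
  qed (use x k finite_G in auto)
  also have "... = x k" using x k by (simp add: F_eq emb_mult_coeff unit_of_coeff mult_unit_coeff)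
  finally show "x k = (\<Oplus>\<^sub>M g\<in>GG. F (x \<cdot> unit_of g) \<cdot> unit_of (inv g)) k" by simp
 qed (use x in "auto intro!: M.finsum_closed")
qed

lemma finsum_list:
 assumes "distinct gs" "set gs = GG" "f : GG \<rightarrow> MM"
 shows "(\<Oplus>\<^sub>M j\<in>{..<length gs}. f (gs ! j)) = (\<Oplus>\<^sub>M g\<in>GG. f g)"
proof -
 have inj: "inj_on (%j. gs ! j) {..<length gs}" using assms(1) by (auto intro!: inj_onI simp: nth_eq_iff_index_eq)
 have im: "(%j. gs ! j) ` {..<length gs} = GG"
  using assms(2) by (auto simp: set_conv_nth)
 show ?thesis using M.finsum_reindex[OF _ inj, of f] assms(3) by (simp add: im)
qed

lemma quasi_basis_units:
 assumes gs: "distinct gs" "set gs = GG"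
 shows "quasi_basis M F (map (%g. (unit_of g, unit_of (inv g))) gs)"
 unfolding quasi_basis_def
proof (intro conjI ballI)
 let ?us = "map (%g. (unit_of g, unit_of (inv g))) gs"
 show "set ?us <= MM \<times> MM" by auto
 fix x assume x: "x : MM"
 have gsc: "gs ! j : GG" if "j < length gs" for j using gs(2) that nth_mem by blast
 have "(\<Oplus>\<^sub>M j\<in>{..<length ?us}. fst (?us ! j) \<cdot> F (snd (?us ! j) \<cdot> x)) =
   (\<Oplus>\<^sub>M j\<in>{..<length gs}. (%g. unit_of g \<cdot> F (unit_of (inv g) \<cdot> x)) (gs ! j))"
  using x by (intro M.finsum_cong') auto
 also have "... = x" using x by (subst finsum_list[OF gs]) (auto simp: expand_units(2)[OF x, symmetric])
 finally show "x = (\<Oplus>\<^sub>M j\<in>{..<length ?us}. fst (?us ! j) \<cdot> F (snd (?us ! j) \<cdot> x))" by simp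
 have "(\<Oplus>\<^sub>M j\<in>{..<length ?us}. F (x \<cdot> fst (?us ! j)) \<cdot> snd (?us ! j)) =
   (\<Oplus>\<^sub>M j\<in>{..<length gs}. (%g. F (x \<cdot> unit_of g) \<cdot> unit_of (inv g)) (gs ! j))"
  using x by (intro M.finsum_cong') auto
 also have "... = x" using x by (subst finsum_list[OF gs]) (auto simp: expand_units(3)[OF x, symmetric])
 finally show "x = (\<Oplus>\<^sub>M j\<in>{..<length ?us}. F (x \<cdot> fst (?us ! j)) \<cdot> snd (?us ! j))" by simp
qed

text \<open>For bases (a, b) and (c, d) expand a_i through the second and d_j through the first:
  both sums equal the double sum of the c_j F(d_j a_i) b_i. This makes the \<open>THE\<close> in
  \<open>index_of\<close> definite.\<close>

lemma quasi_basis_index_unique: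
 assumes us: "quasi_basis M F us" and vs: "quasi_basis M F vs"
 shows "(\<Oplus>\<^sub>M j\<in>{..<length us}. fst (us ! j) \<cdot> snd (us ! j)) =
  (\<Oplus>\<^sub>M j\<in>{..<length vs}. fst (vs ! j) \<cdot> snd (vs ! j))"
proof -
 let ?I = "{..<length us}" and ?J = "{..<length vs}"
 define a where "a j = fst (us ! j)" for j
 define b where "b j = snd (us ! j)" for j
 define c where "c j = fst (vs ! j)" for j
 define d where "d j = snd (vs ! j)" for j
 have car: "a i : MM" "b i : MM" if "i : ?I" for i
  using us that nth_pairs_closed[of us "MM" "MM" i] by (auto simp: quasi_basis_def a_def b_def)
 have car': "c i : MM" "d i : MM" if "i : ?J" for i
  using vs that nth_pairs_closed[of vs "MM" "MM" i] by (auto simp: quasi_basis_def c_def d_def)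
 have ex: "x = (\<Oplus>\<^sub>M j\<in>?J. c j \<cdot> F (d j \<cdot> x))" if "x : MM" for x
  using vs that unfolding quasi_basis_def c_def d_def by blast
 have ex': "x = (\<Oplus>\<^sub>M i\<in>?I. F (x \<cdot> a i) \<cdot> b i)" if "x : MM" for x
  using us that unfolding quasi_basis_def a_def b_def by blast
 let ?t = "%i j. c j \<cdot> F (d j \<cdot> a i) \<cdot> b i"
 have "(\<Oplus>\<^sub>M i\<in>?I. a i \<cdot> b i) = (\<Oplus>\<^sub>M i\<in>?I. \<Oplus>\<^sub>M j\<in>?J. ?t i j)"
 proof (intro M.finsum_cong' refl)
  fix i assume i: "i : ?I"
  have "a i \<cdot> b i = (\<Oplus>\<^sub>M j\<in>?J. c j \<cdot> F (d j \<cdot> a i)) \<cdot> b i"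
   using ex[OF car(1)[OF i]] by simp
  also have "... = (\<Oplus>\<^sub>M j\<in>?J. ?t i j)"
   using car[OF i] car' by (intro M.finsum_ldistr) auto
  finally show "a i \<cdot> b i = (\<Oplus>\<^sub>M j\<in>?J. ?t i j)" .
 qed (use car car' in "auto intro!: M.finsum_closed")
 also have "... = (\<Oplus>\<^sub>M j\<in>?J. \<Oplus>\<^sub>M i\<in>?I. ?t i j)"
  using car car' by (intro M.finsum_Sigma_swap) auto
 also have "... = (\<Oplus>\<^sub>M j\<in>?J. c j \<cdot> d j)"
 proof (intro M.finsum_cong' refl)
  fix j assume j: "j : ?J"
  have "(\<Oplus>\<^sub>M i\<in>?I. ?t i j) = (\<Oplus>\<^sub>M i\<in>?I. c j \<cdot> (F (d j \<cdot> a i) \<cdot> b i))"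
   using car car'[OF j] by (intro M.finsum_cong') (auto simp: M.m_assoc)
  also have "... = c j \<cdot> (\<Oplus>\<^sub>M i\<in>?I. F (d j \<cdot> a i) \<cdot> b i)"
   using car car'[OF j] by (intro M.finsum_rdistr[symmetric]) auto
  also have "... = c j \<cdot> d j" using ex'[OF car'(2)[OF j]] by simp
  finally show "(\<Oplus>\<^sub>M i\<in>?I. ?t i j) = c j \<cdot> d j" .
 qed (use car' in auto)
 finally show ?thesis by (simp add: a_def b_def c_def d_def)
qed

lemma index_finite_F: "index_finite M F"
 and index_of_F: "index_of M F = of_real oG \<odot>\<^sub>M \<one>\<^sub>M"
proof -
 obtain gs where gs: "distinct gs" "set gs = GG" using finite_distinct_list[OF finite_G] by blast
 note qb = quasi_basis_units[OF gs]
 then show "index_finite M F" unfolding index_finite_def by blast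
 let ?us = "map (%g. (unit_of g, unit_of (inv g))) gs"
 have gsc: "gs ! j : GG" if "j < length gs" for j using gs(2) that nth_mem by blast
 have "(\<Oplus>\<^sub>M j\<in>{..<length ?us}. fst (?us ! j) \<cdot> snd (?us ! j)) = (\<Oplus>\<^sub>M j\<in>{..<length gs}. \<one>\<^sub>M)"
  using gsc by (intro M.finsum_cong') (auto simp: unit_of_mult unit_of_one)
 also have "... = of_real oG \<odot>\<^sub>M \<one>\<^sub>M"
  using gs distinct_card[OF gs(1)] by (subst M.finsum_const_smult) (auto simp: oG_def)
 finally have eq: "(\<Oplus>\<^sub>M j\<in>{..<length ?us}. fst (?us ! j) \<cdot> snd (?us ! j)) = of_real oG \<odot>\<^sub>M \<one>\<^sub>M" .
 show "index_of M F = of_real oG \<odot>\<^sub>M \<one>\<^sub>M"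
  unfolding index_of_def
 proof (rule the_equality)
  show "\<exists>us. quasi_basis M F us & of_real oG \<odot>\<^sub>M \<one>\<^sub>M =
    (\<Oplus>\<^sub>M j\<in>{..<length us}. fst (us ! j) \<cdot> snd (us ! j))"
   using qb eq by (intro exI[of _ ?us]) simp
 next
  fix c assume "\<exists>us. quasi_basis M F us & c = (\<Oplus>\<^sub>M j\<in>{..<length us}. fst (us ! j) \<cdot> snd (us ! j))"
  then show "c = of_real oG \<odot>\<^sub>M \<one>\<^sub>M"
   using quasi_basis_index_unique[OF _ qb] eq by auto
 qed
qed

section \<open>The Hilbert module of the expectation and the basic construction\<close>

abbreviation "H0 \<equiv> pre_hilbert_module M F"
abbreviation "HS \<equiv> hilbert_seqs M F"

lemma H0_simps [simp]:
 "carrier H0 = MM" "add H0 = add M" "zero H0 = zero M" "smult H0 = smult M"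
 by (simp_all add: pre_hilbert_module_def)

lemma H0_norm: "x : MM ==> nrm H0 x = hnorm x"
 by (simp add: pre_hilbert_module_def F_eq emb_isometric hnorm_def)

lemma H0_module: "seminormed_module H0"
proof (intro seminormed_module.intro seminormed_module_axioms.intro)
 show "abelian_group H0"
 proof (rule abelian_groupI)
  fix x assume "x : carrier H0"
  then show "\<exists>y\<in>carrier H0. y \<oplus>\<^sub>H0 x = \<zero>\<^sub>H0"
   by (intro bexI[of _ "\<ominus>\<^sub>M x"]) (auto simp: M.l_neg)
 qed (auto simp: M.a_ac)
qed (auto simp: H0_norm M.smult_add_left M.smult_add_right M.smult_smult hnorm_smult hnorm_add)

interpretation H0: seminormed_module H0 by (rule H0_module)

lemma H0_minus: "[|x : MM; y : MM|] ==> x \<ominus>\<^sub>H0 y = x \<ominus>\<^sub>M y"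
 using H0.smult_minus_one[of y] M.smult_minus_one[of y] by (simp add: H0.minus_eq M.minus_eq)

lemma H0_finsum: "(\<Oplus>\<^sub>H0 i\<in>I. f i) = (\<Oplus>\<^sub>M i\<in>I. f i)"
 by (simp add: finsum_def pre_hilbert_module_def)

lemma HS_iff:
 "a : HS \<longleftrightarrow> (\<forall>n. a n : MM) & (\<forall>\<eta>>0. \<exists>N. \<forall>m\<ge>N. \<forall>n\<ge>N. hnorm (a m \<ominus>\<^sub>M a n) < \<eta>)"
proof -
 have "nrm H0 (a m \<ominus>\<^sub>H0 a n) = hnorm (a m \<ominus>\<^sub>M a n)" if "\<forall>n. a n : MM" for m n
  using that by (simp add: H0_minus H0_norm)
 then show ?thesis by (auto simp: hilbert_seqs_def norm_Cauchy_def image_subset_iff)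
qed

lemma HS_lipschitz:
 assumes a: "a : HS" and T: "!!x. x : MM ==> T x : MM"
  and lip: "!!x y. [|x : MM; y : MM|] ==> hnorm (T x \<ominus>\<^sub>M T y) <= K * hnorm (x \<ominus>\<^sub>M y)"
 shows "(%n. T (a n)) : HS"
 unfolding HS_iff
proof (intro conjI allI impI)
 fix \<eta> :: real assume e: "\<eta> > 0"
 have ac: "a n : MM" for n using a by (simp add: HS_iff)
 have "\<eta> / (\<bar>K\<bar> + 1) > 0" using e by (simp add: add_nonneg_pos)
 then obtain N where N: "!!m n. [|m >= N; n >= N|] ==> hnorm (a m \<ominus>\<^sub>M a n) < \<eta> / (\<bar>K\<bar> + 1)"
  using a unfolding HS_iff by blast
 have "hnorm (T (a m) \<ominus>\<^sub>M T (a n)) < \<eta>" if "m >= N" "n >= N" for m n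
 proof -
  have "hnorm (T (a m) \<ominus>\<^sub>M T (a n)) <= K * hnorm (a m \<ominus>\<^sub>M a n)" by (rule lip[OF ac ac])
  also have "... <= (\<bar>K\<bar> + 1) * hnorm (a m \<ominus>\<^sub>M a n)" using ac by (intro mult_right_mono) auto
  also have "... < (\<bar>K\<bar> + 1) * (\<eta> / (\<bar>K\<bar> + 1))"
   using N[OF that] by (intro mult_strict_left_mono) (auto simp: add_nonneg_pos)
  also have "... = \<eta>" by (simp add: add_nonneg_pos less_imp_neq[symmetric])
  finally show ?thesis .
 qed
 then show "\<exists>N. \<forall>m\<ge>N. \<forall>n\<ge>N. hnorm (T (a m) \<ominus>\<^sub>M T (a n)) < \<eta>" by blast
qed (use a T in "auto simp: HS_iff")

lemma H_seq_module: "seq_module (%_. H0) HS sequentially"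
proof (intro seq_module.intro H0_module)
 show "sequentially ~= bot" by simp
 show "a n : carrier H0" if "a : HS" for a n using that by (simp add: HS_iff)
 show "(%n. \<zero>\<^sub>H0) : HS" by (auto simp: HS_iff)
next
 fix a b assume a: "a : HS" and b: "b : HS"
 have ac: "a n : MM" "b n : MM" for n using a b by (auto simp: HS_iff)
 show "(%n. a n \<oplus>\<^sub>H0 b n) : HS"
  unfolding HS_iff
 proof (intro conjI allI impI)
  fix \<eta> :: real assume "\<eta> > 0"
  then have e2: "\<eta> / 2 > 0" by simp
  obtain N1 where N1: "!!m n. [|m >= N1; n >= N1|] ==> hnorm (a m \<ominus>\<^sub>M a n) < \<eta> / 2"
   using a e2 unfolding HS_iff by blast
  obtain N2 where N2: "!!m n. [|m >= N2; n >= N2|] ==> hnorm (b m \<ominus>\<^sub>M b n) < \<eta> / 2"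
   using b e2 unfolding HS_iff by blast
  have "hnorm ((a m \<oplus>\<^sub>M b m) \<ominus>\<^sub>M (a n \<oplus>\<^sub>M b n)) < \<eta>" if "m >= max N1 N2" "n >= max N1 N2" for m n
   using hnorm_add[of "a m \<ominus>\<^sub>M a n" "b m \<ominus>\<^sub>M b n"] N1[of m n] N2[of m n] that ac
   by (simp add: M.minus_add_distrib)
  then show "\<exists>N. \<forall>m\<ge>N. \<forall>n\<ge>N. hnorm ((a m \<oplus>\<^sub>H0 b m) \<ominus>\<^sub>M (a n \<oplus>\<^sub>H0 b n)) < \<eta>"
   by (intro exI[of _ "max N1 N2"]) simp
 qed (use ac in simp)
next
 fix a c assume a: "a : HS"
 show "(%n. c \<odot>\<^sub>H0 a n) : HS"
  using HS_lipschitz[OF a, of "%x. c \<odot>\<^sub>M x" "cmod c"]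
  by (simp add: M.smult_minus_right[symmetric] hnorm_smult)
 have ac: "a n : MM" for n using a by (auto simp: HS_iff)
 have "Cauchy (%n. nrm H0 (a n))"
 proof (rule metric_CauchyI)
  fix \<eta> :: real assume "\<eta> > 0"
  then obtain N where N: "!!m n. [|m >= N; n >= N|] ==> hnorm (a m \<ominus>\<^sub>M a n) < \<eta>"
   using a unfolding HS_iff by blast
  have "dist (nrm H0 (a m)) (nrm H0 (a n)) < \<eta>" if "m >= N" "n >= N" for m n
   using H0.nrm_diff_abs[of "a m" "a n"] N[OF that] ac by (simp add: H0_minus H0_norm dist_real_def)
  then show "\<exists>N. \<forall>m\<ge>N. \<forall>n\<ge>N. dist (nrm H0 (a m)) (nrm H0 (a n)) < \<eta>" by blast
 qed
 then show "\<exists>L. (%n. nrm H0 (a n)) \<longlonglongrightarrow> L" using Cauchy_convergent_iff convergent_def by blast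
qed

sublocale H: seq_module "%_. H0" HS sequentially by (rule H_seq_module)

lemma hilbert_module_eq: "hilbert_module M F = H.quot"
 by (simp add: hilbert_module_def)

lemma HS_closed: "a : HS ==> a n : MM" by (simp add: HS_iff)

text \<open>Since \<open>F\<close> has a quasi-basis, the basic construction consists of all \<open>Q\<close>-linear maps.\<close>

definition mod_maps :: "(('g => 'a) => 'g => 'a) set" where
 "mod_maps = {T. (\<forall>x\<in>MM. T x : MM) \<and>
   (\<forall>x\<in>MM. \<forall>y\<in>MM. T (x \<oplus>\<^sub>M y) = T x \<oplus>\<^sub>M T y) \<and>
   (\<forall>x\<in>MM. \<forall>a\<in>AC. T (x \<cdot> emb a) = T x \<cdot> emb a)}"

lemma mod_mapsD:
 assumes "T : mod_maps" "x : MM"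
 shows "T x : MM" "y : MM ==> T (x \<oplus>\<^sub>M y) = T x \<oplus>\<^sub>M T y"
  "a : AC ==> T (x \<cdot> emb a) = T x \<cdot> emb a"
 using assms by (auto simp: mod_maps_def)

text \<open>Complex scalars act on the right through A, so Q-linear maps are complex linear.\<close>

lemma smult_as_emb: assumes "x : MM" shows "c \<odot>\<^sub>M x = x \<cdot> emb (c \<odot>\<^sub>A \<one>\<^sub>A)"
 using assms by (simp add: emb_smult emb_one M.smult_mult_right)

lemma mod_maps_smult:
 assumes "T : mod_maps" "x : MM" shows "T (c \<odot>\<^sub>M x) = c \<odot>\<^sub>M T x"
 using assms mod_mapsD(1,3)[OF assms] by (simp add: smult_as_emb)

lemma mod_maps_minus:
 assumes "T : mod_maps" "x : MM" "y : MM" shows "T (x \<ominus>\<^sub>M y) = T x \<ominus>\<^sub>M T y"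
 using mod_mapsD(2)[OF assms(1,2), of "(-1) \<odot>\<^sub>M y"] mod_maps_smult[OF assms(1,3), of "-1"] assms
  mod_mapsD(1)[OF assms(1,3)]
 by (simp add: M.minus_eq M.smult_minus_one)

lemma mod_maps_zero: "T : mod_maps ==> T \<zero>\<^sub>M = \<zero>\<^sub>M"
 using mod_maps_smult[of T "\<zero>\<^sub>M" 0] mod_mapsD(1)[of T "\<zero>\<^sub>M"] by simp

lemma mod_maps_finsum:
 assumes T: "T : mod_maps"
 shows "[|finite I; !!i. i : I ==> x i : MM|] ==> T (\<Oplus>\<^sub>M i\<in>I. x i) = (\<Oplus>\<^sub>M i\<in>I. T (x i))"
proof (induction I rule: finite_induct)
 case (insert i I)
 have "T (\<Oplus>\<^sub>M i\<in>insert i I. x i) = T (x i \<oplus>\<^sub>M (\<Oplus>\<^sub>M i\<in>I. x i))"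
  using insert by (subst M.finsum_insert) auto
 also have "... = T (x i) \<oplus>\<^sub>M (\<Oplus>\<^sub>M i\<in>I. T (x i))"
  using insert by (subst mod_mapsD(2)[OF T]) (auto intro!: M.finsum_closed)
 also have "... = (\<Oplus>\<^sub>M i\<in>insert i I. T (x i))"
  using insert mod_mapsD(1)[OF T] by (intro M.finsum_insert[symmetric]) auto
 finally show ?case .
qed (simp add: mod_maps_zero[OF T])

text \<open>The inner product of y a with itself is a* <y, y> a, so right multiplication by a scales
  lengths by at most |a|.\<close>

lemma hnorm_mult_emb:
 assumes y: "y : MM" and a: "a : AC"
 shows "hnorm (y \<cdot> emb a) <= hnorm y * nrm A a"
proof -
 note c = emb_closed[OF a] M.star_closed[OF y] M.star_closed[OF emb_closed[OF a]]
 have "star M (y \<cdot> emb a) \<cdot> (y \<cdot> emb a) = emb (star A a) \<cdot> ((star M y \<cdot> y) \<cdot> emb a)"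
  using y a c by (simp add: M.star_mult M.m_assoc emb_star)
 then have "(star M (y \<cdot> emb a) \<cdot> (y \<cdot> emb a)) \<one> = star A a \<star> ((star M y \<cdot> y) \<one> \<star> a)"
  using y a c by (simp add: emb_mult_coeff mult_emb_coeff act_one)
 then have "(hnorm (y \<cdot> emb a))\<^sup>2 = nrm A (star A a \<star> ((star M y \<cdot> y) \<one> \<star> a))"
  using y a by (simp add: hnorm_square)
 also have "... <= nrm A a * nrm A ((star M y \<cdot> y) \<one> \<star> a)"
  using A.nrm_mult[of "star A a" "(star M y \<cdot> y) \<one> \<star> a"] a y by simp
 also have "... <= nrm A a * ((hnorm y)\<^sup>2 * nrm A a)"
  using A.nrm_mult[of "(star M y \<cdot> y) \<one>" a] a y by (intro mult_left_mono) (auto simp: hnorm_square)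
 also have "... = (hnorm y * nrm A a)\<^sup>2" by (simp add: power2_eq_square)
 finally show ?thesis using y a by (auto intro: power2_le_imp_le)
qed

lemma hnorm_finsum:
 "[|finite I; !!i. i : I ==> x i : MM|] ==> hnorm (\<Oplus>\<^sub>M i\<in>I. x i) <= (\<Sum>i\<in>I. hnorm (x i))"
proof (induction I rule: finite_induct)
 case (insert i I)
 have "hnorm (\<Oplus>\<^sub>M i\<in>insert i I. x i) <= hnorm (x i) + hnorm (\<Oplus>\<^sub>M i\<in>I. x i)"
  using insert by (subst M.finsum_insert) (auto intro!: hnorm_add M.finsum_closed)
 then show ?case using insert by fastforce
qed simp

text \<open>A Q-linear map is determined by its values on the finitely many u_g, and the
  coefficients of x are dominated by its length. Boundedness is what lets T act on Cauchy
  sequences.\<close>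

lemma mod_maps_bounded:
 assumes T: "T : mod_maps" shows "\<exists>K\<ge>0. \<forall>x\<in>MM. hnorm (T x) <= K * hnorm x"
proof (intro exI conjI ballI)
 let ?K = "\<Sum>g\<in>GG. hnorm (T (unit_of g))"
 show "0 <= ?K" using mod_mapsD(1)[OF T] by (intro sum_nonneg) auto
 fix x assume x: "x : MM"
 have "T x = T (\<Oplus>\<^sub>M g\<in>GG. unit_of g \<cdot> emb (\<alpha> (inv g) (x g)))"
  using expand_units(1)[OF x] by simp
 also have "... = (\<Oplus>\<^sub>M g\<in>GG. T (unit_of g \<cdot> emb (\<alpha> (inv g) (x g))))"
  using x finite_G by (intro mod_maps_finsum[OF T]) auto
 also have "... = (\<Oplus>\<^sub>M g\<in>GG. T (unit_of g) \<cdot> emb (\<alpha> (inv g) (x g)))"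
  using x mod_mapsD(1)[OF T] by (intro M.finsum_cong') (auto simp: mod_mapsD(3)[OF T])
 finally have "hnorm (T x) <= (\<Sum>g\<in>GG. hnorm (T (unit_of g) \<cdot> emb (\<alpha> (inv g) (x g))))"
  using x mod_mapsD(1)[OF T] finite_G by (simp add: hnorm_finsum)
 also have "... <= (\<Sum>g\<in>GG. hnorm (T (unit_of g)) * hnorm x)"
 proof (rule sum_mono)
  fix g assume g: "g : GG"
  have Tg: "T (unit_of g) : MM" using mod_mapsD(1)[OF T] by auto
  have "hnorm (T (unit_of g) \<cdot> emb (\<alpha> (inv g) (x g))) <= hnorm (T (unit_of g)) * nrm A (x g)"
   using hnorm_mult_emb[OF Tg, of "\<alpha> (inv g) (x g)"] x g by (simp add: act_isometric)
  also have "... <= hnorm (T (unit_of g)) * hnorm x"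
   using Tg by (intro mult_left_mono coeff_le_hnorm x g) auto
  finally show "hnorm (T (unit_of g) \<cdot> emb (\<alpha> (inv g) (x g))) <= hnorm (T (unit_of g)) * hnorm x" .
 qed
 finally show "hnorm (T x) <= ?K * hnorm x" by (simp add: sum_distrib_right)
qed

lemma mod_maps_HS: assumes T: "T : mod_maps" and a: "a : HS" shows "(%n. T (a n)) : HS"
proof -
 obtain K where K: "!!x. x : MM ==> hnorm (T x) <= K * hnorm x" using mod_maps_bounded[OF T] by blast
 show ?thesis
  using mod_mapsD(1)[OF T] K by (intro HS_lipschitz[OF a, of T K]) (auto simp: mod_maps_minus[OF T, symmetric])
qed

abbreviation hext :: "(('g => 'a) => 'g => 'a) => (nat => 'g => 'a) set => (nat => 'g => 'a) set" where
 "hext \<equiv> hilbert_extend M F"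

lemma hext_cls:
 assumes T: "T : mod_maps" and a: "a : HS" shows "hext T (H.cls a) = H.cls (%n. T (a n))"
proof -
 obtain K where K: "!!x. x : MM ==> hnorm (T x) <= K * hnorm x" using mod_maps_bounded[OF T] by blast
 have "seq_map (null_rel (%_. H0) HS sequentially) (%_. T) (H.cls a) = H.cls (%n. T (a n))"
 proof (rule seq_map_class[OF H_seq_module H_seq_module mod_maps_HS[OF T] _ a])
  fix n :: nat and x y assume "x : carrier H0" "y : carrier H0"
  then show "nrm H0 (T x \<ominus>\<^sub>H0 T y) <= K * nrm H0 (x \<ominus>\<^sub>H0 y)"
   using K[of "x \<ominus>\<^sub>M y"] mod_mapsD(1)[OF T] by (simp add: H0_minus H0_norm mod_maps_minus[OF T])
 qed
 then show ?thesis using a by (simp add: hilbert_extend_def hilbert_rel_def hilbert_module_eq H.cls_closed)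
qed

lemma hext_extensional: "X \<notin> carrier H.quot ==> hext T X = undefined"
 by (simp add: hilbert_extend_def hilbert_module_eq)

text \<open>Elements of the basic construction are extensional functions, so their values outside
  the Hilbert module have to agree as well.\<close>

lemma hext_eqI:
 assumes "S : mod_maps" "!!a. a : HS ==> \<Phi> (H.cls a) = H.cls (%n. S (a n))"
  "!!X. X \<notin> carrier H.quot ==> \<Phi> X = undefined"
 shows "\<Phi> = hext S"
proof
 fix X show "\<Phi> X = hext S X"
 proof (cases "X : carrier H.quot")
  case True
  then obtain a where "a : HS" "X = H.cls a" by (rule H.quotE)
  then show ?thesis using assms by (simp add: hext_cls)
 qed (simp add: assms hext_extensional)
qed

lemma hext_cong:
 assumes "S : mod_maps" "T : mod_maps" "!!x. x : MM ==> S x = T x" shows "hext S = hext T"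
 using assms by (intro hext_eqI) (auto simp: hext_cls HS_closed hext_extensional)

lemma hext_congL:
 assumes "S : mod_maps" "!!x. x : MM ==> S x = T x" shows "hext S = hext T"
proof (rule hext_cong[OF assms(1) _ assms(2)])
 show "T : mod_maps" using assms by (simp add: mod_maps_def)
qed

lemmas hext_congR = hext_congL[symmetric, OF _ sym]

lemma hext_closed: "[|T : mod_maps; X : carrier H.quot|] ==> hext T X : carrier H.quot"
 by (auto elim!: H.quotE simp: hext_cls mod_maps_HS intro!: H.cls_closed)

lemma mod_maps_mult: "x : MM ==> (%z. x \<cdot> z) : mod_maps"
 by (auto simp: mod_maps_def M.r_distr M.m_assoc)

lemma mod_maps_F: "F : mod_maps"
 by (auto simp: mod_maps_def F_eq emb_add mult_emb_coeff act_one emb_mult)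

lemma mod_maps_comp: "[|S : mod_maps; T : mod_maps|] ==> (%x. S (T x)) : mod_maps"
 by (simp add: mod_maps_def)

lemma mod_maps_add: "[|S : mod_maps; T : mod_maps|] ==> (%x. S x \<oplus>\<^sub>M T x) : mod_maps"
 by (simp add: mod_maps_def M.l_distr M.a_ac)

lemma mod_maps_scale: "S : mod_maps ==> (%x. c \<odot>\<^sub>M S x) : mod_maps"
 by (simp add: mod_maps_def M.smult_add_right M.smult_mult_left)

lemma mod_maps_const_zero: "(%x. \<zero>\<^sub>M) : mod_maps"
 by (simp add: mod_maps_def)

lemma mod_maps_id: "(%x. x) : mod_maps"
 by (simp add: mod_maps_def)

lemma mod_maps_sum:
 assumes "finite I" "!!i. i : I ==> S i : mod_maps" shows "(%x. \<Oplus>\<^sub>M i\<in>I. S i x) : mod_maps"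
proof -
 have c: "S i x : MM" if "i : I" "x : MM" for i x
  using mod_mapsD(1)[OF assms(2)] that by blast
 show ?thesis
  unfolding mod_maps_def
 proof (intro CollectI conjI ballI)
  fix x y assume x: "x : MM" and y: "y : MM"
  have "(\<Oplus>\<^sub>M i\<in>I. S i (x \<oplus>\<^sub>M y)) = (\<Oplus>\<^sub>M i\<in>I. S i x \<oplus>\<^sub>M S i y)"
   using c x y by (intro M.finsum_cong') (auto simp: mod_mapsD(2)[OF assms(2)])
  also have "... = (\<Oplus>\<^sub>M i\<in>I. S i x) \<oplus>\<^sub>M (\<Oplus>\<^sub>M i\<in>I. S i y)"
   using c x y by (intro M.finsum_addf) auto
  finally show "(\<Oplus>\<^sub>M i\<in>I. S i (x \<oplus>\<^sub>M y)) = (\<Oplus>\<^sub>M i\<in>I. S i x) \<oplus>\<^sub>M (\<Oplus>\<^sub>M i\<in>I. S i y)" .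
 next
  fix x a assume x: "x : MM" and a: "a : AC"
  have "(\<Oplus>\<^sub>M i\<in>I. S i (x \<cdot> emb a)) = (\<Oplus>\<^sub>M i\<in>I. S i x \<cdot> emb a)"
   using c x a by (intro M.finsum_cong') (auto simp: mod_mapsD(3)[OF assms(2)])
  also have "... = (\<Oplus>\<^sub>M i\<in>I. S i x) \<cdot> emb a"
   using c x a assms(1) by (intro M.finsum_ldistr[symmetric]) auto
  finally show "(\<Oplus>\<^sub>M i\<in>I. S i (x \<cdot> emb a)) = (\<Oplus>\<^sub>M i\<in>I. S i x) \<cdot> emb a" .
 qed (use c in "auto intro!: M.finsum_closed")
qed

lemma left_mult_hext: "left_mult M F x = hext (%z. x \<cdot> z)"
 by (simp add: left_mult_def)

lemma jones_hext: "jones_projection M F = hext F"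
 by (simp add: jones_projection_def)

abbreviation "BC \<equiv> basic_construction M F"

definition pair_sum :: "(('g => 'a) \<times> ('g => 'a)) list => ('g => 'a) => 'g => 'a" where
 "pair_sum ps z = (\<Oplus>\<^sub>M j\<in>{..<length ps}. fst (ps ! j) \<cdot> F (snd (ps ! j) \<cdot> z))"

lemma pair_sum_mod_maps:
 assumes "set ps <= MM \<times> MM" shows "pair_sum ps : mod_maps"
proof -
 have c: "fst (ps ! j) : MM" "snd (ps ! j) : MM" if "j < length ps" for j
  using nth_pairs_closed[OF assms that] .
 show ?thesis unfolding pair_sum_def[abs_def]
  using mod_maps_comp[OF mod_maps_mult[OF c(1)] mod_maps_comp[OF mod_maps_F mod_maps_mult[OF c(2)]]]
  by (intro mod_maps_sum) auto
qed

text \<open>From here on the basic construction is handled through Q-linear maps of M instead of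
  operators on the completion.\<close>

lemma BC_element:
 assumes ps: "set ps <= MM \<times> MM"
 shows "(\<lambda>X\<in>carrier (hilbert_module M F). \<Oplus>\<^sub>(hilbert_module M F) j\<in>{..<length ps}.
  left_mult M F (fst (ps ! j)) (jones_projection M F (left_mult M F (snd (ps ! j)) X))) = hext (pair_sum ps)"
proof (rule hext_eqI[OF pair_sum_mod_maps[OF ps]])
 have c: "fst (ps ! j) : MM" "snd (ps ! j) : MM" if "j < length ps" for j
  using nth_pairs_closed[OF ps that] .
 fix a assume a: "a : HS"
 let ?x = "%j n. fst (ps ! j) \<cdot> F (snd (ps ! j) \<cdot> a n)"
 have step: "left_mult M F (fst (ps ! j)) (jones_projection M F (left_mult M F (snd (ps ! j)) (H.cls a))) = H.cls (?x j)
   & ?x j : HS" if j: "j : {..<length ps}" for j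
 proof -
  note m = mod_maps_mult[OF c(1)] mod_maps_mult[OF c(2)]
  have 1: "(%n. snd (ps ! j) \<cdot> a n) : HS" using mod_maps_HS[OF m(2) a] j by simp
  have 2: "(%n. F (snd (ps ! j) \<cdot> a n)) : HS" using mod_maps_HS[OF mod_maps_F 1] .
  have 3: "?x j : HS" using mod_maps_HS[OF m(1) 2] j by simp
  show ?thesis using j 3 hext_cls[OF m(2) a] hext_cls[OF mod_maps_F 1] hext_cls[OF m(1) 2]
   by (simp add: left_mult_hext jones_hext)
 qed
 have "(\<Oplus>\<^sub>(H.quot) j\<in>{..<length ps}. left_mult M F (fst (ps ! j)) (jones_projection M F (left_mult M F (snd (ps ! j)) (H.cls a)))) =
   (\<Oplus>\<^sub>(H.quot) j\<in>{..<length ps}. H.cls (?x j))"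
  using step by (intro H.Q.finsum_cong') (auto intro!: H.cls_closed)
 also have "... = H.cls (%n. \<Oplus>\<^sub>H0 j\<in>{..<length ps}. ?x j n)"
  using H.finsum_cls[of "{..<length ps}" ?x] step by blast
 finally show "(\<lambda>X\<in>carrier (hilbert_module M F). \<Oplus>\<^sub>(hilbert_module M F) j\<in>{..<length ps}.
  left_mult M F (fst (ps ! j)) (jones_projection M F (left_mult M F (snd (ps ! j)) X))) (H.cls a) =
   H.cls (%n. pair_sum ps (a n))"
  using a by (simp add: hilbert_module_eq H.cls_closed H0_finsum pair_sum_def)
qed (simp add: hilbert_module_eq)

text \<open>Every Q-linear T is the sum of the T(u_g) e_Q u_g* over g, since the u_g form a
  quasi-basis. So the span of the x e_Q y consists of all extensions of Q-linear maps and contains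
  the left multiplications.\<close>

lemma BC_carrier: "carrier BC = hext ` mod_maps"
proof -
 have "carrier BC = {(\<lambda>X\<in>carrier (hilbert_module M F). \<Oplus>\<^sub>(hilbert_module M F) j\<in>{..<length ps}.
  left_mult M F (fst (ps ! j)) (jones_projection M F (left_mult M F (snd (ps ! j)) X))) | ps.
   set ps <= MM \<times> MM}"
  by (simp add: basic_construction_def Let_def)
 also have "... = {hext (pair_sum ps) | ps. set ps <= MM \<times> MM}"
 proof (intro Collect_cong iff_exI)
  fix \<Phi> ps
  show "(\<Phi> = (\<lambda>X\<in>carrier (hilbert_module M F). \<Oplus>\<^sub>(hilbert_module M F) j\<in>{..<length ps}.
   left_mult M F (fst (ps ! j)) (jones_projection M F (left_mult M F (snd (ps ! j)) X))) \<and>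
    set ps <= MM \<times> MM) \<longleftrightarrow>
   (\<Phi> = hext (pair_sum ps) & set ps <= MM \<times> MM)"
   by (cases "set ps <= MM \<times> MM") (simp_all only: BC_element simp_thms)
 qed
 also have "... = hext ` mod_maps"
 proof
  show "{hext (pair_sum ps) | ps. set ps <= MM \<times> MM} <= hext ` mod_maps"
   using pair_sum_mod_maps by blast
  show "hext ` mod_maps <= {hext (pair_sum ps) | ps. set ps <= MM \<times> MM}"
  proof
   fix \<Phi> assume "\<Phi> : hext ` mod_maps"
   then obtain T where T: "T : mod_maps" "\<Phi> = hext T" by blast
   obtain gs where gs: "distinct gs" "set gs = GG" using finite_distinct_list[OF finite_G] by blast
   let ?ps = "map (%g. (T (unit_of g), unit_of (inv g))) gs"
   have ps: "set ?ps <= MM \<times> MM" using mod_mapsD(1)[OF T(1)] by auto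
   have "hext T = hext (pair_sum ?ps)"
   proof (rule hext_cong[OF T(1) pair_sum_mod_maps[OF ps]])
    fix x assume x: "x : MM"
    have "pair_sum ?ps x = (\<Oplus>\<^sub>M j\<in>{..<length gs}. (%g. T (unit_of g) \<cdot> F (unit_of (inv g) \<cdot> x)) (gs ! j))"
     unfolding pair_sum_def using x mod_mapsD(1)[OF T(1)] by (intro M.finsum_cong') auto
    also have "... = (\<Oplus>\<^sub>M g\<in>GG. T (unit_of g) \<cdot> F (unit_of (inv g) \<cdot> x))"
     using x mod_mapsD(1)[OF T(1)] by (intro finsum_list[OF gs]) auto
    also have "... = (\<Oplus>\<^sub>M g\<in>GG. T (unit_of g \<cdot> F (unit_of (inv g) \<cdot> x)))"
     using x mod_mapsD(1)[OF T(1)] by (intro M.finsum_cong') (auto simp: F_eq mod_mapsD(3)[OF T(1)])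
    also have "... = T (\<Oplus>\<^sub>M g\<in>GG. unit_of g \<cdot> F (unit_of (inv g) \<cdot> x))"
     using x finite_G by (intro mod_maps_finsum[OF T(1), symmetric]) auto
    finally show "T x = pair_sum ?ps x" using expand_units(2)[OF x] by simp
   qed
   then show "\<Phi> : {hext (pair_sum ps) | ps. set ps <= MM \<times> MM}" using T ps by blast
  qed
 qed
 finally show ?thesis .
qed

lemma BC_ops:
 assumes "S : mod_maps" "T : mod_maps"
 shows "hext S \<otimes>\<^sub>BC hext T = hext (%x. S (T x))"
  "hext S \<oplus>\<^sub>BC hext T = hext (%x. S x \<oplus>\<^sub>M T x)"
  "c \<odot>\<^sub>BC hext S = hext (%x. c \<odot>\<^sub>M S x)"
  "\<zero>\<^sub>BC = hext (%x. \<zero>\<^sub>M)" "\<one>\<^sub>BC = hext (%x. x)"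
proof -
 note HSS = mod_maps_HS[OF assms(1)] and HST = mod_maps_HS[OF assms(2)]
 have *: "!!a. a : HS ==> H.cls a : carrier H.quot" by (rule H.cls_closed)
 show "hext S \<otimes>\<^sub>BC hext T = hext (%x. S (T x))"
  by (rule hext_eqI[OF mod_maps_comp[OF assms]])
   (simp_all add: basic_construction_def Let_def compose_def hilbert_module_eq * hext_cls assms HST)
 show "hext S \<oplus>\<^sub>BC hext T = hext (%x. S x \<oplus>\<^sub>M T x)"
  by (rule hext_eqI[OF mod_maps_add[OF assms]])
   (simp_all add: basic_construction_def Let_def hilbert_module_eq * hext_cls assms HSS HST H.add_cls)
 show "c \<odot>\<^sub>BC hext S = hext (%x. c \<odot>\<^sub>M S x)"
  by (rule hext_eqI[OF mod_maps_scale[OF assms(1)]])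
   (simp_all add: basic_construction_def Let_def hilbert_module_eq * hext_cls assms HSS H.smult_cls)
 show "\<zero>\<^sub>BC = hext (%x. \<zero>\<^sub>M)"
  by (rule hext_eqI[OF mod_maps_const_zero])
   (simp_all add: basic_construction_def Let_def hilbert_module_eq * H.zero_cls)
 show "\<one>\<^sub>BC = hext (%x. x)"
  by (rule hext_eqI[OF mod_maps_id]) (simp_all add: basic_construction_def Let_def hilbert_module_eq *)
qed

lemma BC_norm_eq: "nrm BC \<Phi> = Sup {nrm H.quot (\<Phi> X) | X. X : carrier H.quot & nrm H.quot X <= 1}"
 by (simp add: basic_construction_def Let_def hilbert_module_eq)

lemma hext_bounded:
 assumes T: "T : mod_maps" and K: "!!x. x : MM ==> hnorm (T x) <= K * hnorm x"
  and X: "X : carrier H.quot"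
 shows "nrm H.quot (hext T X) <= K * nrm H.quot X"
proof -
 obtain a where a: "a : HS" "X = H.cls a" using X by (rule H.quotE)
 have "nrm H0 (T (a n)) <= K * nrm H0 (a n)" for n
  using K HS_closed[OF a(1)] mod_mapsD(1)[OF T] by (simp add: H0_norm)
 then show ?thesis unfolding a(2) hext_cls[OF T a(1)]
  by (intro tendsto_le[OF _ tendsto_mult[OF tendsto_const H.nrm_cls_tendsto[OF a(1)]]
     H.nrm_cls_tendsto[OF mod_maps_HS[OF T a(1)]]] always_eventually allI) simp_all
qed

lemma hext_smult:
 assumes T: "T : mod_maps" and X: "X : carrier H.quot"
 shows "hext T (c \<odot>\<^sub>(H.quot) X) = c \<odot>\<^sub>(H.quot) hext T X"
proof -
 obtain a where a: "a : HS" "X = H.cls a" using X by (rule H.quotE)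
 have "(%n. c \<odot>\<^sub>M a n) : HS" using H.S_smult[OF a(1), of c] by simp
 then show ?thesis using a HS_closed[OF a(1)]
  by (simp add: H.smult_cls hext_cls[OF T] mod_maps_HS[OF T] mod_maps_smult[OF T])
qed

lemma BC_norm_bound:
 assumes T: "T : mod_maps" and X: "X : carrier H.quot"
 shows "nrm H.quot (hext T X) <= nrm BC (hext T) * nrm H.quot X"
proof -
 obtain K where K: "!!x. x : MM ==> hnorm (T x) <= K * hnorm x" using mod_maps_bounded[OF T] by blast
 show ?thesis unfolding BC_norm_eq
  by (rule sup_norm_bound[where sc = "%c X. of_real c \<odot>\<^sub>(H.quot) X", OF _ _ _ hext_bounded[OF T K]])
   (use X in "auto simp: H.Q.nrm_smult hext_smult[OF T] hext_closed[OF T]")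
qed

lemma BC_norm_least:
 assumes "T : mod_maps" "0 <= K" "!!X. X : carrier H.quot ==> nrm H.quot (hext T X) <= K * nrm H.quot X"
 shows "nrm BC (hext T) <= K"
 unfolding BC_norm_eq by (rule sup_norm_least[OF assms(3,2), where v = "\<zero>\<^sub>(H.quot)"]) auto

lemma BC_norm_nonneg: assumes T: "T : mod_maps" shows "0 <= nrm BC (hext T)"
proof -
 obtain K where K: "0 <= K" "!!x. x : MM ==> hnorm (T x) <= K * hnorm x"
  using mod_maps_bounded[OF T] by blast
 have "hext T \<zero>\<^sub>(H.quot) = \<zero>\<^sub>(H.quot)"
  using hext_smult[OF T, of "\<zero>\<^sub>(H.quot)" 0] hext_closed[OF T, of "\<zero>\<^sub>(H.quot)"] by simp
 then show ?thesis unfolding BC_norm_eq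
  by (intro sup_norm_nonneg[OF hext_bounded[OF T K(2)] K(1), where v = "\<zero>\<^sub>(H.quot)"]) auto
qed

text \<open>The Rokhlin identity is an equation between products in the ultrapower of the basic
  construction; this lemma makes that ultrapower an algebra. The algebraic laws are checked on
  Q-linear maps of M.\<close>

lemma BC_algebra: "seminormed_algebra BC"
proof -
 have ab: "abelian_group BC"
 proof (rule abelian_groupI)
  fix \<Phi> assume "\<Phi> : carrier BC"
  then obtain S where S: "S : mod_maps" "\<Phi> = hext S" unfolding BC_carrier by blast
  have "hext (%x. (-1) \<odot>\<^sub>M S x) \<oplus>\<^sub>BC \<Phi> = \<zero>\<^sub>BC"
   unfolding S(2) BC_ops[OF mod_maps_scale[OF S(1)] S(1)] using S(1)
   by (intro hext_congR[OF mod_maps_const_zero]) (auto simp: mod_mapsD[OF S(1)] M.smult_minus_one M.l_neg)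
  then show "\<exists>\<Psi>\<in>carrier BC. \<Psi> \<oplus>\<^sub>BC \<Phi> = \<zero>\<^sub>BC"
   unfolding BC_carrier using mod_maps_scale[OF S(1)] by blast
  show "\<zero>\<^sub>BC \<oplus>\<^sub>BC \<Phi> = \<Phi>"
   unfolding S(2) BC_ops(4)[OF S(1) S(1)] BC_ops(2)[OF mod_maps_const_zero S(1)]
   using S(1) by (intro hext_congR[OF S(1)]) (auto simp: mod_mapsD[OF S(1)])
 next
  fix \<Phi> \<Psi> assume "\<Phi> : carrier BC" "\<Psi> : carrier BC"
  then obtain S T where S: "S : mod_maps" "\<Phi> = hext S" and T: "T : mod_maps" "\<Psi> = hext T"
   unfolding BC_carrier by blast
  show "\<Phi> \<oplus>\<^sub>BC \<Psi> : carrier BC"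
   unfolding BC_carrier S(2) T(2) BC_ops(2)[OF S(1) T(1)] using mod_maps_add[OF S(1) T(1)] by blast
  show "\<Phi> \<oplus>\<^sub>BC \<Psi> = \<Psi> \<oplus>\<^sub>BC \<Phi>"
   unfolding S(2) T(2) BC_ops(2)[OF S(1) T(1)] BC_ops(2)[OF T(1) S(1)]
   using S(1) T(1) by (intro hext_congL[OF mod_maps_add[OF S(1) T(1)]]) (auto simp: mod_mapsD[OF S(1)] mod_mapsD[OF T(1)] M.a_comm)
  fix \<Theta> assume "\<Theta> : carrier BC"
  then obtain R where R: "R : mod_maps" "\<Theta> = hext R" unfolding BC_carrier by blast
  show "\<Phi> \<oplus>\<^sub>BC \<Psi> \<oplus>\<^sub>BC \<Theta> = \<Phi> \<oplus>\<^sub>BC (\<Psi> \<oplus>\<^sub>BC \<Theta>)"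
   unfolding S(2) T(2) R(2) BC_ops(2)[OF S(1) T(1)] BC_ops(2)[OF T(1) R(1)]
    BC_ops(2)[OF mod_maps_add[OF S(1) T(1)] R(1)] BC_ops(2)[OF S(1) mod_maps_add[OF T(1) R(1)]]
   using S(1) T(1) R(1) by (intro hext_congL[OF mod_maps_add[OF mod_maps_add[OF S(1) T(1)] R(1)]]) (auto simp: mod_mapsD[OF S(1)] mod_mapsD[OF T(1)] mod_mapsD[OF R(1)] M.a_assoc)
 next
  show "\<zero>\<^sub>BC : carrier BC"
   unfolding BC_carrier BC_ops(4)[OF mod_maps_id mod_maps_id] using mod_maps_const_zero by blast
 qed
 have ring: "ring BC"
 proof (rule ringI[OF ab monoidI])
  show "\<one>\<^sub>BC : carrier BC" unfolding BC_carrier BC_ops(5)[OF mod_maps_id mod_maps_id] using mod_maps_id by blast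
 next
  fix \<Phi> assume "\<Phi> : carrier BC"
  then obtain S where S: "S : mod_maps" "\<Phi> = hext S" unfolding BC_carrier by blast
  show "\<one>\<^sub>BC \<otimes>\<^sub>BC \<Phi> = \<Phi>" "\<Phi> \<otimes>\<^sub>BC \<one>\<^sub>BC = \<Phi>"
   unfolding S(2) BC_ops(5)[OF mod_maps_id mod_maps_id] BC_ops(1)[OF mod_maps_id S(1)] BC_ops(1)[OF S(1) mod_maps_id]
   by simp_all
 next
  fix \<Phi> \<Psi> assume "\<Phi> : carrier BC" "\<Psi> : carrier BC"
  then obtain S T where S: "S : mod_maps" "\<Phi> = hext S" and T: "T : mod_maps" "\<Psi> = hext T"
   unfolding BC_carrier by blast
  show "\<Phi> \<otimes>\<^sub>BC \<Psi> : carrier BC"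
   unfolding BC_carrier S(2) T(2) BC_ops(1)[OF S(1) T(1)] using mod_maps_comp[OF S(1) T(1)] by blast
  fix \<Theta> assume "\<Theta> : carrier BC"
  then obtain R where R: "R : mod_maps" "\<Theta> = hext R" unfolding BC_carrier by blast
  show "\<Phi> \<otimes>\<^sub>BC \<Psi> \<otimes>\<^sub>BC \<Theta> = \<Phi> \<otimes>\<^sub>BC (\<Psi> \<otimes>\<^sub>BC \<Theta>)"
   unfolding S(2) T(2) R(2) BC_ops(1)[OF S(1) T(1)] BC_ops(1)[OF T(1) R(1)]
    BC_ops(1)[OF mod_maps_comp[OF S(1) T(1)] R(1)] BC_ops(1)[OF S(1) mod_maps_comp[OF T(1) R(1)]] ..
  show "(\<Phi> \<oplus>\<^sub>BC \<Psi>) \<otimes>\<^sub>BC \<Theta> = \<Phi> \<otimes>\<^sub>BC \<Theta> \<oplus>\<^sub>BC \<Psi> \<otimes>\<^sub>BC \<Theta>"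
   unfolding S(2) T(2) R(2) BC_ops(2)[OF S(1) T(1)] BC_ops(1)[OF S(1) R(1)] BC_ops(1)[OF T(1) R(1)]
    BC_ops(1)[OF mod_maps_add[OF S(1) T(1)] R(1)] BC_ops(2)[OF mod_maps_comp[OF S(1) R(1)] mod_maps_comp[OF T(1) R(1)]] ..
  show "\<Theta> \<otimes>\<^sub>BC (\<Phi> \<oplus>\<^sub>BC \<Psi>) = \<Theta> \<otimes>\<^sub>BC \<Phi> \<oplus>\<^sub>BC \<Theta> \<otimes>\<^sub>BC \<Psi>"
   unfolding S(2) T(2) R(2) BC_ops(2)[OF S(1) T(1)] BC_ops(1)[OF R(1) S(1)] BC_ops(1)[OF R(1) T(1)]
    BC_ops(1)[OF R(1) mod_maps_add[OF S(1) T(1)]] BC_ops(2)[OF mod_maps_comp[OF R(1) S(1)] mod_maps_comp[OF R(1) T(1)]]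
   using S(1) T(1) R(1) by (intro hext_congL[OF mod_maps_comp[OF R(1) mod_maps_add[OF S(1) T(1)]]]) (auto simp: mod_mapsD[OF S(1)] mod_mapsD[OF T(1)] mod_mapsD[OF R(1)])
 qed
 have smod: "seminormed_module BC"
 proof (intro seminormed_module.intro ab seminormed_module_axioms.intro)
  fix \<Phi> \<Psi> c d assume "\<Phi> : carrier BC" "\<Psi> : carrier BC"
  then obtain S T where S: "S : mod_maps" "\<Phi> = hext S" and T: "T : mod_maps" "\<Psi> = hext T"
   unfolding BC_carrier by blast
  show "c \<odot>\<^sub>BC (\<Phi> \<oplus>\<^sub>BC \<Psi>) = c \<odot>\<^sub>BC \<Phi> \<oplus>\<^sub>BC c \<odot>\<^sub>BC \<Psi>"
   unfolding S(2) T(2) BC_ops(2)[OF S(1) T(1)] BC_ops(3)[OF S(1) S(1)] BC_ops(3)[OF T(1) T(1)]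
    BC_ops(3)[OF mod_maps_add[OF S(1) T(1)] S(1)] BC_ops(2)[OF mod_maps_scale[OF S(1)] mod_maps_scale[OF T(1)]]
   using S(1) T(1) by (intro hext_congL[OF mod_maps_scale[OF mod_maps_add[OF S(1) T(1)]]]) (auto simp: mod_mapsD[OF S(1)] mod_mapsD[OF T(1)] M.smult_add_right)
  show "nrm BC (\<Phi> \<oplus>\<^sub>BC \<Psi>) <= nrm BC \<Phi> + nrm BC \<Psi>"
   unfolding S(2) T(2) BC_ops(2)[OF S(1) T(1)]
  proof (rule BC_norm_least[OF mod_maps_add[OF S(1) T(1)]])
   fix X assume X: "X : carrier H.quot"
   have "hext (%x. S x \<oplus>\<^sub>M T x) X = hext S X \<oplus>\<^sub>(H.quot) hext T X"
    using X unfolding BC_ops(2)[OF S(1) T(1), symmetric]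
    by (simp add: basic_construction_def Let_def hilbert_module_eq)
   then have "nrm H.quot (hext (%x. S x \<oplus>\<^sub>M T x) X) <= nrm H.quot (hext S X) + nrm H.quot (hext T X)"
    using H.Q.nrm_triangle[OF hext_closed[OF S(1) X] hext_closed[OF T(1) X]] by simp
   then show "nrm H.quot (hext (%x. S x \<oplus>\<^sub>M T x) X) <= (nrm BC (hext S) + nrm BC (hext T)) * nrm H.quot X"
    using BC_norm_bound[OF S(1) X] BC_norm_bound[OF T(1) X] by (simp add: algebra_simps)
  qed (use BC_norm_nonneg S(1) T(1) in "simp add: add_nonneg_nonneg")
 next
  fix \<Phi> c d assume "\<Phi> : carrier BC"
  then obtain S where S: "S : mod_maps" "\<Phi> = hext S" unfolding BC_carrier by blast
  note ss = mod_maps_scale[OF S(1)]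
  show "c \<odot>\<^sub>BC \<Phi> : carrier BC"
   unfolding BC_carrier S(2) BC_ops(3)[OF S(1) S(1)] using ss by blast
  show "(c + d) \<odot>\<^sub>BC \<Phi> = c \<odot>\<^sub>BC \<Phi> \<oplus>\<^sub>BC d \<odot>\<^sub>BC \<Phi>"
   unfolding S(2) BC_ops(3)[OF S(1) S(1)] BC_ops(2)[OF ss ss]
   using S(1) by (intro hext_congL[OF mod_maps_scale[OF S(1)]]) (auto simp: mod_mapsD[OF S(1)] M.smult_add_left)
  show "(c * d) \<odot>\<^sub>BC \<Phi> = c \<odot>\<^sub>BC (d \<odot>\<^sub>BC \<Phi>)"
   unfolding S(2) BC_ops(3)[OF S(1) S(1)] BC_ops(3)[OF ss ss]
   using S(1) by (intro hext_congL[OF mod_maps_scale[OF S(1)]]) (auto simp: mod_mapsD[OF S(1)] M.smult_smult)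
  show "1 \<odot>\<^sub>BC \<Phi> = \<Phi>"
   unfolding S(2) BC_ops(3)[OF S(1) S(1)] using S(1) by (intro hext_congR[OF S(1)]) (auto simp: mod_mapsD[OF S(1)])
  have le: "nrm BC (hext (%x. c \<odot>\<^sub>M S x)) <= cmod c * nrm BC (hext S)" if S: "S : mod_maps" for c S
  proof (rule BC_norm_least[OF mod_maps_scale[OF S]])
   fix X assume X: "X : carrier H.quot"
   have "hext (%x. c \<odot>\<^sub>M S x) X = c \<odot>\<^sub>(H.quot) hext S X"
    using X unfolding BC_ops(3)[OF S S, symmetric]
    by (simp add: basic_construction_def Let_def hilbert_module_eq)
   then show "nrm H.quot (hext (%x. c \<odot>\<^sub>M S x) X) <= cmod c * nrm BC (hext S) * nrm H.quot X"
    using mult_left_mono[OF BC_norm_bound[OF S X], of "cmod c"] hext_closed[OF S X]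
    by (simp add: H.Q.nrm_smult mult.assoc)
  qed (use BC_norm_nonneg[OF S] in simp)
  show "nrm BC (c \<odot>\<^sub>BC \<Phi>) = cmod c * nrm BC \<Phi>"
   unfolding S(2) BC_ops(3)[OF S(1) S(1)]
  proof (cases "c = 0")
   case True
   then show "nrm BC (hext (%x. c \<odot>\<^sub>M S x)) = cmod c * nrm BC (hext S)"
    using le[OF S(1), of 0] BC_norm_nonneg[OF ss, of 0] by simp
  next
   case False
   have "hext (%x. inverse c \<odot>\<^sub>M (c \<odot>\<^sub>M S x)) = hext S"
    using S(1) False by (intro hext_congR[OF S(1)]) (auto simp: mod_mapsD[OF S(1)] M.smult_smult[symmetric])
   then have "nrm BC (hext S) <= inverse (cmod c) * nrm BC (hext (%x. c \<odot>\<^sub>M S x))"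
    using le[OF ss, of "inverse c" c] by (simp add: norm_inverse)
   then show "nrm BC (hext (%x. c \<odot>\<^sub>M S x)) = cmod c * nrm BC (hext S)"
    using le[OF S(1), of c] False by (simp add: field_simps)
  qed
 qed
 show ?thesis
 proof (intro seminormed_algebra.intro ring smod seminormed_algebra_axioms.intro)
  fix \<Phi> \<Psi> c assume "\<Phi> : carrier BC" "\<Psi> : carrier BC"
  then obtain S T where S: "S : mod_maps" "\<Phi> = hext S" and T: "T : mod_maps" "\<Psi> = hext T"
   unfolding BC_carrier by blast
  show "(c \<odot>\<^sub>BC \<Phi>) \<otimes>\<^sub>BC \<Psi> = c \<odot>\<^sub>BC (\<Phi> \<otimes>\<^sub>BC \<Psi>)"
   unfolding S(2) T(2) BC_ops(3)[OF S(1) S(1)] BC_ops(1)[OF S(1) T(1)]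
    BC_ops(1)[OF mod_maps_scale[OF S(1)] T(1)] BC_ops(3)[OF mod_maps_comp[OF S(1) T(1)] S(1)] ..
  show "\<Phi> \<otimes>\<^sub>BC (c \<odot>\<^sub>BC \<Psi>) = c \<odot>\<^sub>BC (\<Phi> \<otimes>\<^sub>BC \<Psi>)"
   unfolding S(2) T(2) BC_ops(3)[OF T(1) T(1)] BC_ops(1)[OF S(1) T(1)]
    BC_ops(1)[OF S(1) mod_maps_scale[OF T(1)]] BC_ops(3)[OF mod_maps_comp[OF S(1) T(1)] S(1)]
   using S(1) T(1) by (intro hext_congL[OF mod_maps_comp[OF S(1) mod_maps_scale[OF T(1)]]]) (auto simp: mod_mapsD[OF S(1)] mod_mapsD[OF T(1)] mod_maps_smult[OF S(1)])
  show "nrm BC (\<Phi> \<otimes>\<^sub>BC \<Psi>) <= nrm BC \<Phi> * nrm BC \<Psi>"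
   unfolding S(2) T(2) BC_ops(1)[OF S(1) T(1)]
  proof (rule BC_norm_least[OF mod_maps_comp[OF S(1) T(1)]])
   fix X assume X: "X : carrier H.quot"
   have "hext (%x. S (T x)) X = hext S (hext T X)"
    using X unfolding BC_ops(1)[OF S(1) T(1), symmetric]
    by (simp add: basic_construction_def Let_def hilbert_module_eq compose_def)
   then have "nrm H.quot (hext (%x. S (T x)) X) <= nrm BC (hext S) * nrm H.quot (hext T X)"
    using BC_norm_bound[OF S(1) hext_closed[OF T(1) X]] by simp
   also have "... <= nrm BC (hext S) * (nrm BC (hext T) * nrm H.quot X)"
    by (intro mult_left_mono BC_norm_bound T(1) X BC_norm_nonneg S(1))
   finally show "nrm H.quot (hext (%x. S (T x)) X) <= nrm BC (hext S) * nrm BC (hext T) * nrm H.quot X"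
    by (simp add: mult.assoc)
  qed (use BC_norm_nonneg S(1) T(1) in simp)
 qed
qed

sublocale BC: seminormed_algebra BC by (rule BC_algebra)

lemma left_mult_closed: "x : MM ==> left_mult M F x : carrier BC"
 unfolding left_mult_hext BC_carrier using mod_maps_mult by blast

lemma jones_closed: "jones_projection M F : carrier BC"
 unfolding jones_hext BC_carrier using mod_maps_F by blast

text \<open>Together with \<open>left_mult_minus\<close> this makes the passage from x to its left
  multiplication 1-Lipschitz, so that it acts on classes of bounded sequences.\<close>

lemma nrm_left_mult: assumes x: "x : MM" shows "nrm BC (left_mult M F x) <= nrm M x"
 unfolding left_mult_hext
 by (rule BC_norm_least[OF mod_maps_mult[OF x] _ hext_bounded[OF mod_maps_mult[OF x]]])
  (use x hnorm_mult_le in auto)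

lemma left_mult_minus:
 assumes x: "x : MM" and y: "y : MM"
 shows "left_mult M F x \<ominus>\<^sub>BC left_mult M F y = left_mult M F (x \<ominus>\<^sub>M y)"
proof -
 note mx = mod_maps_mult[OF x] and my = mod_maps_mult[OF y]
 have "left_mult M F x \<ominus>\<^sub>BC left_mult M F y = left_mult M F x \<oplus>\<^sub>BC (-1) \<odot>\<^sub>BC left_mult M F y"
  using left_mult_closed[OF y] by (simp add: BC.minus_eq BC.smult_minus_one)
 also have "... = hext (%z. x \<cdot> z \<oplus>\<^sub>M (-1) \<odot>\<^sub>M (y \<cdot> z))"
  unfolding left_mult_hext BC_ops(3)[OF my my] BC_ops(2)[OF mx mod_maps_scale[OF my]] ..
 also have "... = left_mult M F (x \<ominus>\<^sub>M y)"
  unfolding left_mult_hext using x y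
  by (intro hext_cong mod_maps_add mod_maps_scale mod_maps_mult)
   (auto simp: M.smult_minus_one M.minus_mult_left M.minus_eq[of "x \<cdot> _"])
 finally show ?thesis .
qed

end

section \<open>Tracially approximately representable actions\<close>

text \<open>\<open>S n\<close> stands for the image of the \<open>n\<close>-th stage, \<open>v n g\<close> for \<open>(U\<^sub>g, 0)\<close>, and \<open>p n i\<close> runs through
 the diagonal matrix units of the second summand of the stage.\<close>

locale representable_system = finite_action G A \<alpha>
 for G :: "('g, 'm) monoid_scheme" (structure) and A :: "'a cstar" and \<alpha> :: "'g => 'a => 'a" +
 fixes S :: "nat => 'a set" and v :: "nat => 'g => 'a" and I :: "nat => 'i set" and p :: "nat => 'i => 'a"
 assumes S_sub: "S n <= AC"
  and S_mono: "S n <= S (Suc n)"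
  and S_zero: "\<zero>\<^sub>A : S n"
  and S_add: "[|x : S n; y : S n|] ==> x \<oplus>\<^sub>A y : S n"
  and S_mult: "[|x : S n; y : S n|] ==> x \<star> y : S n"
  and S_star: "x : S n ==> star A x : S n"
  and S_act: "[|g : GG; x : S n|] ==> \<alpha> g x : S n"
  and S_dense: "[|x : AC; \<eta> > 0|] ==> \<exists>N. \<forall>n\<ge>N. \<exists>b\<in>S n. nrm A (x \<ominus>\<^sub>A b) < \<eta>"
  and v_closed [simp, intro]: "g : GG ==> v n g : AC"
  and v_mult: "[|g : GG; h : GG|] ==> v n g \<star> v n h = v n (g \<otimes> h)"
  and v_star: "g : GG ==> star A (v n g) = v n (inv g)"
  and v_comm: "[|g : GG; x : S n|] ==> v n g \<star> x = \<alpha> g x \<star> v n g"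
  and v_act: "[|g : GG; h : GG|] ==> \<alpha> h (v n g) = v n (h \<otimes> g \<otimes> inv h)"
  and v_nonzero: "v n \<one> ~= \<zero>\<^sub>A"
  and v_S: "g : GG ==> v n g : S n"
  and fin_I: "finite (I n)"
  and p_S: "i : I n ==> p n i : S n"
  and p_star: "i : I n ==> star A (p n i) = p n i"
  and p_idem: "i : I n ==> p n i \<star> p n i = p n i"
  and p_v: "i : I n ==> p n i \<star> v n \<one> = \<zero>\<^sub>A"
  and p_sum: "\<one>\<^sub>A \<ominus>\<^sub>A v n \<one> = (\<Oplus>\<^sub>A i\<in>I n. p n i)"
  and p_minimal: "[|i : I n; x : S n|] ==> \<exists>c. p n i \<star> x \<star> p n i = c \<odot>\<^sub>A p n i"
  and p_free: "[|i : I n; x : S n; g : GG; g ~= \<one>|]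
   ==> p n i \<star> x \<star> \<alpha> g (p n i) = \<zero>\<^sub>A"
  and q_faithful: "x : S n ==> nrm A (x \<star> (\<one>\<^sub>A \<ominus>\<^sub>A v (Suc n) \<one>)) = nrm A x"
  and p_compare: "i : I n ==> \<exists>j\<ge>J. \<exists>y\<in>AC. y \<star> p n i \<star> star A y = \<one>\<^sub>A \<ominus>\<^sub>A v j \<one>"
  and p_full: "i : I n ==> \<exists>(d::nat) w. w : {..<d} \<rightarrow> AC \<and>
   \<one>\<^sub>A = (\<Oplus>\<^sub>A j\<in>{..<d}. w j \<star> p n i \<star> star A (w j))"
begin

lemma S_closed [simp, intro]: "x : S n ==> x : AC" using S_sub by blast

lemma S_mono_le: "[|m <= n; x : S m|] ==> x : S n"
 using lift_Suc_mono_le[of S, OF S_mono] by blast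

lemma p_closed [simp, intro]: "i : I n ==> p n i : AC" using p_S by blast

abbreviation q :: "nat => 'a" where "q n \<equiv> \<one>\<^sub>A \<ominus>\<^sub>A v n \<one>"

lemma q_closed [simp, intro]: "q n : AC" by simp

lemma S_finsum: "[|finite J; !!j. j : J ==> x j : S n|] ==> (\<Oplus>\<^sub>A j\<in>J. x j) : S n"
proof (induction J rule: finite_induct)
 case (insert j J)
 then show ?case by (subst A.finsum_insert) (auto intro!: S_add)
qed (simp add: S_zero)

lemma q_S: "q n : S n"
 unfolding p_sum using p_S by (intro S_finsum fin_I)

lemma v_one_idem: "v n \<one> \<star> v n \<one> = v n \<one>" "star A (v n \<one>) = v n \<one>"
 by (simp_all add: v_mult v_star)

lemma q_idem: "q n \<star> q n = q n" "star A (q n) = q n"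
 by (simp_all add: A.minus_mult_left A.minus_mult_right v_one_idem A.star_diff)

lemma q_act: "g : GG ==> \<alpha> g (q n) = q n"
 by (simp add: star_hom_minus[OF act_hom A.pre_cstar_axioms A.pre_cstar_axioms] v_act)

lemma p_q: "i : I n ==> p n i \<star> q n = p n i"
 by (simp add: A.minus_mult_right p_v)

lemma nrm_v_one: "nrm A (v n \<one>) = 1"
 using A.nrm_projection[of "v n \<one>"] v_one_idem[of n] A.nrm_eq_0[of "v n \<one>"] v_nonzero[of n] by auto

lemma nrm_one: "nrm A \<one>\<^sub>A = 1"
proof -
 have "\<one>\<^sub>A ~= \<zero>\<^sub>A"
  using A.r_one[of "v 0 \<one>"] A.r_null[of "v 0 \<one>"] v_nonzero[of 0] by (metis one_closed v_closed)
 then show ?thesis using A.nrm_projection[of "\<one>\<^sub>A"] A.nrm_eq_0[of "\<one>\<^sub>A"] by auto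
qed

lemma nrm_p_le: "i : I n ==> nrm A (p n i) <= 1"
 using A.nrm_projection[of "p n i"] p_star p_idem by fastforce

lemma nrm_q_le: "nrm A (q n) <= 1"
 using A.nrm_projection[of "q n"] q_idem[of n] by auto

text \<open>The crossed product of the n-th stage by G, a subalgebra of M. Exact computations take
  place in these subalgebras and are transferred to M by density.\<close>

definition SG :: "nat => ('g => 'a) set" where
 "SG n = {x : MM. \<forall>g\<in>GG. x g : S n}"

lemma stage_crossed_closed: "x : SG n ==> x : MM"
 by (simp add: SG_def)

lemma stage_crossed_mono: assumes "m <= n" "x : SG m" shows "x : SG n"
 using assms(2) S_mono_le[OF assms(1)] by (simp add: SG_def)

lemma stage_crossedD: "[|x : SG n; g : GG|] ==> x g : S n"
 by (simp add: SG_def)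

lemma stage_crossedI: "[|x : MM; !!g. g : GG ==> x g : S n|] ==> x : SG n"
 by (simp add: SG_def)

lemma stage_crossed_mult:
 assumes x: "x : SG n" and y: "y : SG n" shows "x \<cdot> y : SG n"
 unfolding SG_def
proof (intro CollectI conjI ballI)
 fix k assume k: "k : GG"
 show "(x \<cdot> y) k : S n"
  unfolding crossed_mult_coeff[OF k]
  by (rule S_finsum[OF finite_G]) (intro S_mult S_act stage_crossedD[OF x] stage_crossedD[OF y] m_closed inv_closed k)
qed (use stage_crossed_closed[OF x] stage_crossed_closed[OF y] in simp)

lemma stage_crossed_star: assumes x: "x : SG n" shows "star M x : SG n"
 unfolding SG_def
proof (intro CollectI conjI ballI)
 fix k assume k: "k : GG"
 have "star M x k = \<alpha> k (star A (x (inv k)))" using stage_crossed_closed[OF x] k by simp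
 then show "star M x k : S n" using S_act[OF k S_star[OF stage_crossedD[OF x inv_closed[OF k]]]] by simp
qed (use stage_crossed_closed[OF x] in simp)

lemma stage_crossed_emb: "a : S n ==> emb a : SG n"
 by (auto simp: SG_def S_zero)

declare stage_crossed_closed [simp, intro]

lemma stage_crossed_dense:
 assumes x: "x : MM" and e: "\<eta> > 0"
 obtains N b where "b : SG N" "nrm M (x \<ominus>\<^sub>M b) < \<eta>"
proof -
 \<comment> \<open>\<open>nrm_le_sum\<close> contributes one factor |G| and its |G| summands
   another; the 2 makes the final inequality strict.\<close>
 define \<delta> where "\<delta> = \<eta> / (2 * oG * oG)"
 have d: "\<delta> > 0" using e order_real_ge by (simp add: \<delta>_def)
 have "\<exists>N. \<forall>n\<ge>N. \<exists>b\<in>S n. nrm A (x g \<ominus>\<^sub>A b) < \<delta>" if "g : GG" for g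
  using S_dense[OF crossed_coeff[OF x that] d] .
 then obtain N where N: "!!g n. [|g : GG; n >= N g|] ==> \<exists>b\<in>S n. nrm A (x g \<ominus>\<^sub>A b) < \<delta>" by metis
 define n where "n = Max (N ` GG)"
 have "\<exists>b\<in>S n. nrm A (x g \<ominus>\<^sub>A b) < \<delta>" if g: "g : GG" for g
  using finite_G g by (intro N) (auto simp: n_def)
 then obtain b where b: "!!g. g : GG ==> b g : S n" "!!g. g : GG ==> nrm A (x g \<ominus>\<^sub>A b g) < \<delta>"
  by metis
 let ?b = "\<lambda>g\<in>GG. b g"
 have bn: "?b : SG n" using b(1) by (intro stage_crossedI) (auto simp: crossed_simps)
 have "nrm M (x \<ominus>\<^sub>M ?b) <= oG * (\<Sum>g\<in>GG. nrm A ((x \<ominus>\<^sub>M ?b) g))"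
  using x bn by (intro nrm_le_sum) auto
 also have "... <= oG * (\<Sum>g\<in>GG. \<delta>)"
  using x bn b(2) order_real_ge by (intro mult_left_mono sum_mono) (auto simp: less_imp_le)
 also have "... = \<eta> / 2" using order_real_ge by (simp add: \<delta>_def flip: oG_def)
 also have "... < \<eta>" using e by simp
 finally show ?thesis using that bn by blast
qed

subsection \<open>The Rokhlin projections\<close>

text \<open>This is the average of the unitaries \<open>v\<^sub>g* u\<^sub>g\<close>, which commute with the \<open>n\<close>-th stage.\<close>

definition rok :: "nat => 'g => 'a" where
 "rok n = (\<lambda>k\<in>GG. of_real (1 / oG) \<odot>\<^sub>A v n (inv k))"

lemma rok_coeff: "k : GG ==> rok n k = of_real (1 / oG) \<odot>\<^sub>A v n (inv k)"
 by (simp add: rok_def)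

lemma rok_closed [simp, intro]: "rok n : MM"
 by (auto simp: rok_def crossed_simps)

lemma rok_star: "star M (rok n) = rok n"
 by (rule crossed_eqI) (auto simp: rok_coeff A.star_smult v_star act_A_smult v_act m_assoc)

lemma rok_mult_coeff:
 assumes x: "x : MM" and k: "k : GG"
 shows "(rok n \<cdot> x) k = of_real (1 / oG) \<odot>\<^sub>A
  (\<Oplus>\<^sub>A h\<in>GG. v n (inv h) \<star> \<alpha> h (x (inv h \<otimes> k)))"
 unfolding crossed_mult_coeff[OF k] using x k finite_G
 by (subst A.smult_finsum) (auto intro!: A.finsum_cong' simp: rok_coeff A.smult_mult_left)

text \<open>Conjugation by u_h permutes the summands v_g* u_g, because \<alpha>_h(v_g) = v_(h g
  h^-1). So the average commutes with the u_h as well as with coefficients from stage n.\<close>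

lemma rok_commute:
 assumes b: "b : SG n" shows "rok n \<cdot> b = b \<cdot> rok n"
proof (rule crossed_eqI)
 fix k assume k: "k : GG"
 have bc: "b : MM" and bS: "!!g. g : GG ==> b g : S n" using b stage_crossedD[OF b] by auto
 let ?f = "%j. b j \<star> v n (j \<otimes> inv k)"
 have f: "?f : GG \<rightarrow> AC" using bc k by auto
 have "(\<Oplus>\<^sub>A h\<in>GG. v n (inv h) \<star> \<alpha> h (b (inv h \<otimes> k))) = (\<Oplus>\<^sub>A h\<in>GG. ?f (inv h \<otimes> k))"
  using bc k bS by (intro A.finsum_cong') (auto simp: v_comm S_act m_assoc)
 also have "... = (\<Oplus>\<^sub>A h\<in>GG. ?f (inv (inv k \<otimes> h)))"
  using bc k by (intro A.finsum_cong') (auto simp: inv_mult_group)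
 also have "... = (\<Oplus>\<^sub>A h\<in>GG. ?f (inv h))"
  using bc k by (intro sum_translate[where f = "%h. ?f (inv h)"]) auto
 also have "... = (\<Oplus>\<^sub>A h\<in>GG. ?f h)" by (rule sum_inverse[OF f])
 finally have 1: "(rok n \<cdot> b) k = of_real (1 / oG) \<odot>\<^sub>A (\<Oplus>\<^sub>A h\<in>GG. ?f h)"
  by (simp add: rok_mult_coeff[OF bc k])
 have "(b \<cdot> rok n) k = (\<Oplus>\<^sub>A h\<in>GG. of_real (1 / oG) \<odot>\<^sub>A ?f h)"
  unfolding crossed_mult_coeff[OF k] using bc k
  by (intro A.finsum_cong')
   (auto simp: rok_coeff act_A_smult v_act A.smult_mult_right inv_mult_group m_assoc)
 also have "... = of_real (1 / oG) \<odot>\<^sub>A (\<Oplus>\<^sub>A h\<in>GG. ?f h)"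
  using f finite_G by (intro A.smult_finsum[symmetric]) auto
 finally show "(rok n \<cdot> b) k = (b \<cdot> rok n) k" using 1 by simp
qed (use b in auto)

lemma order_smult_finsum:
 "x : AC ==> of_real (1 / oG) \<odot>\<^sub>A (\<Oplus>\<^sub>A h\<in>GG. x) = x"
 using finite_G order_real_ge A.finsum_const_smult[of "GG" x] one_closed
 by (auto simp: A.smult_smult[symmetric] oG_def)

text \<open>The map g -> v_g* u_g is multiplicative with values in the unitaries of the corner of
  v_1, so its average over G is the projection onto the invariant vectors.\<close>

lemma rok_idem: "rok n \<cdot> rok n = rok n"
proof (rule crossed_eqI)
 fix k assume k: "k : GG"
 have "(\<Oplus>\<^sub>A h\<in>GG. v n (inv h) \<star> \<alpha> h (rok n (inv h \<otimes> k))) = (\<Oplus>\<^sub>A h\<in>GG. rok n k)"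
 proof (intro A.finsum_cong' refl)
  fix h assume h: "h : GG"
  have "inv h \<otimes> (h \<otimes> (inv k \<otimes> h) \<otimes> inv h) = inv k"
   using h k by (simp add: m_assoc)
  then show "v n (inv h) \<star> \<alpha> h (rok n (inv h \<otimes> k)) = rok n k"
   using h k by (simp add: rok_coeff act_A_smult v_act A.smult_mult_right v_mult inv_mult_group)
 qed (use k in auto)
 then show "(rok n \<cdot> rok n) k = rok n k"
  by (simp only: rok_mult_coeff[OF rok_closed k] order_smult_finsum[OF crossed_coeff[OF rok_closed k]])
qed auto

lemma nrm_rok_le: "nrm M (rok n) <= 1"
 using M.nrm_projection[of "rok n"] rok_star[of n] rok_idem[of n] by auto

lemma F_rok: "F (rok n) = of_real (1 / oG) \<odot>\<^sub>M emb (v n \<one>)"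
 by (simp add: F_eq rok_coeff emb_smult)

text \<open>A lower bound common to all n, which keeps the class of any sequence of these
  projections nonzero in the ultrapower.\<close>

lemma nrm_rok_ge: "1 / oG <= nrm M (rok n)"
 using coeff_le_nrm[of "rok n" \<one>] order_real_ge by (simp add: rok_coeff A.nrm_smult nrm_v_one norm_divide)

text \<open>The projection absorbs every v_k* u_k on its right-hand factor: y = \<open>rok n\<close>
  x satisfies v_k* u_k y = y. Hence y is determined by its coefficient at the identity, y k =
  v_(k^-1) \<alpha>_k(y 1), and this is |G| times the coefficient at k of \<open>rok n\<close> times
  F y.\<close>

lemma rok_jones:
 assumes x: "x : MM"
 shows "of_real oG \<odot>\<^sub>M (rok n \<cdot> F (rok n \<cdot> x)) = rok n \<cdot> x"
proof (rule crossed_eqI)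
 fix k assume k: "k : GG"
 let ?f = "%j. v n (inv j) \<star> \<alpha> j (x (inv j \<otimes> k))"
 let ?g = "%h. v n (inv h) \<star> \<alpha> h (x (inv h))"
 let ?c = "of_real (1 / oG)"
 have f: "?f : GG \<rightarrow> AC" and g: "?g : GG \<rightarrow> AC" using x k by auto
 have gs: "(\<Oplus>\<^sub>A h\<in>GG. ?g h) : AC" using g by (intro A.finsum_closed)
 have "v n (inv k) \<star> \<alpha> k (\<Oplus>\<^sub>A h\<in>GG. ?g h) = v n (inv k) \<star> (\<Oplus>\<^sub>A h\<in>GG. \<alpha> k (?g h))"
  using k g finite_G by (subst act_A_finsum) auto
 also have "... = (\<Oplus>\<^sub>A h\<in>GG. v n (inv k) \<star> \<alpha> k (?g h))"
  using k x finite_G by (intro A.finsum_rdistr) auto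
 also have "... = (\<Oplus>\<^sub>A h\<in>GG. ?f (k \<otimes> h))"
 proof (intro A.finsum_cong' refl)
  fix h assume h: "h : GG"
  have "v n (inv k) \<star> \<alpha> k (?g h) = (v n (inv k) \<star> v n (k \<otimes> inv h \<otimes> inv k)) \<star> \<alpha> (k \<otimes> h) (x (inv h))"
   using h k x by (simp add: act_A_mult v_act act_mult A.m_assoc)
  also have "v n (inv k) \<star> v n (k \<otimes> inv h \<otimes> inv k) = v n (inv (k \<otimes> h))"
   using h k by (simp add: v_mult m_assoc inv_mult_group)
  finally have "v n (inv k) \<star> \<alpha> k (?g h) = v n (inv (k \<otimes> h)) \<star> \<alpha> (k \<otimes> h) (x (inv h))" .
  moreover have "inv (k \<otimes> h) \<otimes> k = inv h" using h k by (simp add: inv_mult_group m_assoc)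
  ultimately show "v n (inv k) \<star> \<alpha> k (?g h) = ?f (k \<otimes> h)" by simp
 qed (use x k in auto)
 also have "... = (\<Oplus>\<^sub>A h\<in>GG. ?f h)" by (rule sum_translate[OF k f])
 finally have 1: "v n (inv k) \<star> \<alpha> k (\<Oplus>\<^sub>A h\<in>GG. ?g h) = (\<Oplus>\<^sub>A h\<in>GG. ?f h)" .
 have "(rok n \<cdot> x) \<one> = ?c \<odot>\<^sub>A (\<Oplus>\<^sub>A h\<in>GG. v n (inv h) \<star> \<alpha> h (x (inv h \<otimes> \<one>)))"
  by (rule rok_mult_coeff[OF x one_closed])
 also have "(\<Oplus>\<^sub>A h\<in>GG. v n (inv h) \<star> \<alpha> h (x (inv h \<otimes> \<one>))) = (\<Oplus>\<^sub>A h\<in>GG. ?g h)"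
  using x by (intro A.finsum_cong') auto
 finally have E: "(rok n \<cdot> x) \<one> = ?c \<odot>\<^sub>A (\<Oplus>\<^sub>A h\<in>GG. ?g h)" .
 have "(rok n \<cdot> F (rok n \<cdot> x)) k = rok n k \<star> \<alpha> k ((rok n \<cdot> x) \<one>)"
  using x k by (simp add: F_eq mult_emb_coeff)
 also have "... = ?c \<odot>\<^sub>A (?c \<odot>\<^sub>A (v n (inv k) \<star> \<alpha> k (\<Oplus>\<^sub>A h\<in>GG. ?g h)))"
  unfolding E rok_coeff[OF k] using k gs by (simp add: act_A_smult A.smult_mult_left A.smult_mult_right)
 also have "... = ?c \<odot>\<^sub>A (rok n \<cdot> x) k" unfolding 1 rok_mult_coeff[OF x k] ..
 finally show "(of_real oG \<odot>\<^sub>M (rok n \<cdot> F (rok n \<cdot> x))) k = (rok n \<cdot> x) k"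
  using x k order_real_ge by (simp add: A.smult_smult[symmetric])
qed (use x in auto)

subsection \<open>Comparison\<close>

abbreviation P :: "nat => 'i => 'g => 'a" where "P n i \<equiv> emb (p n i)"

lemma P_simps:
 assumes "i : I n"
 shows "P n i : MM" "star M (P n i) = P n i" "P n i \<cdot> P n i = P n i" "nrm M (P n i) <= 1"
  "P n i : SG n"
 using assms nrm_p_le[OF assms] stage_crossed_emb[OF p_S[OF assms]]
 by (simp_all add: emb_star[symmetric] emb_mult[symmetric] p_star p_idem emb_isometric)

text \<open>Minimality in the stage handles the coefficient at the identity, and freeness kills all
  others. So a minimal projection of the second summand stays minimal in the crossed product of the
  stage.\<close>

lemma P_corner:
 assumes i: "i : I n" and b: "b : SG n"
 obtains c where "P n i \<cdot> b \<cdot> P n i = c \<odot>\<^sub>M P n i"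
proof -
 have bc: "b : MM" and bS: "!!g. g : GG ==> b g : S n" using b stage_crossedD[OF b] by auto
 obtain c where c: "p n i \<star> b \<one> \<star> p n i = c \<odot>\<^sub>A p n i" using p_minimal[OF i bS[OF one_closed]] by blast
 have "P n i \<cdot> b \<cdot> P n i = c \<odot>\<^sub>M P n i"
 proof (rule crossed_eqI)
  fix k assume k: "k : GG"
  have "(P n i \<cdot> b \<cdot> P n i) k = p n i \<star> b k \<star> \<alpha> k (p n i)"
   using i bc k by (simp add: mult_emb_coeff emb_mult_coeff)
  then show "(P n i \<cdot> b \<cdot> P n i) k = (c \<odot>\<^sub>M P n i) k"
   using i bc k c p_free[OF i bS[OF k] k] by (simp add: act_one)
 qed (use i bc in auto)
 then show ?thesis by (rule that)
qed

lemma emb_q_finsum: "emb (q n) = (\<Oplus>\<^sub>M i\<in>I n. P n i)"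
 unfolding p_sum by (rule star_hom_finsum[OF emb_hom A.pre_cstar_axioms M.pre_cstar_axioms fin_I]) auto

text \<open>\<open>q_faithful\<close> says that cutting one stage later preserves the norm of every
  coefficient; within the same stage an element of the first summand would be cut to 0. One factor
  |G| comes from \<open>nrm_le_sum\<close>, the other from the number of its terms.\<close>

lemma stage_norm_le_cut:
 assumes b: "b : SG n"
 shows "nrm M b <= oG * oG * nrm M (b \<cdot> emb (q (Suc n)))"
proof -
 have bc: "b : MM" and bS: "!!g. g : GG ==> b g : S n" using b stage_crossedD[OF b] by auto
 have "nrm M b <= oG * (\<Sum>g\<in>GG. nrm A (b g))" by (rule nrm_le_sum[OF bc])
 also have "... <= oG * (\<Sum>g\<in>GG. nrm M (b \<cdot> emb (q (Suc n))))"
 proof (intro mult_left_mono sum_mono)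
  fix g assume g: "g : GG"
  have "nrm A (b g) = nrm A ((b \<cdot> emb (q (Suc n))) g)"
   using q_faithful[OF bS[OF g]] bc g q_act[OF g, of "Suc n"] by (simp add: mult_emb_coeff)
  also have "... <= nrm M (b \<cdot> emb (q (Suc n)))"
   using bc g by (intro coeff_le_nrm) auto
  finally show "nrm A (b g) <= nrm M (b \<cdot> emb (q (Suc n)))" .
 qed (use order_real_ge in auto)
 finally show ?thesis by (simp add: oG_def)
qed

lemma emb_q_simps:
 "emb (q n) : MM" "star M (emb (q n)) = emb (q n)" "emb (q n) \<cdot> emb (q n) = emb (q n)"
 "nrm M (emb (q n)) <= 1" "emb (q n) : SG n"
 using nrm_q_le[of n] stage_crossed_emb[OF q_S, of n]
 by (simp_all only: emb_star[OF q_closed, symmetric] emb_mult[OF q_closed q_closed, symmetric] q_idem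
   emb_isometric[OF q_closed] emb_closed[OF q_closed])

lemma stage_crossed_pow: "x : SG n ==> x [^]\<^sub>M Suc k : SG n"
 by (induction k) (auto intro!: stage_crossed_mult)

text \<open>If \<open>a\<close> were small on all columns \<open>M p\<close>, then so would be its powers, which contradicts
 \<open>\<parallel>a\<^sup>k\<parallel> = \<parallel>a\<parallel>\<^sup>k\<close> for \<open>k = 2\<^sup>j\<close>, as the number of columns is fixed.\<close>

lemma column_norming:
 assumes a: "a : SG n" "star M a = a" "a \<cdot> emb (q n) = a" and pos: "nrm M a > 0"
 shows "\<exists>i w. i : I n & w : SG n & w \<cdot> P n i = w & nrm M w > 0 \<and>
  (1/2) * nrm M a * nrm M w <= nrm M (a \<cdot> w)"
proof (rule ccontr)
 assume neg: "\<not> ?thesis"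
 have ac: "a : MM" using a by auto
 have small: "nrm M (a \<cdot> w) <= (1/2) * nrm M a * nrm M w"
  if w: "i : I n" "w : SG n" "w \<cdot> P n i = w" for i w
 proof (cases "nrm M w > 0")
  case True
  then show ?thesis using neg w by (meson linear)
 next
  case False
  then have "nrm M w = 0" using M.nrm_le_zeroD[of w] w by auto
  then have "w = \<zero>\<^sub>M" using M.nrm_eq_0[of w] w by auto
  then show ?thesis using ac by simp
 qed
 have pow: "nrm M (a [^]\<^sub>M k \<cdot> P n i) <= ((1/2) * nrm M a) ^ k" if i: "i : I n" for i and k :: nat
 proof (induction k)
  case 0 show ?case using P_simps[OF i] by simp
 next
  case (Suc k)
  let ?w = "a [^]\<^sub>M k \<cdot> P n i"
  have w: "?w : SG n"
  proof (cases k)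
   case 0 then show ?thesis using P_simps[OF i] by simp
  next
   case (Suc j)
   then show ?thesis using stage_crossed_mult[OF stage_crossed_pow[OF a(1), of j] P_simps(5)[OF i]] by simp
  qed
  have wP: "?w \<cdot> P n i = ?w" using ac P_simps[OF i] by (simp add: M.m_assoc)
  have "a [^]\<^sub>M Suc k \<cdot> P n i = a \<cdot> ?w"
   using ac P_simps[OF i] by (simp only: M.nat_pow_Suc2 M.m_assoc M.nat_pow_closed)
  then have "nrm M (a [^]\<^sub>M Suc k \<cdot> P n i) <= (1/2) * nrm M a * nrm M ?w" using small[OF i w wP] by simp
  also have "... <= (1/2) * nrm M a * ((1/2) * nrm M a) ^ k" using Suc ac by (intro mult_left_mono) auto
  finally show ?case by simp
 qed
 have "nrm M a <= (1/2) * nrm M a"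
 proof (rule power_dominated_le[where C = "real (card (I n))"])
  fix j
  let ?k = "(2::nat) ^ j"
  \<comment> \<open>A positive exponent, so that a = a q gives the same for the power of a.\<close>
  obtain k' where k': "?k = Suc k'" by (metis not0_implies_Suc power_not_zero zero_neq_numeral)
  have "a [^]\<^sub>M ?k = a [^]\<^sub>M ?k \<cdot> emb (q n)"
   unfolding k' using ac a(3) emb_q_simps(1)[of n] by (simp add: M.m_assoc)
  also have "... = (\<Oplus>\<^sub>M i\<in>I n. a [^]\<^sub>M ?k \<cdot> P n i)"
   unfolding emb_q_finsum using ac fin_I by (intro M.finsum_rdistr) (auto simp: P_simps)
  finally have "nrm M (a [^]\<^sub>M ?k) <= (\<Sum>i\<in>I n. nrm M (a [^]\<^sub>M ?k \<cdot> P n i))"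
   using M.nrm_finsum[OF fin_I, of "%i. a [^]\<^sub>M ?k \<cdot> P n i" n] ac by (simp add: P_simps)
  also have "... <= (\<Sum>i\<in>I n. ((1/2) * nrm M a) ^ ?k)" by (intro sum_mono pow)
  finally show "nrm M a ^ 2 ^ j <= real (card (I n)) * ((1/2) * nrm M a) ^ 2 ^ j"
   using M.nrm_pow_selfadjoint[OF ac a(2), of j] by simp
 qed (use ac in simp)
 then show False using pos by simp
qed

text \<open>Self-adjointness makes c a real number r. Were r negative,
  \<open>squares_positive\<close> would bound the norm of |r| (1 + p) by |r|, whereas (1 + p) p = 2
  p shows that 1 + p has norm at least 2.\<close>

lemma corner_scalar_positive:
 assumes i: "i : I n" and d: "d : MM" and eq: "star M d \<cdot> d = c \<odot>\<^sub>M P n i" and d0: "nrm M d > 0"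
 shows "c = of_real ((nrm M d)\<^sup>2)"
proof -
 note P = P_simps[OF i]
 have P0: "nrm M (P n i) ~= 0"
 proof
  assume "nrm M (P n i) = 0"
  then have "(nrm M d)\<^sup>2 = 0" using M.cstar_identity[OF d] P unfolding eq by (simp add: M.nrm_smult)
  then show False using d0 by simp
 qed
 then have P1: "nrm M (P n i) = 1" using M.nrm_projection[OF P(1-3)] by simp
 then have p1: "nrm A (p n i) = 1" using i by (simp add: emb_isometric)
 have cm: "cmod c = (nrm M d)\<^sup>2" using M.cstar_identity[OF d] P P1 unfolding eq by (simp add: M.nrm_smult)
 have "star M (star M d \<cdot> d) = star M d \<cdot> d" using d by (simp add: M.star_mult)
 then have "cnj c \<odot>\<^sub>M P n i = c \<odot>\<^sub>M P n i" unfolding eq using P by (simp add: M.star_smult)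
 then have "nrm M ((cnj c - c) \<odot>\<^sub>M P n i) = 0" using P by (simp add: M.smult_diff_left)
 then have "cnj c = c" using P P1 by (simp add: M.nrm_smult)
 then have "c : \<real>" by (simp add: Reals_cnj_iff)
 then obtain r where r: "c = of_real r" by (auto elim: Reals_cases)
 have "0 <= r"
 proof (rule ccontr)
  assume "\<not> 0 <= r"
  then have rn: "r < 0" by simp
  have f: "untwist d : GG \<rightarrow> AC" using d by (auto simp: untwist_def)
  have s: "(\<Oplus>\<^sub>A h\<in>GG. star A (untwist d h) \<star> untwist d h) = of_real r \<odot>\<^sub>A p n i"
   unfolding inner_coeff[OF d d, symmetric] eq r by simp
  have "nrm A (of_real \<bar>r\<bar> \<odot>\<^sub>A \<one>\<^sub>A \<ominus>\<^sub>A of_real r \<odot>\<^sub>A p n i) <= \<bar>r\<bar>"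
   using squares_positive[unfolded squares_positive_on_def, rule_format, OF f, of "\<bar>r\<bar>"] i
   unfolding s by (simp add: A.nrm_smult p1)
  also have "of_real \<bar>r\<bar> \<odot>\<^sub>A \<one>\<^sub>A \<ominus>\<^sub>A of_real r \<odot>\<^sub>A p n i =
    of_real \<bar>r\<bar> \<odot>\<^sub>A (\<one>\<^sub>A \<oplus>\<^sub>A p n i)"
  proof -
   have "\<ominus>\<^sub>A (of_real r \<odot>\<^sub>A p n i) = of_real \<bar>r\<bar> \<odot>\<^sub>A p n i"
    using i rn A.smult_minus_one[of "of_real r \<odot>\<^sub>A p n i"] A.smult_smult[of "p n i" "-1" "of_real r"]
    by simp
   then show ?thesis using i by (simp add: A.minus_eq A.smult_add_right)
  qed
  finally have "nrm A (\<one>\<^sub>A \<oplus>\<^sub>A p n i) <= 1" using rn i by (simp add: A.nrm_smult)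
  moreover have "(\<one>\<^sub>A \<oplus>\<^sub>A p n i) \<star> p n i = of_real 2 \<odot>\<^sub>A p n i"
   using i A.smult_add_left[of "p n i" 1 1] by (simp add: A.l_distr p_idem)
  then have "2 <= nrm A (\<one>\<^sub>A \<oplus>\<^sub>A p n i) * nrm A (p n i)"
   using A.nrm_mult[of "\<one>\<^sub>A \<oplus>\<^sub>A p n i" "p n i"] i by (simp add: A.nrm_smult p1)
  ultimately show False using p1 by simp
 qed
 then show ?thesis using cm r by simp
qed

text \<open>A column w = w P nearly attains the norm of the cut-down a, so d = b w' is not small;
  and d* d lies in the corner of P, where it is the scalar |d|^2. Dividing by |d| makes y0 b* b y0*
  = P exact, and \<open>p_compare\<close> moves P to some q_j with j as late as desired. The bound
  on |y| |b| is the same for all stages, which later makes sequences of such y bounded.\<close>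

lemma stage_compare:
 assumes b: "b : SG N" and b0: "nrm M b > 0"
 shows "\<exists>j\<ge>J. \<exists>y\<in>MM. y \<cdot> (star M b \<cdot> b) \<cdot> star M y = emb (q j) \<and>
  nrm M y * nrm M b <= 2 * oG ^ 4"
proof -
 \<comment> \<open>One stage after b, where cutting by q is faithful on it.\<close>
 let ?n = "Suc N"
 let ?Q = "emb (q ?n)"
 note Q = emb_q_simps[of ?n]
 have bc: "b : MM" using b by auto
 have bn: "b : SG ?n" using stage_crossed_mono[OF _ b, of ?n] by simp
 let ?a = "star M (b \<cdot> ?Q) \<cdot> (b \<cdot> ?Q)"
 have a_S: "?a : SG ?n" using bn Q(5) by (intro stage_crossed_mult stage_crossed_star)
 have ac: "?a : MM" using a_S by auto
 have a_star: "star M ?a = ?a" using bc Q(1) by (simp add: M.star_mult)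
 have aQ: "?a \<cdot> ?Q = ?a" using bc Q(1,3) by (simp add: M.m_assoc)
 have an: "nrm M ?a = (nrm M (b \<cdot> ?Q))\<^sup>2" using bc Q(1) by (intro M.cstar_identity) auto
 have le: "nrm M b <= oG\<^sup>2 * nrm M (b \<cdot> ?Q)"
  using stage_norm_le_cut[OF b] by (simp add: power2_eq_square)
 have "(nrm M b)\<^sup>2 <= (oG\<^sup>2 * nrm M (b \<cdot> ?Q))\<^sup>2" using le bc by (intro power_mono) auto
 then have abound: "(nrm M b)\<^sup>2 <= oG ^ 4 * nrm M ?a"
  by (simp add: an power_mult_distrib power_mult[symmetric])
 moreover have "(nrm M b)\<^sup>2 > 0" using b0 by simp
 ultimately have "oG ^ 4 * nrm M ?a > 0" by linarith
 then have a0: "nrm M ?a > 0" using order_real_ge by (simp add: zero_less_mult_iff)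
 obtain i w where i: "i : I ?n" and w: "w : SG ?n" "w \<cdot> P ?n i = w" "nrm M w > 0"
  and aw: "(1/2) * nrm M ?a * nrm M w <= nrm M (?a \<cdot> w)"
  using column_norming[OF a_S a_star aQ a0] by blast
 note P = P_simps[OF i]
 have wc: "w : MM" using w by auto
 \<comment> \<open>The cut is moved from b to the column. With Q the cutting projection, a w = Q b*
   d, so |d| is bounded below by |a w| / |b|.\<close>
 define w' where "w' = ?Q \<cdot> w"
 have w'S: "w' : SG ?n" unfolding w'_def by (intro stage_crossed_mult Q(5) w(1))
 then have w'c: "w' : MM" by auto
 have w'P: "w' \<cdot> P ?n i = w'" unfolding w'_def using w(2) wc P(1) Q(1) by (simp add: M.m_assoc)
 have w'n: "nrm M w' <= nrm M w"
  using M.nrm_mult[OF Q(1) wc] mult_right_mono[OF Q(4), of "nrm M w"] wc by (simp add: w'_def)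
 define d where "d = b \<cdot> w'"
 have dc: "d : MM" unfolding d_def using bc w'c by simp
 have "?a \<cdot> w = (?Q \<cdot> star M b) \<cdot> d"
  unfolding d_def w'_def using bc Q wc by (simp add: M.star_mult M.m_assoc)
 then have "nrm M (?a \<cdot> w) <= nrm M (?Q \<cdot> star M b) * nrm M d"
  using M.nrm_mult[of "?Q \<cdot> star M b" d] bc Q(1) dc by simp
 also have "... <= nrm M b * nrm M d"
 proof (rule mult_right_mono)
  show "nrm M (?Q \<cdot> star M b) <= nrm M b"
   using M.nrm_mult[OF Q(1) M.star_closed[OF bc]] mult_right_mono[OF Q(4), of "nrm M b"] bc by simp
 qed (use dc in simp)
 finally have dge: "(1/2) * nrm M ?a * nrm M w <= nrm M b * nrm M d" using aw by linarith
 have d0: "nrm M d > 0"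
 proof -
  have "0 < (1/2) * nrm M ?a * nrm M w" using a0 w(3) by simp
  then have "0 < nrm M b * nrm M d" using dge by linarith
  then show ?thesis using b0 by (simp add: zero_less_mult_iff)
 qed
 let ?m = "star M w' \<cdot> (star M b \<cdot> b) \<cdot> w'"
 have mS: "?m : SG ?n"
  using w'S bn by (intro stage_crossed_mult stage_crossed_star)
 have dd: "star M d \<cdot> d = ?m" unfolding d_def using bc w'c by (simp add: M.star_mult M.m_assoc)
 have w'P': "P ?n i \<cdot> star M w' = star M w'"
  using arg_cong[OF w'P, of "star M"] w'c P by (simp add: M.star_mult)
 obtain c where "P ?n i \<cdot> ?m \<cdot> P ?n i = c \<odot>\<^sub>M P ?n i" by (rule P_corner[OF i mS])
 moreover have "P ?n i \<cdot> ?m \<cdot> P ?n i = (P ?n i \<cdot> star M w') \<cdot> (star M b \<cdot> b) \<cdot> (w' \<cdot> P ?n i)"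
  using P(1) bc w'c by (simp add: M.m_assoc)
 ultimately have mc: "?m = c \<odot>\<^sub>M P ?n i" using w'P w'P' by simp
 have c: "c = of_real ((nrm M d)\<^sup>2)"
  by (rule corner_scalar_positive[OF i dc _ d0]) (simp add: dd mc)
 define y0 where "y0 = of_real (1 / nrm M d) \<odot>\<^sub>M star M w'"
 have y0c: "y0 : MM" using w'c by (simp add: y0_def)
 have "y0 \<cdot> (star M b \<cdot> b) \<cdot> star M y0 =
   of_real (1 / nrm M d) \<odot>\<^sub>M (of_real (1 / nrm M d) \<odot>\<^sub>M ?m)"
  unfolding y0_def using w'c bc by (simp add: M.star_smult M.smult_mult_left M.smult_mult_right)
 also have "... = P ?n i"
  unfolding mc c using P(1) d0 by (simp add: M.smult_smult[symmetric] power2_eq_square flip: of_real_mult)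
 finally have y0: "y0 \<cdot> (star M b \<cdot> b) \<cdot> star M y0 = P ?n i" .
 have y0n: "nrm M y0 <= nrm M w / nrm M d"
  unfolding y0_def using w'c w'n d0 by (simp add: M.nrm_smult norm_divide divide_right_mono)
 \<comment> \<open>The column gives |w| / |d| <= 2 |b| / |a|, and faithfulness of the cut gives
   |b|^2 <= |G|^4 |a|; together they yield 2 |G|^4.\<close>
 have y0b: "nrm M y0 * nrm M b <= 2 * oG ^ 4"
 proof -
  have "nrm M w / nrm M d <= 2 * nrm M b / nrm M ?a" using dge a0 d0 by (simp add: divide_simps mult_ac)
  then have "nrm M y0 * nrm M b <= (2 * nrm M b / nrm M ?a) * nrm M b"
   using y0n b0 by (intro mult_right_mono) auto
  also have "... = 2 * (nrm M b)\<^sup>2 / nrm M ?a" by (simp add: power2_eq_square)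
  also have "... <= 2 * (oG ^ 4 * nrm M ?a) / nrm M ?a"
   using abound a0 by (intro divide_right_mono mult_left_mono) auto
  also have "... = 2 * oG ^ 4" using a0 by simp
  finally show ?thesis .
 qed
 obtain j y1 where j: "j >= J" and y1: "y1 : AC" "y1 \<star> p ?n i \<star> star A y1 = q j"
  using p_compare[OF i, of J] by blast
 define y2 where "y2 = emb y1 \<cdot> P ?n i"
 have y2c: "y2 : MM" using y1 P(1) by (simp add: y2_def)
 have y2q: "y2 \<cdot> star M y2 = emb (q j)"
 proof -
  have "y2 \<cdot> star M y2 = emb y1 \<cdot> (P ?n i \<cdot> P ?n i) \<cdot> star M (emb y1)"
   unfolding y2_def using y1(1) P(1,2) by (simp add: M.star_mult M.m_assoc)
  also have "... = emb (y1 \<star> p ?n i \<star> star A y1)"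
   using y1(1) i P(3) by (simp add: emb_mult emb_star)
  finally show ?thesis using y1(2) by simp
 qed
 \<comment> \<open>Since y2 y2* is the projection q_j, passing from P to q_j does not increase the
   norm of the comparing element.\<close>
 have "(nrm M y2)\<^sup>2 <= 1"
  using M.cstar_identity[OF M.star_closed[OF y2c]] y2c y2q emb_q_simps(4)[of j] by simp
 then have y2n: "nrm M y2 <= 1" using y2c by (simp add: abs_square_le_1)
 let ?y = "y2 \<cdot> y0"
 have "?y \<cdot> (star M b \<cdot> b) \<cdot> star M ?y =
   y2 \<cdot> (y0 \<cdot> (star M b \<cdot> b) \<cdot> star M y0) \<cdot> star M y2"
  using y2c y0c bc by (simp add: M.star_mult M.m_assoc)
 also have "... = y2 \<cdot> star M y2"
  unfolding y0 using y1(1) P by (simp add: y2_def M.m_assoc)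
 finally have yeq: "?y \<cdot> (star M b \<cdot> b) \<cdot> star M ?y = emb (q j)" using y2q by simp
 have "nrm M ?y <= nrm M y0"
  using M.nrm_mult[OF y2c y0c] mult_right_mono[OF y2n, of "nrm M y0"] y0c by simp
 then have "nrm M ?y * nrm M b <= 2 * oG ^ 4"
  using y0b mult_right_mono[of "nrm M ?y" "nrm M y0" "nrm M b"] b0 by linarith
 then show ?thesis using j yeq y2c y0c by (intro exI[of _ j] conjI bexI[of _ ?y]) auto
qed

end

section \<open>Simplicity\<close>

context pre_cstar
begin

lemma sub_sub: assumes "x : carrier C" "y : carrier C" shows "x \<ominus> (x \<ominus> y) = y"
proof -
 have "x \<ominus> (x \<ominus> y) = x \<oplus> (y \<ominus> x)" using assms minus_swap[of x y] by (simp add: minus_eq[of x "x \<ominus> y"])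
 also have "... = y" using assms minus_add_cancel[of y x] by (simp add: a_comm)
 finally show ?thesis .
qed

text \<open>With \<open>t = p (p - d) p\<close>, all \<open>p - t\<^sup>n\<close> are in the ideal, and \<open>t\<^sup>n\<close> tends to zero.\<close>

lemma projection_in_closed_ideal:
 assumes J: "ideal J C" "norm_closed C J" and p: "p : carrier C" "star C p = p" "p \<otimes> p = p"
  and d: "d : J" "nrm C (p \<ominus> d) <= 1/2"
 shows "p : J"
proof -
 interpret J: ideal J C by fact
 have dc: "d : carrier C" using J.a_subset d(1) by blast
 define t where "t = p \<otimes> (p \<ominus> d) \<otimes> p"
 have tc: "t : carrier C" using p dc by (simp add: t_def)
 have pp: "p \<otimes> (p \<otimes> x) = p \<otimes> x" if "x : carrier C" for x
  using p that by (simp add: m_assoc[symmetric])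
 have pt: "p \<otimes> t = t" using p(1) dc by (simp add: t_def m_assoc pp)
 have pn: "nrm C p <= 1" using nrm_projection[OF p] by auto
 have "nrm C t <= nrm C p * nrm C (p \<ominus> d) * nrm C p"
  unfolding t_def using p dc nrm_mult[of "p \<otimes> (p \<ominus> d)" p] mult_right_mono[OF nrm_mult[of p "p \<ominus> d"], of "nrm C p"]
  by simp
 also have "... <= 1 * (1/2) * 1" using p dc d(2) pn by (intro mult_mono) auto
 finally have tn: "nrm C t <= 1/2" by simp
 have "p \<ominus> t = p \<otimes> d \<otimes> p"
  using p dc by (simp add: t_def minus_mult_left minus_mult_right sub_sub)
 then have ptJ: "p \<ominus> t : J" using J.I_l_closed[OF d(1) p(1)] J.I_r_closed[of "p \<otimes> d" p] p(1) by simp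
 have mem: "p \<ominus> t [^] Suc n : J" for n
 proof (induction n)
  case (Suc n)
  have "(p \<ominus> t) \<oplus> (p \<ominus> t [^] Suc n) \<otimes> t = (p \<ominus> t) \<oplus> (t \<ominus> t [^] Suc (Suc n))"
   using p tc pt by (simp add: minus_mult_left)
  also have "... = p \<ominus> t [^] Suc (Suc n)" using p tc by (intro minus_telescope) auto
  finally show ?case using J.a_closed[OF ptJ J.I_r_closed[OF Suc tc]] by simp
 qed (use ptJ tc in simp)
 have "norm_lim C (%n. p \<ominus> t [^] Suc n) p"
  unfolding norm_lim_def
 proof (rule tendsto_sandwich[OF _ _ tendsto_const])
  show "(%n. (1/2::real) ^ Suc n) \<longlonglongrightarrow> 0" by (rule LIMSEQ_Suc[OF LIMSEQ_realpow_zero]) auto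
  show "eventually (%n. nrm C ((p \<ominus> t [^] Suc n) \<ominus> p) <= (1/2) ^ Suc n) sequentially"
  proof (intro always_eventually allI)
   fix n
   have "nrm C ((p \<ominus> t [^] Suc n) \<ominus> p) = nrm C (t [^] Suc n)"
    using p tc nrm_swap[of "p \<ominus> t [^] Suc n" p] by (simp add: sub_sub)
   also have "... <= nrm C t ^ Suc n" by (rule nrm_pow[OF tc])
   also have "... <= (1/2) ^ Suc n" using tn tc by (intro power_mono) auto
   finally show "nrm C ((p \<ominus> t [^] Suc n) \<ominus> p) <= (1/2) ^ Suc n" .
  qed
  show "eventually (%n. 0 <= nrm C ((p \<ominus> t [^] Suc n) \<ominus> p)) sequentially"
   using p tc by (intro always_eventually allI nrm_nonneg) auto
 qed
 moreover have "range (%n. p \<ominus> t [^] Suc n) <= J" using mem by auto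
 ultimately show ?thesis using J(2) p(1) unfolding norm_closed_def by blast
qed

text \<open>Transfers a comparison that is exact for a stage element b to a nearby x. The error
  carries the factor |y|^2, which is why \<open>stage_compare\<close> controls the norm of
  y.\<close>

lemma nrm_conj_square_diff:
 assumes "y : carrier C" "x : carrier C" "b : carrier C"
 shows "nrm C (y \<otimes> (star C x \<otimes> x) \<otimes> star C y \<ominus> y \<otimes> (star C b \<otimes> b) \<otimes> star C y) \<le>
  (nrm C y)\<^sup>2 * (nrm C (x \<ominus> b) * (nrm C x + nrm C b))"
proof -
 let ?z = "star C x \<otimes> x \<ominus> star C b \<otimes> b"
 have z: "nrm C ?z <= nrm C (x \<ominus> b) * (nrm C x + nrm C b)"
  using nrm_mult_diff[of "star C x" x "star C b" b] assms nrm_star[of "x \<ominus> b"]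
  by (simp add: star_diff algebra_simps)
 have "nrm C (y \<otimes> ?z \<otimes> star C y) <= nrm C y * nrm C ?z * nrm C y"
  using nrm_mult[of "y \<otimes> ?z" "star C y"] mult_right_mono[OF nrm_mult[of y ?z], of "nrm C y"] assms by simp
 also have "... = (nrm C y)\<^sup>2 * nrm C ?z" by (simp add: power2_eq_square)
 also have "... <= (nrm C y)\<^sup>2 * (nrm C (x \<ominus> b) * (nrm C x + nrm C b))" by (intro mult_left_mono z) simp
 finally show ?thesis using assms by (simp add: minus_mult_left minus_mult_right)
qed

end

lemma (in ideal) finsum_in_ideal:
 "[|finite J; !!j. j : J ==> f j : I|] ==> (\<Oplus>j\<in>J. f j) : I"
proof (induction J rule: finite_induct)
 case (insert j J)
 then have "f : J \<rightarrow> carrier R" "f j : carrier R" using a_subset by auto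
 then show ?case using insert by (simp add: finsum_insert a_closed)
qed (use zero_closed in simp)

context representable_system
begin

text \<open>The unit belongs to stage n as the sum of \<open>q n\<close> and
  \<open>v n \<one>\<close>, so faithfulness of the next cut applies to it.\<close>

lemma nrm_emb_q: "nrm A (q (Suc n)) = 1"
proof -
 have "\<one>\<^sub>A = q n \<oplus>\<^sub>A v n \<one>" using A.minus_add_cancel[of "\<one>\<^sub>A" "v n \<one>"] by simp
 then have "\<one>\<^sub>A : S n" using S_add[OF q_S v_S[OF one_closed]] by metis
 then show ?thesis using q_faithful[of "\<one>\<^sub>A" n] nrm_one by simp
qed

lemma I_nonempty: "I (Suc n) ~= {}"
proof
 assume "I (Suc n) = {}"
 then have "q (Suc n) = \<zero>\<^sub>A" unfolding p_sum by simp
 then show False using nrm_emb_q[of n] by simp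
qed

lemma nrm_M_one: "nrm M \<one>\<^sub>M = 1"
 using emb_isometric[of "\<one>\<^sub>A"] nrm_one by (simp add: emb_one)

lemma P_full:
 assumes i: "i : I n"
 shows "\<exists>(d::nat) w. w : {..<d} \<rightarrow> AC \<and>
  \<one>\<^sub>M = (\<Oplus>\<^sub>M j\<in>{..<d}. emb (w j) \<cdot> P n i \<cdot> emb (star A (w j)))"
proof -
 obtain d :: nat and w where w: "w : {..<d} \<rightarrow> AC"
  and eq: "\<one>\<^sub>A = (\<Oplus>\<^sub>A j\<in>{..<d}. w j \<star> p n i \<star> star A (w j))"
  using p_full[OF i] by blast
 have wj: "w j : AC" if "j < d" for j using w that by auto
 have "emb \<one>\<^sub>A = (\<Oplus>\<^sub>M j\<in>{..<d}. emb (w j \<star> p n i \<star> star A (w j)))"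
  unfolding eq using wj i
  by (intro star_hom_finsum[OF emb_hom A.pre_cstar_axioms M.pre_cstar_axioms]) auto
 also have "... = (\<Oplus>\<^sub>M j\<in>{..<d}. emb (w j) \<cdot> P n i \<cdot> emb (star A (w j)))"
  using wj i by (intro M.finsum_cong') (auto simp: emb_mult)
 finally show ?thesis using w unfolding emb_one by (intro exI[of _ d] exI[of _ w]) simp
qed

text \<open>Approximate x by a stage element b, for which some y b* b y* is a projection q_j. Then y
  x* x y* is an element of the ideal within 1/2 of q_j, so the ideal contains q_j, hence a minimal
  projection below it, hence 1 by \<open>P_full\<close>.\<close>

lemma ideal_full:
 assumes K: "ideal K M" "norm_closed M K" and x: "x : K" "x ~= \<zero>\<^sub>M"
 shows "K = MM"
proof -
 interpret K: ideal K M by fact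
 have xc: "x : MM" using K.a_subset x(1) by blast
 define \<nu> where "\<nu> = nrm M x"
 have \<nu>: "\<nu> > 0" using M.nrm_le_zero_imp[OF xc] x(2) unfolding \<nu>_def by force
 define c where "c = 2 * oG ^ 4"
 have c: "c >= 2" using one_le_power[OF order_real_ge, of 4] by (simp add: c_def)
 \<comment> \<open>With |y| <= 2 c / \<nu> and |x| + |b| <= 3 \<nu> the error is at most (2 c /
   \<nu>)^2 \<delta> 3 \<nu> = 12 c^2 \<delta> / \<nu>; the 24 makes this 1/2.\<close>
 define \<delta> where "\<delta> = \<nu> / (24 * c\<^sup>2)"
 have "c\<^sup>2 >= 1" using c one_le_power[of c 2] by simp
 then have "\<nu> * 2 <= \<nu> * (24 * c\<^sup>2)" using \<nu> by (intro mult_left_mono) auto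
 then have \<delta>: "\<delta> > 0" "\<delta> <= \<nu> / 2" using \<nu> c by (simp_all add: \<delta>_def divide_simps)
 obtain N b where b: "b : SG N" "nrm M (x \<ominus>\<^sub>M b) < \<delta>"
  by (rule stage_crossed_dense[OF xc \<delta>(1)])
 have bc: "b : MM" using b(1) by blast
 have bn: "\<nu> / 2 <= nrm M b" "nrm M b <= 2 * \<nu>"
  using M.nrm_diff_abs[OF xc bc] b(2) \<delta>(2) \<nu> by (auto simp: \<nu>_def[symmetric])
 then have "nrm M b > 0" using \<nu> by linarith
 \<comment> \<open>A positive j is requested because \<open>I_nonempty\<close> speaks of successor
   stages.\<close>
 then obtain j y where j: "j >= 1" and y: "y : MM"
  and yb: "y \<cdot> (star M b \<cdot> b) \<cdot> star M y = emb (q j)" and yn: "nrm M y * nrm M b <= c"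
  using stage_compare[OF b(1), of 1] unfolding c_def by blast
 have "nrm M y * (\<nu> / 2) <= c" using mult_left_mono[OF bn(1), of "nrm M y"] yn y by simp
 then have yn': "nrm M y <= 2 * c / \<nu>" using \<nu> by (simp add: field_simps)
 let ?d = "y \<cdot> (star M x \<cdot> x) \<cdot> star M y"
 have dK: "?d : K" using x(1) xc y by (intro K.I_l_closed K.I_r_closed) auto
 have "nrm M (emb (q j) \<ominus>\<^sub>M ?d) = nrm M (?d \<ominus>\<^sub>M y \<cdot> (star M b \<cdot> b) \<cdot> star M y)"
  unfolding yb[symmetric] using xc y bc by (intro M.nrm_swap) auto
 also have "... <= (nrm M y)\<^sup>2 * (nrm M (x \<ominus>\<^sub>M b) * (nrm M x + nrm M b))"
  by (rule M.nrm_conj_square_diff[OF y xc bc])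
 also have "... <= (2 * c / \<nu>)\<^sup>2 * (\<delta> * (3 * \<nu>))"
  using yn' b(2) bn y xc bc \<nu> \<delta> by (intro mult_mono power_mono) (auto simp: \<nu>_def[symmetric])
 also have "... = 1/2" using \<nu> c by (simp add: \<delta>_def field_simps power2_eq_square)
 finally have "nrm M (emb (q j) \<ominus>\<^sub>M ?d) <= 1/2" .
 from M.projection_in_closed_ideal[OF K emb_q_simps(1-3) dK this] have qK: "emb (q j) : K" .
 obtain n where n: "j = Suc n" using j by (cases j) auto
 obtain i where i: "i : I j" using I_nonempty[of n] n by auto
 have "P j i = P j i \<cdot> emb (q j)" using i by (simp add: emb_mult[symmetric] p_q)
 then have PK: "P j i : K" using K.I_l_closed[OF qK P_simps(1)[OF i]] by simp
 obtain d :: nat and w where w: "w : {..<d} \<rightarrow> AC"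
  and eq: "\<one>\<^sub>M = (\<Oplus>\<^sub>M k\<in>{..<d}. emb (w k) \<cdot> P j i \<cdot> emb (star A (w k)))"
  using P_full[OF i] by blast
 have "emb (w k) \<cdot> P j i \<cdot> emb (star A (w k)) : K" if "k : {..<d}" for k
 proof -
  have "w k : AC" using w that by auto
  then show ?thesis using PK by (intro K.I_l_closed K.I_r_closed) auto
 qed
 then have "\<one>\<^sub>M : K" unfolding eq by (intro K.finsum_in_ideal) auto
 then show ?thesis by (rule K.one_imp_carrier)
qed

lemma simple_crossed: "simple_cstar M"
 unfolding simple_cstar_def
proof (intro conjI allI impI)
 show "MM ~= {\<zero>\<^sub>M}" using nrm_M_one M.one_closed M.nrm_zero by (metis singletonD zero_neq_one)
 fix K assume K: "ideal K M & norm_closed M K"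
 then interpret K: ideal K M by simp
 show "K = {\<zero>\<^sub>M} \<or> K = MM"
 proof (cases "\<exists>x\<in>K. x ~= \<zero>\<^sub>M")
  case True then show ?thesis using ideal_full K by blast
 next
  case False then show ?thesis using K.zero_closed by blast
 qed
qed

section \<open>The relative commutant is trivial\<close>

text \<open>Fullness writes 1 as a sum of terms w P w*. As d commutes with A, d^k is the sum of the
  w (d P)^k w*, with the same w for all k, and along k = 2^j the constant disappears. A remaining
  constant would depend on P, hence on the stage at which an element is approximated, and would
  spoil the limit taken afterwards.\<close>

lemma commuting_nrm_le_corner:
 assumes i: "i : I n" and d: "d : MM" "star M d = d"
  and comm: "!!a. a : AC ==> emb a \<cdot> d = d \<cdot> emb a"
 shows "nrm M d <= nrm M (d \<cdot> P n i)"
proof -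
 note P = P_simps[OF i]
 obtain m :: nat and w where w: "w : {..<m} \<rightarrow> AC"
  and eq: "\<one>\<^sub>M = (\<Oplus>\<^sub>M k\<in>{..<m}. emb (w k) \<cdot> P n i \<cdot> emb (star A (w k)))"
  using P_full[OF i] by blast
 have wk: "w k : AC" if "k < m" for k using w that by auto
 let ?c = "\<Sum>k<m. nrm A (w k) * nrm A (w k)"
 have dp: "d [^]\<^sub>M Suc k \<cdot> P n i = (d \<cdot> P n i) [^]\<^sub>M Suc k" for k
 proof (induction k)
  case (Suc k)
  have "d [^]\<^sub>M Suc (Suc k) \<cdot> P n i = d [^]\<^sub>M Suc k \<cdot> (P n i \<cdot> (d \<cdot> P n i))"
   using d(1) P(1) comm[of "p n i"] i P(3) by (simp add: M.m_assoc[symmetric]) (simp add: M.m_assoc)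
  also have "... = (d [^]\<^sub>M Suc k \<cdot> P n i) \<cdot> (d \<cdot> P n i)"
   using d(1) P(1) by (intro M.m_assoc[symmetric]) auto
  finally show ?case unfolding Suc by simp
 qed (use d P in simp)
 have dw: "d [^]\<^sub>M (k::nat) \<cdot> emb a = emb a \<cdot> d [^]\<^sub>M k" if "a : AC" for a k
 proof (induction k)
  case (Suc k)
  have "d [^]\<^sub>M Suc k \<cdot> emb a = (d [^]\<^sub>M k \<cdot> emb a) \<cdot> d"
   using d(1) that comm[OF that] by (simp add: M.m_assoc)
  then show ?case unfolding Suc using d(1) that by (simp add: M.m_assoc)
 qed (use that in simp)
 show ?thesis
 proof (rule power_dominated_le[where C = ?c])
  fix j
  obtain k where k: "(2::nat) ^ j = Suc k" by (metis not0_implies_Suc power_not_zero zero_neq_numeral)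
  let ?x = "%l. emb (w l) \<cdot> (d \<cdot> P n i) [^]\<^sub>M Suc k \<cdot> emb (star A (w l))"
  have "d [^]\<^sub>M Suc k = d [^]\<^sub>M Suc k \<cdot> (\<Oplus>\<^sub>M l\<in>{..<m}. emb (w l) \<cdot> P n i \<cdot> emb (star A (w l)))"
   unfolding eq[symmetric] using d(1) by simp
  also have "... = (\<Oplus>\<^sub>M l\<in>{..<m}. d [^]\<^sub>M Suc k \<cdot> (emb (w l) \<cdot> P n i \<cdot> emb (star A (w l))))"
   using d(1) wk P(1) by (intro M.finsum_rdistr) auto
  also have "... = (\<Oplus>\<^sub>M l\<in>{..<m}. ?x l)"
  proof (intro M.finsum_cong' refl)
   fix l assume "l : {..<m}"
   then have l: "w l : AC" using wk by simp
   have "d [^]\<^sub>M Suc k \<cdot> (emb (w l) \<cdot> P n i \<cdot> emb (star A (w l))) =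
     (d [^]\<^sub>M Suc k \<cdot> emb (w l)) \<cdot> (P n i \<cdot> emb (star A (w l)))"
    using d(1) l P(1) by (simp add: M.m_assoc del: M.nat_pow_Suc)
   also have "... = emb (w l) \<cdot> (d [^]\<^sub>M Suc k \<cdot> P n i) \<cdot> emb (star A (w l))"
    unfolding dw[OF l] using d(1) l P(1) by (simp add: M.m_assoc del: M.nat_pow_Suc)
   finally show "d [^]\<^sub>M Suc k \<cdot> (emb (w l) \<cdot> P n i \<cdot> emb (star A (w l))) = ?x l" unfolding dp .
  qed (use d(1) wk P(1) in auto)
  finally have "nrm M (d [^]\<^sub>M Suc k) <= (\<Sum>l<m. nrm M (?x l))"
   using M.nrm_finsum[of "{..<m}" ?x] wk d(1) P(1) by (simp del: M.nat_pow_Suc)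
  also have "... <= (\<Sum>l<m. nrm A (w l) * nrm A (w l) * nrm M (d \<cdot> P n i) ^ Suc k)"
  proof (rule sum_mono)
   fix l assume "l : {..<m}"
   then have l: "w l : AC" using wk by simp
   let ?t = "(d \<cdot> P n i) [^]\<^sub>M Suc k"
   have tc: "?t : MM" using d(1) P(1) by blast
   have "nrm M (?x l) <= nrm M (emb (w l)) * nrm M ?t * nrm M (emb (star A (w l)))"
    using M.nrm_mult[of "emb (w l) \<cdot> ?t" "emb (star A (w l))"] tc l
     mult_right_mono[OF M.nrm_mult[of "emb (w l)" ?t], of "nrm M (emb (star A (w l)))"]
    by (simp del: M.nat_pow_Suc)
   also have "... = nrm A (w l) * nrm A (w l) * nrm M ?t" using l by (simp add: emb_isometric del: M.nat_pow_Suc)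
   also have "... <= nrm A (w l) * nrm A (w l) * nrm M (d \<cdot> P n i) ^ Suc k"
    using l d(1) P(1) by (intro mult_left_mono M.nrm_pow) auto
   finally show "nrm M (?x l) <= nrm A (w l) * nrm A (w l) * nrm M (d \<cdot> P n i) ^ Suc k" .
  qed
  finally show "nrm M d ^ 2 ^ j <= ?c * nrm M (d \<cdot> P n i) ^ 2 ^ j"
   using M.nrm_pow_selfadjoint[OF d, of j] by (simp only: k sum_distrib_right)
 qed (use d P in simp)
qed

text \<open>Take b near c at some stage and a minimal corner with P b P = \<mu> P. Then d = c -
  \<mu> 1 is small on this corner, and since d* d commutes with A, the corner controls its whole
  norm.\<close>

lemma commutant_near_scalar:
 assumes c: "c : MM" and comm: "!!a. a : AC ==> emb a \<cdot> c = c \<cdot> emb a" and e: "\<eta> > 0"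
 shows "\<exists>\<mu>. nrm M (c \<ominus>\<^sub>M \<mu> \<odot>\<^sub>M \<one>\<^sub>M) <= \<eta>"
proof -
 obtain N b where b: "b : SG N" and cb: "nrm M (c \<ominus>\<^sub>M b) < \<eta>" by (rule stage_crossed_dense[OF c e])
 have b': "b : SG (Suc N)" using stage_crossed_mono[OF _ b, of "Suc N"] by simp
 have bc: "b : MM" using b by blast
 obtain i where i: "i : I (Suc N)" using I_nonempty by auto
 let ?P = "P (Suc N) i"
 note P = P_simps[OF i]
 obtain \<mu> where \<mu>: "?P \<cdot> b \<cdot> ?P = \<mu> \<odot>\<^sub>M ?P" by (rule P_corner[OF i b'])
 define d where "d = c \<ominus>\<^sub>M \<mu> \<odot>\<^sub>M \<one>\<^sub>M"
 have dc: "d : MM" using c by (simp add: d_def)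
 have dcomm: "emb a \<cdot> d = d \<cdot> emb a" if "a : AC" for a
  using that c comm[OF that] by (simp add: d_def M.minus_mult_left M.minus_mult_right M.smult_mult_left M.smult_mult_right)
 have sdcomm: "emb a \<cdot> star M d = star M d \<cdot> emb a" if "a : AC" for a
  using arg_cong[OF dcomm[of "star A a"], of "star M"] that dc by (simp add: M.star_mult emb_star[symmetric])
 have Pd: "?P \<cdot> d = d \<cdot> ?P" using dcomm i by simp
 \<comment> \<open>Because \<mu> P equals P b P, the corner of d is P (c - b) P, of norm at most
   \<eta>.\<close>
 have "d \<cdot> ?P = ?P \<cdot> d \<cdot> ?P" using Pd P dc by (simp add: M.m_assoc)
 also have "... = ?P \<cdot> c \<cdot> ?P \<ominus>\<^sub>M \<mu> \<odot>\<^sub>M ?P"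
  using c P by (simp add: d_def M.minus_mult_left M.minus_mult_right M.smult_mult_left M.smult_mult_right)
 also have "... = ?P \<cdot> (c \<ominus>\<^sub>M b) \<cdot> ?P"
  unfolding \<mu>[symmetric] using c bc P(1) by (simp add: M.minus_mult_left M.minus_mult_right)
 finally have "nrm M (d \<cdot> ?P) <= nrm M ?P * nrm M (c \<ominus>\<^sub>M b) * nrm M ?P"
  using M.nrm_mult[of "?P \<cdot> (c \<ominus>\<^sub>M b)" ?P] mult_right_mono[OF M.nrm_mult[of ?P "c \<ominus>\<^sub>M b"], of "nrm M ?P"]
   c bc P(1) by simp
 also have "... <= 1 * \<eta> * 1" using P c bc cb e by (intro mult_mono) auto
 finally have dP: "nrm M (d \<cdot> ?P) <= \<eta>" by simp
 have "(nrm M d)\<^sup>2 = nrm M (star M d \<cdot> d)" using M.cstar_identity[OF dc] by simp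
 also have "... <= nrm M (star M d \<cdot> d \<cdot> ?P)"
 proof (rule commuting_nrm_le_corner[OF i])
  fix a assume a: "a : AC"
  have "emb a \<cdot> (star M d \<cdot> d) = (star M d \<cdot> emb a) \<cdot> d"
   using a dc sdcomm[OF a] by (simp add: M.m_assoc[symmetric])
  then show "emb a \<cdot> (star M d \<cdot> d) = star M d \<cdot> d \<cdot> emb a"
   using a dc dcomm[OF a] by (simp add: M.m_assoc)
 qed (use dc in "auto simp: M.star_mult")
 also have "star M d \<cdot> d \<cdot> ?P = star M (d \<cdot> ?P) \<cdot> (d \<cdot> ?P)"
 proof -
  have "star M (d \<cdot> ?P) \<cdot> (d \<cdot> ?P) = (?P \<cdot> star M d) \<cdot> (d \<cdot> ?P)"
   using dc P by (simp add: M.star_mult)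
  also have "... = star M d \<cdot> (?P \<cdot> d) \<cdot> ?P"
   using sdcomm[of "p (Suc N) i"] i dc P(1) by (simp add: M.m_assoc)
  also have "... = star M d \<cdot> d \<cdot> ?P" unfolding Pd using dc P by (simp add: M.m_assoc)
  finally show ?thesis ..
 qed
 also have "nrm M (star M (d \<cdot> ?P) \<cdot> (d \<cdot> ?P)) <= \<eta>\<^sup>2"
  using M.cstar_identity[of "d \<cdot> ?P"] dc P(1) dP by (simp add: power_mono)
 finally have "nrm M d <= \<eta>" by (rule power2_le_imp_le) (use e in simp)
 then show ?thesis unfolding d_def by blast
qed

text \<open>Multiples of 1 have norm equal to the modulus of the scalar, so approximating scalars
  form a Cauchy sequence and c is its limit.\<close>

lemma commutant_scalar:
 assumes c: "c : MM" and comm: "!!a. a : AC ==> emb a \<cdot> c = c \<cdot> emb a"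
 shows "\<exists>\<mu>. c = \<mu> \<odot>\<^sub>M \<one>\<^sub>M"
proof -
 have "\<forall>n. \<exists>\<mu>. nrm M (c \<ominus>\<^sub>M \<mu> \<odot>\<^sub>M \<one>\<^sub>M) <= inverse (real (Suc n))"
  by (intro allI commutant_near_scalar[OF c comm]) auto
 then obtain \<mu> where \<mu>: "!!n. nrm M (c \<ominus>\<^sub>M \<mu> n \<odot>\<^sub>M \<one>\<^sub>M) <= inverse (real (Suc n))" by metis
 have diff: "cmod (z - w) = nrm M (z \<odot>\<^sub>M \<one>\<^sub>M \<ominus>\<^sub>M w \<odot>\<^sub>M \<one>\<^sub>M)" for z w
  by (simp add: M.smult_diff_left[symmetric] M.nrm_smult nrm_M_one)
 have md: "cmod (\<mu> n - \<mu> k) <= inverse (real (Suc n)) + inverse (real (Suc k))" for n k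
  using M.nrm_dist_triangle[of "\<mu> n \<odot>\<^sub>M \<one>\<^sub>M" c "\<mu> k \<odot>\<^sub>M \<one>\<^sub>M"] \<mu>[of n] \<mu>[of k] c
   M.nrm_swap[of "\<mu> n \<odot>\<^sub>M \<one>\<^sub>M" c] unfolding diff by simp
 have inv: "(%n. inverse (real (Suc n))) \<longlonglongrightarrow> 0" by (rule LIMSEQ_inverse_real_of_nat)
 have "Cauchy \<mu>"
 proof (rule metric_CauchyI)
  fix e :: real assume "e > 0"
  then obtain n0 where n0: "inverse (real (Suc n0)) < e / 2" using reals_Archimedean[of "e / 2"] by auto
  have small: "inverse (real (Suc n)) < e / 2" if "n >= n0" for n
  proof -
   have "inverse (real (Suc n)) <= inverse (real (Suc n0))" using that by (intro le_imp_inverse_le) auto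
   then show ?thesis using n0 by linarith
  qed
  show "\<exists>M. \<forall>m\<ge>M. \<forall>n\<ge>M. dist (\<mu> m) (\<mu> n) < e"
  proof (intro exI[of _ n0] allI impI)
   fix m n assume "n0 <= m" "n0 <= n"
   then show "dist (\<mu> m) (\<mu> n) < e"
    unfolding dist_norm using md[of m n] small[of m] small[of n] by linarith
  qed
 qed
 then obtain L where L: "\<mu> \<longlonglongrightarrow> L" using Cauchy_convergent_iff convergent_def by blast
 have "nrm M (c \<ominus>\<^sub>M L \<odot>\<^sub>M \<one>\<^sub>M) <= inverse (real (Suc n)) + cmod (\<mu> n - L)" for n
  using M.nrm_dist_triangle[of c "\<mu> n \<odot>\<^sub>M \<one>\<^sub>M" "L \<odot>\<^sub>M \<one>\<^sub>M"] \<mu>[of n] c unfolding diff by simp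
 moreover have lim: "(%n. inverse (real (Suc n)) + cmod (\<mu> n - L)) \<longlonglongrightarrow> 0 + 0"
  by (rule tendsto_add[OF inv tendsto_norm_zero[OF LIM_zero[OF L]]])
 ultimately have "nrm M (c \<ominus>\<^sub>M L \<odot>\<^sub>M \<one>\<^sub>M) <= 0 + 0" by (intro LIMSEQ_le_const[OF lim]) blast
 then have "nrm M (c \<ominus>\<^sub>M L \<odot>\<^sub>M \<one>\<^sub>M) = 0" using c M.nrm_le_zeroD by simp
 then show ?thesis using c by (intro exI[of _ L] M.nrm_eq_zeroD) auto
qed

end

section \<open>Not a fixed-point inclusion\<close>

lemma star_isoD:
 assumes "f : star_iso C D"
 shows "x : carrier C ==> f x : carrier D"
  "[|x : carrier C; y : carrier C|] ==> f (x \<otimes>\<^sub>C y) = f x \<otimes>\<^sub>D f y"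
  "f \<one>\<^sub>C = \<one>\<^sub>D" "x : carrier C ==> f (c \<odot>\<^sub>C x) = c \<odot>\<^sub>D f x"
  "x : carrier C ==> f (star C x) = star D (f x)"
  "inj_on f (carrier C)" "f ` carrier C = carrier D"
 using assms
 by (auto simp: star_iso_def bij_betw_def ring_hom_closed ring_hom_mult ring_hom_one)

context finite_action
begin

lemma unit_emb:
 assumes g: "g : GG" and a: "a : AC"
 shows "unit_of g \<cdot> emb a = emb (\<alpha> g a) \<cdot> unit_of g"
proof (rule crossed_eqI)
 fix k assume k: "k : GG"
 have "inv g \<otimes> k = \<one> \<longleftrightarrow> k = g" using g k by (metis inv_equality inv_inv inv_closed l_inv)
 then show "(unit_of g \<cdot> emb a) k = (emb (\<alpha> g a) \<cdot> unit_of g) k"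
  using g a k by (simp add: unit_mult_coeff emb_mult_coeff unit_of_coeff)
qed (use g a in auto)

end

context representable_system
begin

text \<open>An automorphism fixing \<open>A\<close> multiplies \<open>u\<^sub>g\<close> by an element of the relative commutant of \<open>A\<close>,
 which is a scalar of modulus one.\<close>

lemma automorphism_scales_unit:
 assumes D: "cstar_algebra D" and \<Phi>: "\<Phi> : star_iso M D" and \<theta>: "\<theta> : star_iso D D"
  and fixA: "!!a. a : AC ==> \<theta> (\<Phi> (emb a)) = \<Phi> (emb a)" and g: "g : GG"
 shows "\<exists>\<mu>. cmod \<mu> = 1 & \<theta> (\<Phi> (unit_of g)) = \<mu> \<odot>\<^sub>D \<Phi> (unit_of g)"
proof -
 interpret D: pre_cstar D by (rule cstar_algebra_pre_cstar[OF D])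
 note f = star_isoD[OF \<Phi>] and t = star_isoD[OF \<theta>]
 let ?U = "\<Phi> (unit_of g)"
 have U: "?U : carrier D" "\<theta> ?U : carrier D" using f(1) t(1) by auto
 have UU: "star D ?U \<otimes>\<^sub>D ?U = \<one>\<^sub>D" "?U \<otimes>\<^sub>D star D ?U = \<one>\<^sub>D"
  using g by (simp_all add: f(2,3) f(5)[symmetric] star_unit_of flip: f(2)) (simp_all add: unit_of_mult unit_of_one f(3))
 obtain c where c: "c : MM" "\<Phi> c = star D ?U \<otimes>\<^sub>D \<theta> ?U"
  using f(7) U by (metis (no_types, lifting) D.m_closed D.star_closed imageE)
 have "emb a \<cdot> c = c \<cdot> emb a" if a: "a : AC" for a
 proof (rule inj_onD[OF f(6)])
  have ac: "\<Phi> (emb a) : carrier D" "\<Phi> (emb (\<alpha> g a)) : carrier D" using f(1) a g by auto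
  have 1: "?U \<otimes>\<^sub>D \<Phi> (emb a) = \<Phi> (emb (\<alpha> g a)) \<otimes>\<^sub>D ?U"
   using a g unit_emb[OF g a] by (simp add: f(2)[symmetric])
  have 2: "\<theta> ?U \<otimes>\<^sub>D \<Phi> (emb a) = \<Phi> (emb (\<alpha> g a)) \<otimes>\<^sub>D \<theta> ?U"
   using arg_cong[OF 1, of \<theta>] fixA a g ac U by (simp add: t(2))
  have "\<Phi> (c \<cdot> emb a) = star D ?U \<otimes>\<^sub>D (\<theta> ?U \<otimes>\<^sub>D \<Phi> (emb a))"
   using c a ac U by (simp add: f(2) D.m_assoc)
  also have "... = star D ?U \<otimes>\<^sub>D \<Phi> (emb (\<alpha> g a)) \<otimes>\<^sub>D (?U \<otimes>\<^sub>D star D ?U) \<otimes>\<^sub>D \<theta> ?U"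
   unfolding 2 UU using ac U by (simp add: D.m_assoc)
  also have "... = star D ?U \<otimes>\<^sub>D (\<Phi> (emb (\<alpha> g a)) \<otimes>\<^sub>D ?U) \<otimes>\<^sub>D (star D ?U \<otimes>\<^sub>D \<theta> ?U)"
   using ac U by (simp add: D.m_assoc)
  also have "... = (star D ?U \<otimes>\<^sub>D ?U) \<otimes>\<^sub>D \<Phi> (emb a) \<otimes>\<^sub>D (star D ?U \<otimes>\<^sub>D \<theta> ?U)"
   unfolding 1[symmetric] using ac U by (simp add: D.m_assoc)
  also have "... = \<Phi> (emb a \<cdot> c)" unfolding UU using c a ac by (simp add: f(2))
  finally show "\<Phi> (emb a \<cdot> c) = \<Phi> (c \<cdot> emb a)" ..
 qed (use c a in auto)
 then obtain \<mu> where \<mu>: "c = \<mu> \<odot>\<^sub>M \<one>\<^sub>M" using commutant_scalar[OF c(1)] by blast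
 have "\<theta> ?U = (?U \<otimes>\<^sub>D star D ?U) \<otimes>\<^sub>D \<theta> ?U" unfolding UU using U by simp
 also have "... = ?U \<otimes>\<^sub>D \<Phi> c" unfolding c(2) using U by (simp add: D.m_assoc)
 also have "... = \<mu> \<odot>\<^sub>D ?U" unfolding \<mu> using U by (simp add: f(3,4) D.smult_mult_right)
 finally have eq: "\<theta> ?U = \<mu> \<odot>\<^sub>D ?U" .
 have "\<one>\<^sub>D = \<theta> (star D ?U \<otimes>\<^sub>D ?U)" unfolding UU t(3) ..
 also have "... = (cnj \<mu> * \<mu>) \<odot>\<^sub>D (star D ?U \<otimes>\<^sub>D ?U)"
  using U(1) by (simp add: t(2,5) eq D.star_smult D.smult_mult_left D.smult_mult_right D.smult_smult[symmetric] mult.commute)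
 finally have "\<Phi> \<one>\<^sub>M = \<Phi> ((cnj \<mu> * \<mu>) \<odot>\<^sub>M \<one>\<^sub>M)" unfolding UU by (simp add: f(3,4))
 then have "\<one>\<^sub>M = (cnj \<mu> * \<mu>) \<odot>\<^sub>M \<one>\<^sub>M" by (rule inj_onD[OF f(6)]) auto
 then have "nrm M \<one>\<^sub>M = nrm M ((cnj \<mu> * \<mu>) \<odot>\<^sub>M \<one>\<^sub>M)" by simp
 then have "cmod \<mu> * cmod \<mu> = 1" by (simp add: M.nrm_smult nrm_M_one norm_mult)
 then have "cmod \<mu> = 1" by (simp add: square_eq_1_iff) (use norm_ge_zero[of \<mu>] in linarith)
 then show ?thesis using eq by blast
qed

lemma not_iso_to_fixed_point_inclusion:
 assumes nc: "\<not> comm_group G" shows "\<not> iso_to_fixed_point_inclusion M Q F H D \<beta> \<Phi>"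
proof
 assume iso: "iso_to_fixed_point_inclusion M Q F H D \<beta> \<Phi>"
 then have D: "cstar_algebra D" and \<Phi>: "\<Phi> : star_iso M D" and fp: "\<Phi> ` Q = fixed_points H D \<beta>"
  and \<beta>: "!!h. h : carrier H ==> \<beta> h : star_iso D D"
  by (auto simp: iso_to_fixed_point_inclusion_def cstar_action_def)
 interpret D: pre_cstar D by (rule cstar_algebra_pre_cstar[OF D])
 note f = star_isoD[OF \<Phi>]
 obtain g k where gk: "g : GG" "k : GG" "g \<otimes> k ~= k \<otimes> g"
  using nc group_comm_groupI by blast
 let ?U = "\<Phi> (unit_of g)" and ?V = "\<Phi> (unit_of k)"
 \<comment> \<open>In this commutator of u_g and u_k the scalars of modulus one picked up by the two
   unitaries cancel, so every automorphism in question fixes its image.\<close>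
 let ?w = "star M (unit_of g \<cdot> unit_of k) \<cdot> (unit_of k \<cdot> unit_of g)"
 have wc: "?w : MM" by simp
 have UV: "?U : carrier D" "?V : carrier D" using f(1) by auto
 have w: "\<Phi> ?w = star D (?U \<otimes>\<^sub>D ?V) \<otimes>\<^sub>D (?V \<otimes>\<^sub>D ?U)" by (simp add: f(2,5))
 have "\<beta> h (\<Phi> ?w) = \<Phi> ?w" if h: "h : carrier H" for h
 proof -
  note t = star_isoD[OF \<beta>[OF h]]
  have fixA: "\<beta> h (\<Phi> (emb a)) = \<Phi> (emb a)" if "a : AC" for a
   using fp that h unfolding fixed_points_def by blast
  obtain \<mu> \<nu> where \<mu>: "cmod \<mu> = 1" "\<beta> h ?U = \<mu> \<odot>\<^sub>D ?U" and \<nu>: "cmod \<nu> = 1" "\<beta> h ?V = \<nu> \<odot>\<^sub>D ?V"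
   using automorphism_scales_unit[OF D \<Phi> \<beta>[OF h] fixA gk(1)] automorphism_scales_unit[OF D \<Phi> \<beta>[OF h] fixA gk(2)]
   by blast
  have one: "\<nu> * \<mu> * cnj (\<mu> * \<nu>) = 1"
   using \<mu>(1) \<nu>(1) complex_norm_square[of "\<mu> * \<nu>"] by (simp add: norm_mult mult.commute)
  have "\<beta> h (\<Phi> ?w) = star D ((\<mu> \<odot>\<^sub>D ?U) \<otimes>\<^sub>D (\<nu> \<odot>\<^sub>D ?V)) \<otimes>\<^sub>D ((\<nu> \<odot>\<^sub>D ?V) \<otimes>\<^sub>D (\<mu> \<odot>\<^sub>D ?U))"
   unfolding w using UV by (simp add: t(2,5) \<mu>(2) \<nu>(2))
  also have "... = star D ((\<mu> * \<nu>) \<odot>\<^sub>D (?U \<otimes>\<^sub>D ?V)) \<otimes>\<^sub>D ((\<nu> * \<mu>) \<odot>\<^sub>D (?V \<otimes>\<^sub>D ?U))"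
   using UV by (simp add: D.smult_mult_left D.smult_mult_right D.smult_smult[symmetric] mult.commute)
  also have "... = (\<nu> * \<mu> * cnj (\<mu> * \<nu>)) \<odot>\<^sub>D \<Phi> ?w"
   unfolding w using UV
   by (simp add: D.star_smult D.smult_mult_left D.smult_mult_right D.smult_smult[symmetric] mult_ac)
  finally show ?thesis unfolding one using f(1)[OF wc] by simp
 qed
 then have "\<Phi> ?w : \<Phi> ` Q" unfolding fp using f(1)[OF wc] by (simp add: fixed_points_def)
 then obtain a where a: "a : AC" "\<Phi> ?w = \<Phi> (emb a)" by blast
 have "?w = emb a" by (rule inj_onD[OF f(6) a(2) wc emb_closed[OF a(1)]])
 moreover have "?w = unit_of (inv (g \<otimes> k) \<otimes> (k \<otimes> g))"
  using gk(1,2) by (simp add: unit_of_mult star_unit_of)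
 ultimately have e: "unit_of (inv (g \<otimes> k) \<otimes> (k \<otimes> g)) = emb a" by simp
 have ne: "inv (g \<otimes> k) \<otimes> (k \<otimes> g) ~= \<one>"
 proof
  assume "inv (g \<otimes> k) \<otimes> (k \<otimes> g) = \<one>"
  then have "inv (inv (g \<otimes> k)) = k \<otimes> g" using gk(1,2) by (intro inv_unique'[symmetric] inv_equality) (metis inv_closed l_inv m_closed inv_comm)+
  then show False using gk by simp
 qed
 have "\<one>\<^sub>A = \<zero>\<^sub>A"
  using fun_cong[OF e, of "inv (g \<otimes> k) \<otimes> (k \<otimes> g)"] gk(1,2) ne by (simp add: unit_of_coeff)
 then show False using nrm_one by simp
qed

end

section \<open>Ultrapowers\<close>

text \<open>Compactness of [-B, B] gives a cluster point, and the dichotomy of an ultrafilter makes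
  a cluster point a limit.\<close>

lemma free_ultrafilter_convergent:
 fixes X :: "nat => real"
 assumes \<omega>: "free_ultrafilter \<omega>" and B: "!!n. \<bar>X n\<bar> <= B"
 shows "\<exists>L. (X \<longlongrightarrow> L) \<omega>"
proof -
 have "filtermap X \<omega> ~= bot" using \<omega> by (simp add: free_ultrafilter_def filtermap_bot_iff)
 moreover have "eventually (%x. x : {-B..B}) (filtermap X \<omega>)"
  using B by (simp add: eventually_filtermap abs_le_iff minus_le_iff)
 ultimately obtain L where L: "inf (nhds L) (filtermap X \<omega>) ~= bot"
  using compact_Icc[of "-B" B] unfolding compact_filter by blast
 have "(X \<longlongrightarrow> L) \<omega>"
 proof (rule topological_tendstoI, rule ccontr)
  fix S assume S: "open S" "L : S" "\<not> eventually (%n. X n : S) \<omega>"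
  then have "eventually (%n. X n \<notin> S) \<omega>" using \<omega> unfolding free_ultrafilter_def by blast
  then have "eventually (%x. x \<notin> S) (filtermap X \<omega>)" by (simp add: eventually_filtermap)
  moreover have "eventually (%x. x : S) (nhds L)" using S by (simp add: eventually_nhds) blast
  ultimately have "eventually (%x. False) (inf (nhds L) (filtermap X \<omega>))"
   unfolding eventually_inf by (intro exI[of _ "%x. x : S"] exI[of _ "%x. x \<notin> S"]) auto
  then show False using L by (simp add: trivial_limit_def)
 qed
 then show ?thesis by blast
qed

text \<open>Freeness excludes every finite set, so limits along \<open>sequentially\<close> are
  limits along \<omega>.\<close>

lemma free_ultrafilter_le: assumes \<omega>: "free_ultrafilter \<omega>" shows "\<omega> <= sequentially"
proof (rule filter_leI)
 fix P :: "nat => bool" assume "eventually P sequentially"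
 then obtain N where N: "!!n. n >= N ==> P n" by (auto simp: eventually_sequentially)
 have "eventually (%k. \<forall>n\<in>{..<N}. k ~= n) \<omega>"
  using \<omega> by (intro eventually_ball_finite) (auto simp: free_ultrafilter_def)
 then show "eventually P \<omega>" by eventually_elim (metis N lessThan_iff not_le)
qed

lemma bounded_seqsI:
 "[|!!n. a n : carrier C; !!n. nrm C (a n) <= B|] ==> a : bounded_seqs C"
 by (auto simp: bounded_seqs_def)

lemma bounded_seqsE:
 assumes "a : bounded_seqs C"
 obtains B where "B >= 0" "\<forall>n. a n : carrier C" "\<forall>n. nrm C (a n) <= B"
proof -
 obtain B where "range a <= carrier C" "\<forall>n. nrm C (a n) <= B" using assms by (auto simp: bounded_seqs_def)
 then show ?thesis by (intro that[of "max B 0"]) (auto simp: le_max_iff_disj)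
qed

lemma ultra_seq_algebra:
 assumes "seminormed_algebra C" and \<omega>: "free_ultrafilter \<omega>"
 shows "seq_algebra (%_. C) (bounded_seqs C) \<omega>"
proof -
 interpret C: seminormed_algebra C by fact
 show ?thesis
 proof (intro seq_algebra.intro seq_module.intro seq_algebra_axioms.intro C.seminormed_module_axioms C.seminormed_algebra_axioms)
  show "\<omega> ~= bot" using \<omega> by (simp add: free_ultrafilter_def)
  fix a assume a: "a : bounded_seqs C"
  then obtain B where B: "B >= 0" "\<forall>n. a n : carrier C" "\<forall>n. nrm C (a n) <= B" by (rule bounded_seqsE)
  show "a n : carrier C" for n using B by simp
  show "(%n. c \<odot>\<^sub>C a n) : bounded_seqs C" for c
   using B by (intro bounded_seqsI[where B = "cmod c * B"]) (auto simp: C.nrm_smult mult_left_mono)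
  show "\<exists>L. ((%n. nrm C (a n)) \<longlongrightarrow> L) \<omega>"
   using B by (intro free_ultrafilter_convergent[OF \<omega>, where B = B]) simp
  fix b assume "b : bounded_seqs C"
  then obtain B' where B': "B' >= 0" "\<forall>n. b n : carrier C" "\<forall>n. nrm C (b n) <= B'" by (rule bounded_seqsE)
  show "(%n. a n \<oplus>\<^sub>C b n) : bounded_seqs C"
  proof (rule bounded_seqsI)
   show "nrm C (a n \<oplus>\<^sub>C b n) <= B + B'" for n
    using C.nrm_triangle[of "a n" "b n"] B(2,3)[rule_format, of n] B'(2,3)[rule_format, of n] by linarith
  qed (use B B' in simp)
  show "(%n. a n \<otimes>\<^sub>C b n) : bounded_seqs C"
  proof (rule bounded_seqsI)
   show "nrm C (a n \<otimes>\<^sub>C b n) <= B * B'" for n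
    using C.nrm_mult[of "a n" "b n"] B B' mult_mono[of "nrm C (a n)" B "nrm C (b n)" B'] by force
  qed (use B B' in simp)
 qed (auto intro: bounded_seqsI[OF _ order_refl])
qed

lemma ultra_seq_cstar:
 assumes "pre_cstar C" and \<omega>: "free_ultrafilter \<omega>"
 shows "seq_cstar (%_. C) (bounded_seqs C) \<omega>"
proof -
 interpret C: pre_cstar C by fact
 show ?thesis
  by (intro seq_cstar.intro ultra_seq_algebra[OF C.seminormed_algebra_axioms \<omega>] seq_cstar_axioms.intro C.pre_cstar_axioms)
   (auto simp: bounded_seqs_def image_subset_iff)
qed

section \<open>The Rokhlin property in the ultrapower\<close>

context representable_system
begin

text \<open>An approximant of x from stage N commutes exactly with \<open>rok (j n)\<close> once n
  >= N, since j n >= n; what remains is at most twice the approximation error.\<close>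

lemma rok_asymptotically_central:
 assumes \<omega>: "free_ultrafilter \<omega>" and j: "!!n. n <= j n" and x: "x : MM"
 shows "((%n. nrm M (rok (j n) \<cdot> x \<ominus>\<^sub>M x \<cdot> rok (j n))) \<longlongrightarrow> 0) \<omega>"
proof (rule tendstoI)
 fix e :: real assume e: "e > 0"
 obtain N b where b: "b : SG N" and xb: "nrm M (x \<ominus>\<^sub>M b) < e / 2"
  by (rule stage_crossed_dense[OF x, of "e / 2"]) (use e in auto)
 have "nrm M (rok (j n) \<cdot> x \<ominus>\<^sub>M x \<cdot> rok (j n)) < e" if n: "n >= N" for n
 proof -
  let ?r = "rok (j n)" let ?d = "x \<ominus>\<^sub>M b"
  have "b : SG (j n)" using stage_crossed_mono[OF _ b, of "j n"] n j[of n] by simp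
  note c = rok_commute[OF this]
  have bc: "b : MM" using b by blast
  have "?r \<cdot> x \<ominus>\<^sub>M x \<cdot> ?r = (?r \<cdot> x \<ominus>\<^sub>M ?r \<cdot> b) \<oplus>\<^sub>M (b \<cdot> ?r \<ominus>\<^sub>M x \<cdot> ?r)"
   unfolding c using x bc by (intro M.minus_telescope[symmetric]) auto
  also have "... = ?r \<cdot> ?d \<ominus>\<^sub>M ?d \<cdot> ?r"
   using x bc M.minus_swap[of "x \<cdot> ?r" "b \<cdot> ?r"]
   by (simp add: M.minus_mult_left M.minus_mult_right M.minus_eq[of "?r \<cdot> x \<ominus>\<^sub>M ?r \<cdot> b"])
  finally have "nrm M (?r \<cdot> x \<ominus>\<^sub>M x \<cdot> ?r) <= nrm M (?r \<cdot> ?d) + nrm M (?d \<cdot> ?r)"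
   using M.nrm_diff[of "?r \<cdot> ?d" "?d \<cdot> ?r"] x bc by simp
  also have "... <= nrm M ?r * nrm M ?d + nrm M ?d * nrm M ?r"
   using x bc by (intro add_mono M.nrm_mult) auto
  also have "... <= 1 * nrm M ?d + nrm M ?d * 1"
   using x bc nrm_rok_le by (intro add_mono mult_mono) auto
  finally show ?thesis using xb by simp
 qed
 then have "eventually (%n. dist (nrm M (rok (j n) \<cdot> x \<ominus>\<^sub>M x \<cdot> rok (j n))) 0 < e) sequentially"
  using x by (auto simp: eventually_sequentially dist_real_def)
 then show "eventually (%n. dist (nrm M (rok (j n) \<cdot> x \<ominus>\<^sub>M x \<cdot> rok (j n))) 0 < e) \<omega>"
  using free_ultrafilter_le[OF \<omega>] unfolding le_filter_def by blast
qed

text \<open>On vectors of M this is \<open>rok_jones\<close>. The equation is exact at every n, so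
  it passes to the ultrapower term by term.\<close>

lemma rok_basic_construction:
 "left_mult M F (of_real oG \<odot>\<^sub>M \<one>\<^sub>M) \<otimes>\<^sub>BC
   (left_mult M F (rok n) \<otimes>\<^sub>BC jones_projection M F \<otimes>\<^sub>BC left_mult M F (rok n)) = left_mult M F (rok n)"
proof -
 let ?o = "of_real oG \<odot>\<^sub>M \<one>\<^sub>M" let ?r = "rok n"
 have o: "?o : MM" by simp
 note mr = mod_maps_mult[OF rok_closed] and mo = mod_maps_mult[OF o]
 note m1 = mod_maps_comp[OF mr mod_maps_F] note m2 = mod_maps_comp[OF m1 mr]
 show ?thesis
  unfolding left_mult_hext jones_hext BC_ops(1)[OF mr mod_maps_F] BC_ops(1)[OF m1 mr] BC_ops(1)[OF mo m2]
 proof (rule hext_congR[OF mr])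
  fix x assume x: "x : MM"
  show "?o \<cdot> (?r \<cdot> F (?r \<cdot> x)) = ?r \<cdot> x"
   using x rok_jones[OF x] by (simp add: M.smult_mult_left)
 qed
qed

text \<open>At index n an approximant b n of x n, with error below 1/(n + 1), is compared exactly
  with some \<open>q (j n)\<close>. The stage-independent bound on |y| |b| and |b n| >= \<nu>/2 keep
  the y n bounded, so replacing b n by x n costs an error that tends to 0. Asking for j n >= n makes
  the corresponding Rokhlin projections asymptotically central.\<close>

lemma ultrapower_compare:
 assumes \<omega>: "free_ultrafilter \<omega>" and x: "x : bounded_seqs M"
  and ne: "ultra_rel \<omega> M `` {x} ~= \<zero>\<^sub>(ultrapower \<omega> M)"
 shows "\<exists>j y. (\<forall>n. n <= j n) & y : bounded_seqs M \<and>
  ((%n. nrm M (y n \<cdot> (star M (x n) \<cdot> x n) \<cdot> star M (y n) \<ominus>\<^sub>M emb (q (j n)))) \<longlongrightarrow> 0) \<omega>"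
proof -
 interpret U: seq_cstar "%_. M" "bounded_seqs M" \<omega> by (rule ultra_seq_cstar[OF M.pre_cstar_axioms \<omega>])
 obtain B where B: "B >= 0" "\<forall>n. x n : MM" "\<forall>n. nrm M (x n) <= B" using x by (rule bounded_seqsE)
 define \<nu> where "\<nu> = nrm U.quot (U.cls x)"
 have xq: "U.cls x : carrier U.quot" using x by blast
 have \<nu>: "\<nu> > 0" using U.Q.nrm_le_zero_imp[OF xq] ne unfolding \<nu>_def ultra_rel_def ultrapower_def by force
 let ?\<eta> = "%n. inverse (real (Suc n))"
 have "\<exists>N b. b : SG N & nrm M (x n \<ominus>\<^sub>M b) < ?\<eta> n" for n
  using stage_crossed_dense[OF B(2)[rule_format, of n], of "?\<eta> n"] by (metis inverse_positive_iff_positive of_nat_0_less_iff zero_less_Suc)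
 then obtain N b where b: "!!n. b n : SG (N n)" "!!n. nrm M (x n \<ominus>\<^sub>M b n) < ?\<eta> n" by metis
 have bc: "b n : MM" for n using b(1) by blast
 define c where "c = 2 * oG ^ 4"
 have c: "c >= 0" using order_real_ge by (simp add: c_def)
 have "\<exists>j y. n <= j & y : MM & nrm M y <= 2 * c / \<nu> \<and>
   (\<nu> / 2 <= nrm M (b n) --> y \<cdot> (star M (b n) \<cdot> b n) \<cdot> star M y = emb (q j))" for n
 proof (cases "\<nu> / 2 <= nrm M (b n)")
  case True
  then have "nrm M (b n) > 0" using \<nu> by linarith
  then obtain j y where j: "j >= n" and y: "y : MM"
   and eq: "y \<cdot> (star M (b n) \<cdot> b n) \<cdot> star M y = emb (q j)" and yn: "nrm M y * nrm M (b n) <= c"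
   using stage_compare[OF b(1), of n n] unfolding c_def by blast
  have "nrm M y * (\<nu> / 2) <= c" using mult_left_mono[OF True, of "nrm M y"] yn y by simp
  then have "nrm M y <= 2 * c / \<nu>" using \<nu> by (simp add: field_simps)
  then show ?thesis using j y eq by blast
 next
  case False
  \<comment> \<open>A default for indices where b n is short. They are negligible for \<omega>,
    because the norms of the x n tend to \<nu> along it.\<close>
  then show ?thesis using \<nu> c by (intro exI[of _ n] exI[of _ "\<zero>\<^sub>M"]) simp
 qed
 then obtain j y where j: "!!n. n <= j n" and y: "!!n. y n : MM" "!!n. nrm M (y n) <= 2 * c / \<nu>"
  and eq: "!!n. \<nu> / 2 <= nrm M (b n) ==> y n \<cdot> (star M (b n) \<cdot> b n) \<cdot> star M (y n) = emb (q (j n))"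
  by metis
 let ?g = "%n. (2 * c / \<nu>)\<^sup>2 * (?\<eta> n * (2 * B + 1))"
 let ?t = "%n. nrm M (y n \<cdot> (star M (x n) \<cdot> x n) \<cdot> star M (y n) \<ominus>\<^sub>M emb (q (j n)))"
 have e1: "?\<eta> n <= 1" for n using le_imp_inverse_le[of 1 "real (Suc n)"] by simp
 have bn: "nrm M (b n) <= B + 1" "nrm M (x n) - ?\<eta> n <= nrm M (b n)" for n
  using M.nrm_diff_abs[OF B(2)[rule_format, of n] bc[of n]] b(2)[of n] B(3)[rule_format, of n] e1[of n] by linarith+
 have small: "?t n <= ?g n" if n: "3 * \<nu> / 4 < nrm M (x n)" "?\<eta> n < \<nu> / 4" for n
 proof -
  have "\<nu> / 2 <= nrm M (b n)" using bn(2)[of n] n by linarith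
  then have "?t n <= (nrm M (y n))\<^sup>2 * (nrm M (x n \<ominus>\<^sub>M b n) * (nrm M (x n) + nrm M (b n)))"
   using M.nrm_conj_square_diff[OF y(1) B(2)[rule_format] bc, of n n n] eq by simp
  also have "... <= ?g n"
   using y(1)[of n] y(2)[of n] b(2)[of n] bn(1)[of n] B(1) B(2,3)[rule_format, of n] bc[of n] c \<nu>
   by (intro mult_mono power_mono) auto
  finally show ?thesis .
 qed
 have inv: "(?\<eta> \<longlongrightarrow> 0) \<omega>"
  by (rule tendsto_mono[OF free_ultrafilter_le[OF \<omega>] LIMSEQ_inverse_real_of_nat])
 have "((%n. nrm M (x n)) \<longlongrightarrow> \<nu>) \<omega>" unfolding \<nu>_def by (rule U.nrm_cls_tendsto[OF x])
 then have "eventually (%n. 3 * \<nu> / 4 < nrm M (x n)) \<omega>" using \<nu> by (intro order_tendstoD(1)) auto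
 moreover have "eventually (%n. ?\<eta> n < \<nu> / 4) \<omega>" using \<nu> by (intro order_tendstoD(2)[OF inv]) auto
 ultimately have ev: "eventually (%n. ?t n <= ?g n) \<omega>" by eventually_elim (rule small)
 have "(?g \<longlongrightarrow> (2 * c / \<nu>)\<^sup>2 * (0 * (2 * B + 1))) \<omega>"
  by (intro tendsto_mult tendsto_const inv)
 then have g0: "(?g \<longlongrightarrow> 0) \<omega>" by simp
 have nn: "eventually (%n. 0 <= ?t n) \<omega>" using y(1) B(2) by (intro always_eventually allI M.nrm_nonneg) auto
 have "(?t \<longlongrightarrow> 0) \<omega>" by (rule tendsto_sandwich[OF nn ev tendsto_const g0])
 then show ?thesis using j bounded_seqsI[of y M, OF y] by blast
qed

text \<open>The class of \<open>rok (j n)\<close> is a projection, so it serves as e and as its own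
  square root s. The identity with the Jones projection and the formula for the defect hold at every
  index; only centrality and the comparison with a are asymptotic. The Cuntz witness is a constant
  sequence, because the comparison is an equality in the ultrapower.\<close>

theorem weak_tracial_rokhlin_crossed:
 assumes \<omega>: "free_ultrafilter \<omega>" shows "weak_tracial_rokhlin \<omega> M Q F"
proof -
 interpret U: seq_cstar "%_. M" "bounded_seqs M" \<omega> by (rule ultra_seq_cstar[OF M.pre_cstar_axioms \<omega>])
 interpret K: seq_algebra "%_. BC" "bounded_seqs BC" \<omega> by (rule ultra_seq_algebra[OF BC.seminormed_algebra_axioms \<omega>])
 let ?o = "of_real oG \<odot>\<^sub>M \<one>\<^sub>M"
 let ?\<iota> = "seq_map (ultra_rel \<omega> BC) (%_. left_mult M F)"
 let ?F = "seq_map (ultra_rel \<omega> M) (%_. F)"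
 have const: "(%_. z) : bounded_seqs M" if "z : MM" for z
  using that by (intro bounded_seqsI[where B = "nrm M z"]) auto
 have lm: "(%n. left_mult M F (a n)) : bounded_seqs BC" if a: "a : bounded_seqs M" for a
 proof -
  obtain B where B: "B >= 0" "\<forall>n. a n : MM" "\<forall>n. nrm M (a n) <= B" using a by (rule bounded_seqsE)
  show ?thesis
   using B left_mult_closed order_trans[OF nrm_left_mult B(3)[rule_format]] by (intro bounded_seqsI[where B = B]) blast+
 qed
 have \<iota>: "?\<iota> (U.cls a) = K.cls (%n. left_mult M F (a n))" if a: "a : bounded_seqs M" for a
  unfolding ultra_rel_def
  by (rule seq_map_class[OF U.seq_module_axioms K.seq_module_axioms lm _ a, where K = 1])
   (simp_all add: left_mult_minus nrm_left_mult)
 have nF: "nrm M (F z) <= nrm M z" if "z : MM" for z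
  using that coeff_le_nrm[OF that one_closed] by (simp add: F_eq emb_isometric)
 have Fb: "(%n. F (a n)) : bounded_seqs M" if a: "a : bounded_seqs M" for a
 proof -
  obtain B where B: "B >= 0" "\<forall>n. a n : MM" "\<forall>n. nrm M (a n) <= B" using a by (rule bounded_seqsE)
  show ?thesis
   using B F_closed order_trans[OF nF B(3)[rule_format]] by (intro bounded_seqsI[where B = B]) blast+
 qed
 have F\<omega>: "?F (U.cls a) = U.cls (%n. F (a n))" if a: "a : bounded_seqs M" for a
  unfolding ultra_rel_def
 proof (rule seq_map_class[OF U.seq_module_axioms U.seq_module_axioms Fb _ a, where K = 1])
  fix z w assume "z : MM" "w : MM"
  then show "nrm M (F z \<ominus>\<^sub>M F w) <= 1 * nrm M (z \<ominus>\<^sub>M w)"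
   using nF[of "z \<ominus>\<^sub>M w"] mod_maps_minus[OF mod_maps_F, of z w] by simp
 qed
 have main: "\<exists>e\<in>carrier U.quot. e ~= \<zero>\<^sub>(U.quot) & positive U.quot e & nrm U.quot e <= 1 \<and>
   (\<forall>x\<in>MM. e \<otimes>\<^sub>(U.quot) U.cls (%_. x) = U.cls (%_. x) \<otimes>\<^sub>(U.quot) e) \<and>
   (\<exists>s\<in>carrier U.quot. positive U.quot s & s \<otimes>\<^sub>(U.quot) s = e \<and>
    ?\<iota> (U.cls (%_. ?o)) \<otimes>\<^sub>(K.quot) (?\<iota> s \<otimes>\<^sub>(K.quot) K.cls (%_. jones_projection M F) \<otimes>\<^sub>(K.quot) ?\<iota> s) = ?\<iota> e) \<and>
   cuntz_below U.quot (\<one>\<^sub>(U.quot) \<ominus>\<^sub>(U.quot) U.cls (%_. ?o) \<otimes>\<^sub>(U.quot) ?F e) a"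
  if a: "a : carrier U.quot" "positive U.quot a" "a ~= \<zero>\<^sub>(U.quot)" for a
 proof -
  obtain X where X: "X : carrier U.quot" "a = star U.quot X \<otimes>\<^sub>(U.quot) X" using a(2) by (auto simp: positive_def)
  obtain x where x: "x : bounded_seqs M" "X = U.cls x" using X(1) by (rule U.quotE)
  have "U.cls x ~= \<zero>\<^sub>(U.quot)" using a(3) unfolding X(2) x(2)[symmetric] by auto
  then obtain j y where j: "!!n. n <= j n" and y: "y : bounded_seqs M"
   and lim: "((%n. nrm M (y n \<cdot> (star M (x n) \<cdot> x n) \<cdot> star M (y n) \<ominus>\<^sub>M emb (q (j n)))) \<longlongrightarrow> 0) \<omega>"
   using ultrapower_compare[OF \<omega> x(1)] unfolding ultra_rel_def ultrapower_def by blast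
  let ?r = "%n. rok (j n)"
  have r: "?r : bounded_seqs M" using nrm_rok_le by (intro bounded_seqsI) auto
  have rr: "U.cls ?r \<otimes>\<^sub>(U.quot) U.cls ?r = U.cls ?r" using r by (simp add: U.mult_cls rok_idem)
  have rs: "star U.quot (U.cls ?r) = U.cls ?r" using r by (simp add: U.star_cls rok_star)
  have rc: "U.cls ?r : carrier U.quot" by (rule U.cls_closed[OF r])
  have pos: "positive U.quot (U.cls ?r)" unfolding positive_def using rc rr rs by (intro bexI[of _ "U.cls ?r"]) simp_all
  have ge: "1 / oG <= nrm U.quot (U.cls ?r)"
   by (rule tendsto_lowerbound[OF U.nrm_cls_tendsto[OF r] _ U.nontrivial]) (simp add: nrm_rok_ge)
  have ne: "U.cls ?r ~= \<zero>\<^sub>(U.quot)"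
  proof
   assume "U.cls ?r = \<zero>\<^sub>(U.quot)"
   then show False using ge order_real_ge by simp
  qed
  have le: "nrm U.quot (U.cls ?r) <= 1" by (rule U.nrm_cls_le[OF r]) (simp add: nrm_rok_le)
  have comm: "U.cls ?r \<otimes>\<^sub>(U.quot) U.cls (%_. z) = U.cls (%_. z) \<otimes>\<^sub>(U.quot) U.cls ?r" if z: "z : MM" for z
   unfolding U.mult_cls[OF r const[OF z]] U.mult_cls[OF const[OF z] r]
   using U.cls_eq_iff[OF U.S_mult[OF r const[OF z]] U.S_mult[OF const[OF z] r]] rok_asymptotically_central[OF \<omega> j z] by simp
  have jb: "(%_. jones_projection M F) : bounded_seqs BC"
   using jones_closed by (intro bounded_seqsI[OF _ order_refl])
  have o: "?o : MM" by simp
  have index: "?\<iota> (U.cls (%_. ?o)) \<otimes>\<^sub>(K.quot) (?\<iota> (U.cls ?r) \<otimes>\<^sub>(K.quot) K.cls (%_. jones_projection M F) \<otimes>\<^sub>(K.quot) ?\<iota> (U.cls ?r))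
    = ?\<iota> (U.cls ?r)"
   unfolding \<iota>[OF r] \<iota>[OF const[OF o]] K.mult_cls[OF lm[OF r] jb] K.mult_cls[OF K.S_mult[OF lm[OF r] jb] lm[OF r]]
    K.mult_cls[OF lm[OF const[OF o]] K.S_mult[OF K.S_mult[OF lm[OF r] jb] lm[OF r]]] rok_basic_construction ..
  have unit: "\<one>\<^sub>M \<ominus>\<^sub>M ?o \<cdot> F (?r n) = emb (q (j n))" for n
  proof -
   have "?o \<cdot> F (?r n) = emb (v (j n) \<one>)"
    unfolding F_rok using order_real_ge
    by (simp add: M.smult_mult_left M.smult_mult_right M.smult_smult[symmetric] flip: of_real_mult)
   then show ?thesis using emb_minus[of "\<one>\<^sub>A" "v (j n) \<one>"] by (simp add: emb_one)
  qed
  have rest: "\<one>\<^sub>(U.quot) \<ominus>\<^sub>(U.quot) U.cls (%_. ?o) \<otimes>\<^sub>(U.quot) ?F (U.cls ?r) = U.cls (%n. emb (q (j n)))"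
   unfolding F\<omega>[OF r] U.mult_cls[OF const[OF o] Fb[OF r]] U.one_cls
    U.minus_cls[OF U.S_one U.S_mult[OF const[OF o] Fb[OF r]]] unit ..
  have qb: "(%n. emb (q (j n))) : bounded_seqs M" using emb_q_simps by (intro bounded_seqsI) auto
  note xx = U.S_mult[OF U.S_star[OF x(1)] x(1)]
  note yx = U.S_mult[OF y xx] note yxy = U.S_mult[OF yx U.S_star[OF y]]
  have "U.cls y \<otimes>\<^sub>(U.quot) a \<otimes>\<^sub>(U.quot) star U.quot (U.cls y) =
    U.cls (%n. y n \<cdot> (star M (x n) \<cdot> x n) \<cdot> star M (y n))"
   unfolding X(2) x(2) U.star_cls[OF x(1)] U.star_cls[OF y] U.mult_cls[OF U.S_star[OF x(1)] x(1)]
    U.mult_cls[OF y xx] U.mult_cls[OF yx U.S_star[OF y]] ..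
  also have "... = U.cls (%n. emb (q (j n)))" using U.cls_eq_iff[OF yxy qb] lim by simp
  finally have cz: "U.cls y \<otimes>\<^sub>(U.quot) a \<otimes>\<^sub>(U.quot) star U.quot (U.cls y) = U.cls (%n. emb (q (j n)))" .
  have "cuntz_below U.quot (U.cls (%n. emb (q (j n)))) a"
   unfolding cuntz_below_def norm_lim_def
  proof (intro exI[of _ "%_. U.cls y"] conjI)
   show "range (%_. U.cls y) <= carrier U.quot" using U.cls_closed[OF y] by blast
  qed (use U.cls_closed[OF qb] in "simp add: cz")
  then show ?thesis using rc ne pos le comm rr index rest by (intro bexI[of _ "U.cls ?r"] conjI ballI) auto
 qed
 show ?thesis
  unfolding weak_tracial_rokhlin_def Let_def ultrapower_def ultra_const_def index_of_F
  using cstar_algebra_crossed cstar_subalgebra_Q conditional_expectation_F simple_crossed index_finite_F main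
  unfolding ultra_rel_def by blast
qed

end

section \<open>Block matrices\<close>

abbreviation tot :: "('o => nat) => 'o list => nat" where "tot d os \<equiv> sum_list (map d os)"

text \<open>Both inequalities are statements about norms of expressions that a unital homomorphism
  preserves. The application is to a stage embedded in a single matrix algebra.\<close>

lemma isometric_cauchy_schwarz:
 assumes C: "pre_cstar C" and D: "pre_cstar D" and f: "star_hom C D f"
  and iso: "!!x. x : carrier C ==> nrm D (f x) = nrm C x" and I: "finite I"
 shows "cauchy_schwarz_on I D ==> cauchy_schwarz_on I C"
  and "squares_positive_on I D ==> squares_positive_on I C"
proof -
 interpret C: pre_cstar C by fact
 interpret D: pre_cstar D by fact
 have cl: "(\<Oplus>\<^sub>C i\<in>I. star C (x i) \<otimes>\<^sub>C y i) : carrier C"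
  if "x : I \<rightarrow> carrier C" "y : I \<rightarrow> carrier C" for x y
  using that by (intro C.finsum_closed) auto
 have im: "f (\<Oplus>\<^sub>C i\<in>I. star C (x i) \<otimes>\<^sub>C y i) = (\<Oplus>\<^sub>D i\<in>I. star D (f (x i)) \<otimes>\<^sub>D f (y i))"
  if xy: "x : I \<rightarrow> carrier C" "y : I \<rightarrow> carrier C" for x y
 proof -
  have "f (\<Oplus>\<^sub>C i\<in>I. star C (x i) \<otimes>\<^sub>C y i) = (\<Oplus>\<^sub>D i\<in>I. f (star C (x i) \<otimes>\<^sub>C y i))"
   using xy by (intro star_hom_finsum[OF f C D I]) auto
  also have "... = (\<Oplus>\<^sub>D i\<in>I. star D (f (x i)) \<otimes>\<^sub>D f (y i))"
  proof (intro D.finsum_cong' refl)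
   fix i assume "i : I"
   then have "x i : carrier C" "y i : carrier C" using xy by auto
   then show "f (star C (x i) \<otimes>\<^sub>C y i) = star D (f (x i)) \<otimes>\<^sub>D f (y i)"
    by (simp add: star_hom_mult[OF f] star_hom_star[OF f])
  qed (use xy in "auto intro!: star_hom_closed[OF f]")
  finally show ?thesis .
 qed
 have nim: "nrm C (\<Oplus>\<^sub>C i\<in>I. star C (x i) \<otimes>\<^sub>C y i) = nrm D (\<Oplus>\<^sub>D i\<in>I. star D (f (x i)) \<otimes>\<^sub>D f (y i))"
  if xy: "x : I \<rightarrow> carrier C" "y : I \<rightarrow> carrier C" for x y
  unfolding im[OF xy, symmetric] iso[OF cl[OF xy]] ..
 have fx: "(%i. f (x i)) : I \<rightarrow> carrier D" if "x : I \<rightarrow> carrier C" for x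
  using that star_hom_closed[OF f] by auto
 show "cauchy_schwarz_on I C" if cs: "cauchy_schwarz_on I D"
  unfolding cauchy_schwarz_on_def
 proof (intro ballI)
  fix x y assume xy: "x : I \<rightarrow> carrier C" "y : I \<rightarrow> carrier C"
  show "(nrm C (\<Oplus>\<^sub>C i\<in>I. star C (x i) \<otimes>\<^sub>C y i))\<^sup>2 \<le>
   nrm C (\<Oplus>\<^sub>C i\<in>I. star C (x i) \<otimes>\<^sub>C x i) * nrm C (\<Oplus>\<^sub>C i\<in>I. star C (y i) \<otimes>\<^sub>C y i)"
   unfolding nim[OF xy] nim[OF xy(1,1)] nim[OF xy(2,2)]
   using cs[unfolded cauchy_schwarz_on_def, rule_format, OF fx[OF xy(1)] fx[OF xy(2)]] .
 qed
 show "squares_positive_on I C" if sp: "squares_positive_on I D"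
  unfolding squares_positive_on_def
 proof (intro ballI allI impI)
  fix x t assume x: "x : I \<rightarrow> carrier C" and t: "nrm C (\<Oplus>\<^sub>C i\<in>I. star C (x i) \<otimes>\<^sub>C x i) <= t"
  let ?s = "\<Oplus>\<^sub>C i\<in>I. star C (x i) \<otimes>\<^sub>C x i"
  have "nrm C (of_real t \<odot>\<^sub>C \<one>\<^sub>C \<ominus>\<^sub>C ?s) = nrm D (f (of_real t \<odot>\<^sub>C \<one>\<^sub>C \<ominus>\<^sub>C ?s))"
   using cl[OF x x] by (intro iso[symmetric]) simp
  also have "f (of_real t \<odot>\<^sub>C \<one>\<^sub>C \<ominus>\<^sub>C ?s) = of_real t \<odot>\<^sub>D \<one>\<^sub>D \<ominus>\<^sub>D f ?s"
   using cl[OF x x] by (simp add: star_hom_minus[OF f C D] star_hom_smult[OF f] star_hom_one[OF f])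
  finally show "nrm C (of_real t \<odot>\<^sub>C \<one>\<^sub>C \<ominus>\<^sub>C ?s) <= t"
   unfolding im[OF x x] using sp[unfolded squares_positive_on_def, rule_format, OF fx[OF x]] t
   unfolding nim[OF x x] by simp
 qed
qed

abbreviation bdiag :: "('o => complex mat) => 'o list => complex mat" where
 "bdiag f os \<equiv> diag_block_mat (map f os)"

lemma bdiag_closed:
 "(!!t. t : set os ==> f t : sq (d t)) ==>
  bdiag f os : sq (tot d os)"
 by (induction os) (auto simp: Let_def)

lemma bdiag_index:
 assumes "f t : sq a" "bdiag f os : sq b" "i < a + b" "j < a + b"
 shows "bdiag f (t # os) $$ (i, j) = (if i < a then if j < a then f t $$ (i, j) else 0
  else if j < a then 0 else bdiag f os $$ (i - a, j - a))"
 using assms by (auto simp: Let_def)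

context
 fixes f :: "'o => complex mat" and d :: "'o => nat"
begin

lemma bdiag_mult:
 assumes "!!t. t : set os ==> f t : sq (d t)" "!!t. t : set os ==> g t : sq (d t)"
 shows "bdiag f os * bdiag g os = bdiag (%t. f t * g t) os"
 using assms
proof (induction os)
 case (Cons t os)
 have c: "bdiag f os : sq (tot d os)"
  "bdiag g os : sq (tot d os)"
  "f t : sq (d t)" "g t : sq (d t)"
  using Cons.prems by (auto intro: bdiag_closed)
 have IH: "bdiag f os * bdiag g os = bdiag (%t. f t * g t) os" using Cons by simp
 show ?case
  using c IH[symmetric]
  by (simp add: Let_def mult_four_block_mat[OF c(3) _ _ c(1) c(4) _ _ c(2)])
qed simp

lemma bdiag_smult:
 assumes "!!t. t : set os ==> f t : sq (d t)"
 shows "bdiag (%t. c \<cdot>\<^sub>m f t) os = c \<cdot>\<^sub>m bdiag f os"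
 using assms
proof (induction os)
 case (Cons t os)
 have c: "bdiag f os : sq (tot d os)" "f t : sq (d t)"
  using Cons.prems by (auto intro: bdiag_closed)
 have IH: "bdiag (%t. c \<cdot>\<^sub>m f t) os = c \<cdot>\<^sub>m bdiag f os" using Cons by simp
 show ?case using c IH by (simp add: Let_def smult_four_block_mat[OF c(2) _ _ c(1)])
qed auto

lemma bdiag_add:
 assumes "!!t. t : set os ==> f t : sq (d t)" "!!t. t : set os ==> g t : sq (d t)"
 shows "bdiag (%t. f t + g t) os = bdiag f os + bdiag g os"
 using assms
proof (induction os)
 case (Cons t os)
 have c: "bdiag f os : sq (tot d os)"
  "bdiag g os : sq (tot d os)"
  "f t : sq (d t)" "g t : sq (d t)"
  using Cons.prems by (auto intro: bdiag_closed)
 have IH: "bdiag (%t. f t + g t) os = bdiag f os + bdiag g os" using Cons by simp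
 show ?case
  using c IH by (simp add: Let_def add_four_block_mat[OF c(3) _ _ c(1) c(4) _ _ c(2)])
qed simp

lemma bdiag_one: "bdiag (%t. 1\<^sub>m (d t)) os = 1\<^sub>m (tot d os)"
 by (induction os) (auto simp: Let_def)

lemma bdiag_adjoint:
 assumes "!!t. t : set os ==> f t : sq (d t)"
 shows "bdiag (%t. adj (f t)) os = adj (bdiag f os)"
 using assms
proof (induction os)
 case (Cons t os)
 have c: "bdiag f os : sq (tot d os)" "f t : sq (d t)"
  using Cons.prems by (auto intro: bdiag_closed)
 have IH: "bdiag (%t. adj (f t)) os = adj (bdiag f os)" using Cons by simp
 show ?case
  using c IH by (intro eq_matI) (auto simp: Let_def)
qed (simp add: mat_adjoint_zero)

lemma bdiag_entry:
 assumes "!!t. t : set os ==> f t : sq (d t)" "t : set os" "i < d t" "j < d t"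
 shows "\<exists>i'<tot d os. \<exists>j'<tot d os. bdiag f os $$ (i', j') = f t $$ (i, j)"
 using assms
proof (induction os)
 case (Cons u os)
 have c: "bdiag f os : sq (tot d os)" "f u : sq (d u)"
  using Cons.prems by (auto intro: bdiag_closed)
 show ?case
 proof (cases "t = u")
  case True
  then show ?thesis
   using Cons.prems bdiag_index[OF c(2,1), of i j] by (intro exI[of _ i] exI[of _ j] conjI) auto
 next
  case False
  then obtain i' j' where ij: "i' < tot d os" "j' < tot d os" "bdiag f os $$ (i', j') = f t $$ (i, j)"
   using Cons by auto
  then show ?thesis
   using bdiag_index[OF c(2,1), of "d u + i'" "d u + j'"]
   by (intro exI[of _ "d u + i'"] exI[of _ "d u + j'"] conjI) auto
 qed
qed simp

text \<open>Crude on purpose: a bound on the entries is enough, since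
  \<open>star_hom_contractive\<close> replaces the factor by 1.\<close>

lemma bdiag_norm_le:
 assumes f: "!!t. t : set os ==> f t : sq (d t)" and K: "K >= 0"
  "!!t. t : set os ==> nrm (Mat (d t)) (f t) <= K"
 shows "nrm (Mat (tot d os)) (bdiag f os) <= (real (tot d os))\<^sup>2 * K"
proof -
 let ?n = "tot d os"
 have e: "cmod (bdiag f os $$ (i, j)) <= K" if "i < ?n" "j < ?n" for i j
  using f K that
 proof (induction os arbitrary: i j)
  case (Cons t os)
  have c: "bdiag f os : sq (tot d os)" "f t : sq (d t)"
   using Cons.prems by (auto intro: bdiag_closed)
  have ij: "i < d t + tot d os" "j < d t + tot d os" using Cons.prems by auto
  have 1: "cmod (f t $$ (i, j)) <= K" if "i < d t" "j < d t"
   using mat_norm_entry[OF c(2) that] Cons.prems(3)[of t] by simp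
  have 2: "cmod (bdiag f os $$ (i - d t, j - d t)) <= K" if "d t <= i" "d t <= j"
   using that ij Cons.prems(1,3) K(1) by (intro Cons.IH) auto
  show ?case unfolding bdiag_index[OF c(2,1) ij] using 1 2 K(1) by auto
 qed simp
 have "nrm (Mat ?n) (bdiag f os) <= (\<Sum>i<?n. \<Sum>j<?n. cmod (bdiag f os $$ (i, j)))"
  by (rule mat_norm_entry_sum[OF bdiag_closed[OF f]])
 also have "... <= (\<Sum>i<?n. \<Sum>j<?n. K)" using e by (intro sum_mono) auto
 finally show ?thesis by (simp add: power2_eq_square)
qed

text \<open>The entries of a block occur among those of the whole matrix.
  \<open>star_hom_expansive\<close> later removes the factor.\<close>

lemma bdiag_norm_ge:
 assumes f: "!!t. t : set os ==> f t : sq (d t)" and t: "t : set os"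
 shows "nrm (Mat (d t)) (f t) <= (real (d t))\<^sup>2 * nrm (Mat (tot d os)) (bdiag f os)"
proof -
 have "nrm (Mat (d t)) (f t) <= (\<Sum>i<d t. \<Sum>j<d t. cmod (f t $$ (i, j)))"
  by (rule mat_norm_entry_sum[OF f[OF t]])
 also have "... <= (\<Sum>i<d t. \<Sum>j<d t. nrm (Mat (tot d os)) (bdiag f os))"
 proof (intro sum_mono)
  fix i j assume "i : {..<d t}" "j : {..<d t}"
  then obtain i' j' where ij: "i' < tot d os" "j' < tot d os"
   and eq: "bdiag f os $$ (i', j') = f t $$ (i, j)"
   using bdiag_entry[of os, OF f t, of i j] by auto
  then show "cmod (f t $$ (i, j)) <= nrm (Mat (tot d os)) (bdiag f os)"
   using mat_norm_entry[OF bdiag_closed[of os, OF f] ij] unfolding eq by simp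
 qed
 finally show ?thesis by (simp add: power2_eq_square)
qed

end

text \<open>Diagonal projections of rank c. The class is stable under block sums, and block sums are
  all that the connecting maps do to the matrix units that are compared later.\<close>

definition diag01 :: "nat => complex mat => nat => bool" where
 "diag01 n x c \<longleftrightarrow> x : sq n & (\<exists>T\<subseteq>{..<n}. card T = c \<and>
   (\<forall>i<n. \<forall>j<n. x $$ (i, j) = (if i = j & i : T then 1 else 0)))"

lemma diag01E:
 assumes "diag01 n x c"
 obtains T where "x : sq n" "T <= {..<n}" "card T = c"
  "\<forall>i<n. \<forall>j<n. x $$ (i, j) = (if i = j & i : T then 1 else 0)"
 using assms unfolding diag01_def by blast

lemma diag01_bdiag:
 "(!!t. t : set os ==> diag01 (d t) (f t) (c t)) ==> diag01 (tot d os) (bdiag f os) (tot c os)"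
proof (induction os)
 case Nil
 then show ?case by (auto simp: diag01_def)
next
 case (Cons t os)
 let ?n = "tot d os"
 have dt: "diag01 (d t) (f t) (c t)" "diag01 ?n (bdiag f os) (tot c os)" using Cons by auto
 obtain T where T: "f t : sq (d t)" "T <= {..<d t}" "card T = c t"
   "\<forall>i<d t. \<forall>j<d t. f t $$ (i, j) = (if i = j & i : T then 1 else 0)"
  using dt(1) by (rule diag01E)
 obtain T' where T': "bdiag f os : sq ?n" "T' <= {..<?n}" "card T' = tot c os"
   "\<forall>i<?n. \<forall>j<?n. bdiag f os $$ (i, j) = (if i = j & i : T' then 1 else 0)"
  using dt(2) by (rule diag01E)
 let ?S = "T \<union> (+) (d t) ` T'"
 have fin: "finite T" "finite T'" using T(2) T'(2) finite_subset by auto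
 have "card ?S = c t + tot c os"
  using T T' fin by (subst card_Un_disjoint) (auto simp: card_image)
 moreover have "bdiag f (t # os) $$ (i, j) = (if i = j & i : ?S then 1 else 0)"
  if "i < d t + ?n" "j < d t + ?n" for i j
 proof -
  have m: "i : (+) (d t) ` T' \<longleftrightarrow> d t <= i & i - d t : T'" by (auto simp: image_iff intro: bexI[of _ "i - d t"])
  show ?thesis
   unfolding bdiag_index[OF T(1) T'(1) that] using T(2,4) T'(4)[rule_format, of "i - d t" "j - d t"] that m by auto
 qed
 moreover have "bdiag f (t # os) : sq (d t + ?n)" using T(1) T'(1) by (simp add: Let_def)
 moreover have "?S <= {..<d t + ?n}" using T(2) T'(2) by auto
 ultimately show ?case
  unfolding diag01_def by (intro conjI exI[of _ ?S]) (simp_all del: diag_block_mat.simps)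
qed

text \<open>The witness is the matrix of a partial permutation.\<close>

lemma diag01_compare:
 assumes P: "diag01 n P s" and R: "diag01 n R t" and st: "t <= s"
 shows "\<exists>y\<in>sq n. y * P * adj y = R"
proof -
 obtain S where S: "P : sq n" "S <= {..<n}" "card S = s"
  "\<forall>i<n. \<forall>j<n. P $$ (i, j) = (if i = j & i : S then 1 else 0)" using P by (rule diag01E)
 obtain T where T: "R : sq n" "T <= {..<n}" "card T = t"
  "\<forall>i<n. \<forall>j<n. R $$ (i, j) = (if i = j & i : T then 1 else 0)" using R by (rule diag01E)
 have fin: "finite S" "finite T" using S(2) T(2) finite_subset by auto
 obtain \<sigma> where \<sigma>: "inj_on \<sigma> T" "\<sigma> ` T <= S"
  using card_le_inj[OF fin(2,1)] st S(3) T(3) by auto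
 have \<sigma>n: "\<sigma> i < n" "\<sigma> i : S" if "i : T" for i using \<sigma>(2) S(2) that by auto
 let ?y = "mat n n (%(i, j). if i : T & j = \<sigma> i then 1 else 0) :: complex mat"
 have yP: "(?y * P) $$ (i, j) = ?y $$ (i, j)" if "i < n" "j < n" for i j
 proof -
  have "(?y * P) $$ (i, j) = (\<Sum>l<n. ?y $$ (i, l) * P $$ (l, j))"
   using S(1) that by (intro mat_mult_index_sum) auto
  also have "... = (\<Sum>l<n. if l = j then ?y $$ (i, j) else 0)"
   using that S(4) \<sigma>n by (intro sum.cong) auto
  finally show ?thesis using that by simp
 qed
 have "?y * P * adj ?y = R"
 proof (rule eq_matI)
  fix i j assume "i < dim_row R" "j < dim_col R"
  then have ij: "i < n" "j < n" using T(1) by auto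
  have "(?y * P * adj ?y) $$ (i, j) = (\<Sum>l<n. (?y * P) $$ (i, l) * adj ?y $$ (l, j))"
   using S(1) ij by (intro mat_mult_index_sum) auto
  also have "... = (\<Sum>l<n. if l = \<sigma> i then if i = j & i : T then 1 else 0 else 0)"
   using ij yP inj_onD[OF \<sigma>(1), of i j] by (intro sum.cong) auto
  also have "... = R $$ (i, j)" using T(4)[rule_format, OF ij] \<sigma>n(1)[of i] by auto
  finally show "(?y * P * adj ?y) $$ (i, j) = R $$ (i, j)" .
 qed (use S(1) T(1) in auto)
 then show ?thesis by (intro bexI[of _ ?y]) auto
qed

section \<open>Matrices indexed by the group\<close>

lemma sum_div_mod:
 fixes F :: "nat => nat => complex"
 shows "(\<Sum>j<m * r. F (j div r) (j mod r)) = (\<Sum>a<m. \<Sum>b<r. F a b)"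
proof (cases "r = 0")
 case False
 have lt: "a * r + b < m * r" if "a < m" "b < r" for a b
  using mult_le_mono1[of "Suc a" m r] that by simp
 have "(\<Sum>j<m * r. F (j div r) (j mod r)) = (\<Sum>(a, b)\<in>{..<m} \<times> {..<r}. F a b)"
  by (rule sum.reindex_bij_witness[where i = "%(a, b). a * r + b" and j = "%j. (j div r, j mod r)"])
   (use False lt in "auto simp: less_mult_imp_div_less")
 then show ?thesis by (simp add: sum.cartesian_product)
qed simp

lemma star_hom_comp: "[|star_hom C D f; star_hom D E g|] ==> star_hom C E (%x. g (f x))"
 by (rule star_homI) (simp_all add: star_hom_closed star_hom_one star_hom_add star_hom_mult star_hom_smult star_hom_star)

lemma star_hom_pair:
 assumes f: "star_hom C D f" and g: "star_hom C E g" shows "star_hom C (sum_cstar D E) (%x. (f x, g x))"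
 by (rule star_homI)
  (simp_all add: star_hom_closed[OF f] star_hom_one[OF f] star_hom_add[OF f] star_hom_mult[OF f] star_hom_smult[OF f]
   star_hom_star[OF f] star_hom_closed[OF g] star_hom_one[OF g] star_hom_add[OF g] star_hom_mult[OF g]
   star_hom_smult[OF g] star_hom_star[OF g])

lemma star_hom_power:
 assumes "!!j. j : J ==> star_hom C D (f j)" shows "star_hom C (power_cstar J D) (%x. \<lambda>j\<in>J. f j x)"
 by (intro star_homI) (auto simp: star_hom_closed[OF assms] star_hom_one[OF assms] star_hom_add[OF assms]
   star_hom_mult[OF assms] star_hom_smult[OF assms] star_hom_star[OF assms] intro!: restrict_ext)

lemma (in pre_cstar) conjugation_hom:
 assumes u: "u : carrier C" "star C u \<otimes> u = \<one>" "u \<otimes> star C u = \<one>"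
 shows "star_hom C C (%x. u \<otimes> x \<otimes> star C u)"
  and "x : carrier C ==> nrm C (u \<otimes> x \<otimes> star C u) <= nrm C x"
proof -
 have c: "star C u \<otimes> (u \<otimes> y) = y" if "y : carrier C" for y
  using u that by (simp add: m_assoc[symmetric])
 show "star_hom C C (%x. u \<otimes> x \<otimes> star C u)"
  by (rule star_homI) (use u in "simp_all add: l_distr r_distr smult_mult_left smult_mult_right star_mult m_assoc c")
 assume x: "x : carrier C"
 have "(nrm C u)\<^sup>2 <= 1" using cstar_identity[OF u(1)] nrm_one_le u(2) by simp
 then have "nrm C u <= 1" using u(1) by (simp add: abs_square_le_1)
 then have "nrm C u * nrm C x * nrm C u <= 1 * nrm C x * 1" using x u(1) by (intro mult_mono) auto
 then show "nrm C (u \<otimes> x \<otimes> star C u) <= nrm C x"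
  using nrm_mult[of "u \<otimes> x" "star C u"] mult_right_mono[OF nrm_mult[OF u(1) x], of "nrm C u"] x u(1) by simp
qed

context group
begin

lemma unitary_repD:
 assumes "unitary_rep G n U" "g : carrier G"
 shows "U g : sq n" "U g * adj (U g) = 1\<^sub>m n" "adj (U g) * U g = 1\<^sub>m n"
  "h : carrier G ==> U (g \<otimes> h) = U g * U h"
 using assms by (auto simp: unitary_rep_def)

lemma unitary_rep_one: assumes U: "unitary_rep G n U" shows "U \<one> = 1\<^sub>m n"
proof -
 note u = unitary_repD[OF U one_closed]
 have "adj (U \<one>) * (U \<one> * U \<one>) = U \<one>"
  using u(1,3) mat_adjoint_carrier[OF u(1)] by (simp add: assoc_mult_mat[symmetric, of _ n n _ n _ n])
 then show ?thesis using u(4)[OF one_closed] u(3) by simp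
qed

lemma unitary_rep_adjoint:
 assumes U: "unitary_rep G n U" and g: "g : carrier G" shows "adj (U g) = U (inv g)"
proof -
 note u = unitary_repD[OF U g] and v = unitary_repD[OF U inv_closed[OF g]]
 have "U g * U (inv g) = 1\<^sub>m n" using u(4)[of "inv g"] g by (simp add: unitary_rep_one[OF U])
 then have "adj (U g) = adj (U g) * (U g * U (inv g))"
  using mat_adjoint_carrier[OF u(1)] by (simp add: right_mult_one_mat[of _ n n])
 also have "... = U (inv g)"
  using u(1,3) v(1) mat_adjoint_carrier[OF u(1)] by (simp add: assoc_mult_mat[symmetric, of _ n n _ n _ n])
 finally show ?thesis .
qed

end

lemma bdiag_unitary_rep:
 assumes R: "!!t. t : set os ==> unitary_rep G (d t) (R t)"
 shows "unitary_rep G (sum_list (map d os)) (%g. bdiag (%t. R t g) os)"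
proof -
 have c: "R t g : sq (d t)" "adj (R t g) : sq (d t)"
  if "t : set os" "g : carrier G" for t g
  using R[OF that(1)] that(2) by (auto simp: unitary_rep_def)
 have one: "bdiag h os = 1\<^sub>m (sum_list (map d os))" if "!!t. t : set os ==> h t = 1\<^sub>m (d t)" for h
  using bdiag_one[of d os] that by (simp cong: map_cong)
 show ?thesis
  unfolding unitary_rep_def
 proof (intro conjI ballI)
  fix g assume g: "g : carrier G"
  note cg = c[OF _ g]
  show "bdiag (%t. R t g) os : sq (sum_list (map d os))"
   by (rule bdiag_closed[OF cg(1)])
  have a: "adj (bdiag (%t. R t g) os) = bdiag (%t. adj (R t g)) os"
   by (rule bdiag_adjoint[OF cg(1), symmetric])
  have b: "bdiag (%t. R t g) os * bdiag (%t. adj (R t g)) os = bdiag (%t. R t g * adj (R t g)) os"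
   "bdiag (%t. adj (R t g)) os * bdiag (%t. R t g) os = bdiag (%t. adj (R t g) * R t g) os"
   by (rule bdiag_mult[OF cg], assumption+, rule bdiag_mult[OF cg(2,1)], assumption+)
  show "bdiag (%t. R t g) os * adj (bdiag (%t. R t g) os) = 1\<^sub>m (sum_list (map d os))"
   unfolding a b by (rule one) (use R g in "auto simp: unitary_rep_def")
  show "adj (bdiag (%t. R t g) os) * bdiag (%t. R t g) os = 1\<^sub>m (sum_list (map d os))"
   unfolding a b by (rule one) (use R g in "auto simp: unitary_rep_def")
  fix h assume h: "h : carrier G"
  have "bdiag (%t. R t g) os * bdiag (%t. R t h) os = bdiag (%t. R t g * R t h) os"
   by (rule bdiag_mult[OF cg(1) c(1)[OF _ h]])
  then show "bdiag (%t. R t (g \<otimes>\<^sub>G h)) os = bdiag (%t. R t g) os * bdiag (%t. R t h) os"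
   using R g h by (auto simp: unitary_rep_def intro!: arg_cong[of _ _ diag_block_mat])
 qed
qed

locale AF_system = group G for G :: "('g, 'm) monoid_scheme" (structure) +
 fixes gs :: "'g list" and l :: "nat => nat" and k r :: nat and U W :: "'g => complex mat"
 assumes finite_G: "finite (carrier G)" and gs: "distinct gs" "set gs = carrier G"
  and k_pos: "k > 0" and r_pos: "r > 0" and l_pos: "l n > 0" and l_lim: "filterlim l at_top sequentially"
  and rep_U: "unitary_rep G k U" and rep_W: "unitary_rep G r W"
begin

abbreviation "GG \<equiv> carrier G"

abbreviation "m \<equiv> card (GG)"

lemma cancel_left [simp]:
 "[|g : GG; x : GG|] ==> g \<otimes> (inv g \<otimes> x) = x"
 "[|g : GG; x : GG|] ==> inv g \<otimes> (g \<otimes> x) = x"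
 by (simp_all add: m_assoc[symmetric])

lemma length_gs: "length gs = m" using distinct_card[OF gs(1)] gs(2) by simp

lemma nth_gs [simp]: "a < m ==> gs ! a : GG" using gs(2) length_gs nth_mem by metis

text \<open>\<open>gmat d g y\<close> is the matrix of \<open>y u\<^sub>g\<close>, for \<open>y : C(G, M\<^sub>d)\<close>, in the regular representation.\<close>

definition gmat :: "nat => 'g => ('g => complex mat) => complex mat" where
 "gmat d g y = mat (m * d) (m * d)
  (%(i, j). if gs ! (i div d) = g \<otimes> gs ! (j div d) then y (gs ! (i div d)) $$ (i mod d, j mod d) else 0)"

lemma gmat_closed [simp]: "gmat d g y : sq (m * d)" by (simp add: gmat_def)

lemma div_mod_less: assumes "i < m * d" shows "i div d < m" "i mod d < d"
 using assms by (auto simp: less_mult_imp_div_less intro!: mod_less_divisor gr0I)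

text \<open>The rule (y u_g)(z u_h) = y \<alpha>_g(z) u_(g h) of the crossed product by translation.
  In the matrix product for row block s only the middle block labelled g^-1 s survives.\<close>

lemma gmat_mult:
 assumes g: "g : GG" and h: "h : GG"
  and y: "!!t. t : GG ==> y t : sq d" and z: "!!t. t : GG ==> z t : sq d"
 shows "gmat d g y * gmat d h z = gmat d (g \<otimes> h) (%t. y t * z (inv g \<otimes> t))"
proof (rule eq_matI)
 fix i j assume "i < dim_row (gmat d (g \<otimes> h) (%t. y t * z (inv g \<otimes> t)))" "j < dim_col (gmat d (g \<otimes> h) (%t. y t * z (inv g \<otimes> t)))"
 then have ij: "i < m * d" "j < m * d" by (simp_all add: gmat_def)
 note di = div_mod_less[OF ij(1)] and dj = div_mod_less[OF ij(2)]
 let ?s = "gs ! (i div d)" and ?t = "gs ! (j div d)"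
 have st: "?s : GG" "?t : GG" using di dj by auto
 have sg: "inv g \<otimes> ?s : GG" using st g by simp
 then obtain c where c: "c < m" "gs ! c = inv g \<otimes> ?s" using gs(2) length_gs in_set_conv_nth by metis
 have eq: "?s = g \<otimes> gs ! a \<longleftrightarrow> a = c" if "a < m" for a
 proof -
  have "?s = g \<otimes> gs ! a \<longleftrightarrow> gs ! a = gs ! c" unfolding c(2) using st g that by (metis inv_solve_left nth_gs)
  then show ?thesis using nth_eq_iff_index_eq[OF gs(1)] that c(1) length_gs by simp
 qed
 have eq2: "gs ! c = h \<otimes> ?t \<longleftrightarrow> ?s = g \<otimes> h \<otimes> ?t"
  unfolding c(2) using st g h by (metis inv_solve_left m_assoc m_closed)
 let ?F = "%a b. (if ?s = g \<otimes> gs ! a then y ?s $$ (i mod d, b) else 0) *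
   (if gs ! a = h \<otimes> ?t then z (gs ! a) $$ (b, j mod d) else 0)"
 have "(gmat d g y * gmat d h z) $$ (i, j) = (\<Sum>b<m * d. gmat d g y $$ (i, b) * gmat d h z $$ (b, j))"
  using ij by (intro mat_mult_index_sum) auto
 also have "... = (\<Sum>b<m * d. ?F (b div d) (b mod d))"
  using ij by (intro sum.cong) (auto simp: gmat_def)
 also have "... = (\<Sum>a<m. \<Sum>b<d. ?F a b)" by (rule sum_div_mod)
 also have "... = (\<Sum>a<m. if a = c then \<Sum>b<d. ?F c b else 0)"
  using eq by (intro sum.cong) auto
 also have "... = (\<Sum>b<d. ?F c b)" using c(1) by simp
 also have "... = (\<Sum>b<d. if ?s = g \<otimes> h \<otimes> ?t then y ?s $$ (i mod d, b) * z (inv g \<otimes> ?s) $$ (b, j mod d) else 0)"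
  using eq[OF c(1)] eq2 c(2) by (intro sum.cong) auto
 also have "... = (if ?s = g \<otimes> h \<otimes> ?t then (y ?s * z (inv g \<otimes> ?s)) $$ (i mod d, j mod d) else 0)"
  unfolding mat_mult_index_sum[OF y[OF st(1)] z[OF sg] di(2) dj(2)] by simp
 also have "... = gmat d (g \<otimes> h) (%t. y t * z (inv g \<otimes> t)) $$ (i, j)"
  using ij by (simp add: gmat_def)
 finally show "(gmat d g y * gmat d h z) $$ (i, j) = gmat d (g \<otimes> h) (%t. y t * z (inv g \<otimes> t)) $$ (i, j)" .
qed (simp_all add: gmat_def)

lemma gmat_adjoint:
 assumes g: "g : GG" and y: "!!t. t : GG ==> y t : sq d"
 shows "adj (gmat d g y) = gmat d (inv g) (%t. adj (y (g \<otimes> t)))"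
proof (rule eq_matI)
 fix i j assume "i < dim_row (gmat d (inv g) (%t. adj (y (g \<otimes> t))))" "j < dim_col (gmat d (inv g) (%t. adj (y (g \<otimes> t))))"
 then have ij: "i < m * d" "j < m * d" by (simp_all add: gmat_def)
 note di = div_mod_less[OF ij(1)] and dj = div_mod_less[OF ij(2)]
 let ?s = "gs ! (i div d)" and ?t = "gs ! (j div d)"
 have st: "?s : GG" "?t : GG" using di dj by auto
 have eq: "?t = g \<otimes> ?s \<longleftrightarrow> ?s = inv g \<otimes> ?t" using st g by (metis inv_solve_left)
 have d: "dim_row (y ?t) = d" "dim_col (y ?t) = d" using y[OF st(2)] by auto
 show "adj (gmat d g y) $$ (i, j) = gmat d (inv g) (%t. adj (y (g \<otimes> t))) $$ (i, j)"
 proof (cases "?t = g \<otimes> ?s")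
  case True
  then show ?thesis using ij eq d di dj g by (simp add: gmat_def)
 next
  case False
  then show ?thesis using ij eq by (simp add: gmat_def)
 qed
qed (simp_all add: gmat_def)

text \<open>Blocks listed in the order of \<open>gs\<close> are a function on G acting by
  multiplication, the case g = 1 of \<open>gmat\<close>. This puts the D_n part of the connecting
  map into one calculus with the regular representation.\<close>

lemma bdiag_gmat:
 assumes y: "!!t. t : GG ==> y t : sq d" shows "bdiag y gs = gmat d \<one> y"
proof -
 have gen: "bdiag y xs = mat (length xs * d) (length xs * d)
   (%(i, j). if i div d = j div d then y (xs ! (i div d)) $$ (i mod d, j mod d) else 0)"
  if "set xs <= GG" for xs
  using that
 proof (induction xs)
  case (Cons x xs)
  have c: "y x : sq d" "bdiag y xs : sq (length xs * d)"
   using Cons y by auto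
  let ?B = "mat (length (x # xs) * d) (length (x # xs) * d)
   (%(i, j). if i div d = j div d then y ((x # xs) ! (i div d)) $$ (i mod d, j mod d) else 0)"
  show ?case
  proof (rule eq_matI)
   fix i j assume "i < dim_row ?B" "j < dim_col ?B"
   then have ij: "i < d + length xs * d" "j < d + length xs * d" by simp_all
   have ge: "i div d = Suc ((i - d) div d)" "i mod d = (i - d) mod d" if "d <= i" "i < d + length xs * d" for i
    using that by (cases "d = 0"; simp add: le_div_geq le_mod_geq)+
   show "diag_block_mat (map y (x # xs)) $$ (i, j) = ?B $$ (i, j)"
    unfolding bdiag_index[OF c ij] using ij ge[of i] ge[of j] Cons by (auto simp: not_less)
  qed (use c in "simp_all add: Let_def")
 qed (auto intro!: eq_matI)
 show ?thesis
  unfolding gen[OF eq_refl[OF gs(2)]] gmat_def length_gs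
  using div_mod_less nth_eq_iff_index_eq[OF gs(1)] length_gs by (intro eq_matI) auto
qed

lemma kronecker_gmat:
 assumes "w : sq d" shows "kronecker (left_regular G gs g) w = gmat d g (%_. w)"
 using assms div_mod_less by (intro eq_matI) (auto simp: kronecker_def left_regular_def gmat_def length_gs)

lemma gmat_one: "gmat d \<one> (%_. 1\<^sub>m d) = 1\<^sub>m (m * d)"
 using bdiag_gmat[of "%_. 1\<^sub>m d" d] bdiag_one[of "%_. d" gs] by (simp add: sum_list_triv length_gs)

lemma kronecker_rep:
 assumes w: "unitary_rep G d w" shows "unitary_rep G (m * d) (%g. kronecker (left_regular G gs g) (w g))"
proof -
 have k: "kronecker (left_regular G gs g) (w g) = gmat d g (%_. w g)" if "g : GG" for g
  by (rule kronecker_gmat[OF unitary_repD(1)[OF w that]])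
 note u = unitary_repD[OF w]
 have a: "adj (w g) : sq d" if "g : GG" for g using u(1)[OF that] by auto
 have "gmat d g (%_. w g) * adj (gmat d g (%_. w g)) = 1\<^sub>m (m * d)"
  "adj (gmat d g (%_. w g)) * gmat d g (%_. w g) = 1\<^sub>m (m * d)" if g: "g : GG" for g
  using g by (simp_all add: gmat_adjoint[OF g u(1)[OF g]] gmat_mult[OF g inv_closed[OF g] u(1)[OF g] a[OF g]]
    gmat_mult[OF inv_closed[OF g] g a[OF g] u(1)[OF g]] u(2,3) gmat_one)
 moreover have "gmat d (g \<otimes> h) (%_. w (g \<otimes> h)) = gmat d g (%_. w g) * gmat d h (%_. w h)"
  if g: "g : GG" and h: "h : GG" for g h
  using g h by (simp add: gmat_mult[OF g h u(1)[OF g] u(1)[OF h]] u(4))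
 ultimately show ?thesis unfolding unitary_rep_def by (simp add: k)
qed

end

section \<open>The stages\<close>

context AF_system
begin

text \<open>The block \<open>None\<close> of a stage is \<open>B\<^sub>n\<close>, and \<open>Some h\<close> is the summand \<open>h\<close> of \<open>D\<^sub>n\<close>.\<close>

definition dm :: "nat => 'g option => nat" where
 "dm n t = (case t of None => k_dim m l k r n | Some _ => r_dim m l k r n)"

definition rd :: "nat => nat" where "rd n = r_dim m l k r n"

lemma dm_Some [simp]: "dm n (Some h) = rd n" by (simp add: dm_def rd_def)

definition blk :: "'g stage => 'g option => complex mat" where
 "blk x t = (case t of None => fst x | Some h => snd x h)"

definition mk :: "('g option => complex mat) => 'g stage" where
 "mk f = (f None, \<lambda>h\<in>GG. f (Some h))"

text \<open>A row of the Bratteli diagram: the blocks of stage n, with multiplicity, that make up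
  the diagonal of block t at stage n + 1.\<close>

definition row :: "nat => 'g option => 'g option list" where
 "row n t = (case t of None => replicate (l n) None @ map Some gs | Some h => [None, Some h])"

abbreviation "Bl \<equiv> insert None (Some ` GG)"
abbreviation "St \<equiv> stage_algebra G l k r"
abbreviation "\<phi> \<equiv> stage_map G gs l"
abbreviation "act \<equiv> stage_action G gs l U W"

lemma carrier_nonempty: "GG ~= {}" using one_closed by blast

lemma m_pos: "m > 0" using finite_G carrier_nonempty by (simp add: card_gt_0_iff)

lemma St_eq: "St n = sum_cstar (Mat (dm n None)) (power_cstar (GG) (Mat (rd n)))"
 by (simp add: stage_algebra_def dm_def rd_def)

lemma pre_cstar_power_block: "pre_cstar (power_cstar (GG) (Mat d))"
 by (rule pre_cstar_power[OF pre_cstar_mat finite_G carrier_nonempty])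

lemma pre_cstar_St: "pre_cstar (St n)"
 unfolding St_eq by (rule pre_cstar_sum[OF pre_cstar_mat pre_cstar_power_block])

sublocale St: pre_cstar "St n" for n by (rule pre_cstar_St)

lemma blk_closed: "[|x : carrier (St n); t : Bl|] ==> blk x t : sq (dm n t)"
 by (auto simp: St_eq blk_def)

lemma mk_closed: "(!!t. t : Bl ==> f t : sq (dm n t)) ==> mk f : carrier (St n)"
proof -
 assume f: "!!t. t : Bl ==> f t : sq (dm n t)"
 have "f (Some h) : sq (rd n)" if "h : GG" for h using f[of "Some h"] that by simp
 then show ?thesis using f[of None] by (simp add: St_eq mk_def)
qed

lemma blk_mk: "t : Bl ==> blk (mk f) t = f t" by (auto simp: blk_def mk_def)

lemma blk_ops:
 assumes "t : Bl"
 shows "blk (x \<otimes>\<^sub>(St n) y) t = blk x t * blk y t" "blk (x \<oplus>\<^sub>(St n) y) t = blk x t + blk y t"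
  "blk (c \<odot>\<^sub>(St n) x) t = c \<cdot>\<^sub>m blk x t" "blk (star (St n) x) t = adj (blk x t)"
  "blk \<one>\<^sub>(St n) t = 1\<^sub>m (dm n t)" "blk \<zero>\<^sub>(St n) t = 0\<^sub>m (dm n t) (dm n t)"
 using assms by (cases x; cases y; auto simp: St_eq blk_def)+

lemma stage_eqI:
 assumes "x : carrier (St n)" "y : carrier (St n)" "!!t. t : Bl ==> blk x t = blk y t" shows "x = y"
proof (rule prod_eqI)
 show "fst x = fst y" using assms(3)[of None] by (simp add: blk_def)
 show "snd x = snd y"
 proof (rule PiE_ext)
  show "snd x : GG \<rightarrow>\<^sub>E sq (rd n)"
   "snd y : GG \<rightarrow>\<^sub>E sq (rd n)"
   using assms(1,2) by (auto simp: St_eq)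
  show "snd x h = snd y h" if "h : GG" for h using assms(3)[of "Some h"] that by (simp add: blk_def)
 qed
qed

lemma stage_norm_le_iff:
 "nrm (St n) x <= K \<longleftrightarrow> (\<forall>t\<in>Bl. nrm (Mat (dm n t)) (blk x t) <= K)"
 by (cases x) (simp add: St_eq power_norm_le_iff[OF finite_G carrier_nonempty] blk_def)

lemma blk_norm_le: "t : Bl ==> nrm (Mat (dm n t)) (blk x t) <= nrm (St n) x"
 using stage_norm_le_iff[of n x "nrm (St n) x"] by auto

lemma blk_hom: assumes t: "t : Bl" shows "star_hom (St n) (Mat (dm n t)) (%x. blk x t)"
 by (rule star_homI) (use t in "simp_all add: blk_ops[OF t] blk_closed")

lemma set_row: "t : Bl ==> set (row n t) <= Bl"
 using gs(2) by (auto simp: row_def)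

lemma set_row_None: "set (row n None) = Bl"
 using gs(2) l_pos[of n] by (auto simp: row_def)

lemma sum_row_None: "tot (c :: 'g option => nat) (row n None) = l n * c None + (\<Sum>h\<in>GG. c (Some h))"
 using sum.distinct_set_conv_list[OF gs(1), of "%h. c (Some h)"] gs(2)
 by (simp add: row_def sum_list_replicate comp_def)

lemma dm_Suc: "tot (dm n) (row n t) = dm (Suc n) t"
proof (cases t)
 case None
 then show ?thesis unfolding None sum_row_None by (simp add: dm_def rd_def)
qed (simp add: row_def dm_def rd_def)

lemma blk_map: "t : Bl ==> blk (\<phi> n x) t = bdiag (blk x) (row n t)"
 by (cases x; cases t) (auto simp: stage_map_def blk_def row_def comp_def)

lemma stage_map_eq: "\<phi> n x = (bdiag (blk x) (row n None), \<lambda>h\<in>GG. bdiag (blk x) (row n (Some h)))"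
 by (cases x) (auto simp: stage_map_def blk_def row_def comp_def)

lemma row_closed:
 assumes t: "t : Bl" and x: "x : carrier (St n)"
 shows "bdiag (blk x) (row n t) : sq (dm (Suc n) t)"
proof -
 have "bdiag (blk x) (row n t) : sq (tot (dm n) (row n t))"
  by (rule bdiag_closed) (use blk_closed[OF x] set_row[OF t] in blast)
 then show ?thesis unfolding dm_Suc .
qed

lemma row_hom:
 assumes t: "t : Bl" shows "star_hom (St n) (Mat (dm (Suc n) t)) (%x. bdiag (blk x) (row n t))"
proof -
 have sub: "u : Bl" if "u : set (row n t)" for u using set_row[OF t] that by blast
 have bc: "blk x u : sq (dm n u)" if "x : carrier (St n)" "u : set (row n t)" for x u
  using blk_closed[OF that(1) sub[OF that(2)]] .
 have cong: "bdiag f (row n t) = bdiag g (row n t)" if "!!u. u : set (row n t) ==> f u = g u" for f g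
  using that by (simp cong: map_cong)
 show ?thesis
 proof (rule star_homI)
  fix x c assume x: "x : carrier (St n)"
  note xb = row_closed[OF t x]
  show "bdiag (blk x) (row n t) : carrier (Mat (dm (Suc n) t))" using xb by simp
  have "bdiag (blk (c \<odot>\<^sub>(St n) x)) (row n t) = bdiag (%u. c \<cdot>\<^sub>m blk x u) (row n t)"
   by (rule cong) (simp add: blk_ops(3)[OF sub])
  also have "... = c \<cdot>\<^sub>m bdiag (blk x) (row n t)" by (rule bdiag_smult[OF bc[OF x]])
  finally show "bdiag (blk (c \<odot>\<^sub>(St n) x)) (row n t) = c \<odot>\<^sub>(Mat (dm (Suc n) t)) bdiag (blk x) (row n t)" by simp
  have "bdiag (blk (star (St n) x)) (row n t) = bdiag (%u. adj (blk x u)) (row n t)"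
   by (rule cong) (simp add: blk_ops(4)[OF sub])
  also have "... = adj (bdiag (blk x) (row n t))" by (rule bdiag_adjoint[OF bc[OF x]])
  finally show "bdiag (blk (star (St n) x)) (row n t) = star (Mat (dm (Suc n) t)) (bdiag (blk x) (row n t))" by simp
  fix y assume y: "y : carrier (St n)"
  have "bdiag (blk (x \<oplus>\<^sub>(St n) y)) (row n t) = bdiag (%u. blk x u + blk y u) (row n t)"
   by (rule cong) (simp add: blk_ops(2)[OF sub])
  also have "... = bdiag (blk x) (row n t) + bdiag (blk y) (row n t)" by (rule bdiag_add[OF bc[OF x] bc[OF y]])
  finally show "bdiag (blk (x \<oplus>\<^sub>(St n) y)) (row n t) =
   bdiag (blk x) (row n t) \<oplus>\<^sub>(Mat (dm (Suc n) t)) bdiag (blk y) (row n t)" by simp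
  have "bdiag (blk (x \<otimes>\<^sub>(St n) y)) (row n t) = bdiag (%u. blk x u * blk y u) (row n t)"
   by (rule cong) (simp add: blk_ops(1)[OF sub])
  also have "... = bdiag (blk x) (row n t) * bdiag (blk y) (row n t)" by (rule bdiag_mult[OF bc[OF x] bc[OF y], symmetric])
  finally show "bdiag (blk (x \<otimes>\<^sub>(St n) y)) (row n t) =
   bdiag (blk x) (row n t) \<otimes>\<^sub>(Mat (dm (Suc n) t)) bdiag (blk y) (row n t)" by simp
 next
  have "bdiag (blk \<one>\<^sub>(St n)) (row n t) = bdiag (%u. 1\<^sub>m (dm n u)) (row n t)"
   by (rule cong) (simp add: blk_ops(5)[OF sub])
  then show "bdiag (blk \<one>\<^sub>(St n)) (row n t) = \<one>\<^sub>(Mat (dm (Suc n) t))"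
   using bdiag_one[of "dm n" "row n t"] by (simp add: dm_Suc)
 qed
qed

text \<open>The entrywise bound carries a factor depending on the block size, which
  \<open>star_hom_contractive\<close> removes.\<close>

lemma row_contractive:
 assumes t: "t : Bl" and x: "x : carrier (St n)"
 shows "nrm (Mat (dm (Suc n) t)) (bdiag (blk x) (row n t)) <= nrm (St n) x"
proof (rule star_hom_contractive[OF row_hom[OF t] pre_cstar_St pre_cstar_mat _ x])
 fix x assume x: "x : carrier (St n)"
 have "u : Bl" if "u : set (row n t)" for u using set_row[OF t] that by blast
 then show "nrm (Mat (dm (Suc n) t)) (bdiag (blk x) (row n t)) <= (real (dm (Suc n) t))\<^sup>2 * nrm (St n) x"
  using bdiag_norm_le[of "row n t" "blk x" "dm n" "nrm (St n) x"] x blk_closed[OF x] blk_norm_le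
  by (simp add: dm_Suc)
qed

lemma tail_hom: "star_hom (St n) (power_cstar (GG) (Mat (rd (Suc n)))) (%x. snd (\<phi> n x))"
proof -
 have "star_hom (St n) (Mat (rd (Suc n))) (%x. bdiag (blk x) (row n (Some h)))" if "h : GG" for h
  using row_hom[of "Some h" n] that dm_Some[of "Suc n" h] by simp
 from star_hom_power[OF this] show ?thesis by (simp add: stage_map_eq)
qed

lemma stage_map_hom: "star_hom (St n) (St (Suc n)) (\<phi> n)"
proof -
 have "star_hom (St n) (St (Suc n)) (%x. (bdiag (blk x) (row n None), snd (\<phi> n x)))"
  unfolding St_eq[of "Suc n"] using star_hom_pair[OF row_hom[of None] tail_hom] by simp
 then show ?thesis by (simp add: stage_map_eq[abs_def])
qed

lemmas stage_map_closed = star_hom_closed[OF stage_map_hom]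

lemma dm_row_le: "u : set (row n t) ==> dm n u <= dm (Suc n) t"
 unfolding dm_Suc[of n t, symmetric] by (rule member_le_sum_list) auto

text \<open>Every block of stage n occurs in some summand \<open>Some h\<close> of stage n + 1, so
  the second summand alone determines the norm. Hence the connecting maps are isometric and, later,
  cutting by q one stage on preserves norms.\<close>

lemma tail_isometric:
 assumes x: "x : carrier (St n)"
 shows "nrm (power_cstar (GG) (Mat (rd (Suc n)))) (snd (\<phi> n x)) = nrm (St n) x"
  (is "nrm ?D _ = _")
proof (rule antisym)
 show "nrm ?D (snd (\<phi> n x)) <= nrm (St n) x"
  unfolding power_norm_le_iff[OF finite_G carrier_nonempty]
  using row_contractive[OF _ x, of "Some _"] by (auto simp: stage_map_eq)
 show "nrm (St n) x <= nrm ?D (snd (\<phi> n x))"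
 proof (rule star_hom_expansive[OF tail_hom pre_cstar_St pre_cstar_power_block _ x])
  fix x assume x: "x : carrier (St n)"
  let ?d = "rd (Suc n)"
  show "nrm (St n) x <= (real ?d)\<^sup>2 * nrm ?D (snd (\<phi> n x))"
   unfolding stage_norm_le_iff
  proof
   fix t assume t: "t : Bl"
   \<comment> \<open>The block \<open>None\<close> occurs in every row, so for it any summand will
     do; the one of the identity is taken.\<close>
   define h where "h = (case t of None => \<one> | Some h => h)"
   have h: "h : GG" "t : set (row n (Some h))" using t by (auto simp: h_def row_def split: option.splits)
   have c: "blk x u : sq (dm n u)" if "u : set (row n (Some h))" for u
    using blk_closed[OF x] set_row[of "Some h" n] h(1) that by blast
   have "nrm (Mat (dm n t)) (blk x t) <= (real (dm n t))\<^sup>2 * nrm (Mat ?d) (bdiag (blk x) (row n (Some h)))"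
    using bdiag_norm_ge[of "row n (Some h)" "blk x" "dm n", OF c h(2)] dm_Some[of "Suc n" h] by (simp add: dm_Suc)
   also have "... <= (real ?d)\<^sup>2 * nrm ?D (snd (\<phi> n x))"
   proof (intro mult_mono power_mono)
    show "real (dm n t) <= real ?d" using dm_row_le[OF h(2)] dm_Some[of "Suc n" h] by simp
    show "nrm (Mat ?d) (bdiag (blk x) (row n (Some h))) <= nrm ?D (snd (\<phi> n x))"
     using power_norm_component[OF finite_G h(1), of "Mat ?d" "snd (\<phi> n x)"] h(1) by (simp add: stage_map_eq)
    show "0 <= nrm (Mat ?d) (bdiag (blk x) (row n (Some h)))"
     using mat_norm_nonneg[OF row_closed[of "Some h", OF _ x]] h(1) by simp
   qed simp_all
   finally show "nrm (Mat (dm n t)) (blk x t) <= (real ?d)\<^sup>2 * nrm ?D (snd (\<phi> n x))" .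
  qed
 qed
qed

lemma stage_map_isometric: assumes x: "x : carrier (St n)" shows "nrm (St (Suc n)) (\<phi> n x) = nrm (St n) x"
proof -
 have "nrm (St (Suc n)) (\<phi> n x) = max (nrm (Mat (dm (Suc n) None)) (bdiag (blk x) (row n None))) (nrm (St n) x)"
  using tail_isometric[OF x] by (cases "\<phi> n x") (simp add: St_eq[of "Suc n"], simp add: stage_map_eq)
 then show ?thesis using row_contractive[of None x n] x by simp
qed

sublocale L: inductive_system St \<phi>
 by unfold_locales (fact stage_map_hom stage_map_isometric)+

text \<open>Since l n > 0, the first summand of stage n + 1 contains every block of stage n. That
  summand is a single matrix algebra, and the embedding is isometric, so the matrix inequalities are
  inherited.\<close>

lemma stage_inequalities:
 assumes I: "finite I" shows "cauchy_schwarz_on I (St n)" "squares_positive_on I (St n)"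
proof -
 have iso: "nrm (Mat (dm (Suc n) None)) (bdiag (blk x) (row n None)) = nrm (St n) x" if x: "x : carrier (St n)" for x
 proof (rule antisym)
  show "nrm (St n) x <= nrm (Mat (dm (Suc n) None)) (bdiag (blk x) (row n None))"
  proof (rule star_hom_expansive[OF row_hom[of None] pre_cstar_St pre_cstar_mat _ x])
   fix x assume x: "x : carrier (St n)"
   have c: "blk x u : sq (dm n u)" if "u : set (row n None)" for u
    using blk_closed[OF x] set_row[of None n] that by blast
   let ?N = "nrm (Mat (dm (Suc n) None)) (bdiag (blk x) (row n None))"
   have N0: "0 <= ?N" using mat_norm_nonneg[OF row_closed[of None, OF _ x]] by simp
   show "nrm (St n) x <= (real (dm (Suc n) None))\<^sup>2 * ?N"
    unfolding stage_norm_le_iff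
   proof
    fix t assume "t : Bl"
    then have t: "t : set (row n None)" by (simp add: set_row_None)
    have "nrm (Mat (dm n t)) (blk x t) <= (real (dm n t))\<^sup>2 * ?N"
     using bdiag_norm_ge[of "row n None" "blk x" "dm n", OF c t] by (simp add: dm_Suc)
    also have "... <= (real (dm (Suc n) None))\<^sup>2 * ?N"
     using dm_row_le[OF t] N0 by (intro mult_right_mono power_mono) auto
    finally show "nrm (Mat (dm n t)) (blk x t) <= (real (dm (Suc n) None))\<^sup>2 * ?N" .
   qed
  qed simp
 qed (rule row_contractive[OF _ x], simp)
 note t = isometric_cauchy_schwarz[OF pre_cstar_St pre_cstar_mat row_hom[of None] iso I]
 show "cauchy_schwarz_on I (St n)" by (rule t(1)[OF _ _ mat_cauchy_schwarz[OF I]]) simp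
 show "squares_positive_on I (St n)" by (rule t(2)[OF _ _ mat_squares_positive[OF I]]) simp
qed

section \<open>The action on the stages\<close>

definition R :: "nat => 'g => 'g option => complex mat" where
 "R n g t = (case t of None => U_rep G gs l U W n g | Some _ => W_rep G gs l U W n g)"

abbreviation tr :: "'g => 'g option => 'g option" where "tr g \<equiv> map_option (%h. inv g \<otimes> h)"

lemma tr_Bl: "[|g : GG; t : Bl|] ==> tr g t : Bl" by auto

lemma dm_tr: "dm n (tr g t) = dm n t" by (cases t) simp_all

lemma rep_R: "unitary_rep G (dm n t) (%g. R n g t)"
proof (induction n arbitrary: t)
 case 0
 then show ?case using rep_U rep_W by (cases t) (simp_all add: R_def dm_def rd_def)
next
 case (Suc n)
 show ?case
 proof (cases t)
  case (Some h)
  have "unitary_rep G (tot (dm n) (row n t)) (%g. bdiag (%u. R n g u) (row n t))"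
   by (rule bdiag_unitary_rep) (rule Suc)
  then show ?thesis unfolding dm_Suc by (simp add: Some row_def R_def)
 next
  case None
  \<comment> \<open>Booleans label the blocks of U_(n+1): \<open>False\<close> for the copies of
    U_n, \<open>True\<close> for the block with the regular representation.\<close>
  let ?d = "%b. if b then m * rd n else dm n None"
  let ?R = "%b g. if b then kronecker (left_regular G gs g) (R n g (Some \<one>)) else R n g None"
  have "unitary_rep G (sum_list (map ?d (replicate (l n) False @ [True]))) (%g. bdiag (%b. ?R b g) (replicate (l n) False @ [True]))"
   by (rule bdiag_unitary_rep) (use Suc[of None] kronecker_rep[OF Suc[of "Some \<one>"]] in auto)
  then show ?thesis by (simp add: None R_def dm_def rd_def sum_list_replicate)
 qed
qed

lemmas R_rep = unitary_repD[OF rep_R]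
lemmas R_adjoint = unitary_rep_adjoint[OF rep_R]
lemmas R_one = unitary_rep_one[OF rep_R]

lemma blk_act: "t : Bl ==> blk (act n g x) t = R n g t * blk x (tr g t) * adj (R n g t)"
 by (cases x; cases t) (auto simp: stage_action_def blk_def R_def)

lemma act_hom_stage: assumes g: "g : GG" shows "star_hom (St n) (St n) (act n g)"
proof -
 have h: "star_hom (St n) (Mat (dm n t)) (%x. R n g t * blk x (tr g t) * adj (R n g t))" if t: "t : Bl" for t
  using star_hom_comp[OF blk_hom[OF tr_Bl[OF g t], unfolded dm_tr] mat.conjugation_hom(1)[of "R n g t" "dm n t"]] R_rep[OF g, where n = n and t = t]
  by simp
 have "star_hom (St n) (Mat (rd n)) (%x. R n g (Some h) * blk x (tr g (Some h)) * adj (R n g (Some h)))"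
  if "h : GG" for h
  using h[of "Some h"] that dm_Some[of n h] by simp
 from star_hom_pair[OF h[of None] star_hom_power[OF this]]
 have "star_hom (St n) (St n) (%x. (R n g None * blk x None * adj (R n g None),
   \<lambda>h\<in>GG. R n g (Some h) * blk x (Some (inv g \<otimes> h)) * adj (R n g (Some h))))"
  unfolding St_eq[of n] by simp
 moreover have "act n g = (%x. (R n g None * blk x None * adj (R n g None),
   \<lambda>h\<in>GG. R n g (Some h) * blk x (Some (inv g \<otimes> h)) * adj (R n g (Some h))))"
  by (auto simp: stage_action_def blk_def R_def)
 ultimately show ?thesis by simp
qed

lemmas act_closed = star_hom_closed[OF act_hom_stage]

lemma act_stage_mult:
 assumes g: "g : GG" and h: "h : GG" and x: "x : carrier (St n)"
 shows "act n (g \<otimes> h) x = act n g (act n h x)"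
proof (rule stage_eqI[of _ n])
 fix t assume t: "t : Bl"
 let ?d = "dm n t"
 have Rh: "R n h (tr g t) = R n h t" by (cases t) (simp_all add: R_def)
 have tt: "tr (g \<otimes> h) t = tr h (tr g t)" using t g h by (auto simp: inv_mult_group m_assoc)
 note Rg = R_rep[OF g, where n = n and t = t] and Rhh = R_rep(1)[OF h, of n t]
 have b: "blk x (tr h (tr g t)) : sq ?d"
  using blk_closed[OF x tr_Bl[OF h tr_Bl[OF g t]]] by (simp add: dm_tr)
 note ad = mat_adjoint_carrier[OF Rg(1)] mat_adjoint_carrier[OF Rhh]
 show "blk (act n (g \<otimes> h) x) t = blk (act n g (act n h x)) t"
  unfolding blk_act[OF t] blk_act[OF tr_Bl[OF g t]] Rh tt Rg(4)[OF h] mat_adjoint_mult[OF Rg(1) Rhh]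
  using Rg(1) Rhh b ad by (simp add: assoc_mult_mat[of _ ?d ?d _ ?d _ ?d])
qed (use g h x act_closed in auto)

lemma act_stage_one: assumes x: "x : carrier (St n)" shows "act n \<one> x = x"
proof (rule stage_eqI[of _ n])
 fix t assume t: "t : Bl"
 have "tr \<one> t = t" using t by auto
 then show "blk (act n \<one> x) t = blk x t" unfolding blk_act[OF t] R_one using blk_closed[OF x t] by simp
qed (use x act_closed in auto)

lemma act_stage_isometric:
 assumes g: "g : GG" and x: "x : carrier (St n)" shows "nrm (St n) (act n g x) = nrm (St n) x"
proof -
 have le: "nrm (St n) (act n g x) <= nrm (St n) x" if g: "g : GG" and x: "x : carrier (St n)" for g x
  unfolding stage_norm_le_iff
 proof
  fix t assume t: "t : Bl"
  have "blk x (tr g t) : sq (dm n t)" using blk_closed[OF x tr_Bl[OF g t]] by (simp add: dm_tr)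
  then have "nrm (Mat (dm n t)) (blk (act n g x) t) <= nrm (Mat (dm n (tr g t))) (blk x (tr g t))"
   unfolding blk_act[OF t] dm_tr using mat.conjugation_hom(2)[of "R n g t" "dm n t"] R_rep[OF g, where n = n and t = t] by simp
  then show "nrm (Mat (dm n t)) (blk (act n g x) t) <= nrm (St n) x"
   using blk_norm_le[OF tr_Bl[OF g t], of n x] by linarith
 qed
 have "act n (inv g) (act n g x) = x" using act_stage_mult[of "inv g" g x n] g x act_stage_one[OF x] by simp
 then show ?thesis using le[OF g x] le[of "inv g" "act n g x"] g x act_closed[OF g x] by simp
qed

text \<open>On \<open>Some h\<close> both sides are computed block by block. On \<open>None\<close>
  the part from D_n is \<open>gmat\<close> at the identity, and the \<lambda> \<otimes> W part of
  U_(n+1) is \<open>gmat\<close> at g with constant coefficients; conjugation by it translates the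
  function on G. This is what the factor \<lambda> is for.\<close>

lemma act_equivariant:
 assumes g: "g : GG" and x: "x : carrier (St n)" shows "act (Suc n) g (\<phi> n x) = \<phi> n (act n g x)"
proof (rule stage_eqI[of _ "Suc n"])
 show "act (Suc n) g (\<phi> n x) : carrier (St (Suc n))" "\<phi> n (act n g x) : carrier (St (Suc n))"
  using g x act_closed stage_map_closed by auto
 note Rg = R_rep(1)[OF g]
 have ax: "act n g x : carrier (St n)" using act_closed g x by blast
 fix t assume t: "t : Bl"
 have goal: "R (Suc n) g t * bdiag (blk x) (row n (tr g t)) * adj (R (Suc n) g t) = bdiag (blk (act n g x)) (row n t)"
 proof (cases t)
  case (Some h)
  have hG: "h : GG" using t Some by auto
  let ?os = "[None, Some h]"
  have c: "R n g u : sq (dm n u)" "blk x (tr g u) : sq (dm n u)"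
   if "u : set ?os" for u
   using that hG g Rg[of n u] blk_closed[OF x tr_Bl[OF g], of u] by (auto simp: dm_tr)
  note ca = mat_adjoint_carrier[OF c(1)] and cm = mult_carrier_mat[OF c]
  have "R (Suc n) g t = bdiag (R n g) ?os" by (simp add: Some R_def)
  moreover have "bdiag (blk x) (row n (tr g t)) = bdiag (%u. blk x (tr g u)) ?os" by (simp add: Some row_def)
  moreover have "adj (bdiag (R n g) ?os) = bdiag (%u. adj (R n g u)) ?os"
   by (rule bdiag_adjoint[OF c(1), symmetric])
  moreover have "bdiag (R n g) ?os * bdiag (%u. blk x (tr g u)) ?os = bdiag (%u. R n g u * blk x (tr g u)) ?os"
   by (rule bdiag_mult[OF c])
  moreover have "bdiag (%u. R n g u * blk x (tr g u)) ?os * bdiag (%u. adj (R n g u)) ?os =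
    bdiag (%u. R n g u * blk x (tr g u) * adj (R n g u)) ?os"
   by (rule bdiag_mult[OF cm ca])
  moreover have "bdiag (%u. R n g u * blk x (tr g u) * adj (R n g u)) ?os = bdiag (blk (act n g x)) (row n t)"
   using hG by (simp add: blk_act Some row_def)
  ultimately show ?thesis by simp
 next
  case None
  let ?os = "replicate (l n) False @ [True]"
  let ?d = "rd n" and ?w = "R n g (Some \<one>)"
  let ?D = "%b. if b then m * ?d else dm n None"
  let ?K = "%b. if b then gmat ?d g (%_. ?w) else R n g None"
  let ?y = "%h. blk x (Some h)" and ?z = "%h. blk (act n g x) (Some h)"
  let ?X = "%x b. if b then gmat ?d \<one> (%h. blk x (Some h)) else blk x None"
  have y: "blk x (Some h) : sq ?d" if "h : GG" "x : carrier (St n)" for h x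
   using blk_closed[OF that(2), of "Some h"] that(1) dm_Some[of n h] by simp
  have X: "bdiag (blk x) (row n None) = bdiag (?X x) ?os" if x: "x : carrier (St n)" for x
  proof -
   have "bdiag (?X x) ?os = diag_block_mat (replicate (l n) (blk x None) @ [bdiag (%h. blk x (Some h)) gs])"
    using bdiag_gmat[OF y[OF _ x]] by (simp del: diag_block_mat.simps)
   also have "... = diag_block_mat (replicate (l n) (blk x None) @ map (%h. blk x (Some h)) gs)"
    unfolding diag_block_mat_append diag_block_mat_singleton ..
   finally show ?thesis by (simp add: row_def comp_def)
  qed
  have RS: "R (Suc n) g None = bdiag ?K ?os"
   using kronecker_gmat[OF Rg[of n "Some \<one>"], of g] by (simp add: R_def)
  have c: "?K b : sq (?D b)" "?X x b : sq (?D b)" if "b : set ?os" for b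
   using Rg[of n None] blk_closed[OF x, of None] by auto
  note ca = mat_adjoint_carrier[OF c(1)] and cm = mult_carrier_mat[OF c]
  have w: "?w : sq ?d" "adj ?w : sq ?d" using Rg[of n "Some \<one>"] by auto
  have "gmat ?d g (%_. ?w) * gmat ?d \<one> ?y = gmat ?d g (%h. ?w * ?y (inv g \<otimes> h))"
   using g by (simp add: gmat_mult[OF g one_closed w(1) y[OF _ x]])
  moreover have "gmat ?d g (%h. ?w * ?y (inv g \<otimes> h)) * gmat ?d (inv g) (%_. adj ?w) =
    gmat ?d \<one> (%h. ?w * ?y (inv g \<otimes> h) * adj ?w)"
  proof -
   have "?w * ?y (inv g \<otimes> h) : sq ?d" if "h : GG" for h
    using y[OF _ x, of "inv g \<otimes> h"] g that w(1) by auto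
   from gmat_mult[OF g inv_closed[OF g] this w(2)] show ?thesis using g by simp
  qed
  moreover have "gmat ?d \<one> (%h. ?w * ?y (inv g \<otimes> h) * adj ?w) = gmat ?d \<one> ?z"
   unfolding gmat_def using div_mod_less g
   by (intro eq_matI) (auto simp: blk_act R_def)
  ultimately have g3: "gmat ?d g (%_. ?w) * gmat ?d \<one> ?y * adj (gmat ?d g (%_. ?w)) = gmat ?d \<one> ?z"
   by (simp add: gmat_adjoint[OF g w(1)])
  have "bdiag ?K ?os * bdiag (?X x) ?os = bdiag (%b. ?K b * ?X x b) ?os" by (rule bdiag_mult[OF c])
  moreover have "bdiag (%b. ?K b * ?X x b) ?os * bdiag (%b. adj (?K b)) ?os =
    bdiag (%b. ?K b * ?X x b * adj (?K b)) ?os"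
   by (rule bdiag_mult[OF cm ca])
  moreover have "adj (bdiag ?K ?os) = bdiag (%b. adj (?K b)) ?os"
   by (rule bdiag_adjoint[OF c(1), symmetric])
  moreover have "(%b. ?K b * ?X x b * adj (?K b)) = ?X (act n g x)"
   using g3 by (auto simp: blk_act)
  ultimately show ?thesis unfolding None option.map RS X[OF x] X[OF ax] by simp
 qed
 show "blk (act (Suc n) g (\<phi> n x)) t = blk (\<phi> n (act n g x)) t"
  unfolding blk_act[OF t] blk_map[OF t] blk_map[OF tr_Bl[OF g t]] by (rule goal)
qed

end

section \<open>The limit action\<close>

context AF_system
begin

abbreviation "AA \<equiv> AF_algebra G gs l k r"
abbreviation "aa \<equiv> AF_action G gs l k r U W"
abbreviation "\<iota> \<equiv> L.stage_incl"

lemma AA_eq: "AA = inductive_limit St \<phi>" by (simp add: AF_algebra_def)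

lemma aa_eq: "aa g = seq_map (null_rel St (limit_seqs St \<phi>) sequentially) (%n. act n g)"
 by (simp add: AF_action_def limit_action_def)

lemma aa_hom: "g : GG ==> star_hom AA AA (aa g)"
 unfolding AA_eq aa_eq by (rule L.limit_map_hom) (auto intro: act_hom_stage act_stage_isometric act_equivariant)

lemma aa_isometric: "[|g : GG; X : carrier AA|] ==> nrm AA (aa g X) = nrm AA X"
 unfolding AA_eq aa_eq by (rule L.limit_map_isometric) (auto intro: act_hom_stage act_stage_isometric act_equivariant)

lemma aa_cls: "[|g : GG; a : limit_seqs St \<phi>|] ==> aa g (L.limit.cls a) = L.limit.cls (%n. act n g (a n))"
 unfolding aa_eq by (rule L.limit_map_cls) (auto intro: act_hom_stage act_stage_isometric act_equivariant)

lemma aa_seqs: "[|g : GG; a : limit_seqs St \<phi>|] ==> (%n. act n g (a n)) : limit_seqs St \<phi>"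
 by (rule L.limit_seqs_map) (auto intro: act_hom_stage act_stage_isometric act_equivariant)

lemma aa_incl: "[|g : GG; b : carrier (St n)|] ==> aa g (\<iota> n b) = \<iota> n (act n g b)"
 unfolding aa_eq by (rule L.limit_map_stage_incl) (auto intro: act_hom_stage act_stage_isometric act_equivariant)

lemma finite_action_AF: "finite_action G AA aa"
proof (intro finite_action.intro group_axioms finite_G)
 show "cstar_algebra AA" unfolding AA_eq by (rule L.cstar_algebra_limit)
 show "cauchy_schwarz_on (GG) AA" "squares_positive_on (GG) AA"
  unfolding AA_eq by (intro L.limit_cauchy_schwarz L.limit_squares_positive finite_G stage_inequalities)+
 fix X assume X: "X : carrier AA"
 then have "X : carrier L.limit.quot" by (simp add: AA_eq inductive_limit_def)
 then obtain a where a: "a : limit_seqs St \<phi>" "X = L.limit.cls a" by (rule L.limit.quotE)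
 show "aa \<one> X = X"
  unfolding a(2) aa_cls[OF one_closed a(1)] using act_stage_one[OF L.limit_seqs_closed[OF a(1)]] by simp
 show "aa (g \<otimes> h) X = aa g (aa h X)" if "g : GG" "h : GG" for g h
  unfolding a(2) aa_cls[OF m_closed[OF that] a(1)] aa_cls[OF that(2) a(1)] aa_cls[OF that(1) aa_seqs[OF that(2) a(1)]]
  using act_stage_mult[OF that L.limit_seqs_closed[OF a(1)]] by simp
qed (auto intro: aa_hom aa_isometric)

lemma \<iota>_hom: "star_hom (St n) AA (\<iota> n)" unfolding AA_eq by (rule L.stage_incl_hom)

lemma pre_cstar_AA: "pre_cstar AA" unfolding AA_eq by (rule L.L.pre_cstar_axioms)

lemmas \<iota>_closed = star_hom_closed[OF \<iota>_hom]
lemmas \<iota>_mult = star_hom_mult[OF \<iota>_hom, symmetric]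
lemmas \<iota>_star = star_hom_star[OF \<iota>_hom, symmetric]

lemma \<iota>_conj:
 "[|w : carrier (St n); x : carrier (St n)|] ==>
  \<iota> n w \<otimes>\<^sub>AA \<iota> n x \<otimes>\<^sub>AA star AA (\<iota> n w) = \<iota> n (w \<otimes>\<^sub>(St n) x \<otimes>\<^sub>(St n) star (St n) w)"
 by (simp add: \<iota>_mult \<iota>_star)

section \<open>Diagonal projections\<close>

definition eu :: "nat => nat => complex mat" where
 "eu d a = mat d d (%(i, j). if i = a & j = a then 1 else 0)"

definition E :: "nat => 'g option \<times> nat => 'g stage" where
 "E n i = mk (%t. if t = fst i then eu (dm n t) (snd i) else 0\<^sub>m (dm n t) (dm n t))"

definition cut :: "nat => 'g option set => 'g stage" where
 "cut n J = mk (%t. if t : J then 1\<^sub>m (dm n t) else 0\<^sub>m (dm n t) (dm n t))"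

definition ve :: "nat => 'g => 'g stage" where
 "ve n g = mk (%t. if t = None then R n g t else 0\<^sub>m (dm n t) (dm n t))"

definition units :: "nat => 'g option set => ('g option \<times> nat) set" where
 "units n J = Sigma J (%u. {..<dm n u})"

lemma eu_carrier [simp]: "eu d a : sq d" by (simp add: eu_def)

lemma E_closed [simp]: "E n i : carrier (St n)" unfolding E_def by (rule mk_closed) simp

lemma cut_closed [simp]: "cut n J : carrier (St n)" unfolding cut_def by (rule mk_closed) simp

lemma ve_closed [simp]: "g : GG ==> ve n g : carrier (St n)"
 unfolding ve_def by (rule mk_closed) (simp add: R_rep(1))

lemma blk_E: "t : Bl ==> blk (E n i) t = (if t = fst i then eu (dm n t) (snd i) else 0\<^sub>m (dm n t) (dm n t))"
 by (simp only: E_def blk_mk)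

lemma blk_cut: "t : Bl ==> blk (cut n J) t = (if t : J then 1\<^sub>m (dm n t) else 0\<^sub>m (dm n t) (dm n t))"
 by (simp only: cut_def blk_mk)

lemma blk_ve: "t : Bl ==> blk (ve n g) t = (if t = None then R n g t else 0\<^sub>m (dm n t) (dm n t))"
 by (simp only: ve_def blk_mk)

lemma eu_adjoint: "adj (eu d a) = eu d a" by (rule eq_matI) (auto simp: eu_def)

lemma eu_compress:
 assumes x: "x : sq d" and a: "a < d" shows "eu d a * x * eu d a = x $$ (a, a) \<cdot>\<^sub>m eu d a"
proof (rule eq_matI)
 have 1: "(eu d a * x) $$ (i, j) = (if i = a then x $$ (a, j) else 0)" if "i < d" "j < d" for i j
 proof -
  have "(eu d a * x) $$ (i, j) = (\<Sum>l<d. if l = a then if i = a then x $$ (a, j) else 0 else 0)"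
   unfolding mat_mult_index_sum[OF eu_carrier x that] using that by (intro sum.cong) (auto simp: eu_def)
  then show ?thesis using a by simp
 qed
 fix i j assume "i < dim_row (x $$ (a, a) \<cdot>\<^sub>m eu d a)" "j < dim_col (x $$ (a, a) \<cdot>\<^sub>m eu d a)"
 then have ij: "i < d" "j < d" by (simp_all add: eu_def)
 have "(eu d a * x * eu d a) $$ (i, j) = (\<Sum>l<d. (eu d a * x) $$ (i, l) * eu d a $$ (l, j))"
  by (rule mat_mult_index_sum[OF mult_carrier_mat[OF eu_carrier x] eu_carrier ij])
 also have "... = (\<Sum>l<d. if l = a then (eu d a * x) $$ (i, a) * eu d a $$ (a, j) else 0)"
  using ij by (intro sum.cong) (auto simp: eu_def)
 finally show "(eu d a * x * eu d a) $$ (i, j) = (x $$ (a, a) \<cdot>\<^sub>m eu d a) $$ (i, j)"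
  using a ij 1[OF ij(1) a] by (auto simp: eu_def)
qed (use x in "simp_all add: eu_def")

lemma eu_idem: assumes "a < d" shows "eu d a * eu d a = eu d a"
proof -
 have "eu d a * 1\<^sub>m d * eu d a = (1\<^sub>m d $$ (a, a)) \<cdot>\<^sub>m eu d a" using assms by (intro eu_compress) auto
 moreover have "(1 :: complex) \<cdot>\<^sub>m eu d a = eu d a" by (rule eq_matI) auto
 ultimately show ?thesis using assms right_mult_one_mat[OF eu_carrier[of d a]] by simp
qed

lemma mat_finsum_index:
 assumes "finite J" "!!x. x : J ==> f x : sq d" "i < d" "j < d"
 shows "(\<Oplus>\<^sub>(Mat d) x\<in>J. f x) $$ (i, j) = (\<Sum>x\<in>J. f x $$ (i, j))"
 using assms
proof (induction J rule: finite_induct)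
 case (insert x J)
 have c: "(\<Oplus>\<^sub>(Mat d) x\<in>J. f x) : sq d"
  using mat.finsum_closed[of f J d] insert.prems by auto
 have "(\<Oplus>\<^sub>(Mat d) x\<in>insert x J. f x) = f x + (\<Oplus>\<^sub>(Mat d) x\<in>J. f x)"
  using insert mat.finsum_insert[of J x f d] by auto
 then show ?case using insert c by auto
qed simp

lemma sum_units:
 assumes J: "J <= Bl" shows "(\<Oplus>\<^sub>(St n) i\<in>units n J. E n i) = cut n J"
proof (rule stage_eqI[of _ n])
 have fin: "finite (units n J)" unfolding units_def using J finite_G by (intro finite_SigmaI) (auto intro: finite_subset)
 show "(\<Oplus>\<^sub>(St n) i\<in>units n J. E n i) : carrier (St n)" by (intro St.finsum_closed) auto
 fix t assume t: "t : Bl"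
 have fJ: "finite J" using J finite_G finite_subset by blast
 have e: "blk (E n i) t : sq (dm n t)" for i using blk_closed[OF E_closed t] .
 have bs: "blk (\<Oplus>\<^sub>(St n) i\<in>units n J. E n i) t = (\<Oplus>\<^sub>(Mat (dm n t)) i\<in>units n J. blk (E n i) t)"
  by (rule star_hom_finsum[OF blk_hom[OF t] pre_cstar_St pre_cstar_mat fin]) simp
 have cc: "blk (cut n J) t : sq (dm n t)" by (rule blk_closed[OF cut_closed t])
 have sc: "blk (\<Oplus>\<^sub>(St n) i\<in>units n J. E n i) t : sq (dm n t)"
  by (rule blk_closed[OF St.finsum_closed t]) simp
 show "blk (\<Oplus>\<^sub>(St n) i\<in>units n J. E n i) t = blk (cut n J) t"
 proof (rule eq_matI)
  fix i j assume "i < dim_row (blk (cut n J) t)" "j < dim_col (blk (cut n J) t)"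
  then have ij: "i < dm n t" "j < dm n t" using cc by auto
  have "(\<Sum>x\<in>units n J. blk (E n x) t $$ (i, j)) = (\<Sum>u\<in>J. \<Sum>a<dm n u. blk (E n (u, a)) t $$ (i, j))"
   unfolding units_def using fJ by (subst sum.Sigma) (auto simp: case_prod_beta)
  also have "... = (\<Sum>u\<in>J. if u = t then \<Sum>a<dm n t. if a = i then if i = j then 1 else 0 else 0 else 0)"
   using ij by (intro sum.cong refl) (auto simp: blk_E[OF t] eu_def intro!: sum.cong sum.neutral)
  also have "... = blk (cut n J) t $$ (i, j)" using ij fJ by (simp add: blk_cut[OF t])
  finally show "blk (\<Oplus>\<^sub>(St n) i\<in>units n J. E n i) t $$ (i, j) = blk (cut n J) t $$ (i, j)"
   unfolding bs mat_finsum_index[OF fin e ij] .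
 qed (use cc sc in auto)
qed simp

lemma cut_all: "cut n Bl = \<one>\<^sub>(St n)"
 by (rule stage_eqI[of _ n]) (simp_all only: St.one_closed cut_closed blk_cut blk_ops(5) if_True)

lemma cut_complement: "\<one>\<^sub>(St n) \<ominus>\<^sub>(St n) ve n \<one> = cut n (Some ` GG)"
proof -
 have "\<one>\<^sub>(St n) = cut n (Some ` GG) \<oplus>\<^sub>(St n) ve n \<one>"
 proof (rule stage_eqI[of _ n])
  fix t assume t: "t : Bl"
  show "blk \<one>\<^sub>(St n) t = blk (cut n (Some ` GG) \<oplus>\<^sub>(St n) ve n \<one>) t"
   unfolding blk_ops[OF t] blk_cut[OF t] blk_ve[OF t] R_one using t by auto
 qed simp_all
 then show ?thesis by (simp add: St.minus_eq St.a_assoc St.r_neg)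
qed

lemma q_eq: "\<one>\<^sub>AA \<ominus>\<^sub>AA \<iota> n (ve n \<one>) = \<iota> n (cut n (Some ` GG))"
 unfolding cut_complement[symmetric] star_hom_one[OF \<iota>_hom[of n], symmetric]
 by (rule star_hom_minus[OF \<iota>_hom pre_cstar_St pre_cstar_AA, symmetric]) simp_all

subsection \<open>Ranks\<close>

definition has_rank :: "nat => 'g stage => ('g option => nat) => bool" where
 "has_rank n x c \<longleftrightarrow> x : carrier (St n) & (\<forall>t\<in>Bl. diag01 (dm n t) (blk x t) (c t))"

lemma has_rank_compare:
 assumes x: "has_rank n x c" and y: "has_rank n y c'" and le: "!!t. t : Bl ==> c' t <= c t"
 shows "\<exists>w\<in>carrier (St n). w \<otimes>\<^sub>(St n) x \<otimes>\<^sub>(St n) star (St n) w = y"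
proof -
 have "\<forall>t\<in>Bl. \<exists>w\<in>sq (dm n t). w * blk x t * adj w = blk y t"
  using x y le diag01_compare unfolding has_rank_def by blast
 then obtain f where f: "!!t. t : Bl ==> f t : sq (dm n t)"
  "!!t. t : Bl ==> f t * blk x t * adj (f t) = blk y t" by metis
 have c: "mk f : carrier (St n)" by (rule mk_closed[OF f(1)])
 have xy: "x : carrier (St n)" "y : carrier (St n)" using x y by (auto simp: has_rank_def)
 have "mk f \<otimes>\<^sub>(St n) x \<otimes>\<^sub>(St n) star (St n) (mk f) = y"
 proof (rule stage_eqI[of _ n])
  fix t assume t: "t : Bl"
  show "blk (mk f \<otimes>\<^sub>(St n) x \<otimes>\<^sub>(St n) star (St n) (mk f)) t = blk y t"
   unfolding blk_ops[OF t] blk_mk[OF t] by (rule f(2)[OF t])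
 qed (use c xy in auto)
 then show ?thesis using c by blast
qed

text \<open>The connecting map places blocks along a diagonal, so ranks add up along a row of the
  Bratteli diagram.\<close>

lemma has_rank_Suc: "has_rank n x c ==> has_rank (Suc n) (\<phi> n x) (%t. sum_list (map c (row n t)))"
 unfolding has_rank_def
proof (intro conjI ballI)
 assume x: "x : carrier (St n) & (\<forall>t\<in>Bl. diag01 (dm n t) (blk x t) (c t))"
 then show "\<phi> n x : carrier (St (Suc n))" by (simp add: stage_map_closed)
 fix t assume t: "t : Bl"
 have "diag01 (tot (dm n) (row n t)) (bdiag (blk x) (row n t)) (sum_list (map c (row n t)))"
  by (rule diag01_bdiag) (use x set_row[OF t] in blast)
 then show "diag01 (dm (Suc n) t) (blk (\<phi> n x) t) (sum_list (map c (row n t)))"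
  unfolding dm_Suc blk_map[OF t] .
qed

lemma has_rank_cut: "has_rank n (cut n J) (%t. if t : J then dm n t else 0)"
proof -
 have "diag01 (dm n t) (blk (cut n J) t) (if t : J then dm n t else 0)" if "t : Bl" for t
  unfolding diag01_def blk_cut[OF that] by (rule conjI, simp, rule exI[of _ "if t : J then {..<dm n t} else {}"]) auto
 then show ?thesis by (simp add: has_rank_def del: ball_simps)
qed

lemma has_rank_E: assumes "i : units n Bl" shows "has_rank n (E n i) (%t. if t = fst i then 1 else 0)"
proof -
 have "diag01 (dm n t) (blk (E n i) t) (if t = fst i then 1 else 0)" if "t : Bl" for t
  unfolding diag01_def blk_E[OF that] using assms
  by (intro conjI exI[of _ "if t = fst i then {snd i} else {}"]) (auto simp: units_def eu_def)
 then show ?thesis by (simp add: has_rank_def del: ball_simps)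
qed

text \<open>The rank in block t, after d steps, of a minimal projection of block u. It counts the
  paths from u to t in the Bratteli diagram.\<close>

primrec rk :: "nat => 'g option => nat => 'g option => nat" where
 "rk n u 0 = (%t. if t = u then 1 else 0)"
| "rk n u (Suc d) = (%t. sum_list (map (rk n u d) (row (n + d) t)))"

lemma has_rank_connecting:
 assumes "i : units n Bl" shows "has_rank (n + d) (connecting \<phi> n d (E n i)) (rk n (fst i) d)"
 by (induction d) (use has_rank_E[OF assms] has_rank_Suc in auto)

lemma rk_Some: "rk n u (Suc d) (Some h) = rk n u d None + rk n u d (Some h)" by (simp add: row_def)

lemma rk_None: "rk n u (Suc d) None = l (n + d) * rk n u d None + (\<Sum>h\<in>GG. rk n u d (Some h))"
 by (simp only: rk.simps sum_row_None)

lemma rk_None_mono: "rk n u d None <= rk n u (Suc d) None"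
 unfolding rk_None using l_pos[of "n + d"] by (simp add: trans_le_add1)

text \<open>The first step leads from \<open>Some h\<close> to \<open>None\<close>, and from
  \<open>None\<close> the second step reaches every block.\<close>

lemma rk_pos:
 assumes u: "u : Some ` GG" and t: "t : Bl" shows "1 <= rk n u 2 t"
proof -
 obtain h where h: "u = Some h" "h : GG" using u by auto
 have "1 <= (\<Sum>g\<in>GG. rk n u 0 (Some g))"
  using member_le_sum[of h "GG" "%g. rk n u 0 (Some g)"] h finite_G by simp
 then have 1: "1 <= rk n u 1 None" using rk_None[of n u 0] by simp
 show ?thesis using t 1 rk_None_mono[of n u 1] rk_Some[of n u 1] by (auto simp: numeral_2_eq_2)
qed

text \<open>The block sizes and the ranks obey the same recursion with nonnegative coefficients, so
  a bound on their quotient at d = 2 persists for all later d.\<close>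

lemma rk_lower_bound:
 assumes u: "u : Some ` GG"
 shows "\<exists>K>0. \<forall>d\<ge>2. \<forall>t\<in>Bl. dm (n + d) t <= K * rk n u d t"
proof (intro exI conjI allI impI)
 \<comment> \<open>All ranks are at least 1 for d = 2, so K only has to dominate both block sizes at
   stage n + 2; the added 1 makes it positive.\<close>
 let ?K = "dm (n + 2) None + rd (n + 2) + 1"
 show "0 < ?K" by simp
 fix d :: nat assume "2 <= d"
 then show "\<forall>t\<in>Bl. dm (n + d) t <= ?K * rk n u d t"
 proof (induction d rule: dec_induct)
  case base
  show ?case
  proof
   fix t assume t: "t : Bl"
   have "dm (n + 2) t <= ?K * 1" using t by auto
   also have "... <= ?K * rk n u 2 t" by (rule mult_le_mono2[OF rk_pos[OF u t]])
   finally show "dm (n + 2) t <= ?K * rk n u 2 t" .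
  qed
 next
  case (step d)
  show ?case
  proof
   fix t assume t: "t : Bl"
   have "dm (n + Suc d) t = sum_list (map (dm (n + d)) (row (n + d) t))" using dm_Suc[of "n + d" t] by simp
   also have "... <= sum_list (map (%v. ?K * rk n u d v) (row (n + d) t))"
    by (rule sum_list_mono) (use step.IH set_row[OF t] in blast)
   also have "... = ?K * rk n u (Suc d) t" by (simp only: rk.simps sum_list_const_mult)
   finally show "dm (n + Suc d) t <= ?K * rk n u (Suc d) t" .
  qed
 qed
qed

lemma dm_None_Suc: "dm (Suc n) None = l n * dm n None + m * rd n"
 using sum_row_None[of "dm n" n] by (simp add: dm_Suc)

lemma rd_Suc: "rd (Suc n) = dm n None + rd n" by (simp add: rd_def dm_def)

text \<open>The quotient k_n / r_n tends to infinity: the new r is at most twice the old k, while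
  the new k is at least l times the old k.\<close>

lemma ratio: "\<exists>N0. \<forall>N\<ge>N0. T * rd N <= dm N None"
proof -
 have "eventually (%n. 2 * T <= l n) sequentially" using l_lim by (simp add: filterlim_at_top)
 then obtain n0 where n0: "!!n. n >= n0 ==> 2 * T <= l n" by (auto simp: eventually_sequentially)
 have ge: "rd (Suc n) <= dm (Suc n) None" for n
  unfolding dm_None_Suc rd_Suc using l_pos[of n] m_pos by (intro add_mono) auto
 have "T * rd N <= dm N None" if N: "N >= n0 + 2" for N
 proof -
  \<comment> \<open>Two steps back from N: one secures r <= k at stage n + 1, the other brings in a
    large l.\<close>
  obtain n where n: "N = Suc (Suc n)" "Suc n >= n0" using N by (metis Suc_le_D add_2_eq_Suc' le_Suc_eq Suc_le_mono add_leD1)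
  have "T * rd N <= 2 * T * dm (Suc n) None" unfolding n(1) rd_Suc[of "Suc n"] using ge[of n] by (simp add: algebra_simps)
  also have "... <= l (Suc n) * dm (Suc n) None" using n0[OF n(2)] by (intro mult_le_mono1) simp
  also have "... <= dm N None" unfolding n(1) dm_None_Suc[of "Suc n"] by simp
  finally show ?thesis .
 qed
 then show ?thesis by blast
qed

lemma incl_connecting: "b : carrier (St n) ==> \<iota> (n + d) (connecting \<phi> n d b) = \<iota> n b"
 using L.stage_incl_connecting[of b n "n + d"] by simp

lemma connecting_closed: "b : carrier (St n) ==> connecting \<phi> n d b : carrier (St (n + d))"
 by (rule L.connecting_closed)

lemma units_sub: "i : units n (Some ` GG) ==> i : units n Bl & fst i : Some ` GG & snd i < dm n (fst i)"
 by (auto simp: units_def)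

text \<open>At stage N itself the projection q_N fills the whole of D_N, where the image of E has
  smaller rank. One stage later q_N has rank r_N in the summands of D_(N+1) and |G| r_N in B_(N+1),
  while E has in every block at least the rank that it had in B_N. That rank is a fixed proportion
  of k_N, hence at least |G| r_N for large N by \<open>ratio\<close>.\<close>

lemma E_compare:
 assumes i: "i : units n (Some ` GG)"
 shows "\<exists>j\<ge>J. \<exists>y\<in>carrier AA. y \<otimes>\<^sub>AA \<iota> n (E n i) \<otimes>\<^sub>AA star AA y = \<iota> j (cut j (Some ` GG))"
proof -
 note i' = units_sub[OF i]
 let ?u = "fst i"
 obtain K where K: "K > 0" "\<forall>d\<ge>2. \<forall>t\<in>Bl. dm (n + d) t <= K * rk n ?u d t" using rk_lower_bound[of ?u n] i' by blast
 obtain N0 where N0: "\<forall>N\<ge>N0. K * m * rd N <= dm N None" using ratio[of "K * m"] by blast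
 \<comment> \<open>N0 is for \<open>ratio\<close>, J for the requested lower bound on j, and 2 for
   \<open>rk_lower_bound\<close>.\<close>
 define d where "d = N0 + J + 2"
 let ?N = "n + d"
 have d2: "d >= 2" "?N >= N0" "?N >= J" by (simp_all add: d_def)
 have "K * (m * rd ?N) <= dm ?N None" using N0[rule_format, OF d2(2)] by (simp add: mult.assoc)
 also have "... <= K * rk n ?u d None" using K(2)[rule_format, OF d2(1), of None] by simp
 finally have big: "m * rd ?N <= rk n ?u d None" using K(1) by simp
 have x: "has_rank (Suc ?N) (connecting \<phi> n (Suc d) (E n i)) (rk n ?u (Suc d))"
  using has_rank_connecting[of i n "Suc d"] i' by simp
 let ?c = "%t. if t : Some ` GG then dm ?N t else 0"
 have y: "has_rank (Suc ?N) (\<phi> ?N (cut ?N (Some ` GG))) (%t. tot ?c (row ?N t))"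
  by (rule has_rank_Suc[OF has_rank_cut])
 have le: "tot ?c (row ?N t) <= rk n ?u (Suc d) t" if t: "t : Bl" for t
 proof (cases t)
  case None
  have e: "tot ?c (row ?N None) = m * rd ?N" unfolding sum_row_None by simp
  show ?thesis unfolding None e using big rk_None_mono[of n ?u d] by linarith
 next
  case (Some h)
  have "sum_list (map ?c (row ?N (Some h))) <= rd ?N" by (auto simp: row_def)
  also have "... <= m * rd ?N" using m_pos by simp
  finally show ?thesis unfolding Some rk_Some using big by linarith
 qed
 obtain w where w: "w : carrier (St (Suc ?N))"
  "w \<otimes>\<^sub>(St (Suc ?N)) connecting \<phi> n (Suc d) (E n i) \<otimes>\<^sub>(St (Suc ?N)) star (St (Suc ?N)) w = \<phi> ?N (cut ?N (Some ` GG))"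
  using has_rank_compare[OF x y le] by blast
 have cc: "connecting \<phi> n (Suc d) (E n i) : carrier (St (Suc ?N))" using x by (simp add: has_rank_def)
 have e: "\<iota> (Suc ?N) (connecting \<phi> n (Suc d) (E n i)) = \<iota> n (E n i)"
  using incl_connecting[OF E_closed, of n "Suc d" i] by (simp del: connecting.simps)
 have "\<iota> (Suc ?N) w \<otimes>\<^sub>AA \<iota> n (E n i) \<otimes>\<^sub>AA star AA (\<iota> (Suc ?N) w) =
   \<iota> (Suc ?N) (w \<otimes>\<^sub>(St (Suc ?N)) connecting \<phi> n (Suc d) (E n i) \<otimes>\<^sub>(St (Suc ?N)) star (St (Suc ?N)) w)"
  by (rule \<iota>_conj[OF w(1) cc, unfolded e])
 also have "... = \<iota> ?N (cut ?N (Some ` GG))" unfolding w(2) by (rule L.stage_incl_Suc) simp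
 finally show ?thesis using \<iota>_closed[OF w(1)] by (intro exI[of _ ?N] conjI bexI[of _ "\<iota> (Suc ?N) w"] d2)
qed

text \<open>After two steps E has rank at least 1 in every block, so each diagonal matrix unit of
  that stage is obtained from it by compression; these units add up to 1.\<close>

lemma E_full:
 assumes i: "i : units n (Some ` GG)"
 shows "\<exists>(d::nat) w. w : {..<d} \<rightarrow> carrier AA \<and>
  \<one>\<^sub>AA = (\<Oplus>\<^sub>AA j\<in>{..<d}. w j \<otimes>\<^sub>AA \<iota> n (E n i) \<otimes>\<^sub>AA star AA (w j))"
proof -
 interpret A: pre_cstar AA by (rule pre_cstar_AA)
 note i' = units_sub[OF i]
 let ?N = "n + 2" and ?X = "connecting \<phi> n 2 (E n i)"
 have x: "has_rank ?N ?X (rk n (fst i) 2)" using has_rank_connecting[of i n 2] i' by simp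
 have "\<forall>j\<in>units ?N Bl. \<exists>w\<in>carrier (St ?N). w \<otimes>\<^sub>(St ?N) ?X \<otimes>\<^sub>(St ?N) star (St ?N) w = E ?N j"
 proof
  fix j assume j: "j : units ?N Bl"
  show "\<exists>w\<in>carrier (St ?N). w \<otimes>\<^sub>(St ?N) ?X \<otimes>\<^sub>(St ?N) star (St ?N) w = E ?N j"
  proof (rule has_rank_compare[OF x has_rank_E[OF j]])
   fix t assume "t : Bl"
   then show "(if t = fst j then 1 else 0) <= rk n (fst i) 2 t" using rk_pos[of "fst i" t n] i' by auto
  qed
 qed
 then obtain w where w: "!!j. j : units ?N Bl ==> w j : carrier (St ?N)"
  "!!j. j : units ?N Bl ==> w j \<otimes>\<^sub>(St ?N) ?X \<otimes>\<^sub>(St ?N) star (St ?N) (w j) = E ?N j" by metis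
 have fin: "finite (units ?N Bl)" unfolding units_def using finite_G by (intro finite_SigmaI) auto
 let ?y = "%j. \<iota> ?N (w j)" and ?p = "\<iota> n (E n i)"
 have Xc: "?X : carrier (St ?N)" by (rule connecting_closed[OF E_closed])
 have e: "\<iota> ?N ?X = ?p" by (rule incl_connecting[OF E_closed])
 have eq: "?y j \<otimes>\<^sub>AA ?p \<otimes>\<^sub>AA star AA (?y j) = \<iota> ?N (E ?N j)" if j: "j : units ?N Bl" for j
  by (rule \<iota>_conj[OF w(1)[OF j] Xc, unfolded e w(2)[OF j]])
 have yc: "?y j : carrier AA" if "j : units ?N Bl" for j by (rule \<iota>_closed[OF w(1)[OF that]])
 obtain h where h: "bij_betw h {0..<card (units ?N Bl)} (units ?N Bl)" using ex_bij_betw_nat_finite[OF fin] by blast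
 then have hj: "h j : units ?N Bl" if "j < card (units ?N Bl)" for j using that bij_betwE by force
 have "\<one>\<^sub>AA = \<iota> ?N (\<Oplus>\<^sub>(St ?N) j\<in>units ?N Bl. E ?N j)"
  unfolding sum_units[OF order_refl] cut_all by (rule star_hom_one[OF \<iota>_hom, symmetric])
 also have "... = (\<Oplus>\<^sub>AA j\<in>units ?N Bl. \<iota> ?N (E ?N j))"
  by (rule star_hom_finsum[OF \<iota>_hom pre_cstar_St pre_cstar_AA fin]) simp
 also have "... = (\<Oplus>\<^sub>AA j\<in>h ` {..<card (units ?N Bl)}. \<iota> ?N (E ?N j))"
  using h by (simp add: bij_betw_def atLeast0LessThan)
 also have "... = (\<Oplus>\<^sub>AA j\<in>{..<card (units ?N Bl)}. \<iota> ?N (E ?N (h j)))"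
  using h by (intro A.finsum_reindex) (auto simp: bij_betw_def atLeast0LessThan \<iota>_closed)
 also have "... = (\<Oplus>\<^sub>AA j\<in>{..<card (units ?N Bl)}. ?y (h j) \<otimes>\<^sub>AA ?p \<otimes>\<^sub>AA star AA (?y (h j)))"
  using eq[OF hj] by (intro A.finsum_cong') (auto simp: \<iota>_closed)
 finally show ?thesis using yc[OF hj] by (intro exI[of _ "card (units ?N Bl)"] exI[of _ "%j. ?y (h j)"]) auto
qed

end

section \<open>The inductive limit action is approximately representable\<close>

context AF_system
begin

lemma blk_zero: "t : Bl ==> blk \<zero>\<^sub>(St n) t = 0\<^sub>m (dm n t) (dm n t)" by (simp add: blk_ops(6))

lemma k_dim_pos: "dm n None > 0"
proof (induction n)
 case (Suc n)
 then show ?case unfolding dm_None_Suc using l_pos[of n] by simp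
qed (simp add: dm_def k_pos)

lemma ve_mult: assumes g: "g : GG" and h: "h : GG" shows "ve n g \<otimes>\<^sub>(St n) ve n h = ve n (g \<otimes> h)"
proof (rule stage_eqI[of _ n])
 fix t assume t: "t : Bl"
 show "blk (ve n g \<otimes>\<^sub>(St n) ve n h) t = blk (ve n (g \<otimes> h)) t"
  unfolding blk_ops[OF t] blk_ve[OF t] by (cases t) (simp_all add: R_rep(4)[OF g h, of n None])
qed (use g h in auto)

lemma ve_star: assumes g: "g : GG" shows "star (St n) (ve n g) = ve n (inv g)"
proof (rule stage_eqI[of _ n])
 fix t assume t: "t : Bl"
 show "blk (star (St n) (ve n g)) t = blk (ve n (inv g)) t"
  unfolding blk_ops[OF t] blk_ve[OF t] by (cases t) (simp_all add: R_adjoint[OF g, of n None])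
qed (use g in auto)

lemma ve_comm:
 assumes g: "g : GG" and x: "x : carrier (St n)"
 shows "ve n g \<otimes>\<^sub>(St n) x = act n g x \<otimes>\<^sub>(St n) ve n g"
proof (rule stage_eqI[of _ n])
 have ax: "act n g x : carrier (St n)" by (rule act_closed[OF g x])
 then show "ve n g \<otimes>\<^sub>(St n) x : carrier (St n)" "act n g x \<otimes>\<^sub>(St n) ve n g : carrier (St n)" using g x by auto
 fix t assume t: "t : Bl"
 let ?d = "dm n t"
 have b: "blk x t : sq ?d" "blk (act n g x) t : sq ?d" using blk_closed x ax t by auto
 show "blk (ve n g \<otimes>\<^sub>(St n) x) t = blk (act n g x \<otimes>\<^sub>(St n) ve n g) t"
 proof (cases "t = None")
  case True
  note r = R_rep[OF g, where n = n and t = None]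
  have bN: "blk x None : sq (dm n None)" using blk_closed[OF x] by simp
  have "R n g None * blk x None * adj (R n g None) * R n g None = R n g None * blk x None"
   using r(1,3) mat_adjoint_carrier[OF r(1)] bN
   by (simp add: assoc_mult_mat[of _ "dm n None" "dm n None" _ "dm n None" _ "dm n None"])
  then show ?thesis unfolding blk_ops[OF t] blk_ve[OF t] blk_act[OF t] unfolding True by simp
 next
  case False
  show ?thesis unfolding blk_ops[OF t] blk_ve[OF t] if_not_P[OF False] using b by simp
 qed
qed

lemma ve_act:
 assumes g: "g : GG" and h: "h : GG" shows "act n h (ve n g) = ve n (h \<otimes> g \<otimes> inv h)"
proof (rule stage_eqI[of _ n])
 show "act n h (ve n g) : carrier (St n)" by (rule act_closed[OF h ve_closed[OF g]])
 fix t assume t: "t : Bl"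
 note r = R_rep(1)[OF h, of n t]
 show "blk (act n h (ve n g)) t = blk (ve n (h \<otimes> g \<otimes> inv h)) t"
 proof (cases "t = None")
  case True
  have "R n (h \<otimes> g \<otimes> inv h) None = R n h None * R n g None * adj (R n h None)"
   using R_rep(4)[OF m_closed[OF h g] inv_closed[OF h], of n None] R_rep(4)[OF h g, of n None] R_adjoint[OF h, of n None]
   by simp
  then show ?thesis unfolding blk_act[OF t] blk_ve[OF t] unfolding True using blk_ve[of None n g] by simp
 next
  case False
  then have ne: "tr h t ~= None" by simp
  show ?thesis
   unfolding blk_act[OF t] blk_ve[OF t] blk_ve[OF tr_Bl[OF h t]] dm_tr if_not_P[OF False] if_not_P[OF ne]
   using r mat_adjoint_carrier[OF r] by simp
 qed
qed (use g h in simp)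

lemma ve_nonzero: "ve n \<one> ~= \<zero>\<^sub>(St n)"
proof
 assume "ve n \<one> = \<zero>\<^sub>(St n)"
 then have "(1\<^sub>m (dm n None) :: complex mat) = 0\<^sub>m (dm n None) (dm n None)"
  using blk_ve[of None n \<one>] blk_zero[of None n] by (simp add: R_one)
 then have "(1\<^sub>m (dm n None) :: complex mat) $$ (0, 0) = 0\<^sub>m (dm n None) (dm n None) $$ (0, 0)" by simp
 then show False using k_dim_pos[of n] by simp
qed

context
 fixes n :: nat and i :: "'g option \<times> nat"
 assumes i: "i : units n (Some ` GG)"
begin

lemma E_star: "star (St n) (E n i) = E n i"
proof (rule stage_eqI[of _ n])
 fix t assume t: "t : Bl"
 show "blk (star (St n) (E n i)) t = blk (E n i) t" unfolding blk_ops[OF t] blk_E[OF t] by (simp add: eu_adjoint)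
qed auto

lemma E_idem: "E n i \<otimes>\<^sub>(St n) E n i = E n i"
proof (rule stage_eqI[of _ n])
 fix t assume t: "t : Bl"
 show "blk (E n i \<otimes>\<^sub>(St n) E n i) t = blk (E n i) t"
  unfolding blk_ops[OF t] blk_E[OF t] using units_sub[OF i] by (simp add: eu_idem)
qed auto

lemma E_ve: "E n i \<otimes>\<^sub>(St n) ve n \<one> = \<zero>\<^sub>(St n)"
proof (rule stage_eqI[of _ n])
 fix t assume t: "t : Bl"
 show "blk (E n i \<otimes>\<^sub>(St n) ve n \<one>) t = blk \<zero>\<^sub>(St n) t"
  unfolding blk_ops[OF t] blk_E[OF t] blk_ve[OF t] R_one using units_sub[OF i] right_mult_zero_mat[OF eu_carrier] by auto
qed auto

lemma E_minimal:
 assumes x: "x : carrier (St n)" shows "\<exists>c. E n i \<otimes>\<^sub>(St n) x \<otimes>\<^sub>(St n) E n i = c \<odot>\<^sub>(St n) E n i"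
proof (rule exI[of _ "blk x (fst i) $$ (snd i, snd i)"], rule stage_eqI[of _ n])
 fix t assume t: "t : Bl"
 have b: "blk x t : sq (dm n t)" by (rule blk_closed[OF x t])
 show "blk (E n i \<otimes>\<^sub>(St n) x \<otimes>\<^sub>(St n) E n i) t = blk (blk x (fst i) $$ (snd i, snd i) \<odot>\<^sub>(St n) E n i) t"
  unfolding blk_ops[OF t] blk_E[OF t] using units_sub[OF i] b eu_compress[OF b, of "snd i"] by auto
qed (use x in auto)

text \<open>E lives in one block \<open>Some h\<close>, and the action of g moves it to the block of
  g h, which differs from h.\<close>

lemma E_free:
 assumes x: "x : carrier (St n)" and g: "g : GG" "g ~= \<one>"
 shows "E n i \<otimes>\<^sub>(St n) x \<otimes>\<^sub>(St n) act n g (E n i) = \<zero>\<^sub>(St n)"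
proof (rule stage_eqI[of _ n])
 have ac: "act n g (E n i) : carrier (St n)" by (rule act_closed[OF g(1)]) simp
 then show "E n i \<otimes>\<^sub>(St n) x \<otimes>\<^sub>(St n) act n g (E n i) : carrier (St n)" using x by simp
 fix t assume t: "t : Bl"
 let ?d = "dm n t"
 have b: "blk x t : sq ?d" "blk (act n g (E n i)) t : sq ?d"
  using blk_closed[OF x t] blk_closed[OF ac t] by auto
 show "blk (E n i \<otimes>\<^sub>(St n) x \<otimes>\<^sub>(St n) act n g (E n i)) t = blk \<zero>\<^sub>(St n) t"
 proof (cases "t = fst i")
  case False
  have "0\<^sub>m ?d ?d * blk x t * blk (act n g (E n i)) t = 0\<^sub>m ?d ?d"
   using b by (simp add: left_mult_zero_mat[OF b(1)] left_mult_zero_mat[OF b(2)])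
  then show ?thesis unfolding blk_ops[OF t] blk_E[OF t] using False by simp
 next
  case True
  obtain h where h: "t = Some h" "h : GG" using units_sub[OF i] True by auto
  have "inv g \<otimes> h ~= h"
  proof
   assume "inv g \<otimes> h = h"
   moreover have "inv g = inv g \<otimes> h \<otimes> inv h" using h(2) g(1) by (simp add: m_assoc)
   ultimately show False using g h(2) by simp
  qed
  then have ne: "tr g t ~= fst i" using h(1) True by simp
  note r = R_rep(1)[OF g(1), of n t]
  have "blk (act n g (E n i)) t = 0\<^sub>m ?d ?d"
   unfolding blk_act[OF t] blk_E[OF tr_Bl[OF g(1) t]] dm_tr using ne r mat_adjoint_carrier[OF r] by simp
  then show ?thesis unfolding blk_ops[OF t] blk_E[OF t] using b(1) True
   by (simp add: right_mult_zero_mat[OF mult_carrier_mat[OF eu_carrier b(1)]] eu_def)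
 qed
qed simp

end

text \<open>Cutting by the second summand leaves exactly the part whose norm
  \<open>tail_isometric\<close> computes. This is the source of \<open>q_faithful\<close>.\<close>

lemma nrm_cut_tail:
 assumes x: "x : carrier (St n)"
 shows "nrm (St (Suc n)) (\<phi> n x \<otimes>\<^sub>(St (Suc n)) cut (Suc n) (Some ` GG)) = nrm (St n) x"
proof -
 have xc: "\<phi> n x : carrier (St (Suc n))" by (rule stage_map_closed[OF x])
 let ?z = "(0\<^sub>m (dm (Suc n) None) (dm (Suc n) None), snd (\<phi> n x))"
 have zb: "blk ?z t = (if t = None then 0\<^sub>m (dm (Suc n) t) (dm (Suc n) t) else blk (\<phi> n x) t)" for t
  by (cases t) (simp_all add: blk_def)
 have zc: "?z : carrier (St (Suc n))" using xc by (auto simp: St_eq mem_Times_iff)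
 have "\<phi> n x \<otimes>\<^sub>(St (Suc n)) cut (Suc n) (Some ` GG) = ?z"
 proof (rule stage_eqI[of _ "Suc n"])
  fix t assume t: "t : Bl"
  have b: "blk (\<phi> n x) t : sq (dm (Suc n) t)" by (rule blk_closed[OF xc t])
  show "blk (\<phi> n x \<otimes>\<^sub>(St (Suc n)) cut (Suc n) (Some ` GG)) t = blk ?z t"
   unfolding blk_ops[OF t] blk_cut[OF t] zb
   using t right_mult_zero_mat[OF b] right_mult_one_mat[OF b] by auto
 qed (use xc zc in auto)
 moreover have "nrm (St (Suc n)) ?z = max 0 (nrm (St n) x)"
  using tail_isometric[OF x] mat.nrm_zero[of "dm (Suc n) None"] by (simp add: St_eq[of "Suc n"])
 ultimately show ?thesis using x by simp
qed

text \<open>The minimal projections are taken from the second summand only: there translation of the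
  blocks makes the action free, and their sum is the complement of
  \<open>v n \<one>\<close>.\<close>

lemma representable_AF:
 "representable_system G AA aa (%n. \<iota> n ` carrier (St n)) (%n g. \<iota> n (ve n g))
  (%n. units n (Some ` GG)) (%n i. \<iota> n (E n i))"
proof (intro representable_system.intro finite_action_AF representable_system_axioms.intro)
 interpret A: pre_cstar AA by (rule pre_cstar_AA)
 fix n
 note hom = \<iota>_hom[of n]
 show "\<iota> n ` carrier (St n) <= carrier AA" using \<iota>_closed by auto
 have "\<iota> n b : \<iota> (Suc n) ` carrier (St (Suc n))" if "b : carrier (St n)" for b
  using L.stage_incl_Suc[OF that] stage_map_closed[OF that] by (metis imageI)
 then show "\<iota> n ` carrier (St n) <= \<iota> (Suc n) ` carrier (St (Suc n))" by auto
 show "\<zero>\<^sub>AA : \<iota> n ` carrier (St n)"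
  using star_hom_zero[OF hom pre_cstar_St pre_cstar_AA] St.zero_closed[of n] by (metis imageI)
 fix X Y assume "X : \<iota> n ` carrier (St n)"
 then obtain x where x: "x : carrier (St n)" "X = \<iota> n x" by blast
 show "star AA X : \<iota> n ` carrier (St n)" using x by (simp add: \<iota>_star)
 show "aa g X : \<iota> n ` carrier (St n)" if "g : GG" for g
  using x that act_closed by (simp add: aa_incl)
 show "\<iota> n (ve n g) \<otimes>\<^sub>AA X = aa g X \<otimes>\<^sub>AA \<iota> n (ve n g)" if g: "g : GG" for g
  using x g act_closed[OF g x(1)] by (simp add: aa_incl \<iota>_mult ve_comm)
 show "\<exists>c. \<iota> n (E n i) \<otimes>\<^sub>AA X \<otimes>\<^sub>AA \<iota> n (E n i) = c \<odot>\<^sub>AA \<iota> n (E n i)" if i: "i : units n (Some ` GG)" for i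
  using E_minimal[OF i x(1)] x by (auto simp: \<iota>_mult star_hom_smult[OF hom, symmetric])
 show "\<iota> n (E n i) \<otimes>\<^sub>AA X \<otimes>\<^sub>AA aa g (\<iota> n (E n i)) = \<zero>\<^sub>AA"
  if i: "i : units n (Some ` GG)" and g: "g : GG" "g ~= \<one>" for i g
  using x g act_closed[OF g(1) E_closed[of n i]]
  by (simp add: aa_incl \<iota>_mult E_free[OF i x(1) g] star_hom_zero[OF hom pre_cstar_St pre_cstar_AA])
 show "nrm AA (X \<otimes>\<^sub>AA (\<one>\<^sub>AA \<ominus>\<^sub>AA \<iota> (Suc n) (ve (Suc n) \<one>))) = nrm AA X"
 proof -
  have xs: "\<phi> n x : carrier (St (Suc n))" by (rule stage_map_closed[OF x(1)])
  have "X = \<iota> (Suc n) (\<phi> n x)" using L.stage_incl_Suc[OF x(1)] x(2) by simp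
  then have "nrm AA (X \<otimes>\<^sub>AA (\<one>\<^sub>AA \<ominus>\<^sub>AA \<iota> (Suc n) (ve (Suc n) \<one>))) =
    nrm AA (\<iota> (Suc n) (\<phi> n x \<otimes>\<^sub>(St (Suc n)) cut (Suc n) (Some ` GG)))"
   unfolding q_eq using xs by (simp add: \<iota>_mult)
  also have "... = nrm AA X"
   using xs x nrm_cut_tail[OF x(1)] L.stage_incl_isometric by (simp add: AA_eq)
  finally show ?thesis .
 qed
 assume "Y : \<iota> n ` carrier (St n)"
 then obtain y where y: "y : carrier (St n)" "Y = \<iota> n y" by blast
 show "X \<oplus>\<^sub>AA Y : \<iota> n ` carrier (St n)" using x y by (simp add: star_hom_add[OF hom, symmetric])
 show "X \<otimes>\<^sub>AA Y : \<iota> n ` carrier (St n)" using x y by (simp add: \<iota>_mult)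
next
 interpret A: pre_cstar AA by (rule pre_cstar_AA)
 fix X and \<eta> :: real assume X: "X : carrier AA" and \<eta>: "0 < \<eta>"
 obtain N where "!!N'. N <= N' ==> \<exists>b\<in>carrier (St N'). nrm AA (X \<ominus>\<^sub>AA \<iota> N' b) < \<eta>"
  using L.stage_incl_dense[of X \<eta>] X \<eta> unfolding AA_eq by blast
 then show "\<exists>N. \<forall>n\<ge>N. \<exists>b\<in>\<iota> n ` carrier (St n). nrm AA (X \<ominus>\<^sub>AA b) < \<eta>" by (intro exI[of _ N]) auto
next
 interpret A: pre_cstar AA by (rule pre_cstar_AA)
 fix n
 note hom = \<iota>_hom[of n]
 show "finite (units n (Some ` GG))" unfolding units_def using finite_G by (intro finite_SigmaI) auto
 show "\<one>\<^sub>AA \<ominus>\<^sub>AA \<iota> n (ve n \<one>) = (\<Oplus>\<^sub>AA i\<in>units n (Some ` GG). \<iota> n (E n i))"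
  unfolding q_eq sum_units[OF subset_insertI, symmetric] units_def using finite_G
  by (intro star_hom_finsum[OF hom pre_cstar_St pre_cstar_AA]) auto
 show "\<iota> n (ve n \<one>) ~= \<zero>\<^sub>AA"
 proof
  assume "\<iota> n (ve n \<one>) = \<zero>\<^sub>AA"
  then have "nrm (St n) (ve n \<one>) = 0"
   using L.stage_incl_isometric[OF ve_closed[OF one_closed], of n] A.nrm_zero by (simp add: AA_eq)
  then show False using St.nrm_eq_0[OF ve_closed[OF one_closed]] ve_nonzero by blast
 qed
 fix g assume g: "g : GG"
 show "\<iota> n (ve n g) : carrier AA" "\<iota> n (ve n g) : \<iota> n ` carrier (St n)" using g by (auto intro: \<iota>_closed)
 show "star AA (\<iota> n (ve n g)) = \<iota> n (ve n (inv g))" using g by (simp add: \<iota>_star ve_star)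
 fix h assume h: "h : GG"
 show "\<iota> n (ve n g) \<otimes>\<^sub>AA \<iota> n (ve n h) = \<iota> n (ve n (g \<otimes> h))" using g h by (simp add: \<iota>_mult ve_mult)
 show "aa h (\<iota> n (ve n g)) = \<iota> n (ve n (h \<otimes> g \<otimes> inv h))" using g h by (simp add: aa_incl ve_act)
next
 interpret A: pre_cstar AA by (rule pre_cstar_AA)
 fix n i assume i: "i : units n (Some ` GG)"
 note hom = \<iota>_hom[of n]
 show "\<iota> n (E n i) : \<iota> n ` carrier (St n)" by simp
 show "star AA (\<iota> n (E n i)) = \<iota> n (E n i)" by (simp add: \<iota>_star E_star[OF i])
 show "\<iota> n (E n i) \<otimes>\<^sub>AA \<iota> n (E n i) = \<iota> n (E n i)" by (simp add: \<iota>_mult E_idem[OF i])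
 show "\<iota> n (E n i) \<otimes>\<^sub>AA \<iota> n (ve n \<one>) = \<zero>\<^sub>AA"
  by (simp add: \<iota>_mult E_ve[OF i] star_hom_zero[OF hom pre_cstar_St pre_cstar_AA])
 show "\<exists>j\<ge>J. \<exists>y\<in>carrier AA. y \<otimes>\<^sub>AA \<iota> n (E n i) \<otimes>\<^sub>AA star AA y = \<one>\<^sub>AA \<ominus>\<^sub>AA \<iota> j (ve j \<one>)" for J
  unfolding q_eq by (rule E_compare[OF i])
 show "\<exists>(d::nat) w. w : {..<d} \<rightarrow> carrier AA \<and>
   \<one>\<^sub>AA = (\<Oplus>\<^sub>AA j\<in>{..<d}. w j \<otimes>\<^sub>AA \<iota> n (E n i) \<otimes>\<^sub>AA star AA (w j))"
  by (rule E_full[OF i])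
qed

end

theorem corollary5p12:
  fixes G :: "('g, 'm) monoid_scheme" and gs :: "'g list"
    and l :: "nat \<Rightarrow> nat" and k r :: nat and U W :: "'g \<Rightarrow> complex mat"
    and \<omega> :: "nat filter"
    and A :: "(nat \<Rightarrow> 'g stage) set cstar"
    and \<alpha> :: "'g \<Rightarrow> (nat \<Rightarrow> 'g stage) set \<Rightarrow> (nat \<Rightarrow> 'g stage) set"
    and M :: "('g \<Rightarrow> (nat \<Rightarrow> 'g stage) set) cstar"
    and Q :: "('g \<Rightarrow> (nat \<Rightarrow> 'g stage) set) set"
    and F :: "('g \<Rightarrow> (nat \<Rightarrow> 'g stage) set) \<Rightarrow> ('g \<Rightarrow> (nat \<Rightarrow> 'g stage) set)"
  assumes "group G" and "finite (carrier G)" and "\<not> comm_group G"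
    and "distinct gs" and "set gs = carrier G"
    and "k > 0" and "r > 0" and "\<And>n. l n > 0" and "filterlim l at_top sequentially"
    and "unitary_rep G k U" and "unitary_rep G r W"
    and "free_ultrafilter \<omega>"
    and A: "A = AF_algebra G gs l k r" and \<alpha>: "\<alpha> = AF_action G gs l k r U W"
    and M: "M = crossed_product G A \<alpha>" and Q: "Q = crossed_embed G A ` carrier A"
    and F: "F = crossed_expectation G A"
  shows "weak_tracial_rokhlin \<omega> M Q F \<and>
    \<not> (\<exists>(H :: 'h monoid) (D :: 'd cstar) \<beta> \<Phi>. iso_to_fixed_point_inclusion M Q F H D \<beta> \<Phi>)"
proof -
  interpret AF_system G gs l k r U W
    using assms(1-11) by (intro AF_system.intro AF_system_axioms.intro)
  interpret R: representable_system G A \<alpha> "\<lambda>n. \<iota> n ` carrier (St n)" "\<lambda>n g. \<iota> n (ve n g)"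
    "\<lambda>n. units n (Some ` carrier G)" "\<lambda>n i. \<iota> n (E n i)"
    unfolding A \<alpha> by (rule representable_AF)
  show ?thesis
    unfolding M Q F using R.weak_tracial_rokhlin_crossed[OF assms(12)] R.not_iso_to_fixed_point_inclusion[OF assms(3)]
    by blast
qed

end
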